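(* Let $X$ be a locally compact regular locale. Then there exists a unique (up to unique isomorphism) compact regular locale $X^{\infty}$ equipped with a (closed) point $\{\infty\}\subset X^{\infty}$ and an isomorphism between $X$ and the open complement of $\{\infty\}$. (Isomorphisms are those compatible with the point $\infty$ and the identification of $X$ with the open complement.) Moreover $$\mathcal{O}(X^{\infty})\simeq\{(U,p)\in\mathcal{O}(X)\times\Omega \mid p\Rightarrow\omega(U)\},$$ and the two projections from $\mathcal{O}(X^{\infty})$ to $\mathcal{O}(X)$ and to $\Omega$ are the frame homomorphisms corresponding to the inclusions of $X$ and of $\{\infty\}$ into $X^{\infty}$.
   Context: We work constructively, in the internal logic of an arbitrary elementary topos with natural number object (no excluded middle, no choice). $\Omega$ is the frame of truth values (the frame of the one-point locale). For a locale $X$, $\mathcal{O}(X)$ is its frame, whose elements are called open sublocales; the top element is denoted $X$, the bottom $\emptyset$, and $\neg U:=(U\Rightarrow\emptyset)$. A net is an inhabited, upward directed family of open sublocales. For $U,V\in\mathcal{O}(X)$: $U\ll V$ means that for each net $(U_i)_{i\in I}$ whose supremum is bigger than $V$ there is $i\in I$ with $U\leqslant U_i$; $U\triangleleft V$ means $\neg U\cup V=X$. $X$ is locally compact (resp. regular) if every open $V$ is the supremum of opens $U$ with $U\ll V$ (resp. $U\triangleleft V$); $X$ is compact if $X\ll X$. For $U\in\mathcal{O}(X)$, $\omega(U)\in\Omega$ is the proposition ``there exists $W\in\mathcal{O}(X)$ such that $W\ll X$ and $U\cup W=X$''. *)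

theory Defs
  imports Main
begin

section \<open>Elementary toposes with natural number object\<close>

text \<open>
  A category is given by its objects, its arrows and partial operations on them. Finite products,
  exponentials, the subobject classifier and the natural number object are chosen; a topos in
  which they merely exist can be equipped with choices, so this loses no generality.
  \<open>Exp A B\<close> is the object of arrows from \<open>A\<close> to \<open>B\<close>, and \<open>ev A B\<close> its evaluation
  \<open>Exp A B \<times> A \<rightarrow> B\<close>.
\<close>

record ('o, 'm) topos =
  Ob :: "'o set"
  Arr :: "'m set"
  src :: "'m \<Rightarrow> 'o"
  tgt :: "'m \<Rightarrow> 'o"
  ident :: "'o \<Rightarrow> 'm"
  cmp :: "'m \<Rightarrow> 'm \<Rightarrow> 'm" (infixl "\<cdot>\<index>" 70)
  One :: 'o
  Prod :: "'o \<Rightarrow> 'o \<Rightarrow> 'o"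
  pr1 :: "'o \<Rightarrow> 'o \<Rightarrow> 'm"
  pr2 :: "'o \<Rightarrow> 'o \<Rightarrow> 'm"
  Exp :: "'o \<Rightarrow> 'o \<Rightarrow> 'o"
  ev :: "'o \<Rightarrow> 'o \<Rightarrow> 'm"
  Om :: 'o
  tt :: 'm
  Nat :: 'o
  zero :: 'm
  succ :: 'm

context
  fixes E :: "('o, 'm) topos" (structure)
begin

definition hom :: "'o \<Rightarrow> 'o \<Rightarrow> 'm set" where
  "hom A B = {f \<in> Arr E. src E f = A \<and> tgt E f = B}"

definition into :: "'o \<Rightarrow> 'm set" where
  "into B = {f \<in> Arr E. tgt E f = B}"

definition mono :: "'m \<Rightarrow> bool" where
  "mono m \<longleftrightarrow> m \<in> Arr E \<and>
     (\<forall>x\<in>into (src E m). \<forall>y\<in>into (src E m). src E x = src E y \<longrightarrow> m \<cdot> x = m \<cdot> y \<longrightarrow> x = y)"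

definition epi :: "'m \<Rightarrow> bool" where
  "epi e \<longleftrightarrow> e \<in> Arr E \<and>
     (\<forall>B\<in>Ob E. \<forall>x\<in>hom (tgt E e) B. \<forall>y\<in>hom (tgt E e) B. x \<cdot> e = y \<cdot> e \<longrightarrow> x = y)"

definition is_pullback :: "'m \<Rightarrow> 'm \<Rightarrow> 'm \<Rightarrow> 'm \<Rightarrow> bool" where
  "is_pullback f g p q \<longleftrightarrow>
     f \<in> Arr E \<and> g \<in> Arr E \<and> tgt E f = tgt E g \<and>
     p \<in> hom (src E p) (src E f) \<and> q \<in> hom (src E p) (src E g) \<and> f \<cdot> p = g \<cdot> q \<and>
     (\<forall>I\<in>Ob E. \<forall>x\<in>hom I (src E f). \<forall>y\<in>hom I (src E g). f \<cdot> x = g \<cdot> y \<longrightarrow>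
        (\<exists>!z. z \<in> hom I (src E p) \<and> p \<cdot> z = x \<and> q \<cdot> z = y))"

definition bang :: "'o \<Rightarrow> 'm" where
  "bang I = (THE f. f \<in> hom I (One E))"

definition pair :: "'m \<Rightarrow> 'm \<Rightarrow> 'm" where
  "pair f g = (THE h. h \<in> hom (src E f) (Prod E (tgt E f) (tgt E g)) \<and>
     pr1 E (tgt E f) (tgt E g) \<cdot> h = f \<and> pr2 E (tgt E f) (tgt E g) \<cdot> h = g)"

end

locale category =
  fixes E :: "('o, 'm) topos" (structure)
  assumes arr_ob: "f \<in> Arr E \<Longrightarrow> src E f \<in> Ob E \<and> tgt E f \<in> Ob E"
    and ident_hom: "A \<in> Ob E \<Longrightarrow> ident E A \<in> hom E A A"
    and cmp_hom: "f \<in> hom E A B \<Longrightarrow> g \<in> hom E B C \<Longrightarrow> g \<cdot> f \<in> hom E A C"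
    and cmp_ident: "f \<in> hom E A B \<Longrightarrow> f \<cdot> ident E A = f"
    and ident_cmp: "f \<in> hom E A B \<Longrightarrow> ident E B \<cdot> f = f"
    and cmp_assoc: "f \<in> hom E A B \<Longrightarrow> g \<in> hom E B C \<Longrightarrow> h \<in> hom E C D \<Longrightarrow>
      (h \<cdot> g) \<cdot> f = h \<cdot> (g \<cdot> f)"

locale elementary_topos = category +
  assumes One_ob: "One E \<in> Ob E"
    and One_terminal: "I \<in> Ob E \<Longrightarrow> \<exists>!f. f \<in> hom E I (One E)"
    and Prod_ob: "A \<in> Ob E \<Longrightarrow> B \<in> Ob E \<Longrightarrow> Prod E A B \<in> Ob E"
    and pr1_hom: "A \<in> Ob E \<Longrightarrow> B \<in> Ob E \<Longrightarrow> pr1 E A B \<in> hom E (Prod E A B) A"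
    and pr2_hom: "A \<in> Ob E \<Longrightarrow> B \<in> Ob E \<Longrightarrow> pr2 E A B \<in> hom E (Prod E A B) B"
    and Prod_universal: "f \<in> hom E I A \<Longrightarrow> g \<in> hom E I B \<Longrightarrow>
      \<exists>!h. h \<in> hom E I (Prod E A B) \<and> pr1 E A B \<cdot> h = f \<and> pr2 E A B \<cdot> h = g"
    and pullbacks: "f \<in> Arr E \<Longrightarrow> g \<in> Arr E \<Longrightarrow> tgt E f = tgt E g \<Longrightarrow>
      \<exists>p q. is_pullback E f g p q"
    and Exp_ob: "A \<in> Ob E \<Longrightarrow> B \<in> Ob E \<Longrightarrow> Exp E A B \<in> Ob E"
    and ev_hom: "A \<in> Ob E \<Longrightarrow> B \<in> Ob E \<Longrightarrow> ev E A B \<in> hom E (Prod E (Exp E A B) A) B"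
    and Exp_universal: "A \<in> Ob E \<Longrightarrow> B \<in> Ob E \<Longrightarrow> C \<in> Ob E \<Longrightarrow> f \<in> hom E (Prod E C A) B \<Longrightarrow>
      \<exists>!h. h \<in> hom E C (Exp E A B) \<and> ev E A B \<cdot> pair E (h \<cdot> pr1 E C A) (pr2 E C A) = f"
    and Om_ob: "Om E \<in> Ob E"
    and tt_hom: "tt E \<in> hom E (One E) (Om E)"
    and classifier: "mono E m \<Longrightarrow>
      \<exists>!c. c \<in> hom E (tgt E m) (Om E) \<and> is_pullback E c (tt E) m (bang E (src E m))"

locale elementary_topos_nno = elementary_topos +
  assumes Nat_ob: "Nat E \<in> Ob E"
    and zero_hom: "zero E \<in> hom E (One E) (Nat E)"
    and succ_hom: "succ E \<in> hom E (Nat E) (Nat E)"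
    and Nat_universal: "x \<in> hom E (One E) A \<Longrightarrow> f \<in> hom E A A \<Longrightarrow>
      \<exists>!h. h \<in> hom E (Nat E) A \<and> h \<cdot> zero E = x \<and> h \<cdot> succ E = f \<cdot> h"


section \<open>Internal logic\<close>

text \<open>
  Statements of the internal language are interpreted by Kripke-Joyal semantics. A variable of
  type \<open>A\<close> at stage \<open>I\<close> is an arrow \<open>I \<rightarrow> A\<close>; passing to a later stage along \<open>g : J \<rightarrow> I\<close> is
  composition with \<open>g\<close>. Universal quantifiers and implications range over all later stages,
  existential quantifiers are witnessed after passing to a cover, i.e. along an epimorphism, and
  equality is equality of arrows. A truth value at stage \<open>I\<close> is an arrow \<open>I \<rightarrow> Om\<close>. In what
  follows the arguments of a predicate are variables at a common stage, usually recovered as the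
  source of one of them.
\<close>

context
  fixes E :: "('o, 'm) topos" (structure)
begin

definition holds :: "'m \<Rightarrow> bool" where
  "holds p \<longleftrightarrow> p = tt E \<cdot> bang E (src E p)"

definition Pow :: "'o \<Rightarrow> 'o" where
  "Pow A = Exp E A (Om E)"

definition mem :: "'m \<Rightarrow> 'm \<Rightarrow> bool" where
  "mem a S \<longleftrightarrow> holds (ev E (tgt E a) (Om E) \<cdot> pair E S a)"

text \<open>
  \<open>exists_loc I A P\<close> is the existential quantifier over \<open>A\<close> at stage \<open>I\<close>. The first argument of
  \<open>P\<close> is the passage to the later stage, to be applied to the variables that are free in \<open>P\<close>.
\<close>

definition exists_loc :: "'o \<Rightarrow> 'o \<Rightarrow> ('m \<Rightarrow> 'm \<Rightarrow> bool) \<Rightarrow> bool" where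
  "exists_loc I A P \<longleftrightarrow> (\<exists>e a. epi E e \<and> tgt E e = I \<and> a \<in> hom E (src E e) A \<and> P e a)"

text \<open>
  \<open>compr B P\<close> is (the inclusion of) the subobject \<open>{x \<in> B. P x}\<close>, and \<open>rel A P\<close> is the relation
  \<open>P\<close> on \<open>A\<close> as an arrow \<open>A \<times> A \<rightarrow> Om\<close>.
\<close>

definition compr :: "'o \<Rightarrow> ('m \<Rightarrow> bool) \<Rightarrow> 'm" where
  "compr B P = (SOME m. mono E m \<and> tgt E m = B \<and>
     (\<forall>x\<in>into E B. (\<exists>y\<in>hom E (src E x) (src E m). x = m \<cdot> y) \<longleftrightarrow> P x))"

definition rel :: "'o \<Rightarrow> ('m \<Rightarrow> 'm \<Rightarrow> bool) \<Rightarrow> 'm" where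
  "rel A P = (THE r. r \<in> hom E (Prod E A A) (Om E) \<and>
     (\<forall>I\<in>Ob E. \<forall>u\<in>hom E I A. \<forall>v\<in>hom E I A. holds (r \<cdot> pair E u v) \<longleftrightarrow> P u v))"

end


section \<open>Internal locales\<close>

text \<open>
  An internal locale is represented by its frame of opens, an object together with the order
  relation \<open>le : opens \<times> opens \<rightarrow> Om\<close>.
\<close>

record ('o, 'm) frm =
  opens :: 'o
  le :: 'm

context
  fixes E :: "('o, 'm) topos" (structure)
begin

definition leq :: "('o, 'm) frm \<Rightarrow> 'm \<Rightarrow> 'm \<Rightarrow> bool" where
  "leq X u v \<longleftrightarrow> holds E (le X \<cdot> pair E u v)"

definition is_poset :: "('o, 'm) frm \<Rightarrow> bool" where
  "is_poset X \<longleftrightarrow> opens X \<in> Ob E \<and> le X \<in> hom E (Prod E (opens X) (opens X)) (Om E) \<and>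
     (\<forall>I\<in>Ob E. \<forall>u\<in>hom E I (opens X). \<forall>v\<in>hom E I (opens X). \<forall>w\<in>hom E I (opens X).
        leq X u u \<and>
        (leq X u v \<longrightarrow> leq X v w \<longrightarrow> leq X u w) \<and>
        (leq X u v \<longrightarrow> leq X v u \<longrightarrow> u = v))"

text \<open>
  \<open>is_sup X P s\<close>: \<open>s\<close> is the supremum of the opens \<open>a\<close> such that \<open>P a\<close>. Here \<open>P\<close> may depend on
  variables at the stage of \<open>s\<close>, which is why it takes the passage to a later stage as its first
  argument.
\<close>

definition is_sup :: "('o, 'm) frm \<Rightarrow> ('m \<Rightarrow> 'm \<Rightarrow> bool) \<Rightarrow> 'm \<Rightarrow> bool" where
  "is_sup X P s \<longleftrightarrow> (\<forall>g\<in>into E (src E s). \<forall>t\<in>hom E (src E g) (opens X).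
     leq X (s \<cdot> g) t \<longleftrightarrow>
       (\<forall>h\<in>into E (src E g). \<forall>a\<in>hom E (src E h) (opens X). P (g \<cdot> h) a \<longrightarrow> leq X a (t \<cdot> h)))"

definition is_top :: "('o, 'm) frm \<Rightarrow> 'm \<Rightarrow> bool" where
  "is_top X s \<longleftrightarrow> (\<forall>g\<in>into E (src E s). \<forall>t\<in>hom E (src E g) (opens X). leq X t (s \<cdot> g))"

definition is_bottom :: "('o, 'm) frm \<Rightarrow> 'm \<Rightarrow> bool" where
  "is_bottom X s \<longleftrightarrow> (\<forall>g\<in>into E (src E s). \<forall>t\<in>hom E (src E g) (opens X). leq X (s \<cdot> g) t)"

definition is_meet :: "('o, 'm) frm \<Rightarrow> 'm \<Rightarrow> 'm \<Rightarrow> 'm \<Rightarrow> bool" where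
  "is_meet X u v s \<longleftrightarrow> (\<forall>g\<in>into E (src E s). \<forall>t\<in>hom E (src E g) (opens X).
     leq X t (s \<cdot> g) \<longleftrightarrow> leq X t (u \<cdot> g) \<and> leq X t (v \<cdot> g))"

definition is_join :: "('o, 'm) frm \<Rightarrow> 'm \<Rightarrow> 'm \<Rightarrow> 'm \<Rightarrow> bool" where
  "is_join X u v s \<longleftrightarrow> (\<forall>g\<in>into E (src E s). \<forall>t\<in>hom E (src E g) (opens X).
     leq X (s \<cdot> g) t \<longleftrightarrow> leq X (u \<cdot> g) t \<and> leq X (v \<cdot> g) t)"

definition whole :: "('o, 'm) frm \<Rightarrow> 'o \<Rightarrow> 'm" where
  "whole X I = (THE s. s \<in> hom E I (opens X) \<and> is_top X s)"

definition empty :: "('o, 'm) frm \<Rightarrow> 'o \<Rightarrow> 'm" where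
  "empty X I = (THE s. s \<in> hom E I (opens X) \<and> is_bottom X s)"

definition meet :: "('o, 'm) frm \<Rightarrow> 'm \<Rightarrow> 'm \<Rightarrow> 'm" where
  "meet X u v = (THE s. s \<in> hom E (src E u) (opens X) \<and> is_meet X u v s)"

definition join :: "('o, 'm) frm \<Rightarrow> 'm \<Rightarrow> 'm \<Rightarrow> 'm" where
  "join X u v = (THE s. s \<in> hom E (src E u) (opens X) \<and> is_join X u v s)"

definition Join :: "('o, 'm) frm \<Rightarrow> 'm \<Rightarrow> 'm" where
  "Join X S = (THE s. s \<in> hom E (src E S) (opens X) \<and> is_sup X (\<lambda>g a. mem E a (S \<cdot> g)) s)"

definition is_frame :: "('o, 'm) frm \<Rightarrow> bool" where
  "is_frame X \<longleftrightarrow> is_poset X \<and>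
     (\<forall>I\<in>Ob E.
        (\<exists>s\<in>hom E I (opens X). is_top X s) \<and>
        (\<forall>u\<in>hom E I (opens X). \<forall>v\<in>hom E I (opens X). \<exists>s\<in>hom E I (opens X). is_meet X u v s) \<and>
        (\<forall>S\<in>hom E I (Pow E (opens X)). \<exists>s\<in>hom E I (opens X).
           is_sup X (\<lambda>g a. mem E a (S \<cdot> g)) s) \<and>
        (\<forall>u\<in>hom E I (opens X). \<forall>S\<in>hom E I (Pow E (opens X)).
           is_sup X
             (\<lambda>g b. exists_loc E (src E g) (opens X)
                (\<lambda>e a. mem E a (S \<cdot> g \<cdot> e) \<and> b \<cdot> e = meet X (u \<cdot> g \<cdot> e) a))
             (meet X u (Join X S))))"

definition impl :: "('o, 'm) frm \<Rightarrow> 'm \<Rightarrow> 'm \<Rightarrow> 'm" where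
  "impl X u v = (THE s. s \<in> hom E (src E u) (opens X) \<and>
     (\<forall>g\<in>into E (src E s). \<forall>t\<in>hom E (src E g) (opens X).
        leq X t (s \<cdot> g) \<longleftrightarrow> leq X (meet X t (u \<cdot> g)) (v \<cdot> g)))"

definition neg :: "('o, 'm) frm \<Rightarrow> 'm \<Rightarrow> 'm" where
  "neg X u = impl X u (empty X (src E u))"

definition is_net :: "('o, 'm) frm \<Rightarrow> 'm \<Rightarrow> bool" where
  "is_net X S \<longleftrightarrow>
     exists_loc E (src E S) (opens X) (\<lambda>e a. mem E a (S \<cdot> e)) \<and>
     (\<forall>g\<in>into E (src E S). \<forall>a\<in>hom E (src E g) (opens X). \<forall>b\<in>hom E (src E g) (opens X).
        mem E a (S \<cdot> g) \<longrightarrow> mem E b (S \<cdot> g) \<longrightarrow>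
        exists_loc E (src E g) (opens X)
          (\<lambda>e c. mem E c (S \<cdot> g \<cdot> e) \<and> leq X (a \<cdot> e) c \<and> leq X (b \<cdot> e) c))"

definition way_below :: "('o, 'm) frm \<Rightarrow> 'm \<Rightarrow> 'm \<Rightarrow> bool" where
  "way_below X u v \<longleftrightarrow>
     (\<forall>g\<in>into E (src E u). \<forall>S\<in>hom E (src E g) (Pow E (opens X)).
        is_net X S \<longrightarrow> leq X (v \<cdot> g) (Join X S) \<longrightarrow>
        exists_loc E (src E g) (opens X) (\<lambda>e w. mem E w (S \<cdot> e) \<and> leq X (u \<cdot> g \<cdot> e) w))"

definition rather_below :: "('o, 'm) frm \<Rightarrow> 'm \<Rightarrow> 'm \<Rightarrow> bool" where
  "rather_below X u v \<longleftrightarrow> join X (neg X u) v = whole X (src E u)"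

definition locally_compact :: "('o, 'm) frm \<Rightarrow> bool" where
  "locally_compact X \<longleftrightarrow>
     (\<forall>v\<in>into E (opens X). is_sup X (\<lambda>g u. way_below X u (v \<cdot> g)) v)"

definition regular :: "('o, 'm) frm \<Rightarrow> bool" where
  "regular X \<longleftrightarrow>
     (\<forall>v\<in>into E (opens X). is_sup X (\<lambda>g u. rather_below X u (v \<cdot> g)) v)"

definition compact :: "('o, 'm) frm \<Rightarrow> bool" where
  "compact X \<longleftrightarrow> way_below X (whole X (One E)) (whole X (One E))"

definition omega :: "('o, 'm) frm \<Rightarrow> 'm \<Rightarrow> bool" where
  "omega X u \<longleftrightarrow> exists_loc E (src E u) (opens X)
     (\<lambda>e w. way_below X w (whole X (src E e)) \<and> join X (u \<cdot> e) w = whole X (src E e))"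


section \<open>Continuous maps, points, open and closed sublocales\<close>

text \<open>A continuous map from \<open>X\<close> to \<open>Y\<close> is a frame homomorphism from \<open>Y\<close> to \<open>X\<close>.\<close>

definition frame_hom :: "('o, 'm) frm \<Rightarrow> ('o, 'm) frm \<Rightarrow> 'm \<Rightarrow> bool" where
  "frame_hom Y X f \<longleftrightarrow> is_frame Y \<and> is_frame X \<and> f \<in> hom E (opens Y) (opens X) \<and>
     (\<forall>I\<in>Ob E.
        f \<cdot> whole Y I = whole X I \<and>
        (\<forall>u\<in>hom E I (opens Y). \<forall>v\<in>hom E I (opens Y).
           f \<cdot> meet Y u v = meet X (f \<cdot> u) (f \<cdot> v)) \<and>
        (\<forall>S\<in>hom E I (Pow E (opens Y)).
           is_sup X
             (\<lambda>g b. exists_loc E (src E g) (opens Y) (\<lambda>e a. mem E a (S \<cdot> g \<cdot> e) \<and> b \<cdot> e = f \<cdot> a))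
             (f \<cdot> Join Y S)))"

definition frame_iso :: "('o, 'm) frm \<Rightarrow> ('o, 'm) frm \<Rightarrow> 'm \<Rightarrow> bool" where
  "frame_iso Y X f \<longleftrightarrow> frame_hom Y X f \<and>
     (\<exists>g. frame_hom X Y g \<and> f \<cdot> g = ident E (opens X) \<and> g \<cdot> f = ident E (opens Y))"

text \<open>The frame of truth values, i.e. of the one-point locale.\<close>

definition truth_frame :: "('o, 'm) frm" where
  "truth_frame = \<lparr>opens = Om E,
     le = rel E (Om E) (\<lambda>p q. \<forall>g\<in>into E (src E p). holds E (p \<cdot> g) \<longrightarrow> holds E (q \<cdot> g))\<rparr>"

definition is_point :: "('o, 'm) frm \<Rightarrow> 'm \<Rightarrow> bool" where
  "is_point Y p \<longleftrightarrow> frame_hom Y truth_frame p"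

text \<open>The frame on a subobject \<open>m\<close> of \<open>opens Y\<close> with the order of \<open>Y\<close>.\<close>

definition subframe :: "('o, 'm) frm \<Rightarrow> 'm \<Rightarrow> ('o, 'm) frm" where
  "subframe Y m = \<lparr>opens = src E m, le = rel E (src E m) (\<lambda>u v. leq Y (m \<cdot> u) (m \<cdot> v))\<rparr>"

text \<open>
  Let \<open>c : One \<rightarrow> opens Y\<close> be an open. The corresponding open sublocale has the frame
  \<open>{u. u \<le> c}\<close>, with inclusion given by \<open>u \<mapsto> u \<sqinter> c\<close>; its closed complement has the frame
  \<open>{u. c \<le> u}\<close>, with inclusion given by \<open>u \<mapsto> u \<squnion> c\<close>.
\<close>

definition below_incl :: "('o, 'm) frm \<Rightarrow> 'm \<Rightarrow> 'm" where
  "below_incl Y c = compr E (opens Y) (\<lambda>u. leq Y u (c \<cdot> bang E (src E u)))"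

definition open_sublocale :: "('o, 'm) frm \<Rightarrow> 'm \<Rightarrow> ('o, 'm) frm" where
  "open_sublocale Y c = subframe Y (below_incl Y c)"

definition open_restr :: "('o, 'm) frm \<Rightarrow> 'm \<Rightarrow> 'm" where
  "open_restr Y c = (THE r. r \<in> hom E (opens Y) (opens (open_sublocale Y c)) \<and>
     below_incl Y c \<cdot> r = meet Y (ident E (opens Y)) (c \<cdot> bang E (opens Y)))"

definition above_incl :: "('o, 'm) frm \<Rightarrow> 'm \<Rightarrow> 'm" where
  "above_incl Y c = compr E (opens Y) (\<lambda>u. leq Y (c \<cdot> bang E (src E u)) u)"

definition closed_sublocale :: "('o, 'm) frm \<Rightarrow> 'm \<Rightarrow> ('o, 'm) frm" where
  "closed_sublocale Y c = subframe Y (above_incl Y c)"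

definition closed_restr :: "('o, 'm) frm \<Rightarrow> 'm \<Rightarrow> 'm" where
  "closed_restr Y c = (THE r. r \<in> hom E (opens Y) (opens (closed_sublocale Y c)) \<and>
     above_incl Y c \<cdot> r = join Y (ident E (opens Y)) (c \<cdot> bang E (opens Y)))"

text \<open>The open complement of a point: the largest open that does not contain it.\<close>

definition pt_compl :: "('o, 'm) frm \<Rightarrow> 'm \<Rightarrow> 'm" where
  "pt_compl Y p = (THE c. c \<in> hom E (One E) (opens Y) \<and>
     is_sup Y (\<lambda>g u. p \<cdot> u = empty truth_frame (src E u)) c)"

text \<open>
  A point is closed if it is, as a sublocale, the closed complement of its open complement.
\<close>

definition closed_point :: "('o, 'm) frm \<Rightarrow> 'm \<Rightarrow> bool" where
  "closed_point Y p \<longleftrightarrow> is_point Y p \<and>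
     (\<exists>k. frame_iso (closed_sublocale Y (pt_compl Y p)) truth_frame k \<and>
          k \<cdot> closed_restr Y (pt_compl Y p) = p)"


section \<open>One-point compactifications\<close>

text \<open>
  \<open>one_point_compactification X Y p k\<close>: \<open>Y\<close> is a compact regular locale with point \<open>p\<close>, and \<open>k\<close>
  is an isomorphism from \<open>X\<close> to the open complement of \<open>p\<close>. The point is not required to be
  closed, as this is automatic.
\<close>

definition one_point_compactification ::
    "('o, 'm) frm \<Rightarrow> ('o, 'm) frm \<Rightarrow> 'm \<Rightarrow> 'm \<Rightarrow> bool" where
  "one_point_compactification X Y p k \<longleftrightarrow>
     is_frame Y \<and> compact Y \<and> regular Y \<and> is_point Y p \<and>
     frame_iso (open_sublocale Y (pt_compl Y p)) X k"

text \<open>The resulting inclusion of \<open>X\<close> into \<open>Y\<close>, as a frame homomorphism from \<open>Y\<close> to \<open>X\<close>.\<close>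

definition incl :: "('o, 'm) frm \<Rightarrow> 'm \<Rightarrow> 'm \<Rightarrow> 'm" where
  "incl Y p k = k \<cdot> open_restr Y (pt_compl Y p)"

text \<open>
  An isomorphism of locales from \<open>(Y, p, k)\<close> to \<open>(Y', p', k')\<close>, compatible with the points and
  with the inclusions of \<open>X\<close>.
\<close>

definition compatible_iso ::
    "('o, 'm) frm \<Rightarrow> 'm \<Rightarrow> 'm \<Rightarrow> ('o, 'm) frm \<Rightarrow> 'm \<Rightarrow> 'm \<Rightarrow> 'm \<Rightarrow> bool" where
  "compatible_iso Y p k Y' p' k' h \<longleftrightarrow>
     frame_iso Y' Y h \<and> p \<cdot> h = p' \<and> incl Y p k \<cdot> h = incl Y' p' k'"

text \<open>
  The inclusion of \<open>{(U, p). p \<Rightarrow> omega U}\<close> into \<open>opens X \<times> Om\<close>, and the frame on this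
  subobject with the componentwise order.
\<close>

definition omega_incl :: "('o, 'm) frm \<Rightarrow> 'm" where
  "omega_incl X = compr E (Prod E (opens X) (Om E))
     (\<lambda>x. \<forall>g\<in>into E (src E x). holds E (pr2 E (opens X) (Om E) \<cdot> x \<cdot> g) \<longrightarrow>
        omega X (pr1 E (opens X) (Om E) \<cdot> x \<cdot> g))"

definition omega_fst :: "('o, 'm) frm \<Rightarrow> 'm" where
  "omega_fst X = pr1 E (opens X) (Om E) \<cdot> omega_incl X"

definition omega_snd :: "('o, 'm) frm \<Rightarrow> 'm" where
  "omega_snd X = pr2 E (opens X) (Om E) \<cdot> omega_incl X"

definition omega_frame :: "('o, 'm) frm \<Rightarrow> ('o, 'm) frm" where
  "omega_frame X = \<lparr>opens = src E (omega_incl X),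
     le = rel E (src E (omega_incl X))
       (\<lambda>x y. leq X (omega_fst X \<cdot> x) (omega_fst X \<cdot> y) \<and>
              leq truth_frame (omega_snd X \<cdot> x) (omega_snd X \<cdot> y))\<rparr>"

end

end

theory Submission
  imports Defs
begin

text \<open>
  The construction adds to \<open>X\<close> a point at infinity whose neighbourhoods are the opens \<open>U\<close> with
  \<open>omega U\<close>, that is, those which together with some open way below \<open>X\<close> cover \<open>X\<close>. An open of the
  compactification consists of an open \<open>U\<close> of \<open>X\<close> and a truth value \<open>q\<close>, telling whether infinity belongs
  to it, such that \<open>q\<close> implies \<open>omega U\<close>.

  In a one-point compactification \<open>Y\<close> of \<open>X\<close> with point \<open>p\<close> and open complement \<open>c\<close>, opens are of this form.
  The crucial fact is that an open \<open>v\<close> containing the point covers \<open>Y\<close> together with \<open>c\<close>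
  (\<open>covers_if_p\<close>): by regularity some \<open>a\<close> rather below \<open>v\<close> contains the point, and then the complement of
  \<open>a\<close> does not. It follows that an open is determined by its restriction to \<open>X\<close> and its value at the
  point (\<open>leq_if_locally\<close>). By compactness the complement of a neighbourhood of the point is way below
  \<open>X\<close> (\<open>way_below_f_neg\<close>), so that the neighbourhoods of the point satisfy \<open>omega\<close>; by regularity the
  complement in \<open>Y\<close> of an open way below \<open>X\<close> is a neighbourhood of the point (\<open>p_neg_j\<close>), so that all
  opens of \<open>X\<close> satisfying \<open>omega\<close> extend to neighbourhoods of the point (\<open>glue\<close>). Uniqueness and the
  description of the frame are immediate consequences, as is the closedness of the point.

  For existence one shows that the frame of pairs is compact and regular. Compactness holds because a
  member of a covering net that contains infinity misses only an open way below \<open>X\<close>, which is contained in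
  another member. Regularity rests on the interpolation of an open \<open>w'\<close> with \<open>w \<triangleleft> w' \<lless> X\<close> for each
  \<open>w \<lless> X\<close> (\<open>way_below_whole_interpolate\<close>), which uses that \<open>X\<close> is locally compact and regular. It makes the
  complement of \<open>w\<close> a neighbourhood of infinity (\<open>omega_neg\<close>).

  The argument is constructive and is carried out by Kripke-Joyal semantics at an arbitrary stage. What has
  to be supplied for this is that the formulas used for comprehension are represented by arrows to \<open>Om\<close>, with
  universal quantifiers obtained from extensionality of power objects and existential ones from images,
  and that epimorphisms are stable under pullback. Disjunctions and existential statements that come from
  suprema are then used in the form of upper bounds: to derive a statement from \<open>p (u \<squnion> v)\<close>, show that its
  truth value is above \<open>p u\<close> and \<open>p v\<close>. Frame homomorphisms are handled through their adjoints.
\<close>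

section \<open>Arrows and products\<close>

context category
begin

lemma in_hom [simp]: "f \<in> hom E A B \<longleftrightarrow> f \<in> Arr E \<and> src E f = A \<and> tgt E f = B"
  by (auto simp: hom_def)

lemma in_into [simp]: "f \<in> into E B \<longleftrightarrow> f \<in> Arr E \<and> tgt E f = B"
  by (auto simp: into_def)

lemma src_ob [simp]: "f \<in> Arr E \<Longrightarrow> src E f \<in> Ob E"
  and tgt_ob [simp]: "f \<in> Arr E \<Longrightarrow> tgt E f \<in> Ob E"
  by (simp_all add: arr_ob)

lemma cmp_arr [simp]:
  assumes "f \<in> Arr E" "g \<in> Arr E" "tgt E f = src E g"
  shows "g \<cdot> f \<in> Arr E" "src E (g \<cdot> f) = src E f" "tgt E (g \<cdot> f) = tgt E g"
  using cmp_hom[of f "src E f" "tgt E f" g "tgt E g"] assms by simp_all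

lemma cmp_assoc' [simp]:
  assumes "f \<in> Arr E" "g \<in> Arr E" "h \<in> Arr E" "tgt E f = src E g" "tgt E g = src E h"
  shows "(h \<cdot> g) \<cdot> f = h \<cdot> (g \<cdot> f)"
  by (rule cmp_assoc[of f "src E f" "tgt E f" g "tgt E g" h "tgt E h"]) (use assms in simp_all)

text \<open>
  The simplifier brackets composites to the right, which hides a composite \<open>c \<cdot> m\<close> with a known
  value inside \<open>c \<cdot> (m \<cdot> y)\<close>.
\<close>

lemma cmp_reassoc:
  assumes "c \<cdot> m = d" "c \<in> Arr E" "m \<in> Arr E" "y \<in> Arr E" "tgt E m = src E c" "tgt E y = src E m"
  shows "c \<cdot> (m \<cdot> y) = d \<cdot> y"
  using cmp_assoc'[OF assms(4,3,2,6,5)] assms(1) by simp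

lemma ident_arr [simp]:
  assumes "A \<in> Ob E"
  shows "ident E A \<in> Arr E" "src E (ident E A) = A" "tgt E (ident E A) = A"
  using ident_hom[OF assms] by simp_all

lemma cmp_ident' [simp]: "f \<in> Arr E \<Longrightarrow> src E f = A \<Longrightarrow> f \<cdot> ident E A = f"
  by (rule cmp_ident[of f _ "tgt E f"]) simp

lemma ident_cmp' [simp]: "f \<in> Arr E \<Longrightarrow> tgt E f = A \<Longrightarrow> ident E A \<cdot> f = f"
  by (rule ident_cmp[of f "src E f"]) simp

lemma monoD: "mono E m \<Longrightarrow> x \<in> Arr E \<Longrightarrow> y \<in> Arr E \<Longrightarrow> tgt E x = src E m \<Longrightarrow>
    tgt E y = src E m \<Longrightarrow> src E x = src E y \<Longrightarrow> m \<cdot> x = m \<cdot> y \<Longrightarrow> x = y"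
  unfolding mono_def by (metis in_into)

lemma mono_arr [simp]: "mono E m \<Longrightarrow> m \<in> Arr E" by (auto simp: mono_def)

lemma epi_arr [simp]: "epi E m \<Longrightarrow> m \<in> Arr E" by (auto simp: epi_def)

lemma epiD: "epi E e \<Longrightarrow> x \<in> Arr E \<Longrightarrow> y \<in> Arr E \<Longrightarrow> src E x = tgt E e \<Longrightarrow>
    src E y = tgt E e \<Longrightarrow> tgt E x = tgt E y \<Longrightarrow> x \<cdot> e = y \<cdot> e \<Longrightarrow> x = y"
  unfolding epi_def by (metis in_hom tgt_ob)

lemma epi_ident: "A \<in> Ob E \<Longrightarrow> epi E (ident E A)"
  unfolding epi_def by (metis cmp_ident' ident_arr in_hom)

lemma epi_cmp:
  assumes "epi E e" "epi E d" "tgt E d = src E e"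
  shows "epi E (e \<cdot> d)"
  unfolding epi_def
proof (intro conjI ballI impI)
  show "e \<cdot> d \<in> Arr E" using assms by simp
next
  fix B x y
  assume B: "B \<in> Ob E" and x: "x \<in> hom E (tgt E (e \<cdot> d)) B" and y: "y \<in> hom E (tgt E (e \<cdot> d)) B"
    and eq: "x \<cdot> (e \<cdot> d) = y \<cdot> (e \<cdot> d)"
  have "(x \<cdot> e) \<cdot> d = (y \<cdot> e) \<cdot> d" using assms x y eq by simp
  then have "x \<cdot> e = y \<cdot> e" by - (rule epiD[OF assms(2)], use assms x y in simp_all)
  then show "x = y" by - (rule epiD[OF assms(1)], use assms x y in simp_all)
qed

end

context elementary_topos
begin

lemma One_ob' [simp]: "One E \<in> Ob E" by (rule One_ob)
lemma Prod_ob' [simp]: "A \<in> Ob E \<Longrightarrow> B \<in> Ob E \<Longrightarrow> Prod E A B \<in> Ob E" by (rule Prod_ob)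
lemma Om_ob' [simp]: "Om E \<in> Ob E" by (rule Om_ob)
lemma Pow_ob [simp]: "A \<in> Ob E \<Longrightarrow> Pow E A \<in> Ob E" unfolding Pow_def by (intro Exp_ob Om_ob)

lemma bang_arr [simp]:
  assumes "I \<in> Ob E"
  shows "bang E I \<in> Arr E" "src E (bang E I) = I" "tgt E (bang E I) = One E"
  using theI'[OF One_terminal[OF assms]] by (auto simp: bang_def)

lemma bang_unique: "f \<in> Arr E \<Longrightarrow> tgt E f = One E \<Longrightarrow> f = bang E (src E f)"
  using One_terminal[of "src E f"] bang_arr[of "src E f"] by (metis in_hom src_ob)

lemma bang_cmp [simp]: "f \<in> Arr E \<Longrightarrow> tgt E f = I \<Longrightarrow> bang E I \<cdot> f = bang E (src E f)"
  by (rule trans[OF bang_unique]) auto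

lemma bang_One [simp]: "bang E (One E) = ident E (One E)"
  using bang_unique[of "ident E (One E)"] by simp

lemma pr_arr [simp]:
  assumes "A \<in> Ob E" "B \<in> Ob E"
  shows "pr1 E A B \<in> Arr E" "src E (pr1 E A B) = Prod E A B" "tgt E (pr1 E A B) = A"
    "pr2 E A B \<in> Arr E" "src E (pr2 E A B) = Prod E A B" "tgt E (pr2 E A B) = B"
  using pr1_hom[OF assms] pr2_hom[OF assms] by auto

lemma pair_props:
  assumes "f \<in> Arr E" "g \<in> Arr E" "src E f = src E g"
  shows "pair E f g \<in> hom E (src E f) (Prod E (tgt E f) (tgt E g)) \<and>
     pr1 E (tgt E f) (tgt E g) \<cdot> pair E f g = f \<and> pr2 E (tgt E f) (tgt E g) \<cdot> pair E f g = g"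
  unfolding pair_def
  by (rule theI') (rule Prod_universal, use assms in auto)

lemma pair_arr [simp]:
  assumes "f \<in> Arr E" "g \<in> Arr E" "src E f = src E g"
  shows "pair E f g \<in> Arr E" "src E (pair E f g) = src E g"
    "tgt E (pair E f g) = Prod E (tgt E f) (tgt E g)"
  using pair_props[OF assms] assms by auto

lemma pr_pair [simp]:
  assumes "f \<in> Arr E" "g \<in> Arr E" "src E f = src E g" "tgt E f = A" "tgt E g = B"
  shows "pr1 E A B \<cdot> pair E f g = f" "pr2 E A B \<cdot> pair E f g = g"
  using pair_props[OF assms(1-3)] assms by auto

lemma pair_ext:
  assumes "z \<in> Arr E" "w \<in> Arr E" "src E z = src E w" "tgt E z = Prod E A B"
    "tgt E w = Prod E A B" "A \<in> Ob E" "B \<in> Ob E"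
    "pr1 E A B \<cdot> z = pr1 E A B \<cdot> w" "pr2 E A B \<cdot> z = pr2 E A B \<cdot> w"
  shows "z = w"
  using Prod_universal[of "pr1 E A B \<cdot> z" "src E z" A "pr2 E A B \<cdot> z" B] assms by auto

lemma pair_eta [simp]:
  assumes "z \<in> Arr E" "tgt E z = Prod E A B" "A \<in> Ob E" "B \<in> Ob E"
  shows "pair E (pr1 E A B \<cdot> z) (pr2 E A B \<cdot> z) = z"
  by (rule pair_ext[of _ _ A B]) (use assms in auto)

lemma pair_cmp [simp]:
  assumes "f \<in> Arr E" "g \<in> Arr E" "src E f = src E g" "h \<in> Arr E" "tgt E h = src E g"
  shows "pair E f g \<cdot> h = pair E (f \<cdot> h) (g \<cdot> h)"
proof (rule pair_ext[of _ _ "tgt E f" "tgt E g"])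
  have "pr1 E (tgt E f) (tgt E g) \<cdot> (pair E f g \<cdot> h) = (pr1 E (tgt E f) (tgt E g) \<cdot> pair E f g) \<cdot> h"
    using assms by (subst cmp_assoc') simp_all
  then show "pr1 E (tgt E f) (tgt E g) \<cdot> (pair E f g \<cdot> h) = pr1 E (tgt E f) (tgt E g) \<cdot> pair E (f \<cdot> h) (g \<cdot> h)"
    using assms by simp
  have "pr2 E (tgt E f) (tgt E g) \<cdot> (pair E f g \<cdot> h) = (pr2 E (tgt E f) (tgt E g) \<cdot> pair E f g) \<cdot> h"
    using assms by (subst cmp_assoc') simp_all
  then show "pr2 E (tgt E f) (tgt E g) \<cdot> (pair E f g \<cdot> h) = pr2 E (tgt E f) (tgt E g) \<cdot> pair E (f \<cdot> h) (g \<cdot> h)"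
    using assms by simp
qed (use assms in auto)

lemma pair_inject:
  assumes "f \<in> Arr E" "g \<in> Arr E" "src E f = src E g" "f' \<in> Arr E" "g' \<in> Arr E" "src E f' = src E g'"
    "tgt E f = tgt E f'" "tgt E g = tgt E g'"
  shows "pair E f g = pair E f' g' \<longleftrightarrow> f = f' \<and> g = g'"
  using pr_pair[OF assms(1-3) refl refl] pr_pair[OF assms(4-6) refl refl] assms(7,8) by metis

section \<open>Truth values\<close>

lemma tt_arr [simp]: "tt E \<in> Arr E" "src E (tt E) = One E" "tgt E (tt E) = Om E"
  using tt_hom by auto

lemma holds_tt [simp]: "I \<in> Ob E \<Longrightarrow> holds E (tt E \<cdot> bang E I)"
  by (simp add: holds_def)

lemma holds_iff: "src E p = I \<Longrightarrow> holds E p \<longleftrightarrow> p = tt E \<cdot> bang E I"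
  by (simp add: holds_def)

lemma holdsD: "holds E p \<Longrightarrow> p = tt E \<cdot> bang E (src E p)"
  unfolding holds_def .

lemma holdsI: "p = tt E \<cdot> bang E (src E p) \<Longrightarrow> holds E p"
  unfolding holds_def .

lemma holds_cmp [simp]:
  assumes "holds E p" "p \<in> Arr E" "tgt E p = Om E" "g \<in> Arr E" "tgt E g = src E p"
  shows "holds E (p \<cdot> g)"
proof -
  have "p \<cdot> g = (tt E \<cdot> bang E (src E p)) \<cdot> g"
    by (rule arg_cong[OF holdsD[OF assms(1)]])
  then show ?thesis using assms(2-) holds_iff[of "p \<cdot> g" "src E g"] by simp
qed

text \<open>
  Truth is an equation between arrows, and these may be checked on a cover.
\<close>

lemma holds_local:
  assumes "holds E (p \<cdot> e)" "epi E e" "p \<in> Arr E" "tgt E p = Om E" "src E p = tgt E e"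
  shows "holds E p"
proof -
  have "p \<cdot> e = (tt E \<cdot> bang E (src E p)) \<cdot> e"
    using holds_iff[of "p \<cdot> e" "src E e"] assms by simp
  then have "p = tt E \<cdot> bang E (src E p)"
    by - (rule epiD[OF assms(2)], use assms in simp_all)
  then show ?thesis by (rule holdsI)
qed

lemma is_pullbackD:
  assumes "is_pullback E f g p q"
  shows "f \<in> Arr E" "g \<in> Arr E" "tgt E f = tgt E g" "p \<in> Arr E" "q \<in> Arr E"
    "tgt E p = src E f" "src E q = src E p" "tgt E q = src E g" "f \<cdot> p = g \<cdot> q"
  using assms unfolding is_pullback_def in_hom by blast+

lemma is_pullback_factor:
  assumes "is_pullback E f g p q" "x \<in> Arr E" "y \<in> Arr E" "src E x = src E y"
    "tgt E x = src E f" "tgt E y = src E g" "f \<cdot> x = g \<cdot> y"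
  shows "\<exists>!z. z \<in> hom E (src E x) (src E p) \<and> p \<cdot> z = x \<and> q \<cdot> z = y"
proof -
  have "\<forall>I\<in>Ob E. \<forall>x\<in>hom E I (src E f). \<forall>y\<in>hom E I (src E g). f \<cdot> x = g \<cdot> y \<longrightarrow>
        (\<exists>!z. z \<in> hom E I (src E p) \<and> p \<cdot> z = x \<and> q \<cdot> z = y)"
    using assms(1) unfolding is_pullback_def by blast
  then show ?thesis using assms(2-) by simp
qed

lemma is_pullback_tt:
  assumes "is_pullback E c (tt E) m (bang E (src E m))" "x \<in> Arr E" "tgt E x = src E c"
  shows "holds E (c \<cdot> x) \<longleftrightarrow> (\<exists>y\<in>hom E (src E x) (src E m). x = m \<cdot> y)"
proof -
  note pb = is_pullbackD(1,4,6,9)[OF assms(1)]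
  show ?thesis
  proof
    assume "holds E (c \<cdot> x)"
    then have "c \<cdot> x = tt E \<cdot> bang E (src E x)"
      using assms(2,3) pb(1) holds_iff[of "c \<cdot> x" "src E x"] by simp
    then show "\<exists>y\<in>hom E (src E x) (src E m). x = m \<cdot> y"
      using is_pullback_factor[OF assms(1,2), of "bang E (src E x)"] assms(2,3)
      by (metis bang_arr src_ob tt_arr(2))
  next
    assume "\<exists>y\<in>hom E (src E x) (src E m). x = m \<cdot> y"
    then obtain y where y: "y \<in> Arr E" "src E y = src E x" "tgt E y = src E m" "x = m \<cdot> y"
      by (metis in_hom)
    have "c \<cdot> x = (tt E \<cdot> bang E (src E m)) \<cdot> y"
      using cmp_reassoc[OF pb(4)] y pb by simp
    also have "\<dots> = tt E \<cdot> bang E (src E x)" using y pb by simp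
    finally show "holds E (c \<cdot> x)" using assms(2,3) pb holds_iff[of "c \<cdot> x" "src E x"] by simp
  qed
qed

lemma classify:
  assumes "mono E m"
  obtains c where "c \<in> Arr E" "src E c = tgt E m" "tgt E c = Om E"
    "\<And>x. x \<in> Arr E \<Longrightarrow> tgt E x = tgt E m \<Longrightarrow>
      holds E (c \<cdot> x) \<longleftrightarrow> (\<exists>y\<in>hom E (src E x) (src E m). x = m \<cdot> y)"
proof -
  obtain c where c: "c \<in> hom E (tgt E m) (Om E)" "is_pullback E c (tt E) m (bang E (src E m))"
    using classifier[OF assms] by blast
  show ?thesis by (rule that[of c]) (use c is_pullback_tt[OF c(2)] in simp_all)
qed

lemma subobject_pullback:
  assumes "r \<in> Arr E" "tgt E r = Om E"
  obtains m where "mono E m" "tgt E m = src E r" "is_pullback E r (tt E) m (bang E (src E m))"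
proof -
  obtain m q where pb: "is_pullback E r (tt E) m q" using pullbacks[of r "tt E"] assms by auto
  note D = is_pullbackD[OF pb]
  have q: "q = bang E (src E m)" using bang_unique[of q] D by simp
  have m: "m \<in> Arr E" "tgt E m = src E r" using D by simp_all
  have "mono E m" unfolding mono_def
  proof (intro conjI ballI impI)
    show "m \<in> Arr E" by fact
    fix x y assume xy: "x \<in> into E (src E m)" "y \<in> into E (src E m)" "src E x = src E y" "m \<cdot> x = m \<cdot> y"
    have "r \<cdot> (m \<cdot> x) = (tt E \<cdot> q) \<cdot> x"
      by (rule cmp_reassoc[OF D(9)]) (use xy m assms in simp_all)
    then have eq: "r \<cdot> (m \<cdot> x) = tt E \<cdot> bang E (src E x)"
      unfolding q using xy m by simp
    have "\<exists>!z. z \<in> hom E (src E (m \<cdot> x)) (src E m) \<and> m \<cdot> z = m \<cdot> x \<and> q \<cdot> z = bang E (src E x)"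
      by (rule is_pullback_factor[OF pb]) (use eq xy m in simp_all)
    moreover have "q \<cdot> x = bang E (src E x)" "q \<cdot> y = bang E (src E x)"
      using xy m q by simp_all
    ultimately show "x = y" using xy m by (metis cmp_arr(2) in_hom in_into)
  qed
  then show ?thesis using that m pb q by metis
qed

text \<open>
  An arrow to \<open>Om\<close> is the classifier of the subobject of those generalized elements at which it holds,
  and classifiers are unique.
\<close>

lemma Om_ext:
  assumes "r \<in> Arr E" "s \<in> Arr E" "src E r = src E s" "tgt E r = Om E" "tgt E s = Om E"
    and "\<And>x. x \<in> Arr E \<Longrightarrow> tgt E x = src E s \<Longrightarrow> holds E (r \<cdot> x) \<longleftrightarrow> holds E (s \<cdot> x)"
  shows "r = s"
proof -
  obtain m where m: "mono E m" "tgt E m = src E r" "is_pullback E r (tt E) m (bang E (src E m))"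
    using subobject_pullback assms by metis
  have rm: "holds E (r \<cdot> x) \<longleftrightarrow> (\<exists>y\<in>hom E (src E x) (src E m). x = m \<cdot> y)"
    if "x \<in> Arr E" "tgt E x = src E r" for x
    using is_pullback_tt[OF m(3)] that by blast
  have "holds E (s \<cdot> m)" using rm[of m] m assms by (metis cmp_ident' ident_arr in_hom mono_arr src_ob)
  then have sm: "s \<cdot> m = tt E \<cdot> bang E (src E m)"
    using m assms holds_iff[of "s \<cdot> m" "src E m"] by simp
  have "is_pullback E s (tt E) m (bang E (src E m))"
    unfolding is_pullback_def
  proof (intro conjI ballI impI)
    fix I x y assume I: "I \<in> Ob E" and x: "x \<in> hom E I (src E s)" and y: "y \<in> hom E I (src E (tt E))"
      and eq: "s \<cdot> x = tt E \<cdot> y"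
    have "y = bang E I" using y bang_unique[of y] by simp
    then have "holds E (s \<cdot> x)" using eq I by simp
    then obtain z where z: "z \<in> hom E I (src E m)" "x = m \<cdot> z"
      using assms(3,6) rm[of x] x by (metis in_hom)
    have "bang E (src E m) \<cdot> z = y" using z m \<open>y = bang E I\<close> by simp
    then show "\<exists>!z. z \<in> hom E I (src E m) \<and> m \<cdot> z = x \<and> bang E (src E m) \<cdot> z = y"
      using z monoD[OF m(1)] by (intro ex1I[of _ z]) simp_all
  qed (use assms m sm in auto)
  then show ?thesis using classifier[OF m(1)] m assms(1-5) by (metis in_hom)
qed

end

context elementary_topos
begin

section \<open>Power objects\<close>

lemma ev_arr [simp]:
  assumes "A \<in> Ob E"
  shows "ev E A (Om E) \<in> Arr E" "src E (ev E A (Om E)) = Prod E (Pow E A) A" "tgt E (ev E A (Om E)) = Om E"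
  using ev_hom[of A "Om E"] assms by (simp_all add: Pow_def)

lemma mem_cmp:
  assumes "mem E a S" "a \<in> Arr E" "S \<in> Arr E" "src E S = src E a" "tgt E S = Pow E (tgt E a)"
    "g \<in> Arr E" "tgt E g = src E a"
  shows "mem E (a \<cdot> g) (S \<cdot> g)"
proof -
  have "holds E ((ev E (tgt E a) (Om E) \<cdot> pair E S a) \<cdot> g)"
    by (rule holds_cmp) (use assms in \<open>simp_all add: mem_def\<close>)
  then show ?thesis using assms by (simp add: mem_def)
qed

lemma transpose:
  assumes "r \<in> Arr E" "src E r = Prod E I A" "tgt E r = Om E" "I \<in> Ob E" "A \<in> Ob E"
  obtains S where "S \<in> Arr E" "src E S = I" "tgt E S = Pow E A"
    "\<And>x a. x \<in> Arr E \<Longrightarrow> a \<in> Arr E \<Longrightarrow> src E x = src E a \<Longrightarrow> tgt E x = I \<Longrightarrow> tgt E a = A \<Longrightarrow>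
      mem E a (S \<cdot> x) \<longleftrightarrow> holds E (r \<cdot> pair E x a)"
proof -
  obtain S where S: "S \<in> hom E I (Exp E A (Om E))"
    "ev E A (Om E) \<cdot> pair E (S \<cdot> pr1 E I A) (pr2 E I A) = r"
    using Exp_universal[of A "Om E" I r] assms by (metis Om_ob in_hom)
  have S': "S \<in> Arr E" "src E S = I" "tgt E S = Pow E A" using S by (simp_all add: Pow_def)
  show ?thesis
  proof (rule that[OF S'])
    fix x a assume x: "x \<in> Arr E" "a \<in> Arr E" "src E x = src E a" "tgt E x = I" "tgt E a = A"
    have "r \<cdot> pair E x a = ev E A (Om E) \<cdot> (pair E (S \<cdot> pr1 E I A) (pr2 E I A) \<cdot> pair E x a)"
      by (rule cmp_reassoc[OF S(2), symmetric]) (use S' x assms in simp_all)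
    also have "\<dots> = ev E A (Om E) \<cdot> pair E (S \<cdot> x) a"
      using S' x assms by simp
    finally show "mem E a (S \<cdot> x) \<longleftrightarrow> holds E (r \<cdot> pair E x a)"
      using x by (simp add: mem_def)
  qed
qed

text \<open>
  Extensionality of subsets: by transposition it is extensionality of truth values on a product.
\<close>

lemma Pow_ext:
  assumes "S \<in> Arr E" "T \<in> Arr E" "src E S = src E T" "tgt E S = Pow E A" "tgt E T = Pow E A" "A \<in> Ob E"
    and ext: "\<And>g a. g \<in> Arr E \<Longrightarrow> a \<in> Arr E \<Longrightarrow> tgt E g = src E T \<Longrightarrow> src E a = src E g \<Longrightarrow> tgt E a = A \<Longrightarrow>
      mem E a (S \<cdot> g) \<longleftrightarrow> mem E a (T \<cdot> g)"
  shows "S = T"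
proof -
  let ?I = "src E T"
  let ?r = "\<lambda>S. ev E A (Om E) \<cdot> pair E (S \<cdot> pr1 E ?I A) (pr2 E ?I A)"
  have "?r S = ?r T"
  proof (rule Om_ext)
    fix x assume x: "x \<in> Arr E" "tgt E x = src E (?r T)"
    show "holds E (?r S \<cdot> x) \<longleftrightarrow> holds E (?r T \<cdot> x)"
      using ext[of "pr1 E ?I A \<cdot> x" "pr2 E ?I A \<cdot> x"] assms x by (simp add: mem_def)
  qed (use assms in simp_all)
  then show ?thesis
    using Exp_universal[of A "Om E" ?I "?r T"] assms
    by (smt (verit, best) Om_ob Pow_def src_ob cmp_arr ev_arr in_hom pair_arr pr_arr)
qed

section \<open>Representable predicates\<close>

text \<open>
  The internal language is handled through the following two notions. A term with a variable of type
  \<open>A\<close> is a function on the generalized elements of \<open>A\<close>; by the Yoneda lemma it commutes with change of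
  stage exactly if it is composition with an arrow.
\<close>

definition natural where
  "natural A B t \<longleftrightarrow> A \<in> Ob E \<and> (\<exists>f\<in>hom E A B. \<forall>x\<in>into E A. t x = f \<cdot> x)"

text \<open>
  A predicate on generalized elements defines a subobject only if some truth value represents it.
  Representability is also what makes a predicate stable under change of stage and local with respect to
  covers. It is established by recursion on the formula, with one rule for each connective and quantifier.
\<close>

definition representable where
  "representable A P \<longleftrightarrow> A \<in> Ob E \<and> (\<exists>r\<in>hom E A (Om E). \<forall>x\<in>into E A. holds E (r \<cdot> x) \<longleftrightarrow> P x)"

lemma naturalE:
  assumes "natural A B t"
  obtains f where "f \<in> Arr E" "src E f = A" "tgt E f = B" "\<And>x. x \<in> Arr E \<Longrightarrow> tgt E x = A \<Longrightarrow> t x = f \<cdot> x"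
  using assms unfolding natural_def by (metis in_hom in_into)

lemma naturalI:
  assumes "f \<in> Arr E" "src E f = A" "tgt E f = B" "\<And>x. x \<in> Arr E \<Longrightarrow> tgt E x = A \<Longrightarrow> t x = f \<cdot> x"
  shows "natural A B t"
  using assms unfolding natural_def by (metis in_hom in_into src_ob)

lemma natural_ob: "natural A B t \<Longrightarrow> A \<in> Ob E \<and> B \<in> Ob E"
  unfolding natural_def by (metis in_hom tgt_ob)

lemma natural_arr:
  assumes "natural A B t" "x \<in> Arr E" "tgt E x = A"
  shows "t x \<in> Arr E" "src E (t x) = src E x" "tgt E (t x) = B"
  using assms by (auto elim!: naturalE)

lemma natural_cmp:
  assumes "natural A B t" "x \<in> Arr E" "tgt E x = A" "g \<in> Arr E" "tgt E g = src E x"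
  shows "t (x \<cdot> g) = t x \<cdot> g"
  by (rule naturalE[OF assms(1)]) (use assms in simp)

lemma natural_id: "A \<in> Ob E \<Longrightarrow> natural A A (\<lambda>x. x)"
  by (rule naturalI[of "ident E A"]) simp_all

lemma natural_comp:
  assumes "natural A B t" "f \<in> Arr E" "src E f = B" "tgt E f = C"
  shows "natural A C (\<lambda>x. f \<cdot> t x)"
proof (rule naturalE[OF assms(1)])
  fix k assume "k \<in> Arr E" "src E k = A" "tgt E k = B" "\<And>x. x \<in> Arr E \<Longrightarrow> tgt E x = A \<Longrightarrow> t x = k \<cdot> x"
  then show ?thesis using assms by (intro naturalI[of "f \<cdot> k"]) simp_all
qed

lemma natural_subst:
  assumes "natural A B t" "natural B C s"
  shows "natural A C (\<lambda>x. s (t x))"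
proof -
  obtain f where f: "f \<in> Arr E" "src E f = B" "tgt E f = C" "\<And>x. x \<in> Arr E \<Longrightarrow> tgt E x = B \<Longrightarrow> s x = f \<cdot> x"
    by (rule naturalE[OF assms(2)]) blast
  obtain k where k: "k \<in> Arr E" "src E k = A" "tgt E k = B" "\<And>x. x \<in> Arr E \<Longrightarrow> tgt E x = A \<Longrightarrow> t x = k \<cdot> x"
    by (rule naturalE[OF assms(1)]) blast
  show ?thesis by (rule naturalI[of "f \<cdot> k"]) (use f k in simp_all)
qed

lemma natural_pair:
  assumes "natural A B t" "natural A C s"
  shows "natural A (Prod E B C) (\<lambda>x. pair E (t x) (s x))"
proof -
  obtain f where f: "f \<in> Arr E" "src E f = A" "tgt E f = C" "\<And>x. x \<in> Arr E \<Longrightarrow> tgt E x = A \<Longrightarrow> s x = f \<cdot> x"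
    by (rule naturalE[OF assms(2)]) blast
  obtain k where k: "k \<in> Arr E" "src E k = A" "tgt E k = B" "\<And>x. x \<in> Arr E \<Longrightarrow> tgt E x = A \<Longrightarrow> t x = k \<cdot> x"
    by (rule naturalE[OF assms(1)]) blast
  show ?thesis by (rule naturalI[of "pair E k f"]) (use f k in simp_all)
qed

lemma natural_const:
  assumes "A \<in> Ob E" "c \<in> Arr E" "src E c = One E" "tgt E c = B"
  shows "natural A B (\<lambda>x. c \<cdot> bang E (src E x))"
  by (rule naturalI[of "c \<cdot> bang E A"]) (use assms in simp_all)

lemma natural_pr1:
  assumes "natural C (Prod E A B) t" "A \<in> Ob E" "B \<in> Ob E"
  shows "natural C A (\<lambda>x. pr1 E A B \<cdot> t x)"
  by (rule natural_comp[OF assms(1)]) (use assms in simp_all)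

lemma natural_pr2:
  assumes "natural C (Prod E A B) t" "A \<in> Ob E" "B \<in> Ob E"
  shows "natural C B (\<lambda>x. pr2 E A B \<cdot> t x)"
  by (rule natural_comp[OF assms(1)]) (use assms in simp_all)

lemma representableE:
  assumes "representable A P"
  obtains r where "r \<in> Arr E" "src E r = A" "tgt E r = Om E" "A \<in> Ob E"
    "\<And>x. x \<in> Arr E \<Longrightarrow> tgt E x = A \<Longrightarrow> holds E (r \<cdot> x) \<longleftrightarrow> P x"
  using assms unfolding representable_def by (metis in_hom in_into)

lemma representableI:
  assumes "r \<in> Arr E" "src E r = A" "tgt E r = Om E" "\<And>x. x \<in> Arr E \<Longrightarrow> tgt E x = A \<Longrightarrow> holds E (r \<cdot> x) \<longleftrightarrow> P x"
  shows "representable A P"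
  using assms unfolding representable_def by (metis in_hom in_into src_ob)

lemma representable_ob: "representable A P \<Longrightarrow> A \<in> Ob E"
  by (simp add: representable_def)

lemma representable_cong:
  assumes "representable A P" "\<And>x. x \<in> Arr E \<Longrightarrow> tgt E x = A \<Longrightarrow> Q x \<longleftrightarrow> P x"
  shows "representable A Q"
  using assms unfolding representable_def by simp

lemma representable_cmp:
  assumes "representable A P" "P x" "x \<in> Arr E" "tgt E x = A" "g \<in> Arr E" "tgt E g = src E x"
  shows "P (x \<cdot> g)"
proof (rule representableE[OF assms(1)])
  fix r assume r: "r \<in> Arr E" "src E r = A" "tgt E r = Om E"
    "\<And>x. x \<in> Arr E \<Longrightarrow> tgt E x = A \<Longrightarrow> holds E (r \<cdot> x) \<longleftrightarrow> P x"
  have "holds E ((r \<cdot> x) \<cdot> g)" by (rule holds_cmp) (use assms r in simp_all)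
  then show ?thesis using r assms by simp
qed

lemma representable_local:
  assumes "representable A P" "P (x \<cdot> e)" "x \<in> Arr E" "tgt E x = A" "epi E e" "tgt E e = src E x"
  shows "P x"
proof (rule representableE[OF assms(1)])
  fix r assume r: "r \<in> Arr E" "src E r = A" "tgt E r = Om E"
    "\<And>x. x \<in> Arr E \<Longrightarrow> tgt E x = A \<Longrightarrow> holds E (r \<cdot> x) \<longleftrightarrow> P x"
  have "holds E (r \<cdot> x)" by (rule holds_local[OF _ assms(5)]) (use assms r in simp_all)
  then show ?thesis using r assms by simp
qed

lemma representable_subst:
  assumes "representable B P" "natural A B t"
  shows "representable A (\<lambda>x. P (t x))"
proof -
  obtain r where r: "r \<in> Arr E" "src E r = B" "tgt E r = Om E"
    "\<And>x. x \<in> Arr E \<Longrightarrow> tgt E x = B \<Longrightarrow> holds E (r \<cdot> x) \<longleftrightarrow> P x"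
    by (rule representableE[OF assms(1)]) blast
  obtain k where k: "k \<in> Arr E" "src E k = A" "tgt E k = B" "\<And>x. x \<in> Arr E \<Longrightarrow> tgt E x = A \<Longrightarrow> t x = k \<cdot> x"
    by (rule naturalE[OF assms(2)]) blast
  show ?thesis
  proof (rule representableI[of "r \<cdot> k"])
    fix x assume "x \<in> Arr E" "tgt E x = A"
    then show "holds E ((r \<cdot> k) \<cdot> x) \<longleftrightarrow> P (t x)"
      using r(1-3) r(4)[of "k \<cdot> x"] k by simp
  qed (use r k in simp_all)
qed

lemma representable_holds:
  assumes "natural A (Om E) t"
  shows "representable A (\<lambda>x. holds E (t x))"
proof -
  obtain k where k: "k \<in> Arr E" "src E k = A" "tgt E k = Om E" "\<And>x. x \<in> Arr E \<Longrightarrow> tgt E x = A \<Longrightarrow> t x = k \<cdot> x"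
    by (rule naturalE[OF assms]) blast
  show ?thesis by (rule representableI[of k]) (use k in simp_all)
qed

lemma representable_True: "A \<in> Ob E \<Longrightarrow> representable A (\<lambda>x. True)"
  by (rule representable_cong[OF representable_holds[OF natural_const[of _ "tt E"]]]) simp_all

text \<open>
  Equality is classified by the diagonal.
\<close>

lemma representable_eq:
  assumes "natural A B t" "natural A B s"
  shows "representable A (\<lambda>x. t x = s x)"
proof -
  have B: "B \<in> Ob E" using natural_ob assms by blast
  let ?d = "pair E (ident E B) (ident E B)"
  have d_inj: "?d \<cdot> x = ?d \<cdot> y \<longleftrightarrow> x = y" if "x \<in> Arr E" "y \<in> Arr E" "tgt E x = B" "tgt E y = B" for x y
    using that B by (simp add: pair_inject)
  have "mono E ?d" unfolding mono_def
  proof (intro conjI ballI impI)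
    fix x y assume "x \<in> into E (src E ?d)" "y \<in> into E (src E ?d)" "?d \<cdot> x = ?d \<cdot> y"
    then show "x = y" using d_inj[of x y] B by simp
  qed (use B in simp)
  then obtain c where c: "c \<in> Arr E" "src E c = tgt E ?d" "tgt E c = Om E"
    "\<And>x. x \<in> Arr E \<Longrightarrow> tgt E x = tgt E ?d \<Longrightarrow>
      holds E (c \<cdot> x) \<longleftrightarrow> (\<exists>y\<in>hom E (src E x) (src E ?d). x = ?d \<cdot> y)"
    by (rule classify) blast
  have "representable A (\<lambda>x. holds E (c \<cdot> pair E (t x) (s x)))"
    by (rule representable_holds, rule natural_comp[OF natural_pair[OF assms]]) (use c B in simp_all)
  then show ?thesis
  proof (rule representable_cong)
    fix x assume x: "x \<in> Arr E" "tgt E x = A"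
    note n = natural_arr[OF assms(1) x] natural_arr[OF assms(2) x]
    have "(\<exists>y\<in>hom E (src E (pair E (t x) (s x))) (src E ?d). pair E (t x) (s x) = ?d \<cdot> y) \<longleftrightarrow> t x = s x"
    proof
      assume "\<exists>y\<in>hom E (src E (pair E (t x) (s x))) (src E ?d). pair E (t x) (s x) = ?d \<cdot> y"
      then obtain y where "y \<in> Arr E" "src E y = src E x" "tgt E y = B" "pair E (t x) (s x) = pair E y y"
        using n B by auto
      then show "t x = s x" using pair_inject[of "t x" "s x" y y] n by simp
    next
      assume "t x = s x"
      then show "\<exists>y\<in>hom E (src E (pair E (t x) (s x))) (src E ?d). pair E (t x) (s x) = ?d \<cdot> y"
        using n B by (intro bexI[of _ "s x"]) simp_all
    qed
    then show "t x = s x \<longleftrightarrow> holds E (c \<cdot> pair E (t x) (s x))" using c(4) n B by simp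
  qed
qed

lemma representable_mem:
  assumes "natural A B t" "natural A (Pow E B) s"
  shows "representable A (\<lambda>x. mem E (t x) (s x))"
proof -
  have B: "B \<in> Ob E" using natural_ob assms by blast
  have "representable A (\<lambda>x. holds E (ev E B (Om E) \<cdot> pair E (s x) (t x)))"
    by (rule representable_holds, rule natural_comp[OF natural_pair[OF assms(2,1)]]) (use B in simp_all)
  then show ?thesis
    by (rule representable_cong) (use natural_arr[OF assms(1)] in \<open>simp add: mem_def\<close>)
qed

text \<open>
  A conjunction is an equation between pairs of truth values.
\<close>

lemma representable_conj:
  assumes "representable A P" "representable A Q"
  shows "representable A (\<lambda>x. P x \<and> Q x)"
proof -
  obtain r where r: "r \<in> Arr E" "src E r = A" "tgt E r = Om E"  "A \<in> Ob E"
    "\<And>x. x \<in> Arr E \<Longrightarrow> tgt E x = A \<Longrightarrow> holds E (r \<cdot> x) \<longleftrightarrow> P x"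
    by (rule representableE[OF assms(1)]) blast
  obtain s where s: "s \<in> Arr E" "src E s = A" "tgt E s = Om E"
    "\<And>x. x \<in> Arr E \<Longrightarrow> tgt E x = A \<Longrightarrow> holds E (s \<cdot> x) \<longleftrightarrow> Q x"
    by (rule representableE[OF assms(2)]) blast
  let ?t = "tt E \<cdot> bang E A"
  have "representable A (\<lambda>x. pair E r s \<cdot> x = pair E ?t ?t \<cdot> x)"
    by (rule representable_eq; rule natural_comp[OF natural_id]) (use r s in simp_all)
  then show ?thesis
  proof (rule representable_cong)
    fix x assume x: "x \<in> Arr E" "tgt E x = A"
    show "P x \<and> Q x \<longleftrightarrow> pair E r s \<cdot> x = pair E ?t ?t \<cdot> x"
      using r(1-4) s(1-3) x r(5)[OF x] s(4)[OF x] holds_iff[of "r \<cdot> x" "src E x"] holds_iff[of "s \<cdot> x" "src E x"]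
      by (simp add: pair_inject)
  qed
qed

text \<open>
  Comprehension with a parameter \<open>x\<close>: the family of subsets \<open>{b. Q x b}\<close> as an arrow to the power object.
\<close>

lemma subset_of_rep:
  assumes "representable (Prod E A B) (\<lambda>z. Q (pr1 E A B \<cdot> z) (pr2 E A B \<cdot> z))" "A \<in> Ob E" "B \<in> Ob E"
  obtains S where "S \<in> Arr E" "src E S = A" "tgt E S = Pow E B"
    "\<And>x b. x \<in> Arr E \<Longrightarrow> b \<in> Arr E \<Longrightarrow> tgt E x = A \<Longrightarrow> tgt E b = B \<Longrightarrow> src E b = src E x \<Longrightarrow>
      mem E b (S \<cdot> x) \<longleftrightarrow> Q x b"
proof -
  obtain r where r: "r \<in> Arr E" "src E r = Prod E A B" "tgt E r = Om E"
    "\<And>x. x \<in> Arr E \<Longrightarrow> tgt E x = Prod E A B \<Longrightarrow> holds E (r \<cdot> x) \<longleftrightarrow> Q (pr1 E A B \<cdot> x) (pr2 E A B \<cdot> x)"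
    by (rule representableE[OF assms(1)]) blast
  obtain S where S: "S \<in> Arr E" "src E S = A" "tgt E S = Pow E B"
    "\<And>x a. x \<in> Arr E \<Longrightarrow> a \<in> Arr E \<Longrightarrow> src E x = src E a \<Longrightarrow> tgt E x = A \<Longrightarrow> tgt E a = B \<Longrightarrow>
      mem E a (S \<cdot> x) \<longleftrightarrow> holds E (r \<cdot> pair E x a)"
    by (rule transpose[OF r(1-3) assms(2,3)]) blast
  show ?thesis by (rule that[of S]) (use S r(4) in simp_all)
qed

text \<open>
  Two families of subsets are equal at \<open>x\<close> exactly if they have the same elements at all later stages, so
  this quantified equivalence is an equation. Implication and universal quantification are the special
  cases in which \<open>P \<and> Q\<close> is compared with \<open>P\<close>, and \<open>Q\<close> with truth.
\<close>

lemma representable_all_iff: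
  assumes "representable (Prod E A B) (\<lambda>z. P (pr1 E A B \<cdot> z) (pr2 E A B \<cdot> z))"
    "representable (Prod E A B) (\<lambda>z. Q (pr1 E A B \<cdot> z) (pr2 E A B \<cdot> z))" "A \<in> Ob E" "B \<in> Ob E"
  shows "representable A (\<lambda>x. \<forall>g\<in>into E (src E x). \<forall>b\<in>hom E (src E g) B. P (x \<cdot> g) b \<longleftrightarrow> Q (x \<cdot> g) b)"
proof -
  obtain S where S: "S \<in> Arr E" "src E S = A" "tgt E S = Pow E B"
    "\<And>x b. x \<in> Arr E \<Longrightarrow> b \<in> Arr E \<Longrightarrow> tgt E x = A \<Longrightarrow> tgt E b = B \<Longrightarrow> src E b = src E x \<Longrightarrow>
      mem E b (S \<cdot> x) \<longleftrightarrow> P x b"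
    by (rule subset_of_rep[OF assms(1,3,4)]) blast
  obtain T where T: "T \<in> Arr E" "src E T = A" "tgt E T = Pow E B"
    "\<And>x b. x \<in> Arr E \<Longrightarrow> b \<in> Arr E \<Longrightarrow> tgt E x = A \<Longrightarrow> tgt E b = B \<Longrightarrow> src E b = src E x \<Longrightarrow>
      mem E b (T \<cdot> x) \<longleftrightarrow> Q x b"
    by (rule subset_of_rep[OF assms(2,3,4)]) blast
  have "representable A (\<lambda>x. S \<cdot> x = T \<cdot> x)"
    by (rule representable_eq; rule natural_comp[OF natural_id]) (use S T assms in simp_all)
  then show ?thesis
  proof (rule representable_cong)
    fix x assume x: "x \<in> Arr E" "tgt E x = A"
    have SPg: "mem E b ((S \<cdot> x) \<cdot> g) \<longleftrightarrow> P (x \<cdot> g) b" "mem E b ((T \<cdot> x) \<cdot> g) \<longleftrightarrow> Q (x \<cdot> g) b"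
      if "g \<in> Arr E" "tgt E g = src E x" "b \<in> Arr E" "src E b = src E g" "tgt E b = B" for g b
      using S(1-3) S(4)[of "x \<cdot> g" b] T(1-3) T(4)[of "x \<cdot> g" b] that x by simp_all
    show "(\<forall>g\<in>into E (src E x). \<forall>b\<in>hom E (src E g) B. P (x \<cdot> g) b \<longleftrightarrow> Q (x \<cdot> g) b) \<longleftrightarrow> S \<cdot> x = T \<cdot> x"
    proof
      assume all: "\<forall>g\<in>into E (src E x). \<forall>b\<in>hom E (src E g) B. P (x \<cdot> g) b \<longleftrightarrow> Q (x \<cdot> g) b"
      show "S \<cdot> x = T \<cdot> x"
      proof (rule Pow_ext[of _ _ B])
        fix g b assume gb: "g \<in> Arr E" "b \<in> Arr E" "tgt E g = src E (T \<cdot> x)" "src E b = src E g" "tgt E b = B"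
        then have g: "tgt E g = src E x" using T x by simp
        show "mem E b ((S \<cdot> x) \<cdot> g) \<longleftrightarrow> mem E b ((T \<cdot> x) \<cdot> g)"
          unfolding SPg[OF gb(1) g gb(2,4,5)] using all gb g by simp
      qed (use S T x assms in simp_all)
    next
      assume eq: "S \<cdot> x = T \<cdot> x"
      show "\<forall>g\<in>into E (src E x). \<forall>b\<in>hom E (src E g) B. P (x \<cdot> g) b \<longleftrightarrow> Q (x \<cdot> g) b"
        using SPg unfolding eq by (metis in_hom in_into)
    qed
  qed
qed

lemma representable_all_imp:
  assumes "representable (Prod E A B) (\<lambda>z. P (pr1 E A B \<cdot> z) (pr2 E A B \<cdot> z))"
    "representable (Prod E A B) (\<lambda>z. Q (pr1 E A B \<cdot> z) (pr2 E A B \<cdot> z))" "A \<in> Ob E" "B \<in> Ob E"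
  shows "representable A (\<lambda>x. \<forall>g\<in>into E (src E x). \<forall>b\<in>hom E (src E g) B. P (x \<cdot> g) b \<longrightarrow> Q (x \<cdot> g) b)"
  by (rule representable_cong[OF representable_all_iff[where P="\<lambda>x y. P x y \<and> Q x y" and Q=P,
    OF representable_conj[OF assms(1,2)] assms(1,3,4)]]) blast

lemma representable_all:
  assumes "representable (Prod E A B) (\<lambda>z. Q (pr1 E A B \<cdot> z) (pr2 E A B \<cdot> z))" "A \<in> Ob E" "B \<in> Ob E"
  shows "representable A (\<lambda>x. \<forall>g\<in>into E (src E x). \<forall>b\<in>hom E (src E g) B. Q (x \<cdot> g) b)"
  by (rule representable_cong[OF representable_all_imp[where P="\<lambda>x y. True" and Q=Q,
    OF representable_True assms]]) (use assms in simp_all)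

text \<open>
  Implication is quantification over the one-element type.
\<close>

lemma representable_imp:
  assumes "representable A P" "representable A Q"
  shows "representable A (\<lambda>x. \<forall>g\<in>into E (src E x). P (x \<cdot> g) \<longrightarrow> Q (x \<cdot> g))"
proof -
  have A: "A \<in> Ob E" using assms representable_ob by blast
  have n: "natural (Prod E A (One E)) A (\<lambda>z. pr1 E A (One E) \<cdot> z)"
    by (rule natural_pr1[OF natural_id]) (use A in simp_all)
  show ?thesis
  proof (rule representable_cong[OF representable_all_imp[where P="\<lambda>x y. P x" and Q="\<lambda>x y. Q x",
      OF representable_subst[OF assms(1) n] representable_subst[OF assms(2) n] A One_ob]])
    fix x assume x: "x \<in> Arr E" "tgt E x = A"
    show "(\<forall>g\<in>into E (src E x). P (x \<cdot> g) \<longrightarrow> Q (x \<cdot> g)) \<longleftrightarrow>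
      (\<forall>g\<in>into E (src E x). \<forall>b\<in>hom E (src E g) (One E). P (x \<cdot> g) \<longrightarrow> Q (x \<cdot> g))"
      by (metis One_terminal in_into src_ob)
  qed
qed

section \<open>Images and covers\<close>

text \<open>
  A topos is balanced: the classifier of \<open>m\<close> holds after composition with the epimorphism \<open>m\<close>, hence it holds.
\<close>

lemma epi_mono_iso:
  assumes "mono E m" "epi E m"
  obtains n where "n \<in> Arr E" "src E n = tgt E m" "tgt E n = src E m" "m \<cdot> n = ident E (tgt E m)"
proof -
  obtain c where c: "c \<in> Arr E" "src E c = tgt E m" "tgt E c = Om E"
    "\<And>x. x \<in> Arr E \<Longrightarrow> tgt E x = tgt E m \<Longrightarrow>
      holds E (c \<cdot> x) \<longleftrightarrow> (\<exists>y\<in>hom E (src E x) (src E m). x = m \<cdot> y)"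
    using classify[OF assms(1)] by blast
  have "holds E (c \<cdot> m)" unfolding c(4)[OF epi_arr[OF assms(2)] refl]
    by (rule bexI[of _ "ident E (src E m)"]) (use assms in simp_all)
  then have "holds E c" by (rule holds_local) (use assms c in simp_all)
  then have "holds E (c \<cdot> ident E (tgt E m))" using c by simp
  then show ?thesis using that c(4)[of "ident E (tgt E m)"] assms by (metis epi_arr ident_arr in_hom tgt_ob)
qed

text \<open>
  The impredicative form of the statement that \<open>i\<close> is in the image of \<open>f\<close>: every truth value implied by
  each \<open>f a = i\<close> holds. It uses only universal quantifiers and implications, and so is available before
  existential quantifiers are.
\<close>

definition in_image where
  "in_image f i \<longleftrightarrow> (\<forall>g\<in>into E (src E i). \<forall>p\<in>hom E (src E g) (Om E).
     (\<forall>h\<in>into E (src E g). \<forall>a\<in>hom E (src E h) (src E f). f \<cdot> a = i \<cdot> g \<cdot> h \<longrightarrow> holds E (p \<cdot> h)) \<longrightarrow>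
     holds E p)"

lemma representable_in_image:
  assumes "f \<in> Arr E"
  shows "representable (tgt E f) (in_image f)"
proof -
  let ?A = "src E f" and ?B = "tgt E f" and ?C = "Prod E (tgt E f) (Om E)"
  let ?P = "\<lambda>i p. \<forall>h\<in>into E (src E p). \<forall>a\<in>hom E (src E h) (src E f). f \<cdot> a = i \<cdot> h \<longrightarrow> holds E (p \<cdot> h)"
  have "representable ?C (\<lambda>z. \<forall>g\<in>into E (src E z). \<forall>a\<in>hom E (src E g) ?A.
      f \<cdot> a = pr1 E ?B (Om E) \<cdot> (z \<cdot> g) \<longrightarrow> holds E (pr2 E ?B (Om E) \<cdot> (z \<cdot> g)))"
    by (rule representable_all_imp[where P="\<lambda>z a. f \<cdot> a = pr1 E ?B (Om E) \<cdot> z"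
        and Q="\<lambda>z a. holds E (pr2 E ?B (Om E) \<cdot> z)"])
      (rule representable_eq representable_holds natural_comp natural_id natural_pr1 natural_pr2 |
        use assms in simp)+
  then have P: "representable ?C (\<lambda>z. ?P (pr1 E ?B (Om E) \<cdot> z) (pr2 E ?B (Om E) \<cdot> z))"
    by (rule representable_cong) (use assms in simp)
  have Q: "representable ?C (\<lambda>z. holds E (pr2 E ?B (Om E) \<cdot> z))"
    by (rule representable_holds natural_pr2 natural_id | use assms in simp)+
  show ?thesis
    by (rule representable_cong[OF representable_all_imp[where P="?P" and Q="\<lambda>i p. holds E p", OF P Q]])
      (use assms in \<open>simp_all add: in_image_def\<close>)
qed

text \<open>
  The corestriction \<open>e\<close> to the image is an epimorphism: if two arrows agree after \<open>e\<close>, apply the definition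
  of the image to the truth value of their equality.
\<close>

lemma image:
  assumes "f \<in> Arr E"
  obtains e m where "epi E e" "mono E m" "tgt E m = tgt E f" "src E e = src E f" "tgt E e = src E m"
    "f = m \<cdot> e" "\<And>i. i \<in> Arr E \<Longrightarrow> tgt E i = tgt E f \<Longrightarrow> (\<exists>y\<in>hom E (src E i) (src E m). i = m \<cdot> y) \<longleftrightarrow> in_image f i"
proof -
  obtain r where r: "r \<in> Arr E" "src E r = tgt E f" "tgt E r = Om E"
    "\<And>x. x \<in> Arr E \<Longrightarrow> tgt E x = tgt E f \<Longrightarrow> holds E (r \<cdot> x) \<longleftrightarrow> in_image f x"
    by (rule representableE[OF representable_in_image[OF assms]]) blast
  obtain m where m: "mono E m" "tgt E m = src E r" "is_pullback E r (tt E) m (bang E (src E m))"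
    using subobject_pullback[OF r(1,3)] by blast
  have im: "(\<exists>y\<in>hom E (src E i) (src E m). i = m \<cdot> y) \<longleftrightarrow> in_image f i" if "i \<in> Arr E" "tgt E i = tgt E f" for i
    using is_pullback_tt[OF m(3)] r that by metis
  have "in_image f f" unfolding in_image_def
  proof (intro ballI impI)
    fix g p assume g: "g \<in> into E (src E f)" and p: "p \<in> hom E (src E g) (Om E)"
      and all: "\<forall>h\<in>into E (src E g). \<forall>a\<in>hom E (src E h) (src E f). f \<cdot> a = f \<cdot> g \<cdot> h \<longrightarrow> holds E (p \<cdot> h)"
    have "holds E (p \<cdot> ident E (src E g))"
      using all[rule_format, of "ident E (src E g)" g] g assms by simp
    then show "holds E p" using p g by simp
  qed
  then obtain e where e: "e \<in> Arr E" "src E e = src E f" "tgt E e = src E m" "f = m \<cdot> e"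
    using im[OF assms refl] by (metis in_hom)
  have "in_image f m" using im[of m] m r by (metis cmp_ident' ident_arr in_hom mono_arr src_ob)
  have "epi E e" unfolding epi_def
  proof (intro conjI ballI impI)
    fix B x y assume B: "B \<in> Ob E" and x: "x \<in> hom E (tgt E e) B" and y: "y \<in> hom E (tgt E e) B"
      and eq: "x \<cdot> e = y \<cdot> e"
    have "representable (src E m) (\<lambda>z. x \<cdot> z = y \<cdot> z)"
      by (rule representable_eq natural_comp natural_id | use e(1-3) x y m in simp)+
    then obtain p where p: "p \<in> Arr E" "src E p = src E m" "tgt E p = Om E"
      "\<And>z. z \<in> Arr E \<Longrightarrow> tgt E z = src E m \<Longrightarrow> holds E (p \<cdot> z) \<longleftrightarrow> x \<cdot> z = y \<cdot> z"
      by (rule representableE) blast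
    have "holds E p"
    proof (rule \<open>in_image f m\<close>[unfolded in_image_def, rule_format, of "ident E (src E m)" p])
      fix h a assume h: "h \<in> into E (src E (ident E (src E m)))" and a: "a \<in> hom E (src E h) (src E f)"
        and fa: "f \<cdot> a = m \<cdot> ident E (src E m) \<cdot> h"
      have h': "h \<in> Arr E" "tgt E h = src E m" using h m by simp_all
      have "m \<cdot> (e \<cdot> a) = f \<cdot> a"
        by (rule cmp_reassoc[OF e(4)[symmetric]]) (use a e(1-3) m in simp_all)
      then have mea: "m \<cdot> (e \<cdot> a) = m \<cdot> h" using fa h' m by simp
      have ea: "e \<cdot> a = h" by (rule monoD[OF m(1) _ _ _ _ _ mea]) (use a e(1-3) h' m in simp_all)
      have "x \<cdot> (e \<cdot> a) = (y \<cdot> e) \<cdot> a" by (rule cmp_reassoc[OF eq]) (use x e(1-3) a in simp_all)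
      then have "x \<cdot> (e \<cdot> a) = y \<cdot> (e \<cdot> a)" using y e(1-3) a by simp
      then have "x \<cdot> h = y \<cdot> h" unfolding ea .
      then show "holds E (p \<cdot> h)" using p h' by simp
    qed (use m p in simp_all)
    then have "holds E (p \<cdot> ident E (src E m))" using p by simp
    then show "x = y" using p(4)[of "ident E (src E m)"] m x y e(1-3) by simp
  qed (use e(1) in simp)
  show ?thesis
    by (rule that[of e m, OF \<open>epi E e\<close> m(1) _ e(2,3,4) im]) (use m r in simp_all)
qed

text \<open>
  The image of an epimorphism is a subobject that is both mono and epi, hence everything.
\<close>

lemma epi_in_image:
  assumes "epi E e" "i \<in> Arr E" "tgt E i = tgt E e"
  shows "in_image e i"
proof -
  obtain d m where d: "epi E d" "mono E m" "tgt E m = tgt E e" "src E d = src E e" "tgt E d = src E m"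
    "e = m \<cdot> d" "\<And>i. i \<in> Arr E \<Longrightarrow> tgt E i = tgt E e \<Longrightarrow> (\<exists>y\<in>hom E (src E i) (src E m). i = m \<cdot> y) \<longleftrightarrow> in_image e i"
    using image[OF epi_arr[OF assms(1)]] by blast
  have "epi E m" unfolding epi_def
  proof (intro conjI ballI impI)
    fix B x y assume x: "x \<in> hom E (tgt E m) B" and y: "y \<in> hom E (tgt E m) B" and eq: "x \<cdot> m = y \<cdot> m"
    have "x \<cdot> (m \<cdot> d) = (y \<cdot> m) \<cdot> d" by (rule cmp_reassoc[OF eq]) (use x d(1-5) in simp_all)
    then have "x \<cdot> e = y \<cdot> e" unfolding d(6) using d(1-3,5) epi_arr[OF d(1)] x y by simp
    then show "x = y" by - (rule epiD[OF assms(1)], use x y d(3) assms in simp_all)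
  qed (use d(2) in simp)
  then obtain n where n: "n \<in> Arr E" "src E n = tgt E m" "tgt E n = src E m" "m \<cdot> n = ident E (tgt E m)"
    using epi_mono_iso[OF d(2)] by blast
  have "m \<cdot> (n \<cdot> i) = ident E (tgt E m) \<cdot> i" by (rule cmp_reassoc[OF n(4)]) (use n d(1-3) assms in simp_all)
  then have "i = m \<cdot> (n \<cdot> i)" using assms d(3) by simp
  moreover have "n \<cdot> i \<in> hom E (src E i) (src E m)" using n assms d(3) by simp
  ultimately show ?thesis using d(7)[OF assms(2,3)] by blast
qed

text \<open>
  Covers are stable under pullback. Being in the image is stable under change of stage by the form of its
  definition; if two arrows agree on the pullback of the cover, then the truth value of their equality is
  implied by each preimage, and therefore holds.
\<close>

lemma epi_pullback:
  assumes "epi E e" "g \<in> Arr E" "tgt E g = tgt E e"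
  obtains e' g' where "epi E e'" "tgt E e' = src E g" "g' \<in> Arr E" "src E g' = src E e'" "tgt E g' = src E e"
    "e \<cdot> g' = g \<cdot> e'"
proof -
  obtain g' e' where pb: "is_pullback E e g g' e'" using pullbacks[of e g] assms by auto
  note D = is_pullbackD[OF pb]
  have "epi E e'" unfolding epi_def
  proof (intro conjI ballI impI)
    fix B x y assume x: "x \<in> hom E (tgt E e') B" and y: "y \<in> hom E (tgt E e') B" and eq: "x \<cdot> e' = y \<cdot> e'"
    have "representable (src E g) (\<lambda>z. x \<cdot> z = y \<cdot> z)"
      by (rule representable_eq natural_comp natural_id | use D x y in simp)+
    then obtain p where p: "p \<in> Arr E" "src E p = src E g" "tgt E p = Om E"
      "\<And>z. z \<in> Arr E \<Longrightarrow> tgt E z = src E g \<Longrightarrow> holds E (p \<cdot> z) \<longleftrightarrow> x \<cdot> z = y \<cdot> z"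
      by (rule representableE) blast
    have "holds E p"
    proof (rule epi_in_image[OF assms, unfolded in_image_def, rule_format, of "ident E (src E g)" p])
      fix h a assume h: "h \<in> into E (src E (ident E (src E g)))" and a: "a \<in> hom E (src E h) (src E e)"
        and ea: "e \<cdot> a = g \<cdot> ident E (src E g) \<cdot> h"
      have h': "h \<in> Arr E" "tgt E h = src E g" using h assms by simp_all
      have "\<exists>!z. z \<in> hom E (src E a) (src E g') \<and> g' \<cdot> z = a \<and> e' \<cdot> z = h"
        by (rule is_pullback_factor[OF pb]) (use ea h' a assms in simp_all)
      then obtain z where z: "z \<in> Arr E" "src E z = src E a" "tgt E z = src E g'" "e' \<cdot> z = h"
        by (metis in_hom)
      have "x \<cdot> (e' \<cdot> z) = (y \<cdot> e') \<cdot> z" by (rule cmp_reassoc[OF eq]) (use x D z in simp_all)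
      then have "x \<cdot> (e' \<cdot> z) = y \<cdot> (e' \<cdot> z)" using y D z(1-3) by simp
      then have "x \<cdot> h = y \<cdot> h" unfolding z(4) .
      then show "holds E (p \<cdot> h)" using p h' by simp
    qed (use assms p in simp_all)
    then have "holds E (p \<cdot> ident E (src E g))" using p by simp
    then show "x = y" using p(4)[of "ident E (src E g)"] assms x y D by simp
  qed (use D in simp)
  then show ?thesis using that[of e' g'] D by simp
qed

section \<open>Local existence\<close>

lemma exists_locE:
  assumes "exists_loc E I A P"
  obtains e a where "epi E e" "e \<in> Arr E" "tgt E e = I" "a \<in> Arr E" "src E a = src E e" "tgt E a = A" "P e a"
  using assms unfolding exists_loc_def by (metis epi_arr in_hom)

lemma exists_locI:
  assumes "epi E e" "tgt E e = I" "a \<in> Arr E" "src E a = src E e" "tgt E a = A" "P e a"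
  shows "exists_loc E I A P"
  using assms unfolding exists_loc_def by (metis in_hom)

lemma exists_loc_here:
  assumes "I \<in> Ob E" "a \<in> Arr E" "src E a = I" "tgt E a = A" "P (ident E I) a"
  shows "exists_loc E I A P"
  by (rule exists_locI[of "ident E I" _ a]) (use assms epi_ident in simp_all)

text \<open>
  Existential statements are stable under change of stage, as the witnessing cover can be pulled back.
\<close>

lemma exists_loc_cmp:
  assumes "exists_loc E I A P" "g \<in> Arr E" "tgt E g = I"
    "\<And>e a d h. epi E e \<Longrightarrow> e \<in> Arr E \<Longrightarrow> tgt E e = I \<Longrightarrow> a \<in> Arr E \<Longrightarrow> src E a = src E e \<Longrightarrow> tgt E a = A \<Longrightarrow> P e a \<Longrightarrow>
      epi E d \<Longrightarrow> d \<in> Arr E \<Longrightarrow> tgt E d = src E g \<Longrightarrow> h \<in> Arr E \<Longrightarrow> src E h = src E d \<Longrightarrow> tgt E h = src E e \<Longrightarrow>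
      e \<cdot> h = g \<cdot> d \<Longrightarrow> Q d (a \<cdot> h)"
  shows "exists_loc E (src E g) A Q"
proof -
  obtain e a where e: "epi E e" "e \<in> Arr E" "tgt E e = I" "a \<in> Arr E" "src E a = src E e" "tgt E a = A" "P e a"
    by (rule exists_locE[OF assms(1)]) blast
  obtain d h where d: "epi E d" "tgt E d = src E g" "h \<in> Arr E" "src E h = src E d" "tgt E h = src E e" "e \<cdot> h = g \<cdot> d"
    using epi_pullback[OF e(1), of g] assms e by auto
  show ?thesis
    by (rule exists_locI[of d _ "a \<cdot> h"]) (use d e assms(4)[OF e d(1) epi_arr[OF d(1)] d(2-)] in simp_all)
qed

text \<open>
  The existential quantifier is the image of the projection from the subobject defined by \<open>Q\<close>. An element
  of the image is lifted on the pullback of the cover onto the image, and conversely membership in the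
  image is local.
\<close>

lemma representable_ex:
  assumes "representable (Prod E A B) (\<lambda>z. Q (pr1 E A B \<cdot> z) (pr2 E A B \<cdot> z))" "A \<in> Ob E" "B \<in> Ob E"
  shows "representable A (\<lambda>x. exists_loc E (src E x) B (\<lambda>e b. Q (x \<cdot> e) b))"
proof -
  obtain r where r: "r \<in> Arr E" "src E r = Prod E A B" "tgt E r = Om E"
    "\<And>x. x \<in> Arr E \<Longrightarrow> tgt E x = Prod E A B \<Longrightarrow> holds E (r \<cdot> x) \<longleftrightarrow> Q (pr1 E A B \<cdot> x) (pr2 E A B \<cdot> x)"
    by (rule representableE[OF assms(1)]) blast
  obtain m where m: "mono E m" "tgt E m = src E r" "is_pullback E r (tt E) m (bang E (src E m))"
    using subobject_pullback[OF r(1,3)] by blast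
  let ?f = "pr1 E A B \<cdot> m"
  have m': "m \<in> Arr E" "tgt E m = Prod E A B" using m r by simp_all
  have f: "?f \<in> Arr E" "src E ?f = src E m" "tgt E ?f = A" using m' assms by simp_all
  obtain d n where d: "epi E d" "mono E n" "tgt E n = tgt E ?f" "src E d = src E ?f" "tgt E d = src E n" "?f = n \<cdot> d"
    by (rule image[OF f(1)]) (rule that)
  have d': "epi E d" "d \<in> Arr E" "n \<in> Arr E" "tgt E n = A" "src E d = src E m" "tgt E d = src E n"
    using d(1-5) f by simp_all
  obtain c where c: "c \<in> Arr E" "src E c = tgt E n" "tgt E c = Om E"
    "\<And>x. x \<in> Arr E \<Longrightarrow> tgt E x = tgt E n \<Longrightarrow>
      holds E (c \<cdot> x) \<longleftrightarrow> (\<exists>y\<in>hom E (src E x) (src E n). x = n \<cdot> y)"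
    using classify[OF d(2)] by blast
  show ?thesis
  proof (rule representableI[of c])
    fix x assume x: "x \<in> Arr E" "tgt E x = A"
    show "holds E (c \<cdot> x) \<longleftrightarrow> exists_loc E (src E x) B (\<lambda>e b. Q (x \<cdot> e) b)"
    proof
      assume "holds E (c \<cdot> x)"
      then obtain y where y: "y \<in> Arr E" "src E y = src E x" "tgt E y = src E n" "x = n \<cdot> y"
        using c(4)[of x] x d'(4) by (metis in_hom)
      obtain e h where e: "epi E e" "tgt E e = src E y" "h \<in> Arr E" "src E h = src E e" "tgt E h = src E d" "d \<cdot> h = y \<cdot> e"
        using epi_pullback[OF d(1) y(1,3)[folded d'(6)]] by blast
      have h: "h \<in> Arr E" "tgt E h = src E m" using e d' by simp_all
      have "?f \<cdot> h = n \<cdot> (d \<cdot> h)" unfolding d(6) using d' e(1-5) by simp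
      also have "\<dots> = x \<cdot> e" unfolding e(6) y(4) using y(1-3) d' e(1-5) by simp
      finally have fh: "pr1 E A B \<cdot> (m \<cdot> h) = x \<cdot> e" using m' h assms by simp
      have "holds E (r \<cdot> (m \<cdot> h))"
      proof (rule is_pullback_tt[OF m(3), THEN iffD2])
        show "\<exists>y\<in>hom E (src E (m \<cdot> h)) (src E m). m \<cdot> h = m \<cdot> y"
          by (rule bexI[of _ h]) (use m' h in simp_all)
      qed (use m' h r(1-3) in simp_all)
      then have "Q (x \<cdot> e) (pr2 E A B \<cdot> (m \<cdot> h))"
        using r(4)[of "m \<cdot> h"] m' h fh by simp
      then show "exists_loc E (src E x) B (\<lambda>e b. Q (x \<cdot> e) b)"
        by - (rule exists_locI[of e _ "pr2 E A B \<cdot> (m \<cdot> h)"], use e y m' h assms in simp_all)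
    next
      assume "exists_loc E (src E x) B (\<lambda>e b. Q (x \<cdot> e) b)"
      then obtain e b where e: "epi E e" "e \<in> Arr E" "tgt E e = src E x" "b \<in> Arr E" "src E b = src E e" "tgt E b = B" "Q (x \<cdot> e) b"
        by (rule exists_locE) blast
      have "holds E (r \<cdot> pair E (x \<cdot> e) b)" using r(4) e x by simp
      then have "\<exists>y\<in>hom E (src E (pair E (x \<cdot> e) b)) (src E m). pair E (x \<cdot> e) b = m \<cdot> y"
        by - (rule is_pullback_tt[OF m(3), THEN iffD1], use r(1-3) e(1-6) x in simp_all)
      then obtain y where y0: "y \<in> hom E (src E (pair E (x \<cdot> e) b)) (src E m)" "pair E (x \<cdot> e) b = m \<cdot> y"
        by (rule bexE) (rule that)
      have y: "y \<in> Arr E" "src E y = src E e" "tgt E y = src E m" "pair E (x \<cdot> e) b = m \<cdot> y"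
        using y0(1) e(1-6) x by (simp_all add: y0(2)[symmetric])
      have "x \<cdot> e = pr1 E A B \<cdot> (m \<cdot> y)" unfolding y(4)[symmetric] using x e by simp
      also have "\<dots> = (n \<cdot> d) \<cdot> y" using cmp_reassoc[OF d(6)] m' y(1-3) assms by simp
      also have "\<dots> = n \<cdot> (d \<cdot> y)" using d' y(1-3) by simp
      finally have xe: "x \<cdot> e = n \<cdot> (d \<cdot> y)" .
      have "holds E (c \<cdot> (x \<cdot> e))"
      proof (rule c(4)[THEN iffD2])
        show "\<exists>z\<in>hom E (src E (x \<cdot> e)) (src E n). x \<cdot> e = n \<cdot> z"
          by (rule bexI[of _ "d \<cdot> y"], rule xe) (use x e(1-6) d' y(1-3) in simp)
      qed (use x e(1-6) d' in simp_all)
      then show "holds E (c \<cdot> x)" by - (rule holds_local[OF _ e(1)], use c(1-3) x e(1-6) d' in simp_all)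
    qed
  qed (use c(1-3) d' in simp_all)
qed

section \<open>Subobjects and relations defined by predicates\<close>

lemma compr_props:
  assumes "representable B P"
  shows "mono E (compr E B P) \<and> tgt E (compr E B P) = B \<and>
     (\<forall>x\<in>into E B. (\<exists>y\<in>hom E (src E x) (src E (compr E B P)). x = compr E B P \<cdot> y) \<longleftrightarrow> P x)"
proof -
  obtain r where r: "r \<in> Arr E" "src E r = B" "tgt E r = Om E"
    "\<And>x. x \<in> Arr E \<Longrightarrow> tgt E x = B \<Longrightarrow> holds E (r \<cdot> x) \<longleftrightarrow> P x"
    by (rule representableE[OF assms]) blast
  obtain m where m: "mono E m" "tgt E m = src E r" "is_pullback E r (tt E) m (bang E (src E m))"
    using subobject_pullback[OF r(1,3)] by blast
  show ?thesis unfolding compr_def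
    by (rule someI[of _ m]) (use m r is_pullback_tt[OF m(3)] in simp)
qed

lemma compr_arr:
  assumes "representable B P"
  shows "compr E B P \<in> Arr E" "tgt E (compr E B P) = B" "mono E (compr E B P)"
  using compr_props[OF assms] by simp_all

lemma compr_factor:
  assumes "representable B P" "x \<in> Arr E" "tgt E x = B" "P x"
  obtains y where "y \<in> Arr E" "src E y = src E x" "tgt E y = src E (compr E B P)" "compr E B P \<cdot> y = x"
  using compr_props[OF assms(1)] assms by (metis in_hom in_into)

lemma compr_sat:
  assumes "representable B P" "y \<in> Arr E" "tgt E y = src E (compr E B P)"
  shows "P (compr E B P \<cdot> y)"
proof -
  let ?m = "compr E B P"
  have "\<exists>z\<in>hom E (src E (?m \<cdot> y)) (src E ?m). ?m \<cdot> y = ?m \<cdot> z"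
    by (rule bexI[of _ y]) (use assms compr_arr[OF assms(1)] in simp_all)
  then show ?thesis
    by (rule compr_props[OF assms(1), THEN conjunct2, THEN conjunct2, rule_format, THEN iffD1, rotated])
      (use assms(2,3) compr_arr[OF assms(1)] in simp)
qed

lemma rel_props:
  assumes "representable (Prod E A A) (\<lambda>z. R (pr1 E A A \<cdot> z) (pr2 E A A \<cdot> z))" "A \<in> Ob E"
  shows "rel E A R \<in> hom E (Prod E A A) (Om E) \<and>
     (\<forall>I\<in>Ob E. \<forall>u\<in>hom E I A. \<forall>v\<in>hom E I A. holds E (rel E A R \<cdot> pair E u v) \<longleftrightarrow> R u v)"
  unfolding rel_def
proof (rule theI')
  obtain r where r: "r \<in> Arr E" "src E r = Prod E A A" "tgt E r = Om E"
    "\<And>x. x \<in> Arr E \<Longrightarrow> tgt E x = Prod E A A \<Longrightarrow> holds E (r \<cdot> x) \<longleftrightarrow> R (pr1 E A A \<cdot> x) (pr2 E A A \<cdot> x)"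
    by (rule representableE[OF assms(1)]) blast
  show "\<exists>!r. r \<in> hom E (Prod E A A) (Om E) \<and>
     (\<forall>I\<in>Ob E. \<forall>u\<in>hom E I A. \<forall>v\<in>hom E I A. holds E (r \<cdot> pair E u v) \<longleftrightarrow> R u v)"
  proof (rule ex1I[of _ r])
    show "r \<in> hom E (Prod E A A) (Om E) \<and>
     (\<forall>I\<in>Ob E. \<forall>u\<in>hom E I A. \<forall>v\<in>hom E I A. holds E (r \<cdot> pair E u v) \<longleftrightarrow> R u v)"
      using r by simp
  next
    fix s assume s: "s \<in> hom E (Prod E A A) (Om E) \<and>
     (\<forall>I\<in>Ob E. \<forall>u\<in>hom E I A. \<forall>v\<in>hom E I A. holds E (s \<cdot> pair E u v) \<longleftrightarrow> R u v)"
    show "s = r"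
    proof (rule Om_ext)
      fix x assume x: "x \<in> Arr E" "tgt E x = src E r"
      have "holds E (s \<cdot> pair E (pr1 E A A \<cdot> x) (pr2 E A A \<cdot> x)) \<longleftrightarrow> R (pr1 E A A \<cdot> x) (pr2 E A A \<cdot> x)"
        using s x r(1-3) assms by (intro s[THEN conjunct2, rule_format, of "src E x"]) simp_all
      then show "holds E (s \<cdot> x) \<longleftrightarrow> holds E (r \<cdot> x)" using r(4)[of x] r(1-3) x assms by simp
    qed (use r s in simp_all)
  qed
qed

end

section \<open>Internal frames\<close>

locale internal_poset = elementary_topos E for E :: "('o, 'm) topos" (structure) +
  fixes X :: "('o, 'm) frm"
  assumes poset: "is_poset E X"
begin

lemma opens_ob [simp]: "opens X \<in> Ob E"
  using poset unfolding is_poset_def by blast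

lemma le_arr [simp]: "le X \<in> Arr E" "src E (le X) = Prod E (opens X) (opens X)" "tgt E (le X) = Om E"
  using poset unfolding is_poset_def in_hom by blast+

lemma leq_refl [simp]: "u \<in> Arr E \<Longrightarrow> tgt E u = opens X \<Longrightarrow> leq E X u u"
proof -
  assume "u \<in> Arr E" "tgt E u = opens X"
  then have "u \<in> hom E (src E u) (opens X)" "src E u \<in> Ob E" by simp_all
  then show ?thesis using poset unfolding is_poset_def by blast
qed

lemma leq_trans:
  assumes "leq E X u v" "leq E X v w" "u \<in> hom E I (opens X)" "v \<in> hom E I (opens X)" "w \<in> hom E I (opens X)"
  shows "leq E X u w"
proof -
  have "I \<in> Ob E" using assms(3) by auto
  then show ?thesis using poset assms unfolding is_poset_def by blast
qed

lemma leq_antisym: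
  assumes "leq E X u v" "leq E X v u" "u \<in> hom E I (opens X)" "v \<in> hom E I (opens X)"
  shows "u = v"
proof -
  have "I \<in> Ob E" using assms(3) by auto
  then show ?thesis using poset assms unfolding is_poset_def by blast
qed

lemma representable_leq:
  assumes "natural A (opens X) t" "natural A (opens X) s"
  shows "representable A (\<lambda>x. leq E X (t x) (s x))"
  unfolding leq_def
  by (rule representable_holds natural_comp natural_pair assms | simp)+

lemma leq_cmp:
  assumes "leq E X u v" "u \<in> hom E I (opens X)" "v \<in> hom E I (opens X)" "g \<in> Arr E" "tgt E g = I"
  shows "leq E X (u \<cdot> g) (v \<cdot> g)"
proof -
  have "holds E ((le X \<cdot> pair E u v) \<cdot> g)"
    by (rule holds_cmp) (use assms in \<open>simp_all add: leq_def\<close>)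
  then show ?thesis using assms by (simp add: leq_def)
qed

lemma leq_local:
  assumes "leq E X (u \<cdot> e) (v \<cdot> e)" "epi E e" "u \<in> hom E I (opens X)" "v \<in> hom E I (opens X)" "tgt E e = I"
  shows "leq E X u v"
  unfolding leq_def
  by (rule holds_local[OF _ assms(2)]) (use assms in \<open>simp_all add: leq_def\<close>)

lemma eq_by_upper_bounds:
  assumes "s \<in> hom E I (opens X)" "s' \<in> hom E I (opens X)"
    "\<And>t. t \<in> hom E I (opens X) \<Longrightarrow> leq E X s t \<longleftrightarrow> leq E X s' t"
  shows "s = s'"
proof (rule leq_antisym[OF _ _ assms(1,2)])
  show "leq E X s s'" using assms(3)[of s'] assms(1,2) by simp
  show "leq E X s' s" using assms(3)[of s] assms(1,2) by simp
qed

lemma eq_by_lower_bounds: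
  assumes "s \<in> hom E I (opens X)" "s' \<in> hom E I (opens X)"
    "\<And>t. t \<in> hom E I (opens X) \<Longrightarrow> leq E X t s \<longleftrightarrow> leq E X t s'"
  shows "s = s'"
proof (rule leq_antisym[OF _ _ assms(1,2)])
  show "leq E X s s'" using assms(3)[of s] assms(1,2) by simp
  show "leq E X s' s" using assms(3)[of s'] assms(1,2) by simp
qed

lemma stage_here:
  assumes "\<forall>g\<in>into E (src E s). \<forall>t\<in>hom E (src E g) (opens X). Q g t" "s \<in> Arr E" "t \<in> hom E (src E s) (opens X)"
  shows "Q (ident E (src E s)) t"
  using assms by simp

lemma is_meet_here:
  assumes "is_meet E X u v s" "s \<in> hom E I (opens X)" "u \<in> hom E I (opens X)" "v \<in> hom E I (opens X)"
    "t \<in> hom E I (opens X)"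
  shows "leq E X t s \<longleftrightarrow> leq E X t u \<and> leq E X t v"
  using stage_here[OF assms(1)[unfolded is_meet_def], of t] assms(2-) by simp

lemma is_meet_cmp:
  assumes "is_meet E X u v s" "s \<in> hom E I (opens X)" "u \<in> hom E I (opens X)" "v \<in> hom E I (opens X)"
    "g \<in> Arr E" "tgt E g = I"
  shows "is_meet E X (u \<cdot> g) (v \<cdot> g) (s \<cdot> g)"
  unfolding is_meet_def
proof (intro ballI)
  fix h t assume "h \<in> into E (src E (s \<cdot> g))" "t \<in> hom E (src E h) (opens X)"
  then show "leq E X t (s \<cdot> g \<cdot> h) \<longleftrightarrow> leq E X t (u \<cdot> g \<cdot> h) \<and> leq E X t (v \<cdot> g \<cdot> h)"
    using assms(1)[unfolded is_meet_def, rule_format, of "g \<cdot> h" t] assms(2-) by simp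
qed

lemma is_sup_here:
  assumes "is_sup E X P s" "s \<in> hom E I (opens X)" "t \<in> hom E I (opens X)"
    "\<And>h a. h \<in> Arr E \<Longrightarrow> tgt E h = I \<Longrightarrow> a \<in> hom E (src E h) (opens X) \<Longrightarrow> P h a \<Longrightarrow> leq E X a (t \<cdot> h)"
  shows "leq E X s t"
proof -
  have I: "I \<in> Ob E" using assms(2) by auto
  have "leq E X (s \<cdot> ident E I) t"
    by (rule assms(1)[unfolded is_sup_def, rule_format, of "ident E I" t, THEN iffD2])
      (use assms I in simp_all)
  then show ?thesis using assms(2) by simp
qed

lemma is_sup_upper:
  assumes "is_sup E X P s" "s \<in> hom E I (opens X)" "P h a" "h \<in> Arr E" "tgt E h = I" "a \<in> hom E (src E h) (opens X)"
  shows "leq E X a (s \<cdot> h)"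
proof -
  have "leq E X a (s \<cdot> h \<cdot> ident E (src E h))"
    by (rule assms(1)[unfolded is_sup_def, rule_format, of h "s \<cdot> h", THEN iffD1, rule_format])
      (use assms in simp_all)
  then show ?thesis using assms(2-) by simp
qed

lemma is_supI:
  assumes "s \<in> hom E I (opens X)"
    and upper: "\<And>h a. h \<in> Arr E \<Longrightarrow> tgt E h = I \<Longrightarrow> a \<in> hom E (src E h) (opens X) \<Longrightarrow> P h a \<Longrightarrow> leq E X a (s \<cdot> h)"
    and least: "\<And>g t. g \<in> Arr E \<Longrightarrow> tgt E g = I \<Longrightarrow> t \<in> hom E (src E g) (opens X) \<Longrightarrow>
      (\<And>h a. h \<in> Arr E \<Longrightarrow> tgt E h = src E g \<Longrightarrow> a \<in> hom E (src E h) (opens X) \<Longrightarrow> P (g \<cdot> h) a \<Longrightarrow> leq E X a (t \<cdot> h)) \<Longrightarrow>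
      leq E X (s \<cdot> g) t"
  shows "is_sup E X P s"
  unfolding is_sup_def
proof (intro ballI iffI impI)
  fix g t h a assume g: "g \<in> into E (src E s)" and t: "t \<in> hom E (src E g) (opens X)" and st: "leq E X (s \<cdot> g) t"
    and h: "h \<in> into E (src E g)" and a: "a \<in> hom E (src E h) (opens X)" and P: "P (g \<cdot> h) a"
  have "leq E X ((s \<cdot> g) \<cdot> h) (t \<cdot> h)" by (rule leq_cmp[OF st]) (use assms(1) g t h in simp_all)
  moreover have "leq E X a (s \<cdot> (g \<cdot> h))" by (rule upper[OF _ _ _ P]) (use assms(1) g t h a in simp_all)
  ultimately show "leq E X a (t \<cdot> h)"
    by - (rule leq_trans[of _ "s \<cdot> (g \<cdot> h)" _ "src E h"], use assms(1) g t h a in simp_all)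
next
  fix g t assume g: "g \<in> into E (src E s)" and t: "t \<in> hom E (src E g) (opens X)"
    and all: "\<forall>h\<in>into E (src E g). \<forall>a\<in>hom E (src E h) (opens X). P (g \<cdot> h) a \<longrightarrow> leq E X a (t \<cdot> h)"
  show "leq E X (s \<cdot> g) t"
    by (rule least[of g t]) (use all g t assms(1) in simp_all)
qed

lemma is_sup_cmp:
  assumes "is_sup E X P s" "s \<in> hom E I (opens X)" "g \<in> Arr E" "tgt E g = I"
  shows "is_sup E X (\<lambda>h. P (g \<cdot> h)) (s \<cdot> g)"
  unfolding is_sup_def
proof (intro ballI)
  fix h t assume h: "h \<in> into E (src E (s \<cdot> g))" "t \<in> hom E (src E h) (opens X)"
  show "leq E X (s \<cdot> g \<cdot> h) t \<longleftrightarrow> (\<forall>k\<in>into E (src E h). \<forall>a\<in>hom E (src E k) (opens X). P (g \<cdot> (h \<cdot> k)) a \<longrightarrow> leq E X a (t \<cdot> k))"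
    using assms(1)[unfolded is_sup_def, rule_format, of "g \<cdot> h" t] assms(2-) h by simp
qed

lemma is_sup_cong:
  assumes "is_sup E X P s" "s \<in> hom E I (opens X)"
    "\<And>h a. h \<in> Arr E \<Longrightarrow> tgt E h = I \<Longrightarrow> a \<in> hom E (src E h) (opens X) \<Longrightarrow> Q h a \<longleftrightarrow> P h a"
  shows "is_sup E X Q s"
  unfolding is_sup_def
proof (intro ballI)
  fix h t assume h: "h \<in> into E (src E s)" "t \<in> hom E (src E h) (opens X)"
  have "leq E X (s \<cdot> h) t \<longleftrightarrow> (\<forall>k\<in>into E (src E h). \<forall>a\<in>hom E (src E k) (opens X). P (h \<cdot> k) a \<longrightarrow> leq E X a (t \<cdot> k))"
    using assms(1)[unfolded is_sup_def, rule_format, of h t] h by simp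
  also have "\<dots> \<longleftrightarrow> (\<forall>k\<in>into E (src E h). \<forall>a\<in>hom E (src E k) (opens X). Q (h \<cdot> k) a \<longrightarrow> leq E X a (t \<cdot> k))"
    using assms(2,3) h by simp
  finally show "leq E X (s \<cdot> h) t \<longleftrightarrow> (\<forall>k\<in>into E (src E h). \<forall>a\<in>hom E (src E k) (opens X). Q (h \<cdot> k) a \<longrightarrow> leq E X a (t \<cdot> k))" .
qed

lemma is_sup_unique:
  assumes "is_sup E X P s" "is_sup E X P s'" "s \<in> hom E I (opens X)" "s' \<in> hom E I (opens X)"
  shows "s = s'"
proof (rule leq_antisym[OF _ _ assms(3,4)])
  show "leq E X s s'" by (rule is_sup_here[OF assms(1,3,4)]) (rule is_sup_upper[OF assms(2,4)])
  show "leq E X s' s" by (rule is_sup_here[OF assms(2,4,3)]) (rule is_sup_upper[OF assms(1,3)])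
qed

lemma meet_props_if_exists:
  assumes "u \<in> hom E I (opens X)" "v \<in> hom E I (opens X)" "\<exists>s\<in>hom E I (opens X). is_meet E X u v s"
  shows "meet E X u v \<in> hom E I (opens X) \<and> is_meet E X u v (meet E X u v)"
proof -
  have I: "src E u = I" using assms by auto
  obtain s where s: "s \<in> hom E I (opens X)" "is_meet E X u v s"
    using assms(3) by blast
  show ?thesis unfolding meet_def I
  proof (rule theI', rule ex1I[of _ s])
    fix s' assume "s' \<in> hom E I (opens X) \<and> is_meet E X u v s'"
    then show "s' = s" using is_meet_here[OF _ _ assms(1,2)] s eq_by_lower_bounds by metis
  qed (use s in blast)
qed

lemma is_meet_unique:
  assumes "is_meet E X u v s" "is_meet E X u v s'" "s \<in> hom E I (opens X)" "s' \<in> hom E I (opens X)"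
    "u \<in> hom E I (opens X)" "v \<in> hom E I (opens X)"
  shows "s = s'"
  by (rule eq_by_lower_bounds[OF assms(3,4)])
    (use is_meet_here[OF assms(1,3,5,6)] is_meet_here[OF assms(2,4,5,6)] in blast)

lemma Join_props_if_exists:
  assumes "S \<in> hom E I (Pow E (opens X))"
    "\<exists>s\<in>hom E I (opens X). is_sup E X (\<lambda>g a. mem E a (S \<cdot> g)) s"
  shows "Join E X S \<in> hom E I (opens X) \<and> is_sup E X (\<lambda>g a. mem E a (S \<cdot> g)) (Join E X S)"
proof -
  have I: "src E S = I" using assms by auto
  obtain s where s: "s \<in> hom E I (opens X)" "is_sup E X (\<lambda>g a. mem E a (S \<cdot> g)) s"
    using assms(2) by blast
  show ?thesis unfolding Join_def I
  proof (rule theI', rule ex1I[of _ s])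
    fix s' assume "s' \<in> hom E I (opens X) \<and> is_sup E X (\<lambda>g a. mem E a (S \<cdot> g)) s'"
    then show "s' = s" using s is_sup_unique by blast
  qed (use s in blast)
qed

text \<open>
  The law of distributivity in the form of a bound, with finite meets and suprema described only by their
  universal properties. This form can be checked before the operations are known to exist as functions.
\<close>

lemma is_frameI:
  assumes top: "\<And>I. I \<in> Ob E \<Longrightarrow> \<exists>s\<in>hom E I (opens X). is_top E X s"
    and meets: "\<And>I u v. u \<in> hom E I (opens X) \<Longrightarrow> v \<in> hom E I (opens X) \<Longrightarrow> \<exists>s\<in>hom E I (opens X). is_meet E X u v s"
    and sups: "\<And>I S. S \<in> hom E I (Pow E (opens X)) \<Longrightarrow>
      \<exists>s\<in>hom E I (opens X). is_sup E X (\<lambda>g a. mem E a (S \<cdot> g)) s"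
    and dist: "\<And>I u S s m t. u \<in> hom E I (opens X) \<Longrightarrow> S \<in> hom E I (Pow E (opens X)) \<Longrightarrow> s \<in> hom E I (opens X) \<Longrightarrow>
      m \<in> hom E I (opens X) \<Longrightarrow> t \<in> hom E I (opens X) \<Longrightarrow>
      is_sup E X (\<lambda>g a. mem E a (S \<cdot> g)) s \<Longrightarrow> is_meet E X u s m \<Longrightarrow>
      (\<And>h a b. h \<in> Arr E \<Longrightarrow> tgt E h = I \<Longrightarrow> a \<in> hom E (src E h) (opens X) \<Longrightarrow> b \<in> hom E (src E h) (opens X) \<Longrightarrow>
        mem E a (S \<cdot> h) \<Longrightarrow> is_meet E X (u \<cdot> h) a b \<Longrightarrow> leq E X b (t \<cdot> h)) \<Longrightarrow> leq E X m t"
  shows "is_frame E X"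
  unfolding is_frame_def
proof (intro conjI ballI)
  fix I u S assume I: "I \<in> Ob E" and u: "u \<in> hom E I (opens X)" and S: "S \<in> hom E I (Pow E (opens X))"
  note J = Join_props_if_exists[OF S sups[OF S]]
  let ?s = "Join E X S" and ?m = "meet E X u (Join E X S)"
  note M = meet_props_if_exists[OF u J[THEN conjunct1] meets[OF u J[THEN conjunct1]]]
  have s: "?s \<in> hom E I (opens X)" and m: "?m \<in> hom E I (opens X)" using J M by blast+
  show "is_sup E X (\<lambda>g b. exists_loc E (src E g) (opens X)
                (\<lambda>e a. mem E a (S \<cdot> g \<cdot> e) \<and> b \<cdot> e = meet E X (u \<cdot> g \<cdot> e) a)) ?m"
  proof (rule is_supI[OF m])
    fix h b assume h: "h \<in> Arr E" "tgt E h = I" and b: "b \<in> hom E (src E h) (opens X)"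
      and ex: "exists_loc E (src E h) (opens X) (\<lambda>e a. mem E a (S \<cdot> h \<cdot> e) \<and> b \<cdot> e = meet E X (u \<cdot> h \<cdot> e) a)"
    obtain e a where e: "epi E e" "e \<in> Arr E" "tgt E e = src E h" "a \<in> Arr E" "src E a = src E e"
      "tgt E a = opens X" "mem E a (S \<cdot> h \<cdot> e) \<and> b \<cdot> e = meet E X (u \<cdot> h \<cdot> e) a"
      by (rule exists_locE[OF ex]) (rule that)
    have ue: "u \<cdot> h \<cdot> e \<in> hom E (src E e) (opens X)" and ae: "a \<in> hom E (src E e) (opens X)" using u h e(1-6) by simp_all
    have mea: "meet E X (u \<cdot> h \<cdot> e) a \<in> hom E (src E e) (opens X)"
      "is_meet E X (u \<cdot> h \<cdot> e) a (meet E X (u \<cdot> h \<cdot> e) a)"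
      using meet_props_if_exists[OF ue ae meets[OF ue ae]] by blast+
    have be: "b \<cdot> e \<in> hom E (src E e) (opens X)" using b e(1-6) by simp
    have bm: "leq E X (b \<cdot> e) (meet E X (u \<cdot> h \<cdot> e) a)"
      unfolding e(7)[THEN conjunct2] using mea(1) by simp
    have bb: "leq E X (b \<cdot> e) (u \<cdot> h \<cdot> e)" "leq E X (b \<cdot> e) a"
      using is_meet_here[OF mea(2,1) ue ae be] bm by blast+
    have "leq E X a (?s \<cdot> (h \<cdot> e))"
      by (rule is_sup_upper[OF J[THEN conjunct2] s]) (use h e S in simp_all)
    then have bs: "leq E X (b \<cdot> e) (?s \<cdot> (h \<cdot> e))"
      by (rule leq_trans[OF bb(2)]) (use be ae s h e(1-6) in simp_all)
    have "is_meet E X (u \<cdot> (h \<cdot> e)) (?s \<cdot> (h \<cdot> e)) (?m \<cdot> (h \<cdot> e))"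
      by (rule is_meet_cmp[OF M[THEN conjunct2] m]) (use u s h e(1-6) in simp_all)
    then have "leq E X (b \<cdot> e) (?m \<cdot> (h \<cdot> e)) \<longleftrightarrow> leq E X (b \<cdot> e) (u \<cdot> (h \<cdot> e)) \<and> leq E X (b \<cdot> e) (?s \<cdot> (h \<cdot> e))"
      by (rule is_meet_here[of _ _ _ "src E e"]) (use m u s h e(1-6) b in simp_all)
    then have "leq E X (b \<cdot> e) ((?m \<cdot> h) \<cdot> e)" using bs bb(1) u m h e(1-6) by simp
    then show "leq E X b (?m \<cdot> h)" by (rule leq_local[OF _ e(1)]) (use m h e(1-6) b in simp_all)
  next
    fix g t assume g: "g \<in> Arr E" "tgt E g = I" and t: "t \<in> hom E (src E g) (opens X)"
      and all: "\<And>h a. h \<in> Arr E \<Longrightarrow> tgt E h = src E g \<Longrightarrow> a \<in> hom E (src E h) (opens X) \<Longrightarrow>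
        exists_loc E (src E (g \<cdot> h)) (opens X)
          (\<lambda>e aa. mem E aa (S \<cdot> (g \<cdot> h) \<cdot> e) \<and> a \<cdot> e = meet E X (u \<cdot> (g \<cdot> h) \<cdot> e) aa) \<Longrightarrow> leq E X a (t \<cdot> h)"
    show "leq E X (?m \<cdot> g) t"
    proof (rule dist)
      show "is_sup E X (\<lambda>h a. mem E a ((S \<cdot> g) \<cdot> h)) (?s \<cdot> g)"
        by (rule is_sup_cong[OF is_sup_cmp[OF J[THEN conjunct2] s g], of "src E g"])
          (use S s g in simp_all)
      show "is_meet E X (u \<cdot> g) (?s \<cdot> g) (?m \<cdot> g)"
        by (rule is_meet_cmp[OF M[THEN conjunct2] m]) (use u s g in simp_all)
      fix h a b assume h: "h \<in> Arr E" "tgt E h = src E g" and a: "a \<in> hom E (src E h) (opens X)"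
        and b: "b \<in> hom E (src E h) (opens X)" and mem: "mem E a ((S \<cdot> g) \<cdot> h)" and ism: "is_meet E X ((u \<cdot> g) \<cdot> h) a b"
      have ue: "(u \<cdot> g) \<cdot> h \<in> hom E (src E h) (opens X)" using u g h by simp
      have "b = meet E X ((u \<cdot> g) \<cdot> h) a"
        using is_meet_unique[OF ism _ b _ ue a] meet_props_if_exists[OF ue a meets[OF ue a]] by blast
      then have "exists_loc E (src E (g \<cdot> h)) (opens X)
          (\<lambda>e aa. mem E aa (S \<cdot> (g \<cdot> h) \<cdot> e) \<and> b \<cdot> e = meet E X (u \<cdot> (g \<cdot> h) \<cdot> e) aa)"
        by - (rule exists_loc_here[of _ a], use a b mem u S g h in simp_all)
      then show "leq E X b (t \<cdot> h)" by (rule all[OF h b])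
    qed (use u s m S t g in simp_all)
  qed
qed (use poset top meets sups in auto)

end

locale internal_frame = internal_poset +
  assumes frame: "is_frame E X"

lemma internal_frameI: "elementary_topos E \<Longrightarrow> is_frame E X \<Longrightarrow> internal_frame E X"
  by (intro internal_frame.intro internal_poset.intro internal_poset_axioms.intro internal_frame_axioms.intro)
    (simp_all add: is_frame_def)

context internal_frame
begin

subsection \<open>Top and binary meets\<close>

lemma whole_props:
  assumes "I \<in> Ob E"
  shows "whole E X I \<in> hom E I (opens X) \<and> is_top E X (whole E X I)"
  unfolding whole_def
proof (rule theI')
  obtain s where s: "s \<in> hom E I (opens X)" "is_top E X s"
    using frame assms unfolding is_frame_def by blast
  have top: "leq E X t s" if "is_top E X s" "t \<in> hom E I (opens X)" "s \<in> hom E I (opens X)" for s t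
    using stage_here[OF that(1)[unfolded is_top_def], of t] that by simp
  show "\<exists>!s. s \<in> hom E I (opens X) \<and> is_top E X s"
    by (rule ex1I[of _ s]) (use s top leq_antisym in blast)+
qed

lemma whole_arr [simp]:
  assumes "I \<in> Ob E"
  shows "whole E X I \<in> Arr E" "src E (whole E X I) = I" "tgt E (whole E X I) = opens X"
  using whole_props[OF assms] by simp_all

lemma leq_whole [simp]: "u \<in> Arr E \<Longrightarrow> tgt E u = opens X \<Longrightarrow> I = src E u \<Longrightarrow> leq E X u (whole E X I)"
  using whole_props[of I] stage_here[of "whole E X I" "\<lambda>g t. leq E X t (whole E X I \<cdot> g)" u]
  unfolding is_top_def by simp

lemma whole_cmp [simp]:
  assumes "g \<in> Arr E" "tgt E g = I"
  shows "whole E X I \<cdot> g = whole E X (src E g)"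
proof -
  have "I \<in> Ob E" using assms by auto
  then have "leq E X (whole E X (src E g)) (whole E X I \<cdot> g)"
    using whole_props[of I] assms unfolding is_top_def by simp
  then show ?thesis
    by (intro leq_antisym[of _ _ "src E g"]) (use assms in auto)
qed

lemma meet_props:
  assumes "u \<in> hom E I (opens X)" "v \<in> hom E I (opens X)"
  shows "meet E X u v \<in> hom E I (opens X) \<and> is_meet E X u v (meet E X u v)"
proof (rule meet_props_if_exists[OF assms])
  have "I \<in> Ob E" using assms by auto
  then show "\<exists>s\<in>hom E I (opens X). is_meet E X u v s"
    using frame assms unfolding is_frame_def by blast
qed

lemma meet_hom: "u \<in> hom E I (opens X) \<Longrightarrow> v \<in> hom E I (opens X) \<Longrightarrow> meet E X u v \<in> hom E I (opens X)"
  using meet_props by blast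

lemma meet_arr [simp]:
  assumes "u \<in> Arr E" "v \<in> Arr E" "src E u = src E v" "tgt E u = opens X" "tgt E v = opens X"
  shows "meet E X u v \<in> Arr E" "src E (meet E X u v) = src E v" "tgt E (meet E X u v) = opens X"
  using meet_hom[of u "src E v" v] assms by simp_all

lemma leq_meet_iff:
  assumes "u \<in> hom E I (opens X)" "v \<in> hom E I (opens X)" "t \<in> hom E I (opens X)"
  shows "leq E X t (meet E X u v) \<longleftrightarrow> leq E X t u \<and> leq E X t v"
  using is_meet_here meet_props assms by blast

lemma meet_cmp [simp]:
  assumes "u \<in> Arr E" "v \<in> Arr E" "src E u = src E v" "tgt E u = opens X" "tgt E v = opens X"
    "g \<in> Arr E" "tgt E g = src E v"
  shows "meet E X u v \<cdot> g = meet E X (u \<cdot> g) (v \<cdot> g)"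
proof (rule eq_by_lower_bounds[of _ "src E g"])
  have uv: "u \<in> hom E (src E v) (opens X)" "v \<in> hom E (src E v) (opens X)" using assms by simp_all
  have 1: "is_meet E X (u \<cdot> g) (v \<cdot> g) (meet E X u v \<cdot> g)"
    by (rule is_meet_cmp) (use meet_props[OF uv] assms in simp_all)
  fix t assume t: "t \<in> hom E (src E g) (opens X)"
  show "leq E X t (meet E X u v \<cdot> g) \<longleftrightarrow> leq E X t (meet E X (u \<cdot> g) (v \<cdot> g))"
    using is_meet_here[OF 1, of "src E g" t] leq_meet_iff[of "u \<cdot> g" "src E g" "v \<cdot> g" t] assms t by simp
qed (use assms in simp_all)

lemma meet_lower [simp]:
  assumes "u \<in> Arr E" "v \<in> Arr E" "src E u = src E v" "tgt E u = opens X" "tgt E v = opens X"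
  shows "leq E X (meet E X u v) u" "leq E X (meet E X u v) v"
  using leq_meet_iff[of u "src E v" v "meet E X u v"] assms by simp_all

lemma meet_greatest:
  assumes "leq E X t u" "leq E X t v" "u \<in> hom E I (opens X)" "v \<in> hom E I (opens X)" "t \<in> hom E I (opens X)"
  shows "leq E X t (meet E X u v)"
  using leq_meet_iff assms by blast

lemma meet_mono:
  assumes "leq E X u u'" "leq E X v v'" "u \<in> hom E I (opens X)" "v \<in> hom E I (opens X)"
     "u' \<in> hom E I (opens X)" "v' \<in> hom E I (opens X)"
  shows "leq E X (meet E X u v) (meet E X u' v')"
proof (rule meet_greatest)
  show "leq E X (meet E X u v) u'" by (rule leq_trans[OF _ assms(1)]) (use assms in simp_all)
  show "leq E X (meet E X u v) v'" by (rule leq_trans[OF _ assms(2)]) (use assms in simp_all)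
qed (use assms in simp_all)

lemma natural_meet:
  assumes "natural A (opens X) t" "natural A (opens X) s"
  shows "natural A (opens X) (\<lambda>x. meet E X (t x) (s x))"
proof -
  obtain f where f: "f \<in> Arr E" "src E f = A" "tgt E f = opens X" "\<And>x. x \<in> Arr E \<Longrightarrow> tgt E x = A \<Longrightarrow> s x = f \<cdot> x"
    by (rule naturalE[OF assms(2)]) (rule that)
  obtain k where k: "k \<in> Arr E" "src E k = A" "tgt E k = opens X" "\<And>x. x \<in> Arr E \<Longrightarrow> tgt E x = A \<Longrightarrow> t x = k \<cdot> x"
    by (rule naturalE[OF assms(1)]) (rule that)
  show ?thesis by (rule naturalI[of "meet E X k f"]) (use f k in simp_all)
qed

lemma natural_whole:
  assumes "A \<in> Ob E"
  shows "natural A (opens X) (\<lambda>x. whole E X (src E x))"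
  by (rule naturalI[of "whole E X A"]) (use assms in simp_all)

subsection \<open>Suprema\<close>

lemma Join_props:
  assumes "S \<in> hom E I (Pow E (opens X))"
  shows "Join E X S \<in> hom E I (opens X) \<and> is_sup E X (\<lambda>g a. mem E a (S \<cdot> g)) (Join E X S)"
proof (rule Join_props_if_exists[OF assms])
  have "I \<in> Ob E" using assms by auto
  then show "\<exists>s\<in>hom E I (opens X). is_sup E X (\<lambda>g a. mem E a (S \<cdot> g)) s"
    using frame assms unfolding is_frame_def by blast
qed

lemma Join_arr [simp]:
  assumes "S \<in> Arr E" "tgt E S = Pow E (opens X)"
  shows "Join E X S \<in> Arr E" "src E (Join E X S) = src E S" "tgt E (Join E X S) = opens X"
  using Join_props[of S "src E S"] assms by simp_all

lemma Join_cmp [simp]: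
  assumes "S \<in> Arr E" "tgt E S = Pow E (opens X)" "g \<in> Arr E" "tgt E g = src E S"
  shows "Join E X S \<cdot> g = Join E X (S \<cdot> g)"
proof (rule is_sup_unique[of _ _ _ "src E g"])
  have "is_sup E X (\<lambda>h a. mem E a (S \<cdot> (g \<cdot> h))) (Join E X S \<cdot> g)"
    by (rule is_sup_cmp[of "\<lambda>h a. mem E a (S \<cdot> h)" _ "src E S"])
      (use Join_props[of S "src E S"] assms in simp_all)
  then show "is_sup E X (\<lambda>h a. mem E a (S \<cdot> g \<cdot> h)) (Join E X S \<cdot> g)"
    by (rule is_sup_cong[of _ _ "src E g"]) (use assms in simp_all)
  show "is_sup E X (\<lambda>h a. mem E a (S \<cdot> g \<cdot> h)) (Join E X (S \<cdot> g))"
    using Join_props[of "S \<cdot> g" "src E g"] assms by simp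
qed (use assms in simp_all)

lemma natural_Join:
  assumes "natural A (Pow E (opens X)) t"
  shows "natural A (opens X) (\<lambda>x. Join E X (t x))"
proof -
  obtain k where k: "k \<in> Arr E" "src E k = A" "tgt E k = Pow E (opens X)" "\<And>x. x \<in> Arr E \<Longrightarrow> tgt E x = A \<Longrightarrow> t x = k \<cdot> x"
    by (rule naturalE[OF assms(1)]) (rule that)
  show ?thesis by (rule naturalI[of "Join E X k"]) (use k in simp_all)
qed

lemma Join_upper:
  assumes "mem E a S" "S \<in> hom E I (Pow E (opens X))" "a \<in> hom E I (opens X)"
  shows "leq E X a (Join E X S)"
proof -
  have I: "I \<in> Ob E" using assms by auto
  have "leq E X a (Join E X S \<cdot> ident E I)"
    by (rule is_sup_upper[OF Join_props[OF assms(2), THEN conjunct2]]) (use assms I in simp_all)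
  then show ?thesis using assms by simp
qed

lemma Join_least:
  assumes "S \<in> hom E I (Pow E (opens X))" "t \<in> hom E I (opens X)"
    "\<And>h a. h \<in> Arr E \<Longrightarrow> tgt E h = I \<Longrightarrow> a \<in> hom E (src E h) (opens X) \<Longrightarrow> mem E a (S \<cdot> h) \<Longrightarrow> leq E X a (t \<cdot> h)"
  shows "leq E X (Join E X S) t"
  by (rule is_sup_here[OF Join_props[OF assms(1), THEN conjunct2] _ assms(2)]) (use assms in simp_all)

text \<open>
  The infinite distributive law; the existential quantifier in its definition disappears since the order is
  local.
\<close>

lemma meet_Join_leq:
  assumes "S \<in> hom E I (Pow E (opens X))" "t \<in> hom E I (opens X)" "u \<in> hom E I (opens X)"
    and le: "\<And>h a. h \<in> Arr E \<Longrightarrow> tgt E h = I \<Longrightarrow> a \<in> hom E (src E h) (opens X) \<Longrightarrow> mem E a (S \<cdot> h) \<Longrightarrow>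
      leq E X (meet E X (u \<cdot> h) a) (t \<cdot> h)"
  shows "leq E X (meet E X u (Join E X S)) t"
proof -
  have I: "I \<in> Ob E" using assms(1) by auto
  have sup: "is_sup E X (\<lambda>g b. exists_loc E (src E g) (opens X)
                (\<lambda>e a. mem E a (S \<cdot> g \<cdot> e) \<and> b \<cdot> e = meet E X (u \<cdot> g \<cdot> e) a))
             (meet E X u (Join E X S))"
    using frame I assms(1,3) unfolding is_frame_def by blast
  show ?thesis
  proof (rule is_sup_here[OF sup _ assms(2)])
    fix h b assume h: "h \<in> Arr E" "tgt E h = I" and b: "b \<in> hom E (src E h) (opens X)"
      and ex: "exists_loc E (src E h) (opens X) (\<lambda>e a. mem E a (S \<cdot> h \<cdot> e) \<and> b \<cdot> e = meet E X (u \<cdot> h \<cdot> e) a)"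
    obtain e a where e: "epi E e" "e \<in> Arr E" "tgt E e = src E h" "a \<in> Arr E" "src E a = src E e"
      "tgt E a = opens X" "mem E a (S \<cdot> h \<cdot> e) \<and> b \<cdot> e = meet E X (u \<cdot> h \<cdot> e) a"
      by (rule exists_locE[OF ex]) (rule that)
    have "leq E X (meet E X (u \<cdot> (h \<cdot> e)) a) (t \<cdot> (h \<cdot> e))"
      by (rule le) (use assms(1) e h in simp_all)
    then have "leq E X (b \<cdot> e) ((t \<cdot> h) \<cdot> e)" using e assms(2,3) h by simp
    then show "leq E X b (t \<cdot> h)" by (rule leq_local[OF _ e(1)]) (use e h b assms(2) in simp_all)
  qed (use assms in simp)
qed

lemma sup_exists:
  assumes "representable (Prod E A (opens X)) (\<lambda>z. Q (pr1 E A (opens X) \<cdot> z) (pr2 E A (opens X) \<cdot> z))" "A \<in> Ob E"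
  obtains S where "S \<in> hom E A (Pow E (opens X))" "is_sup E X Q (Join E X S)"
    "\<And>x b. x \<in> Arr E \<Longrightarrow> b \<in> Arr E \<Longrightarrow> tgt E x = A \<Longrightarrow> tgt E b = opens X \<Longrightarrow> src E b = src E x \<Longrightarrow>
      mem E b (S \<cdot> x) \<longleftrightarrow> Q x b"
proof -
  obtain S where S: "S \<in> Arr E" "src E S = A" "tgt E S = Pow E (opens X)"
    "\<And>x b. x \<in> Arr E \<Longrightarrow> b \<in> Arr E \<Longrightarrow> tgt E x = A \<Longrightarrow> tgt E b = opens X \<Longrightarrow> src E b = src E x \<Longrightarrow>
      mem E b (S \<cdot> x) \<longleftrightarrow> Q x b"
    by (rule subset_of_rep[OF assms opens_ob]) (rule that)
  have "is_sup E X Q (Join E X S)"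
  proof (rule is_sup_cong[OF Join_props[THEN conjunct2], of _ A])
    fix h a assume "h \<in> Arr E" "tgt E h = A" "a \<in> hom E (src E h) (opens X)"
    then show "Q h a \<longleftrightarrow> mem E a (S \<cdot> h)" using S(4)[of h a] by simp
  qed (use S in simp_all)
  then show ?thesis by - (rule that[of S], use S in simp_all)
qed

subsection \<open>Bottom, joins and implication\<close>

lemma is_bottom_here:
  assumes "is_bottom E X s" "s \<in> hom E I (opens X)" "t \<in> hom E I (opens X)"
  shows "leq E X s t"
  using stage_here[OF assms(1)[unfolded is_bottom_def], of t] assms(2-) by simp

text \<open>
  The bottom element is the supremum of the opens that lie below all opens.
\<close>

lemma empty_props:
  assumes "I \<in> Ob E"
  shows "empty E X I \<in> hom E I (opens X) \<and> is_bottom E X (empty E X I)"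
  unfolding empty_def
proof (rule theI')
  let ?Q = "\<lambda>x a. \<forall>g\<in>into E (src E a). \<forall>t\<in>hom E (src E g) (opens X). leq E X (a \<cdot> g) t"
  have "representable (opens X) (\<lambda>a. \<forall>g\<in>into E (src E a). \<forall>t\<in>hom E (src E g) (opens X). leq E X (a \<cdot> g) t)"
    by (rule representable_all) (rule representable_leq natural_pr1 natural_pr2 natural_id | simp)+
  then have rep: "representable (Prod E I (opens X)) (\<lambda>z. ?Q (pr1 E I (opens X) \<cdot> z) (pr2 E I (opens X) \<cdot> z))"
    by (rule representable_subst[where t="\<lambda>z. pr2 E I (opens X) \<cdot> z"])
      (rule natural_pr2 natural_id | use assms in simp)+
  obtain S where S: "S \<in> hom E I (Pow E (opens X))" "is_sup E X ?Q (Join E X S)"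
    by (rule sup_exists[where Q="?Q", OF rep assms]) (rule that)
  have bot: "is_bottom E X (Join E X S)" unfolding is_bottom_def
  proof (intro ballI)
    fix g t assume g: "g \<in> into E (src E (Join E X S))" "t \<in> hom E (src E g) (opens X)"
    have sup: "is_sup E X (\<lambda>h. ?Q (g \<cdot> h)) (Join E X S \<cdot> g)"
      by (rule is_sup_cmp[OF S(2), of I]) (use S(1) g in simp_all)
    show "leq E X (Join E X S \<cdot> g) t"
    proof (rule is_sup_here[OF sup])
      fix h a assume h: "h \<in> Arr E" "tgt E h = src E g" "a \<in> hom E (src E h) (opens X)" and Q: "?Q (g \<cdot> h) a"
      have "leq E X (a \<cdot> ident E (src E h)) (t \<cdot> h)"
        by (rule Q[rule_format]) (use h g in simp_all)
      then show "leq E X a (t \<cdot> h)" using h by simp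
    qed (use S(1) g in simp_all)
  qed
  have J: "Join E X S \<in> hom E I (opens X)" using S by simp
  show "\<exists>!s. s \<in> hom E I (opens X) \<and> is_bottom E X s"
    by (rule ex1I[of _ "Join E X S"]) (use J bot is_bottom_here leq_antisym in blast)+
qed

lemma empty_arr [simp]:
  assumes "I \<in> Ob E"
  shows "empty E X I \<in> Arr E" "src E (empty E X I) = I" "tgt E (empty E X I) = opens X"
  using empty_props[OF assms] by simp_all

lemma empty_leq [simp]: "u \<in> Arr E \<Longrightarrow> tgt E u = opens X \<Longrightarrow> I = src E u \<Longrightarrow> leq E X (empty E X I) u"
  using empty_props[of I] is_bottom_here[of "empty E X I" I u] by simp

lemma empty_cmp [simp]:
  assumes "g \<in> Arr E" "tgt E g = I"
  shows "empty E X I \<cdot> g = empty E X (src E g)"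
proof -
  have "I \<in> Ob E" using assms by auto
  then have "leq E X (empty E X I \<cdot> g) (empty E X (src E g))"
    using empty_props[of I] assms unfolding is_bottom_def by simp
  then show ?thesis
    by (intro leq_antisym[of _ _ "src E g"]) (use assms in auto)
qed

lemma is_join_here:
  assumes "is_join E X u v s" "s \<in> hom E I (opens X)" "u \<in> hom E I (opens X)" "v \<in> hom E I (opens X)"
    "t \<in> hom E I (opens X)"
  shows "leq E X s t \<longleftrightarrow> leq E X u t \<and> leq E X v t"
  using stage_here[OF assms(1)[unfolded is_join_def], of t] assms(2-) by simp

text \<open>
  The join of \<open>u\<close> and \<open>v\<close> is the supremum of the opens that lie below all common upper bounds. This
  description by universal quantifiers replaces the disjunction \<open>a = u \<or> a = v\<close>.
\<close>

lemma join_exists: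
  assumes "u \<in> hom E I (opens X)" "v \<in> hom E I (opens X)"
  shows "\<exists>s\<in>hom E I (opens X). is_join E X u v s"
proof -
  have I: "I \<in> Ob E" using assms(1) by auto
  let ?C = "Prod E I (opens X)" and ?p = "pr1 E I (opens X)" and ?q = "pr2 E I (opens X)"
  let ?Q = "\<lambda>x a. \<forall>g\<in>into E (src E a). \<forall>t\<in>hom E (src E g) (opens X).
      leq E X (u \<cdot> (x \<cdot> g)) t \<and> leq E X (v \<cdot> (x \<cdot> g)) t \<longrightarrow> leq E X (a \<cdot> g) t"
  have "representable ?C (\<lambda>z. \<forall>g\<in>into E (src E z). \<forall>t\<in>hom E (src E g) (opens X).
      leq E X (u \<cdot> (?p \<cdot> (z \<cdot> g))) t \<and> leq E X (v \<cdot> (?p \<cdot> (z \<cdot> g))) t \<longrightarrow> leq E X (?q \<cdot> (z \<cdot> g)) t)"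
    by (rule representable_all_imp[where P="\<lambda>z t. leq E X (u \<cdot> (?p \<cdot> z)) t \<and> leq E X (v \<cdot> (?p \<cdot> z)) t"
        and Q="\<lambda>z t. leq E X (?q \<cdot> z) t"])
      (rule representable_conj representable_leq natural_comp natural_pr1 natural_pr2 natural_id | use assms I in simp)+
  then have rep: "representable ?C (\<lambda>z. ?Q (?p \<cdot> z) (?q \<cdot> z))"
    by (rule representable_cong) (use assms I in simp)
  obtain S where S: "S \<in> hom E I (Pow E (opens X))" "is_sup E X ?Q (Join E X S)"
    by (rule sup_exists[where Q="?Q", OF rep I]) (rule that)
  let ?s = "Join E X S"
  have J: "?s \<in> hom E I (opens X)" using S by simp
  have up: "leq E X u ?s" "leq E X v ?s"
  proof -
    have "leq E X u (?s \<cdot> ident E I)"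
    proof (rule is_sup_upper[OF S(2) J])
      show "?Q (ident E I) u" using assms I by simp
    qed (use assms I in simp_all)
    then show "leq E X u ?s" using J by simp
    have "leq E X v (?s \<cdot> ident E I)"
    proof (rule is_sup_upper[OF S(2) J])
      show "?Q (ident E I) v" using assms I by simp
    qed (use assms I in simp_all)
    then show "leq E X v ?s" using J by simp
  qed
  have "is_join E X u v ?s" unfolding is_join_def
  proof (intro ballI iffI conjI)
    fix g t assume g: "g \<in> into E (src E ?s)" and t: "t \<in> hom E (src E g) (opens X)" and st: "leq E X (?s \<cdot> g) t"
    have "leq E X (u \<cdot> g) (?s \<cdot> g)" by (rule leq_cmp[OF up(1)]) (use assms J g in simp_all)
    then show "leq E X (u \<cdot> g) t" by (rule leq_trans[OF _ st]) (use assms J g t in simp_all)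
    have "leq E X (v \<cdot> g) (?s \<cdot> g)" by (rule leq_cmp[OF up(2)]) (use assms J g in simp_all)
    then show "leq E X (v \<cdot> g) t" by (rule leq_trans[OF _ st]) (use assms J g t in simp_all)
  next
    fix g t assume g: "g \<in> into E (src E ?s)" and t: "t \<in> hom E (src E g) (opens X)"
      and uv: "leq E X (u \<cdot> g) t \<and> leq E X (v \<cdot> g) t"
    have sup: "is_sup E X (\<lambda>h. ?Q (g \<cdot> h)) (?s \<cdot> g)"
      by (rule is_sup_cmp[OF S(2) J]) (use S(1) g in simp_all)
    show "leq E X (?s \<cdot> g) t"
    proof (rule is_sup_here[OF sup])
      fix h a assume h: "h \<in> Arr E" "tgt E h = src E g" "a \<in> hom E (src E h) (opens X)" and Q: "?Q (g \<cdot> h) a"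
      have "leq E X ((u \<cdot> g) \<cdot> h) (t \<cdot> h)" "leq E X ((v \<cdot> g) \<cdot> h) (t \<cdot> h)"
        by (rule leq_cmp[OF uv[THEN conjunct1]] leq_cmp[OF uv[THEN conjunct2]]; use assms J g t h in simp)+
      then have "leq E X (a \<cdot> ident E (src E h)) (t \<cdot> h)"
        using assms J g t h by (intro Q[rule_format]) simp_all
      then show "leq E X a (t \<cdot> h)" using h by simp
    qed (use J g t in simp_all)
  qed
  then show ?thesis using J by blast
qed

lemma join_props:
  assumes "u \<in> hom E I (opens X)" "v \<in> hom E I (opens X)"
  shows "join E X u v \<in> hom E I (opens X) \<and> is_join E X u v (join E X u v)"
proof -
  have I: "src E u = I" using assms by auto
  obtain s where s: "s \<in> hom E I (opens X)" "is_join E X u v s"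
    using join_exists[OF assms] by blast
  show ?thesis unfolding join_def I
  proof (rule theI', rule ex1I[of _ s])
    fix s' assume "s' \<in> hom E I (opens X) \<and> is_join E X u v s'"
    then show "s' = s" using is_join_here[OF _ _ assms] s eq_by_upper_bounds by metis
  qed (use s in blast)
qed

lemma join_arr [simp]:
  assumes "u \<in> Arr E" "v \<in> Arr E" "src E u = src E v" "tgt E u = opens X" "tgt E v = opens X"
  shows "join E X u v \<in> Arr E" "src E (join E X u v) = src E v" "tgt E (join E X u v) = opens X"
  using join_props[of u "src E v" v] assms by simp_all

lemma join_leq_iff:
  assumes "u \<in> hom E I (opens X)" "v \<in> hom E I (opens X)" "t \<in> hom E I (opens X)"
  shows "leq E X (join E X u v) t \<longleftrightarrow> leq E X u t \<and> leq E X v t"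
  using is_join_here join_props assms by blast

lemma is_join_cmp:
  assumes "is_join E X u v s" "s \<in> hom E I (opens X)" "u \<in> hom E I (opens X)" "v \<in> hom E I (opens X)"
    "g \<in> Arr E" "tgt E g = I"
  shows "is_join E X (u \<cdot> g) (v \<cdot> g) (s \<cdot> g)"
  unfolding is_join_def
proof (intro ballI)
  fix h t assume "h \<in> into E (src E (s \<cdot> g))" "t \<in> hom E (src E h) (opens X)"
  then show "leq E X (s \<cdot> g \<cdot> h) t \<longleftrightarrow> leq E X (u \<cdot> g \<cdot> h) t \<and> leq E X (v \<cdot> g \<cdot> h) t"
    using assms(1)[unfolded is_join_def, rule_format, of "g \<cdot> h" t] assms(2-) by simp
qed

lemma join_cmp [simp]:
  assumes "u \<in> Arr E" "v \<in> Arr E" "src E u = src E v" "tgt E u = opens X" "tgt E v = opens X"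
    "g \<in> Arr E" "tgt E g = src E v"
  shows "join E X u v \<cdot> g = join E X (u \<cdot> g) (v \<cdot> g)"
proof (rule eq_by_upper_bounds[of _ "src E g"])
  have uv: "u \<in> hom E (src E v) (opens X)" "v \<in> hom E (src E v) (opens X)" using assms by simp_all
  have 1: "is_join E X (u \<cdot> g) (v \<cdot> g) (join E X u v \<cdot> g)"
    by (rule is_join_cmp) (use join_props[OF uv] assms in simp_all)
  fix t assume t: "t \<in> hom E (src E g) (opens X)"
  show "leq E X (join E X u v \<cdot> g) t \<longleftrightarrow> leq E X (join E X (u \<cdot> g) (v \<cdot> g)) t"
    using is_join_here[OF 1, of "src E g" t] join_leq_iff[of "u \<cdot> g" "src E g" "v \<cdot> g" t] assms t by simp
qed (use assms in simp_all)

lemma natural_join: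
  assumes "natural A (opens X) t" "natural A (opens X) s"
  shows "natural A (opens X) (\<lambda>x. join E X (t x) (s x))"
proof -
  obtain f where f: "f \<in> Arr E" "src E f = A" "tgt E f = opens X" "\<And>x. x \<in> Arr E \<Longrightarrow> tgt E x = A \<Longrightarrow> s x = f \<cdot> x"
    by (rule naturalE[OF assms(2)]) (rule that)
  obtain k where k: "k \<in> Arr E" "src E k = A" "tgt E k = opens X" "\<And>x. x \<in> Arr E \<Longrightarrow> tgt E x = A \<Longrightarrow> t x = k \<cdot> x"
    by (rule naturalE[OF assms(1)]) (rule that)
  show ?thesis by (rule naturalI[of "join E X k f"]) (use f k in simp_all)
qed

lemma join_upper [simp]:
  assumes "u \<in> Arr E" "v \<in> Arr E" "src E u = src E v" "tgt E u = opens X" "tgt E v = opens X"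
  shows "leq E X u (join E X u v)" "leq E X v (join E X u v)"
  using join_leq_iff[of u "src E v" v "join E X u v"] assms by simp_all

lemma join_least:
  assumes "leq E X u t" "leq E X v t" "u \<in> hom E I (opens X)" "v \<in> hom E I (opens X)" "t \<in> hom E I (opens X)"
  shows "leq E X (join E X u v) t"
  using join_leq_iff assms by blast

text \<open>
  The supremum of the opens \<open>a\<close> with \<open>a \<sqinter> u \<le> v\<close>; it has this property itself by distributivity.
\<close>

lemma impl_exists:
  assumes "u \<in> hom E I (opens X)" "v \<in> hom E I (opens X)"
  shows "\<exists>s\<in>hom E I (opens X). \<forall>g\<in>into E (src E s). \<forall>t\<in>hom E (src E g) (opens X).
        leq E X t (s \<cdot> g) \<longleftrightarrow> leq E X (meet E X t (u \<cdot> g)) (v \<cdot> g)"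
proof -
  have I: "I \<in> Ob E" using assms(1) by auto
  let ?C = "Prod E I (opens X)" and ?p = "pr1 E I (opens X)" and ?q = "pr2 E I (opens X)"
  let ?Q = "\<lambda>x a. leq E X (meet E X a (u \<cdot> x)) (v \<cdot> x)"
  have rep: "representable ?C (\<lambda>z. ?Q (?p \<cdot> z) (?q \<cdot> z))"
    by (rule representable_leq natural_meet natural_comp natural_pr1 natural_pr2 natural_id | use assms I in simp)+
  obtain S where S: "S \<in> hom E I (Pow E (opens X))" "is_sup E X ?Q (Join E X S)"
    "\<And>x b. x \<in> Arr E \<Longrightarrow> b \<in> Arr E \<Longrightarrow> tgt E x = I \<Longrightarrow> tgt E b = opens X \<Longrightarrow> src E b = src E x \<Longrightarrow>
      mem E b (S \<cdot> x) \<longleftrightarrow> ?Q x b"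
    by (rule sup_exists[where Q="?Q", OF rep I]) (rule that)
  let ?s = "Join E X S"
  have J: "?s \<in> hom E I (opens X)" using S by simp
  have comm: "leq E X (meet E X a b) (meet E X b a)" if "a \<in> hom E K (opens X)" "b \<in> hom E K (opens X)" for a b K
    by (rule meet_greatest) (use that in simp_all)
  show ?thesis
  proof (intro bexI[OF _ J] ballI iffI)
    fix g t assume g: "g \<in> into E (src E ?s)" and t: "t \<in> hom E (src E g) (opens X)" and le: "?Q g t"
    show "leq E X t (?s \<cdot> g)" by (rule is_sup_upper[OF S(2) J le]) (use J g t in simp_all)
  next
    fix g t assume g: "g \<in> into E (src E ?s)" and t: "t \<in> hom E (src E g) (opens X)" and le: "leq E X t (?s \<cdot> g)"
    have 1: "leq E X (meet E X (u \<cdot> g) (Join E X (S \<cdot> g))) (v \<cdot> g)"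
    proof (rule meet_Join_leq)
      fix h a assume h: "h \<in> Arr E" "tgt E h = src E g" "a \<in> hom E (src E h) (opens X)" and m: "mem E a ((S \<cdot> g) \<cdot> h)"
      have "?Q (g \<cdot> h) a" using S(3)[of "g \<cdot> h" a] m h g S(1) by simp
      then have "leq E X (meet E X (u \<cdot> (g \<cdot> h)) a) (v \<cdot> (g \<cdot> h))"
        by - (rule leq_trans[where I="src E h", OF comm[where K="src E h"]], use h g assms S(1) in simp_all)
      then show "leq E X (meet E X ((u \<cdot> g) \<cdot> h) a) ((v \<cdot> g) \<cdot> h)"
        using h g assms S(1) by simp
    qed (use g assms S(1) in simp_all)
    have "leq E X (meet E X t (u \<cdot> g)) (meet E X (u \<cdot> g) (Join E X (S \<cdot> g)))"
    proof (rule meet_greatest)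
      show "leq E X (meet E X t (u \<cdot> g)) (Join E X (S \<cdot> g))"
        by (rule leq_trans[where I="src E g" and v=t]) (use g assms S(1) t le in simp_all)
    qed (use g assms S(1) t in simp_all)
    then show "?Q g t" by (rule leq_trans[OF _ 1]) (use g assms S(1) t in simp_all)
  qed
qed

lemma impl_props:
  assumes "u \<in> hom E I (opens X)" "v \<in> hom E I (opens X)"
  shows "impl E X u v \<in> hom E I (opens X) \<and> (\<forall>g\<in>into E (src E (impl E X u v)). \<forall>t\<in>hom E (src E g) (opens X).
        leq E X t (impl E X u v \<cdot> g) \<longleftrightarrow> leq E X (meet E X t (u \<cdot> g)) (v \<cdot> g))"
proof -
  have I: "src E u = I" "I \<in> Ob E" using assms by auto
  let ?P = "\<lambda>s. \<forall>g\<in>into E (src E s). \<forall>t\<in>hom E (src E g) (opens X).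
        leq E X t (s \<cdot> g) \<longleftrightarrow> leq E X (meet E X t (u \<cdot> g)) (v \<cdot> g)"
  obtain s where s: "s \<in> hom E I (opens X)" "?P s"
    using impl_exists[OF assms] by blast
  have here: "leq E X t s \<longleftrightarrow> leq E X (meet E X t u) v" if "?P s" "s \<in> hom E I (opens X)" "t \<in> hom E I (opens X)" for s t
    using stage_here[OF that(1), of t] that(2,3) assms by simp
  show ?thesis unfolding impl_def I
  proof (rule theI', rule ex1I[of _ s])
    fix s' assume "s' \<in> hom E I (opens X) \<and> ?P s'"
    then show "s' = s" using here[of s'] here[OF s(2,1)] s(1) by (intro eq_by_lower_bounds[of s' I s]) blast+
  qed (use s in blast)
qed

lemma impl_arr [simp]:
  assumes "u \<in> Arr E" "v \<in> Arr E" "src E u = src E v" "tgt E u = opens X" "tgt E v = opens X"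
  shows "impl E X u v \<in> Arr E" "src E (impl E X u v) = src E v" "tgt E (impl E X u v) = opens X"
  using impl_props[of u "src E v" v] assms by simp_all

lemma leq_impl_cmp_iff:
  assumes "u \<in> hom E I (opens X)" "v \<in> hom E I (opens X)" "g \<in> Arr E" "tgt E g = I" "t \<in> hom E (src E g) (opens X)"
  shows "leq E X t (impl E X u v \<cdot> g) \<longleftrightarrow> leq E X (meet E X t (u \<cdot> g)) (v \<cdot> g)"
  using impl_props[OF assms(1,2)] assms(3-) by simp

lemma leq_impl_iff:
  assumes "u \<in> hom E I (opens X)" "v \<in> hom E I (opens X)" "t \<in> hom E I (opens X)"
  shows "leq E X t (impl E X u v) \<longleftrightarrow> leq E X (meet E X t u) v"
proof -
  have "I \<in> Ob E" using assms by auto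
  then show ?thesis using leq_impl_cmp_iff[OF assms(1,2), of "ident E I" t] assms by simp
qed

lemma impl_cmp [simp]:
  assumes "u \<in> Arr E" "v \<in> Arr E" "src E u = src E v" "tgt E u = opens X" "tgt E v = opens X"
    "g \<in> Arr E" "tgt E g = src E v"
  shows "impl E X u v \<cdot> g = impl E X (u \<cdot> g) (v \<cdot> g)"
  by (rule eq_by_lower_bounds[of _ "src E g"])
    (use assms leq_impl_cmp_iff[of u "src E v" v g] leq_impl_iff[of "u \<cdot> g" "src E g" "v \<cdot> g"] in simp_all)

lemma neg_arr [simp]:
  assumes "u \<in> Arr E" "tgt E u = opens X"
  shows "neg E X u \<in> Arr E" "src E (neg E X u) = src E u" "tgt E (neg E X u) = opens X"
  using assms by (simp_all add: neg_def)

lemma neg_cmp [simp]: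
  assumes "u \<in> Arr E" "tgt E u = opens X" "g \<in> Arr E" "tgt E g = src E u"
  shows "neg E X u \<cdot> g = neg E X (u \<cdot> g)"
  using assms by (simp add: neg_def)

lemma natural_neg:
  assumes "natural A (opens X) t"
  shows "natural A (opens X) (\<lambda>x. neg E X (t x))"
proof -
  obtain k where k: "k \<in> Arr E" "src E k = A" "tgt E k = opens X" "\<And>x. x \<in> Arr E \<Longrightarrow> tgt E x = A \<Longrightarrow> t x = k \<cdot> x"
    by (rule naturalE[OF assms(1)]) (rule that)
  show ?thesis by (rule naturalI[of "neg E X k"]) (use k in simp_all)
qed

lemma leq_neg_iff:
  assumes "u \<in> hom E I (opens X)" "t \<in> hom E I (opens X)"
  shows "leq E X t (neg E X u) \<longleftrightarrow> leq E X (meet E X t u) (empty E X I)"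
proof -
  have "I \<in> Ob E" using assms by auto
  then show ?thesis unfolding neg_def using assms leq_impl_iff[of u I "empty E X I" t] by simp
qed

end

context internal_frame
begin

section \<open>Covers and the relation rather below\<close>

lemma meet_leq1:
  assumes "leq E X u t" "u \<in> hom E I (opens X)" "v \<in> hom E I (opens X)" "t \<in> hom E I (opens X)"
  shows "leq E X (meet E X u v) t"
  by (rule leq_trans[OF _ assms(1)]) (use assms in simp_all)

lemma meet_leq2:
  assumes "leq E X v t" "u \<in> hom E I (opens X)" "v \<in> hom E I (opens X)" "t \<in> hom E I (opens X)"
  shows "leq E X (meet E X u v) t"
  by (rule leq_trans[OF _ assms(1)]) (use assms in simp_all)

lemma leq_join1:
  assumes "leq E X t u" "u \<in> hom E I (opens X)" "v \<in> hom E I (opens X)" "t \<in> hom E I (opens X)"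
  shows "leq E X t (join E X u v)"
  by (rule leq_trans[OF assms(1)]) (use assms in simp_all)

lemma leq_join2:
  assumes "leq E X t v" "u \<in> hom E I (opens X)" "v \<in> hom E I (opens X)" "t \<in> hom E I (opens X)"
  shows "leq E X t (join E X u v)"
  by (rule leq_trans[OF assms(1)]) (use assms in simp_all)

lemma join_mono:
  assumes "leq E X u u'" "leq E X v v'" "u \<in> hom E I (opens X)" "v \<in> hom E I (opens X)"
    "u' \<in> hom E I (opens X)" "v' \<in> hom E I (opens X)"
  shows "leq E X (join E X u v) (join E X u' v')"
  by (rule join_least[OF leq_join1[OF assms(1)] leq_join2[OF assms(2)]]) (use assms in simp_all)

lemma meet_commute_leq:
  assumes "u \<in> hom E I (opens X)" "v \<in> hom E I (opens X)"
  shows "leq E X (meet E X u v) (meet E X v u)"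
  by (rule meet_greatest) (use assms in simp_all)

lemma meet_join_leq:
  assumes "leq E X (meet E X w u) t" "leq E X (meet E X w v) t"
    "u \<in> hom E I (opens X)" "v \<in> hom E I (opens X)" "w \<in> hom E I (opens X)" "t \<in> hom E I (opens X)"
  shows "leq E X (meet E X w (join E X u v)) t"
proof -
  have "leq E X u (impl E X w t)"
    unfolding leq_impl_iff[OF assms(5,6,3)]
    by (rule leq_trans[OF meet_commute_leq[OF assms(3,5)] assms(1)]) (use assms in simp_all)
  moreover have "leq E X v (impl E X w t)"
    unfolding leq_impl_iff[OF assms(5,6,4)]
    by (rule leq_trans[OF meet_commute_leq[OF assms(4,5)] assms(2)]) (use assms in simp_all)
  ultimately have "leq E X (join E X u v) (impl E X w t)"
    by (rule join_least) (use assms in simp_all)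
  moreover have J: "join E X u v \<in> hom E I (opens X)" using assms by simp
  ultimately have "leq E X (meet E X (join E X u v) w) t"
    unfolding leq_impl_iff[OF assms(5,6) J] by simp
  then show ?thesis
    by (rule leq_trans[OF meet_commute_leq[OF assms(5) J]]) (use assms in simp_all)
qed

definition covers where
  "covers u v \<longleftrightarrow> leq E X (whole E X (src E u)) (join E X u v)"

lemma covers_iff:
  assumes "u \<in> hom E I (opens X)" "v \<in> hom E I (opens X)"
  shows "covers u v \<longleftrightarrow> join E X u v = whole E X I"
proof -
  have I: "I \<in> Ob E" using assms by auto
  show ?thesis
  proof
    assume "covers u v"
    then show "join E X u v = whole E X I"
      by (intro leq_antisym[of _ _ I]) (use assms I in \<open>simp_all add: covers_def\<close>)
  qed (use assms I in \<open>simp add: covers_def\<close>)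
qed

text \<open>
  The internal form of reasoning by cases: to bound \<open>c\<close> it suffices to do so on each part of a cover.
\<close>

lemma leq_if_covers:
  assumes "covers a b" "leq E X (meet E X c a) d" "leq E X (meet E X c b) d"
    "a \<in> hom E I (opens X)" "b \<in> hom E I (opens X)" "c \<in> hom E I (opens X)" "d \<in> hom E I (opens X)"
  shows "leq E X c d"
proof -
  have I: "I \<in> Ob E" using assms(4) by auto
  have 1: "leq E X (meet E X c (join E X a b)) d"
    by (rule meet_join_leq[OF assms(2-)])
  have 2: "leq E X c (join E X a b)"
    by (rule leq_trans[of _ "whole E X I" _ I]) (use assms I in \<open>simp_all add: covers_def\<close>)
  have "leq E X c (meet E X c (join E X a b))"
    by (rule meet_greatest[OF _ 2]) (use assms in simp_all)
  then show ?thesis by (rule leq_trans[OF _ 1]) (use assms in simp_all)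
qed

lemma covers_mono:
  assumes "covers a b" "leq E X a a'" "leq E X b b'"
    "a \<in> hom E I (opens X)" "b \<in> hom E I (opens X)" "a' \<in> hom E I (opens X)" "b' \<in> hom E I (opens X)"
  shows "covers a' b'"
  unfolding covers_def
  by (rule leq_trans[of _ "join E X a b" _ I])
    (use assms join_mono[OF assms(2-)] in \<open>auto simp: covers_def\<close>)

lemma covers_commute:
  assumes "covers a b" "a \<in> hom E I (opens X)" "b \<in> hom E I (opens X)"
  shows "covers b a"
proof -
  have "leq E X (join E X a b) (join E X b a)" by (rule join_least) (use assms in simp_all)
  then show ?thesis unfolding covers_def
    by - (rule leq_trans[of _ "join E X a b" _ I], use assms in \<open>auto simp: covers_def\<close>)
qed

lemma covers_meet:
  assumes "covers a b" "covers a' b"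
    "a \<in> hom E I (opens X)" "b \<in> hom E I (opens X)" "a' \<in> hom E I (opens X)"
  shows "covers (meet E X a a') b"
proof -
  have I: "I \<in> Ob E" using assms(3) by auto
  let ?w = "whole E X I" and ?d = "join E X (meet E X a a') b"
  have t: "?w \<in> hom E I (opens X)" "?d \<in> hom E I (opens X)" "meet E X ?w a \<in> hom E I (opens X)"
    using assms I by simp_all
  have "leq E X (meet E X ?w a) ?d"
  proof (rule leq_if_covers[OF assms(2) _ _ assms(5,4) t(3,2)])
    have "leq E X (meet E X (meet E X ?w a) a') (meet E X a a')"
      by (rule meet_mono) (use assms t in simp_all)
    then show "leq E X (meet E X (meet E X ?w a) a') ?d"
      by (rule leq_join1) (use assms t in simp_all)
    show "leq E X (meet E X (meet E X ?w a) b) ?d"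
      by (rule meet_leq2[OF leq_join2[OF leq_refl]]) (use assms t in simp_all)
  qed
  then have "leq E X ?w ?d"
    by (rule leq_if_covers[OF assms(1) _ _ assms(3,4) t(1,2)])
      (rule meet_leq2[OF leq_join2[OF leq_refl]], use assms t in simp_all)
  then show ?thesis using assms by (simp add: covers_def)
qed

lemma covers_cmp:
  assumes "covers a b" "a \<in> hom E I (opens X)" "b \<in> hom E I (opens X)" "g \<in> Arr E" "tgt E g = I"
  shows "covers (a \<cdot> g) (b \<cdot> g)"
proof -
  have I: "I \<in> Ob E" using assms by auto
  have "leq E X (whole E X I \<cdot> g) (join E X a b \<cdot> g)"
    by (rule leq_cmp[of _ _ I]) (use assms I in \<open>simp_all add: covers_def\<close>)
  then show ?thesis using assms by (simp add: covers_def)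
qed

lemma representable_covers:
  assumes "natural A (opens X) t" "natural A (opens X) s"
  shows "representable A (\<lambda>x. covers (t x) (s x))"
  unfolding covers_def
  by (rule representable_cong[where P="\<lambda>x. leq E X (whole E X (src E x)) (join E X (t x) (s x))"])
    (rule representable_leq natural_whole natural_join assms natural_ob[OF assms(1), THEN conjunct1] |
      use natural_arr[OF assms(1)] in simp)+

lemma covers_local:
  assumes "covers (a \<cdot> e) (b \<cdot> e)" "epi E e" "a \<in> hom E I (opens X)" "b \<in> hom E I (opens X)" "tgt E e = I"
  shows "covers a b"
proof -
  have I: "I \<in> Ob E" using assms by auto
  show ?thesis unfolding covers_def
    by (rule leq_local[OF _ assms(2), of _ _ I]) (use assms I in \<open>simp_all add: covers_def\<close>)
qed

lemma rather_below_iff: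
  assumes "u \<in> hom E I (opens X)" "v \<in> hom E I (opens X)"
  shows "rather_below E X u v \<longleftrightarrow> covers (neg E X u) v"
  unfolding rather_below_def using covers_iff[of "neg E X u" I v] assms by simp

lemma meet_neg_leq:
  assumes "u \<in> hom E I (opens X)" "v \<in> hom E I (opens X)"
  shows "leq E X (meet E X (neg E X u) u) v" "leq E X (meet E X u (neg E X u)) v"
proof -
  have I: "I \<in> Ob E" using assms by auto
  have "leq E X (neg E X u) (neg E X u)" using assms by simp
  then have 1: "leq E X (meet E X (neg E X u) u) (empty E X I)"
    using leq_neg_iff[of u I "neg E X u"] assms by simp
  show 2: "leq E X (meet E X (neg E X u) u) v"
    by (rule leq_trans[OF 1, of _ I]) (use assms I in simp_all)
  show "leq E X (meet E X u (neg E X u)) v"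
    by (rule leq_trans[OF meet_commute_leq 2]) (use assms in simp_all)
qed

text \<open>
  The complement of \<open>u\<close> is the largest open disjoint from \<open>u\<close>.
\<close>

lemma rather_belowI:
  assumes "leq E X (meet E X d u) (empty E X I)" "covers d v"
    "u \<in> hom E I (opens X)" "v \<in> hom E I (opens X)" "d \<in> hom E I (opens X)"
  shows "rather_below E X u v"
proof -
  have "leq E X d (neg E X u)" using leq_neg_iff[OF assms(3,5)] assms(1) by simp
  then show ?thesis unfolding rather_below_iff[OF assms(3,4)]
    by - (rule covers_mono[OF assms(2), of _ _ I], use assms in simp_all)
qed

lemma neg_antimono:
  assumes "leq E X u v" "u \<in> hom E I (opens X)" "v \<in> hom E I (opens X)"
  shows "leq E X (neg E X v) (neg E X u)"
proof -
  have I: "I \<in> Ob E" using assms by auto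
  have 1: "leq E X (meet E X (neg E X v) u) (meet E X (neg E X v) v)"
    by (rule meet_mono[where I=I]) (use assms in simp_all)
  have "leq E X (meet E X (neg E X v) u) (empty E X I)"
    by (rule leq_trans[OF 1 meet_neg_leq(1)]) (use assms I in simp_all)
  then show ?thesis using leq_neg_iff[of u I "neg E X v"] assms by simp
qed

lemma rather_below_mono:
  assumes "rather_below E X u v" "leq E X u' u" "leq E X v v'"
    "u \<in> hom E I (opens X)" "v \<in> hom E I (opens X)" "u' \<in> hom E I (opens X)" "v' \<in> hom E I (opens X)"
  shows "rather_below E X u' v'"
  using assms(1) unfolding rather_below_iff[OF assms(4,5)] rather_below_iff[OF assms(6,7)]
  by (rule covers_mono[OF _ neg_antimono[OF assms(2)] assms(3)]) (use assms in simp_all)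

lemma rather_below_leq:
  assumes "rather_below E X u v" "u \<in> hom E I (opens X)" "v \<in> hom E I (opens X)"
  shows "leq E X u v"
  using assms(1) unfolding rather_below_iff[OF assms(2,3)]
  by (rule leq_if_covers) (use assms meet_neg_leq in simp_all)

lemma rather_below_join:
  assumes "rather_below E X a c" "rather_below E X b c"
    "a \<in> hom E I (opens X)" "b \<in> hom E I (opens X)" "c \<in> hom E I (opens X)"
  shows "rather_below E X (join E X a b) c"
proof (rule rather_belowI[of "meet E X (neg E X a) (neg E X b)" _ I])
  have I: "I \<in> Ob E" using assms by auto
  show "leq E X (meet E X (meet E X (neg E X a) (neg E X b)) (join E X a b)) (empty E X I)"
  proof (rule meet_join_leq)
    have "leq E X (meet E X (meet E X (neg E X a) (neg E X b)) a) (meet E X (neg E X a) a)"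
      by (rule meet_mono[where I=I]) (use assms in simp_all)
    then show "leq E X (meet E X (meet E X (neg E X a) (neg E X b)) a) (empty E X I)"
      by (rule leq_trans[OF _ meet_neg_leq(1)]) (use assms I in simp_all)
    have "leq E X (meet E X (meet E X (neg E X a) (neg E X b)) b) (meet E X (neg E X b) b)"
      by (rule meet_mono[where I=I]) (use assms in simp_all)
    then show "leq E X (meet E X (meet E X (neg E X a) (neg E X b)) b) (empty E X I)"
      by (rule leq_trans[OF _ meet_neg_leq(1)]) (use assms I in simp_all)
  qed (use assms I in simp_all)
  show "covers (meet E X (neg E X a) (neg E X b)) c"
    by (rule covers_meet) (use assms rather_below_iff[of _ I] in simp_all)
qed (use assms in simp_all)

lemma rather_below_empty:
  assumes "v \<in> hom E I (opens X)"
  shows "rather_below E X (empty E X I) v"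
proof -
  have I: "I \<in> Ob E" using assms by auto
  have "covers (whole E X I) v" using assms I by (simp add: covers_def)
  then show ?thesis
    by (rule rather_belowI[OF meet_lower(2)[of _ "empty E X I"], rotated 5]) (use assms I in simp_all)
qed

lemma rather_below_cmp:
  assumes "rather_below E X u v" "u \<in> hom E I (opens X)" "v \<in> hom E I (opens X)" "g \<in> Arr E" "tgt E g = I"
  shows "rather_below E X (u \<cdot> g) (v \<cdot> g)"
  using covers_cmp[of "neg E X u" v I g] assms rather_below_iff[of u I v] rather_below_iff[of "u \<cdot> g" "src E g" "v \<cdot> g"]
  by simp

lemma rather_below_local:
  assumes "rather_below E X (u \<cdot> e) (v \<cdot> e)" "epi E e" "u \<in> hom E I (opens X)" "v \<in> hom E I (opens X)" "tgt E e = I"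
  shows "rather_below E X u v"
  using covers_local[of "neg E X u" e v I] assms rather_below_iff[of u I v] rather_below_iff[of "u \<cdot> e" "src E e" "v \<cdot> e"]
  by simp

lemma representable_rather_below:
  assumes "natural A (opens X) t" "natural A (opens X) s"
  shows "representable A (\<lambda>x. rather_below E X (t x) (s x))"
  by (rule representable_cong[OF representable_covers[OF natural_neg[OF assms(1)] assms(2)]])
    (use natural_arr[OF assms(1)] natural_arr[OF assms(2)] rather_below_iff in simp)

section \<open>Nets and the relation way below\<close>

lemma is_netI:
  assumes "S \<in> hom E I (Pow E (opens X))"
    "exists_loc E I (opens X) (\<lambda>e a. mem E a (S \<cdot> e))"
    "\<And>g a b. g \<in> Arr E \<Longrightarrow> tgt E g = I \<Longrightarrow> a \<in> hom E (src E g) (opens X) \<Longrightarrow> b \<in> hom E (src E g) (opens X) \<Longrightarrow>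
      mem E a (S \<cdot> g) \<Longrightarrow> mem E b (S \<cdot> g) \<Longrightarrow> exists_loc E (src E g) (opens X)
          (\<lambda>e c. mem E c (S \<cdot> g \<cdot> e) \<and> leq E X (a \<cdot> e) c \<and> leq E X (b \<cdot> e) c)"
  shows "is_net E X S"
  unfolding is_net_def using assms by simp

lemma is_net_inhabited:
  assumes "is_net E X S" "S \<in> hom E I (Pow E (opens X))"
  shows "exists_loc E I (opens X) (\<lambda>e a. mem E a (S \<cdot> e))"
  using assms unfolding is_net_def by simp

lemma is_net_directed:
  assumes "is_net E X S" "S \<in> hom E I (Pow E (opens X))"
    "g \<in> Arr E" "tgt E g = I" "a \<in> hom E (src E g) (opens X)" "b \<in> hom E (src E g) (opens X)"
      "mem E a (S \<cdot> g)" "mem E b (S \<cdot> g)"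
  shows "exists_loc E (src E g) (opens X)
          (\<lambda>e c. mem E c (S \<cdot> g \<cdot> e) \<and> leq E X (a \<cdot> e) c \<and> leq E X (b \<cdot> e) c)"
  using assms(1) unfolding is_net_def using assms(2-) by simp

text \<open>
  Directedness quantifies over two members of the net at the same stage, that is, over a pair.
\<close>

lemma representable_is_net:
  assumes "natural A (Pow E (opens X)) s"
  shows "representable A (\<lambda>x. is_net E X (s x))"
proof -
  let ?O = "opens X" and ?P = "Pow E (opens X)"
  have inh: "representable ?P (\<lambda>S. exists_loc E (src E S) ?O (\<lambda>e a. mem E a (S \<cdot> e)))"
    by (rule representable_ex[where Q="\<lambda>S a. mem E a S"])
      (rule representable_mem natural_pr1 natural_pr2 natural_id | simp)+
  let ?C = "Prod E ?P (Prod E ?O ?O)"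
  let ?S = "\<lambda>z. pr1 E ?P (Prod E ?O ?O) \<cdot> z"
  let ?a = "\<lambda>z. pr1 E ?O ?O \<cdot> (pr2 E ?P (Prod E ?O ?O) \<cdot> z)"
  let ?b = "\<lambda>z. pr2 E ?O ?O \<cdot> (pr2 E ?P (Prod E ?O ?O) \<cdot> z)"
  have nat: "natural ?C ?P ?S" "natural ?C ?O ?a" "natural ?C ?O ?b"
    by (rule natural_pr1 natural_pr2 natural_id | simp)+
  have "representable ?C (\<lambda>z. exists_loc E (src E z) ?O
      (\<lambda>e c. mem E c (?S (z \<cdot> e)) \<and> leq E X (?a (z \<cdot> e)) c \<and> leq E X (?b (z \<cdot> e)) c))"
    by (rule representable_ex[where Q="\<lambda>z c. mem E c (?S z) \<and> leq E X (?a z) c \<and> leq E X (?b z) c"])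
      (rule representable_conj representable_mem representable_leq natural_pr1 natural_pr2 natural_id | simp)+
  then have ex: "representable ?C (\<lambda>z. exists_loc E (src E (?S z)) ?O
      (\<lambda>e c. mem E c (?S z \<cdot> e) \<and> leq E X (?a z \<cdot> e) c \<and> leq E X (?b z \<cdot> e) c))"
    by (rule representable_cong) (simp add: exists_loc_def cong: conj_cong)
  have mem: "representable ?C (\<lambda>z. mem E (?a z) (?S z) \<and> mem E (?b z) (?S z))"
    by (rule representable_conj representable_mem nat)+
  have dir: "representable ?P (\<lambda>S. \<forall>g\<in>into E (src E S). \<forall>c\<in>hom E (src E g) (Prod E ?O ?O).
      mem E (pr1 E ?O ?O \<cdot> c) (S \<cdot> g) \<and> mem E (pr2 E ?O ?O \<cdot> c) (S \<cdot> g) \<longrightarrow>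
        exists_loc E (src E (S \<cdot> g)) ?O
          (\<lambda>e d. mem E d ((S \<cdot> g) \<cdot> e) \<and> leq E X (pr1 E ?O ?O \<cdot> c \<cdot> e) d \<and> leq E X (pr2 E ?O ?O \<cdot> c \<cdot> e) d))"
    by (rule representable_all_imp[where
        P="\<lambda>S c. mem E (pr1 E ?O ?O \<cdot> c) S \<and> mem E (pr2 E ?O ?O \<cdot> c) S" and
        Q="\<lambda>S c. exists_loc E (src E S) ?O
          (\<lambda>e d. mem E d (S \<cdot> e) \<and> leq E X (pr1 E ?O ?O \<cdot> c \<cdot> e) d \<and> leq E X (pr2 E ?O ?O \<cdot> c \<cdot> e) d)", OF mem ex])
      simp_all
  have "representable ?P (\<lambda>S. is_net E X S)"
  proof (rule representable_cong[OF representable_conj[OF inh dir]])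
    fix S assume S: "S \<in> Arr E" "tgt E S = ?P"
    show "is_net E X S \<longleftrightarrow> exists_loc E (src E S) ?O (\<lambda>e a. mem E a (S \<cdot> e)) \<and>
     (\<forall>g\<in>into E (src E S). \<forall>c\<in>hom E (src E g) (Prod E ?O ?O).
      mem E (pr1 E ?O ?O \<cdot> c) (S \<cdot> g) \<and> mem E (pr2 E ?O ?O \<cdot> c) (S \<cdot> g) \<longrightarrow>
        exists_loc E (src E (S \<cdot> g)) ?O
          (\<lambda>e d. mem E d ((S \<cdot> g) \<cdot> e) \<and> leq E X (pr1 E ?O ?O \<cdot> c \<cdot> e) d \<and> leq E X (pr2 E ?O ?O \<cdot> c \<cdot> e) d))"
      (is "_ \<longleftrightarrow> ?inh \<and> ?dir")
    proof
      assume net: "is_net E X S"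
      have ?dir
      proof (intro ballI impI)
        fix g c assume g: "g \<in> into E (src E S)" and c: "c \<in> hom E (src E g) (Prod E ?O ?O)"
          and m: "mem E (pr1 E ?O ?O \<cdot> c) (S \<cdot> g) \<and> mem E (pr2 E ?O ?O \<cdot> c) (S \<cdot> g)"
        have "exists_loc E (src E g) ?O
          (\<lambda>e d. mem E d ((S \<cdot> g) \<cdot> e) \<and> leq E X ((pr1 E ?O ?O \<cdot> c) \<cdot> e) d \<and> leq E X ((pr2 E ?O ?O \<cdot> c) \<cdot> e) d)"
          by (rule is_net_directed[OF net, of "src E S"]) (use S g c m in simp_all)
        then show "exists_loc E (src E (S \<cdot> g)) ?O
          (\<lambda>e d. mem E d ((S \<cdot> g) \<cdot> e) \<and> leq E X (pr1 E ?O ?O \<cdot> c \<cdot> e) d \<and> leq E X (pr2 E ?O ?O \<cdot> c \<cdot> e) d)"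
          using g S by simp
      qed
      then show "?inh \<and> ?dir" using is_net_inhabited[OF net] S by simp
    next
      assume id: "?inh \<and> ?dir"
      show "is_net E X S"
      proof (rule is_netI[of _ "src E S"])
        fix g a b assume g: "g \<in> Arr E" "tgt E g = src E S" "a \<in> hom E (src E g) ?O" "b \<in> hom E (src E g) ?O"
          "mem E a (S \<cdot> g)" "mem E b (S \<cdot> g)"
        have "exists_loc E (src E (S \<cdot> g)) ?O
          (\<lambda>e d. mem E d ((S \<cdot> g) \<cdot> e) \<and> leq E X (pr1 E ?O ?O \<cdot> pair E a b \<cdot> e) d \<and> leq E X (pr2 E ?O ?O \<cdot> pair E a b \<cdot> e) d)"
          by (rule id[THEN conjunct2, rule_format]) (use g in simp_all)
        then show "exists_loc E (src E g) ?O (\<lambda>e c. mem E c (S \<cdot> g \<cdot> e) \<and> leq E X (a \<cdot> e) c \<and> leq E X (b \<cdot> e) c)"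
          using g S by simp
      qed (use S id in simp_all)
    qed
  qed
  then show ?thesis by (rule representable_subst[OF _ assms])
qed

lemma way_belowD:
  assumes "way_below E X u v" "is_net E X S" "leq E X (v \<cdot> g) (Join E X S)"
    "u \<in> hom E I (opens X)" "v \<in> hom E I (opens X)" "g \<in> Arr E" "tgt E g = I" "S \<in> hom E (src E g) (Pow E (opens X))"
  shows "exists_loc E (src E g) (opens X) (\<lambda>e w. mem E w (S \<cdot> e) \<and> leq E X (u \<cdot> g \<cdot> e) w)"
  using assms(1) unfolding way_below_def using assms(2-) by simp

lemma way_belowI:
  assumes "\<And>g S. g \<in> Arr E \<Longrightarrow> tgt E g = I \<Longrightarrow> S \<in> hom E (src E g) (Pow E (opens X)) \<Longrightarrow> is_net E X S \<Longrightarrow>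
      leq E X (v \<cdot> g) (Join E X S) \<Longrightarrow> exists_loc E (src E g) (opens X) (\<lambda>e w. mem E w (S \<cdot> e) \<and> leq E X (u \<cdot> g \<cdot> e) w)"
    "u \<in> hom E I (opens X)"
  shows "way_below E X u v"
  unfolding way_below_def using assms by simp

lemma representable_way_below:
  assumes "natural A (opens X) t" "natural A (opens X) s"
  shows "representable A (\<lambda>x. way_below E X (t x) (s x))"
proof -
  let ?O = "opens X" and ?P = "Pow E (opens X)"
  have A: "A \<in> Ob E" using natural_ob[OF assms(1)] by simp
  let ?C = "Prod E A ?P"
  let ?x = "\<lambda>z. pr1 E A ?P \<cdot> z" and ?S = "\<lambda>z. pr2 E A ?P \<cdot> z"
  have nat: "natural ?C A ?x" "natural ?C ?P ?S"
    by (rule natural_pr1 natural_pr2 natural_id | use A in simp)+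
  note ns = natural_subst[OF nat(1) assms(2)] and nt = natural_subst[OF nat(1) assms(1)]
  have P: "representable ?C (\<lambda>z. is_net E X (?S z) \<and> leq E X (s (?x z)) (Join E X (?S z)))"
    by (rule representable_conj representable_is_net representable_leq natural_Join nat ns)+
  have nt': "natural (Prod E ?C ?O) ?O (\<lambda>z. t (?x (pr1 E ?C ?O \<cdot> z)))"
    by (rule natural_subst[where t="\<lambda>z. pr1 E ?C ?O \<cdot> z", OF _ nt]) (rule natural_pr1 natural_id | use A in simp)+
  have "representable ?C (\<lambda>z. exists_loc E (src E z) ?O (\<lambda>e w. mem E w (?S (z \<cdot> e)) \<and> leq E X (t (?x (z \<cdot> e))) w))"
    by (rule representable_ex[where Q="\<lambda>z w. mem E w (?S z) \<and> leq E X (t (?x z)) w"])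
      (rule representable_conj representable_mem representable_leq nt' natural_pr1 natural_pr2 natural_id | use A in simp)+
  then have Q: "representable ?C (\<lambda>z. exists_loc E (src E (?x z)) ?O (\<lambda>e w. mem E w (?S z \<cdot> e) \<and> leq E X (t (?x z \<cdot> e)) w))"
    by (rule representable_cong) (use A in \<open>simp add: exists_loc_def cong: conj_cong\<close>)
  have "representable A (\<lambda>x. \<forall>g\<in>into E (src E x). \<forall>S\<in>hom E (src E g) ?P.
      is_net E X S \<and> leq E X (s (x \<cdot> g)) (Join E X S) \<longrightarrow>
      exists_loc E (src E (x \<cdot> g)) ?O (\<lambda>e w. mem E w (S \<cdot> e) \<and> leq E X (t ((x \<cdot> g) \<cdot> e)) w))"
    by (rule representable_all_imp[where P="\<lambda>x S. is_net E X S \<and> leq E X (s x) (Join E X S)"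
       and Q="\<lambda>x S. exists_loc E (src E x) ?O (\<lambda>e w. mem E w (S \<cdot> e) \<and> leq E X (t (x \<cdot> e)) w)", OF P Q])
      (use A in simp_all)
  then show ?thesis
  proof (rule representable_cong)
    fix x assume x: "x \<in> Arr E" "tgt E x = A"
    have 1: "leq E X (t x \<cdot> g \<cdot> e) w \<longleftrightarrow> leq E X (t ((x \<cdot> g) \<cdot> e)) w"
      if "g \<in> Arr E" "tgt E g = src E x" "epi E e" "tgt E e = src E g" for g e w
      using natural_cmp[OF assms(1) x, of "g \<cdot> e"] natural_arr[OF assms(1) x] that x by simp
    show "way_below E X (t x) (s x) \<longleftrightarrow> (\<forall>g\<in>into E (src E x). \<forall>S\<in>hom E (src E g) ?P.
      is_net E X S \<and> leq E X (s (x \<cdot> g)) (Join E X S) \<longrightarrow>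
      exists_loc E (src E (x \<cdot> g)) ?O (\<lambda>e w. mem E w (S \<cdot> e) \<and> leq E X (t ((x \<cdot> g) \<cdot> e)) w))"
      unfolding way_below_def exists_loc_def
      using natural_arr[OF assms(1) x] natural_cmp[OF assms(2) x] x 1
      by (simp add: imp_conjL cong: conj_cong)
  qed
qed

lemma way_below_cmp:
  assumes "way_below E X u v" "u \<in> hom E I (opens X)" "v \<in> hom E I (opens X)" "g \<in> Arr E" "tgt E g = I"
  shows "way_below E X (u \<cdot> g) (v \<cdot> g)"
proof (rule way_belowI[of "src E g"])
  fix h S assume h: "h \<in> Arr E" "tgt E h = src E g" "S \<in> hom E (src E h) (Pow E (opens X))" "is_net E X S"
    "leq E X ((v \<cdot> g) \<cdot> h) (Join E X S)"
  have "exists_loc E (src E (g \<cdot> h)) (opens X) (\<lambda>e w. mem E w (S \<cdot> e) \<and> leq E X (u \<cdot> (g \<cdot> h) \<cdot> e) w)"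
    by (rule way_belowD[OF assms(1) h(4), of _ I]) (use assms h in simp_all)
  then show "exists_loc E (src E h) (opens X) (\<lambda>e w. mem E w (S \<cdot> e) \<and> leq E X (u \<cdot> g \<cdot> h \<cdot> e) w)"
    using assms h by simp
qed (use assms in simp_all)

lemma way_below_mono:
  assumes "way_below E X u v" "leq E X u' u" "leq E X v v'"
    "u \<in> hom E I (opens X)" "v \<in> hom E I (opens X)" "u' \<in> hom E I (opens X)" "v' \<in> hom E I (opens X)"
  shows "way_below E X u' v'"
proof (rule way_belowI[of I])
  fix g S assume g: "g \<in> Arr E" "tgt E g = I" "S \<in> hom E (src E g) (Pow E (opens X))" "is_net E X S"
    "leq E X (v' \<cdot> g) (Join E X S)"
  have "leq E X (v \<cdot> g) (v' \<cdot> g)" by (rule leq_cmp[OF assms(3)]) (use assms g in simp_all)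
  then have le: "leq E X (v \<cdot> g) (Join E X S)" by (rule leq_trans[OF _ g(5)]) (use assms g in simp_all)
  obtain e w where e: "epi E e" "e \<in> Arr E" "tgt E e = src E g" "w \<in> Arr E" "src E w = src E e" "tgt E w = opens X"
    "mem E w (S \<cdot> e) \<and> leq E X (u \<cdot> g \<cdot> e) w"
    by (rule exists_locE[OF way_belowD[OF assms(1) g(4) le assms(4,5) g(1-3)]]) (rule that)
  have "leq E X (u' \<cdot> (g \<cdot> e)) (u \<cdot> (g \<cdot> e))" by (rule leq_cmp[OF assms(2)]) (use assms g e in simp_all)
  then have "leq E X (u' \<cdot> (g \<cdot> e)) w"
    by (rule leq_trans[where I="src E e"]) (use assms g e in simp_all)
  then show "exists_loc E (src E g) (opens X) (\<lambda>e w. mem E w (S \<cdot> e) \<and> leq E X (u' \<cdot> g \<cdot> e) w)"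
    by - (rule exists_locI[OF e(1,3-6)], use assms g e in simp)
qed (use assms in simp_all)

lemma way_below_empty:
  assumes "v \<in> hom E I (opens X)"
  shows "way_below E X (empty E X I) v"
proof (rule way_belowI[of I])
  have I: "I \<in> Ob E" using assms by auto
  fix g S assume g: "g \<in> Arr E" "tgt E g = I" "S \<in> hom E (src E g) (Pow E (opens X))" "is_net E X S"
  obtain e w where e: "epi E e" "e \<in> Arr E" "tgt E e = src E g" "w \<in> Arr E" "src E w = src E e" "tgt E w = opens X"
    "mem E w (S \<cdot> e)"
    by (rule exists_locE[OF is_net_inhabited[OF g(4,3)]]) (rule that)
  show "exists_loc E (src E g) (opens X) (\<lambda>e w. mem E w (S \<cdot> e) \<and> leq E X (empty E X I \<cdot> g \<cdot> e) w)"
    by (rule exists_locI[OF e(1,3-6)]) (use e g I in simp)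
qed (use assms in auto)

text \<open>
  Given bounds of \<open>a\<close> and \<open>b\<close> in the net, directedness gives a common bound after a further cover.
\<close>

lemma way_below_join:
  assumes "way_below E X a v" "way_below E X b v"
    "a \<in> hom E I (opens X)" "b \<in> hom E I (opens X)" "v \<in> hom E I (opens X)"
  shows "way_below E X (join E X a b) v"
proof (rule way_belowI[of I])
  fix g S assume g: "g \<in> Arr E" "tgt E g = I" "S \<in> hom E (src E g) (Pow E (opens X))" "is_net E X S"
    "leq E X (v \<cdot> g) (Join E X S)"
  obtain e w where e: "epi E e" "e \<in> Arr E" "tgt E e = src E g" "w \<in> Arr E" "src E w = src E e" "tgt E w = opens X"
    "mem E w (S \<cdot> e) \<and> leq E X (a \<cdot> g \<cdot> e) w"
    by (rule exists_locE[OF way_belowD[OF assms(1) g(4,5) assms(3,5) g(1-3)]]) (rule that)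
  have "exists_loc E (src E e) (opens X) (\<lambda>d w. mem E w (S \<cdot> e \<cdot> d) \<and> leq E X (b \<cdot> g \<cdot> e \<cdot> d) w)"
  proof (rule exists_loc_cmp[OF way_belowD[OF assms(2) g(4,5) assms(4,5) g(1-3)] e(2,3)])
    fix k w' d h assume k: "epi E k" "k \<in> Arr E" "tgt E k = src E g" "w' \<in> Arr E" "src E w' = src E k" "tgt E w' = opens X"
      "mem E w' (S \<cdot> k) \<and> leq E X (b \<cdot> g \<cdot> k) w'"
      and d: "epi E d" "d \<in> Arr E" "tgt E d = src E e" "h \<in> Arr E" "src E h = src E d" "tgt E h = src E k" and kh: "k \<cdot> h = e \<cdot> d"
    have "mem E (w' \<cdot> h) ((S \<cdot> k) \<cdot> h)" by (rule mem_cmp) (use k d g in simp_all)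
    moreover have "leq E X ((b \<cdot> g \<cdot> k) \<cdot> h) (w' \<cdot> h)" by (rule leq_cmp[where I="src E k"]) (use k d g assms in simp_all)
    ultimately show "mem E (w' \<cdot> h) (S \<cdot> e \<cdot> d) \<and> leq E X (b \<cdot> g \<cdot> e \<cdot> d) (w' \<cdot> h)"
      using k d e(1-6) g assms kh by simp
  qed
  then obtain d w' where d: "epi E d" "d \<in> Arr E" "tgt E d = src E e" "w' \<in> Arr E" "src E w' = src E d" "tgt E w' = opens X"
      "mem E w' (S \<cdot> e \<cdot> d) \<and> leq E X (b \<cdot> g \<cdot> e \<cdot> d) w'"
    by (rule exists_locE) (rule that)
  have "mem E (w \<cdot> d) ((S \<cdot> e) \<cdot> d)" by (rule mem_cmp) (use d e g in simp_all)
  then have "exists_loc E (src E (e \<cdot> d)) (opens X)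
          (\<lambda>k c. mem E c (S \<cdot> (e \<cdot> d) \<cdot> k) \<and> leq E X ((w \<cdot> d) \<cdot> k) c \<and> leq E X (w' \<cdot> k) c)"
    by - (rule is_net_directed[OF g(4,3)], use d e g in simp_all)
  then obtain k c where k: "epi E k" "k \<in> Arr E" "tgt E k = src E (e \<cdot> d)" "c \<in> Arr E" "src E c = src E k" "tgt E c = opens X"
      "mem E c (S \<cdot> (e \<cdot> d) \<cdot> k) \<and> leq E X ((w \<cdot> d) \<cdot> k) c \<and> leq E X (w' \<cdot> k) c"
    by (rule exists_locE) (rule that)
  have tk: "tgt E k = src E d" using k d e by simp
  have "leq E X ((a \<cdot> g \<cdot> e) \<cdot> (d \<cdot> k)) (w \<cdot> (d \<cdot> k))"
    by (rule leq_cmp[where I="src E e"]) (use d e g k(1,2,4-7) tk assms in simp_all)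
  then have 1: "leq E X (a \<cdot> (g \<cdot> (e \<cdot> (d \<cdot> k)))) c"
    by - (rule leq_trans[where v="w \<cdot> (d \<cdot> k)" and I="src E k"], use d e g k(1,2,4-7) tk assms in simp_all)
  have "leq E X ((b \<cdot> g \<cdot> e \<cdot> d) \<cdot> k) (w' \<cdot> k)"
    by (rule leq_cmp[where I="src E d"]) (use d e g k(1,2,4-7) tk assms in simp_all)
  then have 2: "leq E X (b \<cdot> (g \<cdot> (e \<cdot> (d \<cdot> k)))) c"
    by - (rule leq_trans[where v="w' \<cdot> k" and I="src E k"], use d e g k(1,2,4-7) tk assms in simp_all)
  have "leq E X (join E X (a \<cdot> (g \<cdot> (e \<cdot> (d \<cdot> k)))) (b \<cdot> (g \<cdot> (e \<cdot> (d \<cdot> k))))) c"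
    by (rule join_least[OF 1 2]) (use d e g k(1,2,4-7) tk assms in simp_all)
  then show "exists_loc E (src E g) (opens X) (\<lambda>e w. mem E w (S \<cdot> e) \<and> leq E X (join E X a b \<cdot> g \<cdot> e) w)"
    by - (rule exists_locI[of "e \<cdot> (d \<cdot> k)" _ c], use d e g k(1,2,4-7) tk assms in \<open>simp_all add: epi_cmp\<close>)
qed (use assms in simp_all)

end

context internal_frame
begin

text \<open>
  An ideal of opens is in particular a net, so the opens that satisfy a property closed under finite joins
  may be used as a net.
\<close>

lemma way_below_ideal:
  assumes wb: "way_below E X u v" and u: "u \<in> hom E I (opens X)" and v: "v \<in> hom E I (opens X)"
    and rep: "representable (Prod E I (opens X)) (\<lambda>z. Q (pr1 E I (opens X) \<cdot> z) (pr2 E I (opens X) \<cdot> z))"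
    and bot: "Q (ident E I) (empty E X I)"
    and joins: "\<And>g a b. g \<in> Arr E \<Longrightarrow> tgt E g = I \<Longrightarrow> a \<in> hom E (src E g) (opens X) \<Longrightarrow> b \<in> hom E (src E g) (opens X) \<Longrightarrow>
      Q g a \<Longrightarrow> Q g b \<Longrightarrow> Q g (join E X a b)"
    and cov: "\<And>t. t \<in> hom E I (opens X) \<Longrightarrow>
      (\<And>h a. h \<in> Arr E \<Longrightarrow> tgt E h = I \<Longrightarrow> a \<in> hom E (src E h) (opens X) \<Longrightarrow> Q h a \<Longrightarrow> leq E X a (t \<cdot> h)) \<Longrightarrow> leq E X v t"
  shows "exists_loc E I (opens X) (\<lambda>e w. Q e w \<and> leq E X (u \<cdot> e) w)"
proof -
  have I: "I \<in> Ob E" using u by auto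
  obtain S where S: "S \<in> hom E I (Pow E (opens X))" "is_sup E X Q (Join E X S)"
    "\<And>x b. x \<in> Arr E \<Longrightarrow> b \<in> Arr E \<Longrightarrow> tgt E x = I \<Longrightarrow> tgt E b = opens X \<Longrightarrow> src E b = src E x \<Longrightarrow>
      mem E b (S \<cdot> x) \<longleftrightarrow> Q x b"
    by (rule sup_exists[where Q=Q, OF rep I]) (rule that)
  have mQ: "mem E b (S \<cdot> x) \<longleftrightarrow> Q x b" if "x \<in> Arr E" "tgt E x = I" "b \<in> hom E (src E x) (opens X)" for x b
    using S(3)[of x b] that by simp
  have net: "is_net E X S"
  proof (rule is_netI[OF S(1)])
    show "exists_loc E I (opens X) (\<lambda>e a. mem E a (S \<cdot> e))"
      by (rule exists_loc_here[of _ "empty E X I"]) (use I bot mQ in simp_all)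
    fix g a b assume g: "g \<in> Arr E" "tgt E g = I" "a \<in> hom E (src E g) (opens X)" "b \<in> hom E (src E g) (opens X)"
      "mem E a (S \<cdot> g)" "mem E b (S \<cdot> g)"
    have "Q g (join E X a b)" by (rule joins) (use g mQ in simp_all)
    then have "mem E (join E X a b) (S \<cdot> g)" using mQ g by simp
    then show "exists_loc E (src E g) (opens X) (\<lambda>e c. mem E c (S \<cdot> g \<cdot> e) \<and> leq E X (a \<cdot> e) c \<and> leq E X (b \<cdot> e) c)"
      by - (rule exists_loc_here[of _ "join E X a b"], use g S(1) in simp_all)
  qed
  have "leq E X v (Join E X S)"
  proof (rule cov)
    fix h a assume h: "h \<in> Arr E" "tgt E h = I" "a \<in> hom E (src E h) (opens X)" "Q h a"
    show "leq E X a (Join E X S \<cdot> h)"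
      by (rule is_sup_upper[OF S(2) _ h(4)]) (use h S(1) in simp_all)
  qed (use S(1) in simp)
  then have "exists_loc E (src E (ident E I)) (opens X) (\<lambda>e w. mem E w (S \<cdot> e) \<and> leq E X (u \<cdot> ident E I \<cdot> e) w)"
    by - (rule way_belowD[OF wb net, of _ I], use u v I S(1) in simp_all)
  then obtain e w where e: "epi E e" "e \<in> Arr E" "tgt E e = src E (ident E I)" "w \<in> Arr E" "src E w = src E e" "tgt E w = opens X"
    "mem E w (S \<cdot> e) \<and> leq E X (u \<cdot> ident E I \<cdot> e) w"
    by (rule exists_locE) (rule that)
  show ?thesis
    by (rule exists_locI[of e _ w]) (use e I u mQ[of e w] in simp_all)
qed

text \<open>
  Nets are sets of opens, but the ones met below are indexed by other sets; the set of opens \<open>\<phi> a\<close> is then a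
  net of opens, each of which has an index only locally.
\<close>

lemma way_below_image:
  assumes wb: "way_below E X u v" and u: "u \<in> hom E I (opens X)" and v: "v \<in> hom E I (opens X)"
    and S: "S \<in> hom E I (Pow E A)" and A: "A \<in> Ob E" and \<phi>: "\<phi> \<in> hom E (Prod E I A) (opens X)"
    and inh: "exists_loc E I A (\<lambda>e a. mem E a (S \<cdot> e))"
    and dir: "\<And>g a b. g \<in> Arr E \<Longrightarrow> tgt E g = I \<Longrightarrow> a \<in> hom E (src E g) A \<Longrightarrow> b \<in> hom E (src E g) A \<Longrightarrow>
      mem E a (S \<cdot> g) \<Longrightarrow> mem E b (S \<cdot> g) \<Longrightarrow>
      exists_loc E (src E g) A (\<lambda>e c. mem E c (S \<cdot> (g \<cdot> e)) \<and>
        leq E X (\<phi> \<cdot> pair E (g \<cdot> e) (a \<cdot> e)) (\<phi> \<cdot> pair E (g \<cdot> e) c) \<and>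
        leq E X (\<phi> \<cdot> pair E (g \<cdot> e) (b \<cdot> e)) (\<phi> \<cdot> pair E (g \<cdot> e) c))"
    and cov: "\<And>t. t \<in> hom E I (opens X) \<Longrightarrow>
      (\<And>h a. h \<in> Arr E \<Longrightarrow> tgt E h = I \<Longrightarrow> a \<in> hom E (src E h) A \<Longrightarrow> mem E a (S \<cdot> h) \<Longrightarrow>
        leq E X (\<phi> \<cdot> pair E h a) (t \<cdot> h)) \<Longrightarrow> leq E X v t"
  shows "exists_loc E I A (\<lambda>e a. mem E a (S \<cdot> e) \<and> leq E X (u \<cdot> e) (\<phi> \<cdot> pair E e a))"
proof -
  let ?O = "opens X"
  have I: "I \<in> Ob E" using u by auto
  let ?C = "Prod E I ?O" and ?p = "pr1 E I ?O" and ?q = "pr2 E I ?O"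
  let ?Q = "\<lambda>x y. exists_loc E (src E y) A (\<lambda>e a. mem E a (S \<cdot> (x \<cdot> e)) \<and> y \<cdot> e = \<phi> \<cdot> pair E (x \<cdot> e) a)"
  let ?D = "Prod E ?C A"
  have n: "natural ?D I (\<lambda>z. ?p \<cdot> (pr1 E ?C A \<cdot> z))" "natural ?D ?O (\<lambda>z. ?q \<cdot> (pr1 E ?C A \<cdot> z))"
    "natural ?D A (\<lambda>z. pr2 E ?C A \<cdot> z)"
    by (rule natural_pr1 natural_pr2 natural_id | use I A in simp)+
  have nS: "natural ?D (Pow E A) (\<lambda>z. S \<cdot> (?p \<cdot> (pr1 E ?C A \<cdot> z)))"
    by (rule natural_comp[OF n(1)]) (use S in simp_all)
  have n\<phi>: "natural ?D ?O (\<lambda>z. \<phi> \<cdot> pair E (?p \<cdot> (pr1 E ?C A \<cdot> z)) (pr2 E ?C A \<cdot> z))"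
    by (rule natural_comp[OF natural_pair[OF n(1,3)]]) (use \<phi> in simp_all)
  have "representable ?C (\<lambda>z. exists_loc E (src E z) A (\<lambda>e a. mem E a (S \<cdot> (?p \<cdot> (z \<cdot> e))) \<and>
      ?q \<cdot> (z \<cdot> e) = \<phi> \<cdot> pair E (?p \<cdot> (z \<cdot> e)) a))"
    by (rule representable_ex[where Q="\<lambda>z a. mem E a (S \<cdot> (?p \<cdot> z)) \<and> ?q \<cdot> z = \<phi> \<cdot> pair E (?p \<cdot> z) a",
        OF representable_conj[OF representable_mem[OF n(3) nS] representable_eq[OF n(2) n\<phi>]]]) (use I A in simp_all)
  then have rep: "representable ?C (\<lambda>z. ?Q (?p \<cdot> z) (?q \<cdot> z))"
    by (rule representable_cong) (use I A in \<open>simp add: exists_loc_def cong: conj_cong\<close>)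
  obtain T where T: "T \<in> hom E I (Pow E (opens X))" "is_sup E X ?Q (Join E X T)"
    "\<And>x b. x \<in> Arr E \<Longrightarrow> b \<in> Arr E \<Longrightarrow> tgt E x = I \<Longrightarrow> tgt E b = opens X \<Longrightarrow> src E b = src E x \<Longrightarrow>
      mem E b (T \<cdot> x) \<longleftrightarrow> ?Q x b"
    by (rule sup_exists[where Q="?Q", OF rep I]) (rule that)
  have \<phi>h: "\<phi> \<cdot> pair E x a \<in> hom E (src E x) ?O" if "x \<in> Arr E" "tgt E x = I" "a \<in> hom E (src E x) A" for x a
    using that \<phi> by simp
  have memT: "mem E (\<phi> \<cdot> pair E x a) (T \<cdot> x)" if "x \<in> Arr E" "tgt E x = I" "a \<in> hom E (src E x) A" "mem E a (S \<cdot> x)" for x a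
  proof -
    have "?Q x (\<phi> \<cdot> pair E x a)"
      by (rule exists_loc_here[of _ a]) (use that \<phi> S in simp_all)
    then show ?thesis using T(3)[of x "\<phi> \<cdot> pair E x a"] that \<phi> by simp
  qed
  have memTE: "\<exists>e a. epi E e \<and> e \<in> Arr E \<and> tgt E e = src E x \<and> a \<in> hom E (src E e) A \<and> mem E a (S \<cdot> (x \<cdot> e)) \<and>
      y \<cdot> e = \<phi> \<cdot> pair E (x \<cdot> e) a" if "mem E y (T \<cdot> x)" "x \<in> Arr E" "tgt E x = I" "y \<in> hom E (src E x) ?O" for x y
  proof -
    have "?Q x y" using T(3)[of x y] that by simp
    then show ?thesis using that unfolding exists_loc_def by (metis epi_arr in_hom)
  qed
  have net: "is_net E X T"
  proof (rule is_netI[OF T(1)])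
    obtain e a where e: "epi E e" "e \<in> Arr E" "tgt E e = I" "a \<in> Arr E" "src E a = src E e" "tgt E a = A" "mem E a (S \<cdot> e)"
      by (rule exists_locE[OF inh]) (rule that)
    show "exists_loc E I ?O (\<lambda>e a. mem E a (T \<cdot> e))"
      by (rule exists_locI[of e _ "\<phi> \<cdot> pair E e a"]) (use e \<phi> memT[of e a] in simp_all)
  next
    fix g y1 y2 assume g: "g \<in> Arr E" "tgt E g = I" and y: "y1 \<in> hom E (src E g) ?O" "y2 \<in> hom E (src E g) ?O"
      and m: "mem E y1 (T \<cdot> g)" "mem E y2 (T \<cdot> g)"
    obtain e1 a1 where e1: "epi E e1" "e1 \<in> Arr E" "tgt E e1 = src E g" "a1 \<in> hom E (src E e1) A" "mem E a1 (S \<cdot> (g \<cdot> e1))"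
      and y1: "y1 \<cdot> e1 = \<phi> \<cdot> pair E (g \<cdot> e1) a1"
      using memTE[OF m(1) g y(1)] by blast
    have "mem E (y2 \<cdot> e1) ((T \<cdot> g) \<cdot> e1)" by (rule mem_cmp[OF m(2)]) (use y g e1 T(1) in simp_all)
    then have "mem E (y2 \<cdot> e1) (T \<cdot> (g \<cdot> e1))" using y g e1 T(1) by simp
    then obtain e2 a2 where e2: "epi E e2" "e2 \<in> Arr E" "tgt E e2 = src E (g \<cdot> e1)" "a2 \<in> hom E (src E e2) A" "mem E a2 (S \<cdot> ((g \<cdot> e1) \<cdot> e2))"
      and y2: "(y2 \<cdot> e1) \<cdot> e2 = \<phi> \<cdot> pair E ((g \<cdot> e1) \<cdot> e2) a2"
      using memTE[of "y2 \<cdot> e1" "g \<cdot> e1"] y g e1 by auto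
    have te2: "tgt E e2 = src E e1" using e2 e1 g by simp
    let ?k = "g \<cdot> (e1 \<cdot> e2)"
    have k: "?k \<in> Arr E" "tgt E ?k = I" "src E ?k = src E e2" using g e1 e2(1,2) te2 by simp_all
    have "mem E (a1 \<cdot> e2) ((S \<cdot> (g \<cdot> e1)) \<cdot> e2)" by (rule mem_cmp[OF e1(5)]) (use S g e1(1-4) e2(1,2) te2 in simp_all)
    then have "mem E (a1 \<cdot> e2) (S \<cdot> ?k)" using S g e1(1-4) e2(1,2) te2 by simp
    moreover have "mem E a2 (S \<cdot> ?k)" using e2(5) S g e1(1-4) e2(1,2) te2 by simp
    moreover have "a1 \<cdot> e2 \<in> hom E (src E ?k) A" "a2 \<in> hom E (src E ?k) A" using g e1(1-4) e2(1,2,4) te2 by simp_all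
    ultimately have "exists_loc E (src E ?k) A (\<lambda>e c. mem E c (S \<cdot> (?k \<cdot> e)) \<and>
        leq E X (\<phi> \<cdot> pair E (?k \<cdot> e) ((a1 \<cdot> e2) \<cdot> e)) (\<phi> \<cdot> pair E (?k \<cdot> e) c) \<and>
        leq E X (\<phi> \<cdot> pair E (?k \<cdot> e) (a2 \<cdot> e)) (\<phi> \<cdot> pair E (?k \<cdot> e) c))"
      using dir[OF k(1,2)] by blast
    then obtain d c where d: "epi E d" "d \<in> Arr E" "tgt E d = src E ?k" "c \<in> Arr E" "src E c = src E d" "tgt E c = A"
      "mem E c (S \<cdot> (?k \<cdot> d)) \<and>
        leq E X (\<phi> \<cdot> pair E (?k \<cdot> d) ((a1 \<cdot> e2) \<cdot> d)) (\<phi> \<cdot> pair E (?k \<cdot> d) c) \<and>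
        leq E X (\<phi> \<cdot> pair E (?k \<cdot> d) (a2 \<cdot> d)) (\<phi> \<cdot> pair E (?k \<cdot> d) c)"
      by (rule exists_locE) (rule that)
    have td: "tgt E d = src E e2" using d(3) k(3) by simp
    note ty = g e1(2-4) e2(2,4) te2 d(2,4-6) td \<phi> y S T(1)
    have epi: "epi E (e1 \<cdot> (e2 \<cdot> d))" by (intro epi_cmp e1 e2 d) (use ty in simp_all)
    have "y1 \<cdot> (e1 \<cdot> (e2 \<cdot> d)) = (\<phi> \<cdot> pair E (g \<cdot> e1) a1) \<cdot> (e2 \<cdot> d)"
      by (rule cmp_reassoc[OF y1]) (use ty in simp_all)
    then have Y1: "y1 \<cdot> (e1 \<cdot> (e2 \<cdot> d)) = \<phi> \<cdot> pair E (?k \<cdot> d) ((a1 \<cdot> e2) \<cdot> d)" using ty by simp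
    have "(y2 \<cdot> e1) \<cdot> (e2 \<cdot> d) = (\<phi> \<cdot> pair E ((g \<cdot> e1) \<cdot> e2) a2) \<cdot> d"
      by (rule cmp_reassoc[OF y2]) (use ty in simp_all)
    then have Y2: "y2 \<cdot> (e1 \<cdot> (e2 \<cdot> d)) = \<phi> \<cdot> pair E (?k \<cdot> d) (a2 \<cdot> d)" using ty by simp
    have "mem E (\<phi> \<cdot> pair E (?k \<cdot> d) c) (T \<cdot> (?k \<cdot> d))" by (rule memT) (use ty d(7) in simp_all)
    then have M: "mem E (\<phi> \<cdot> pair E (?k \<cdot> d) c) ((T \<cdot> g) \<cdot> (e1 \<cdot> (e2 \<cdot> d)))" using ty by simp
    show "exists_loc E (src E g) ?O (\<lambda>e c. mem E c (T \<cdot> g \<cdot> e) \<and> leq E X (y1 \<cdot> e) c \<and> leq E X (y2 \<cdot> e) c)"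
    proof (rule exists_locI[OF epi, of _ "\<phi> \<cdot> pair E (?k \<cdot> d) c"])
      show "mem E (\<phi> \<cdot> pair E (?k \<cdot> d) c) (T \<cdot> g \<cdot> (e1 \<cdot> (e2 \<cdot> d))) \<and>
        leq E X (y1 \<cdot> (e1 \<cdot> (e2 \<cdot> d))) (\<phi> \<cdot> pair E (?k \<cdot> d) c) \<and> leq E X (y2 \<cdot> (e1 \<cdot> (e2 \<cdot> d))) (\<phi> \<cdot> pair E (?k \<cdot> d) c)"
        unfolding Y1 Y2 using M d(7) by blast
    qed (use ty in simp_all)
  qed
  have "leq E X v (Join E X T)"
  proof (rule cov)
    fix h a assume h: "h \<in> Arr E" "tgt E h = I" "a \<in> hom E (src E h) A" "mem E a (S \<cdot> h)"
    have "leq E X (\<phi> \<cdot> pair E h a) (Join E X (T \<cdot> h))"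
      by (rule Join_upper[of _ _ "src E h"]) (use memT[OF h] h T(1) \<phi> in simp_all)
    then show "leq E X (\<phi> \<cdot> pair E h a) (Join E X T \<cdot> h)" using T(1) h by simp
  qed (use T(1) in simp)
  then have "exists_loc E (src E (ident E I)) ?O (\<lambda>e w. mem E w (T \<cdot> e) \<and> leq E X (u \<cdot> ident E I \<cdot> e) w)"
    by - (rule way_belowD[OF wb net, of _ I], use u v I T(1) in simp_all)
  then obtain e w where e0: "epi E e" "e \<in> Arr E" "tgt E e = src E (ident E I)" "w \<in> Arr E" "src E w = src E e" "tgt E w = ?O"
    "mem E w (T \<cdot> e) \<and> leq E X (u \<cdot> ident E I \<cdot> e) w"
    by (rule exists_locE) (rule that)
  have e: "epi E e" "e \<in> Arr E" "tgt E e = I" "w \<in> hom E (src E e) ?O" "mem E w (T \<cdot> e)" "leq E X (u \<cdot> e) w"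
    using e0 I u by simp_all
  obtain d a where d: "epi E d" "d \<in> Arr E" "tgt E d = src E e" "a \<in> hom E (src E d) A" "mem E a (S \<cdot> (e \<cdot> d))"
      and w: "w \<cdot> d = \<phi> \<cdot> pair E (e \<cdot> d) a"
    using memTE[OF e(5,2,3,4)] by blast
  have "leq E X ((u \<cdot> e) \<cdot> d) (w \<cdot> d)" by (rule leq_cmp[OF e(6)]) (use e u d in simp_all)
  then have "leq E X ((u \<cdot> e) \<cdot> d) (\<phi> \<cdot> pair E (e \<cdot> d) a)" unfolding w .
  then show ?thesis
    by - (rule exists_locI[of "e \<cdot> d" _ a], use e(1-3) u d in \<open>simp_all add: epi_cmp\<close>)
qed

section \<open>Locally compact and regular locales\<close>

lemma regular_leqI:
  assumes "regular E X" "v \<in> hom E I (opens X)" "t \<in> hom E I (opens X)"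
    "\<And>h a. h \<in> Arr E \<Longrightarrow> tgt E h = I \<Longrightarrow> a \<in> hom E (src E h) (opens X) \<Longrightarrow> rather_below E X a (v \<cdot> h) \<Longrightarrow> leq E X a (t \<cdot> h)"
  shows "leq E X v t"
proof -
  have "is_sup E X (\<lambda>g u. rather_below E X u (v \<cdot> g)) v"
    using assms(1,2) unfolding regular_def by simp
  then show ?thesis by (rule is_sup_here[OF _ assms(2,3)]) (rule assms(4))
qed

lemma locally_compact_leqI:
  assumes "locally_compact E X" "v \<in> hom E I (opens X)" "t \<in> hom E I (opens X)"
    "\<And>h a. h \<in> Arr E \<Longrightarrow> tgt E h = I \<Longrightarrow> a \<in> hom E (src E h) (opens X) \<Longrightarrow> way_below E X a (v \<cdot> h) \<Longrightarrow> leq E X a (t \<cdot> h)"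
  shows "leq E X v t"
proof -
  have "is_sup E X (\<lambda>g u. way_below E X u (v \<cdot> g)) v"
    using assms(1,2) unfolding locally_compact_def by simp
  then show ?thesis by (rule is_sup_here[OF _ assms(2,3)]) (rule assms(4))
qed

text \<open>
  The opens rather below \<open>v\<close> form an ideal, which has supremum \<open>v\<close> by regularity.
\<close>

lemma way_below_rather_below:
  assumes reg: "regular E X" and wb: "way_below E X u v" and u: "u \<in> hom E I (opens X)" and v: "v \<in> hom E I (opens X)"
  shows "rather_below E X u v"
proof -
  have I: "I \<in> Ob E" using u by auto
  have "exists_loc E I (opens X) (\<lambda>e w. rather_below E X w (v \<cdot> e) \<and> leq E X (u \<cdot> e) w)"
  proof (rule way_below_ideal[where Q="\<lambda>e w. rather_below E X w (v \<cdot> e)", OF wb u v])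
    show "representable (Prod E I (opens X)) (\<lambda>z. rather_below E X (pr2 E I (opens X) \<cdot> z) (v \<cdot> (pr1 E I (opens X) \<cdot> z)))"
      by (rule representable_rather_below natural_comp natural_pr1 natural_pr2 natural_id | use v I in simp)+
    show "rather_below E X (empty E X I) (v \<cdot> ident E I)"
      using rather_below_empty[OF v] v by simp
    fix g a b assume g: "g \<in> Arr E" "tgt E g = I" "a \<in> hom E (src E g) (opens X)" "b \<in> hom E (src E g) (opens X)"
      "rather_below E X a (v \<cdot> g)" "rather_below E X b (v \<cdot> g)"
    show "rather_below E X (join E X a b) (v \<cdot> g)"
      by (rule rather_below_join[OF g(5,6)]) (use g v in simp_all)
  next
    fix t assume "t \<in> hom E I (opens X)" "\<And>h a. h \<in> Arr E \<Longrightarrow> tgt E h = I \<Longrightarrow> a \<in> hom E (src E h) (opens X) \<Longrightarrow>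
      rather_below E X a (v \<cdot> h) \<Longrightarrow> leq E X a (t \<cdot> h)"
    then show "leq E X v t" by (rule regular_leqI[OF reg v])
  qed
  then obtain e w where e: "epi E e" "e \<in> Arr E" "tgt E e = I" "w \<in> Arr E" "src E w = src E e" "tgt E w = opens X"
    "rather_below E X w (v \<cdot> e) \<and> leq E X (u \<cdot> e) w"
    by (rule exists_locE) (rule that)
  have "rather_below E X (u \<cdot> e) (v \<cdot> e)"
    by (rule rather_below_mono[of w "v \<cdot> e" _ _ "src E e"]) (use e u v in simp_all)
  then show ?thesis by (rule rather_below_local[OF _ e(1) u v e(3)])
qed

text \<open>
  The opens \<open>w\<close> that are rather below some open way below the whole form an ideal, which
  exhausts the locale; hence every open way below the whole belongs to it.
\<close>

lemma way_below_whole_interpolate: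
  assumes lc: "locally_compact E X" and reg: "regular E X" and wb: "way_below E X w (whole E X I)" and w: "w \<in> hom E I (opens X)"
  shows "exists_loc E I (opens X) (\<lambda>e w'. way_below E X w' (whole E X (src E e)) \<and> rather_below E X (w \<cdot> e) w')"
proof -
  let ?O = "opens X"
  have I: "I \<in> Ob E" using w by auto
  let ?R = "\<lambda>a b. way_below E X b (whole E X (src E b)) \<and> rather_below E X a b"
  let ?Q = "\<lambda>a. exists_loc E (src E a) ?O (\<lambda>e b. ?R (a \<cdot> e) b)"
  have R: "representable (Prod E ?O ?O) (\<lambda>z. ?R (pr1 E ?O ?O \<cdot> z) (pr2 E ?O ?O \<cdot> z))"
    by (rule representable_cong[where P="\<lambda>z. way_below E X (pr2 E ?O ?O \<cdot> z) (whole E X (src E z)) \<and>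
        rather_below E X (pr1 E ?O ?O \<cdot> z) (pr2 E ?O ?O \<cdot> z)"])
      (rule representable_conj representable_way_below representable_rather_below natural_whole natural_pr1 natural_pr2 natural_id | simp)+
  have repQ: "representable ?O ?Q" by (rule representable_ex[OF R]) simp_all
  have Rcmp: "?R (a \<cdot> g) (b \<cdot> g)" if "?R a b" "a \<in> hom E J ?O" "b \<in> hom E J ?O" "g \<in> Arr E" "tgt E g = J" for a b g J
    using way_below_cmp[of b "whole E X J" J g] rather_below_cmp[of a b J g] that src_ob[of a] by auto
  have "exists_loc E I ?O (\<lambda>e b. ?Q b \<and> leq E X (w \<cdot> e) b)"
  proof (rule way_below_ideal[where Q="\<lambda>e b. ?Q b", OF wb w])
    show "whole E X I \<in> hom E I ?O" using I by simp
    show "representable (Prod E I ?O) (\<lambda>z. ?Q (pr2 E I ?O \<cdot> z))"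
      by (rule representable_subst[OF repQ]) (rule natural_pr2 natural_id | use I in simp)+
    show "?Q (empty E X I)"
      by (rule exists_loc_here[of _ "empty E X I"])
        (use I way_below_empty[of "whole E X I" I] rather_below_empty[of "empty E X I" I] in simp_all)
    fix g a b assume g: "g \<in> Arr E" "tgt E g = I" and a: "a \<in> hom E (src E g) ?O" and b: "b \<in> hom E (src E g) ?O"
      and Qa: "?Q a" and Qb: "?Q b"
    obtain e c where e: "epi E e" "e \<in> Arr E" "tgt E e = src E a" "c \<in> Arr E" "src E c = src E e" "tgt E c = ?O" "?R (a \<cdot> e) c"
      by (rule exists_locE[OF Qa]) (rule that)
    have "?Q (b \<cdot> e)" by (rule representable_cmp[OF repQ, of b]) (use Qb a b e in simp_all)
    then obtain k d where k: "epi E k" "k \<in> Arr E" "tgt E k = src E (b \<cdot> e)" "d \<in> Arr E" "src E d = src E k" "tgt E d = ?O" "?R ((b \<cdot> e) \<cdot> k) d"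
      by (rule exists_locE) (rule that)
    have tk: "tgt E k = src E e" using k(3) a b e(1-3) by simp
    note ty = a b e(2-6) k(2,4-6) tk
    have Ra: "?R ((a \<cdot> e) \<cdot> k) (c \<cdot> k)" by (rule Rcmp[OF e(7), of "src E e"]) (use ty in simp_all)
    let ?cd = "join E X (c \<cdot> k) d"
    have ra: "rather_below E X ((a \<cdot> e) \<cdot> k) ?cd"
      by (rule rather_below_mono[OF Ra[THEN conjunct2], of _ _ "src E k"]) (use ty in simp_all)
    have rb: "rather_below E X ((b \<cdot> e) \<cdot> k) ?cd"
      by (rule rather_below_mono[OF k(7)[THEN conjunct2], of _ _ "src E k"]) (use ty in simp_all)
    have r: "rather_below E X (join E X ((a \<cdot> e) \<cdot> k) ((b \<cdot> e) \<cdot> k)) ?cd"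
      by (rule rather_below_join[OF ra rb, of "src E k"]) (use ty in simp_all)
    have wcd: "way_below E X ?cd (whole E X (src E k))"
      by (rule way_below_join[of _ _ _ "src E k"]) (use Ra[THEN conjunct1] k(7)[THEN conjunct1] ty in simp_all)
    show "?Q (join E X a b)"
      by (rule exists_locI[of "e \<cdot> k" _ ?cd]) (use ty r wcd e(1) k(1) in \<open>simp_all add: epi_cmp\<close>)
  next
    fix t assume t: "t \<in> hom E I ?O" and all: "\<And>h a. h \<in> Arr E \<Longrightarrow> tgt E h = I \<Longrightarrow> a \<in> hom E (src E h) ?O \<Longrightarrow> ?Q a \<Longrightarrow> leq E X a (t \<cdot> h)"
    show "leq E X (whole E X I) t"
    proof (rule locally_compact_leqI[OF lc _ t])
      fix h b assume h: "h \<in> Arr E" "tgt E h = I" and b: "b \<in> hom E (src E h) ?O" and wb: "way_below E X b (whole E X I \<cdot> h)"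
      show "leq E X b (t \<cdot> h)"
      proof (rule regular_leqI[OF reg b])
        fix k a assume k: "k \<in> Arr E" "tgt E k = src E h" and a: "a \<in> hom E (src E k) ?O" and rb: "rather_below E X a (b \<cdot> k)"
        have "way_below E X (b \<cdot> k) ((whole E X I \<cdot> h) \<cdot> k)"
          by (rule way_below_cmp[OF wb, of "src E h"]) (use h b k in simp_all)
        then have "?R a (b \<cdot> k)" using rb h b k by simp
        then have "?Q a" by - (rule exists_loc_here[of _ "b \<cdot> k"], use a b k in simp_all)
        then have "leq E X a (t \<cdot> (h \<cdot> k))" by - (rule all, use h k a in simp_all)
        then show "leq E X a ((t \<cdot> h) \<cdot> k)" using t h k by simp
      qed (use t h in simp)
    qed (use I in simp)
  qed
  then obtain e b where e: "epi E e" "e \<in> Arr E" "tgt E e = I" "b \<in> Arr E" "src E b = src E e" "tgt E b = ?O" "?Q b \<and> leq E X (w \<cdot> e) b"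
    by (rule exists_locE) (rule that)
  obtain d c where d: "epi E d" "d \<in> Arr E" "tgt E d = src E b" "c \<in> Arr E" "src E c = src E d" "tgt E c = ?O" "?R (b \<cdot> d) c"
    by (rule exists_locE[OF e(7)[THEN conjunct1]]) (rule that)
  have "leq E X ((w \<cdot> e) \<cdot> d) (b \<cdot> d)" by (rule leq_cmp[OF e(7)[THEN conjunct2]]) (use e(1-6) d(1-6) w in simp_all)
  then have "rather_below E X ((w \<cdot> e) \<cdot> d) c"
    by - (rule rather_below_mono[OF d(7)[THEN conjunct2], of _ _ "src E d"], use e(1-6) d(1-6) w in simp_all)
  then show ?thesis
    by - (rule exists_locI[of "e \<cdot> d" _ c], use e(1-6) d w in \<open>simp_all add: epi_cmp\<close>)
qed

section \<open>The predicate omega\<close>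

lemma omegaI:
  assumes "way_below E X w (whole E X I)" "covers u w" "u \<in> hom E I (opens X)" "w \<in> hom E I (opens X)"
  shows "omega E X u"
proof -
  have "join E X u w = whole E X I" using covers_iff[OF assms(3,4)] assms(2) by blast
  then show ?thesis unfolding omega_def
    by - (rule exists_loc_here[of _ w], use assms in auto)
qed

lemma omegaE:
  assumes "omega E X u" "u \<in> hom E I (opens X)"
  obtains e w where "epi E e" "e \<in> Arr E" "tgt E e = I" "w \<in> hom E (src E e) (opens X)"
    "way_below E X w (whole E X (src E e))" "covers (u \<cdot> e) w"
proof -
  obtain e w where e: "epi E e" "e \<in> Arr E" "tgt E e = src E u" "w \<in> Arr E" "src E w = src E e" "tgt E w = opens X"
    "way_below E X w (whole E X (src E e)) \<and> join E X (u \<cdot> e) w = whole E X (src E e)"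
    by (rule exists_locE[OF assms(1)[unfolded omega_def]]) (rule that)
  show ?thesis
    by (rule that[of e w]) (use e assms(2) covers_iff[of "u \<cdot> e" "src E e" w] in simp_all)
qed

lemma representable_omega: "representable (opens X) (omega E X)"
proof -
  let ?O = "opens X"
  let ?R = "\<lambda>u w. way_below E X w (whole E X (src E w)) \<and> join E X u w = whole E X (src E w)"
  have R: "representable (Prod E ?O ?O) (\<lambda>z. ?R (pr1 E ?O ?O \<cdot> z) (pr2 E ?O ?O \<cdot> z))"
    by (rule representable_cong[where P="\<lambda>z. way_below E X (pr2 E ?O ?O \<cdot> z) (whole E X (src E z)) \<and>
        join E X (pr1 E ?O ?O \<cdot> z) (pr2 E ?O ?O \<cdot> z) = whole E X (src E z)"])
      (rule representable_conj representable_way_below representable_eq[where B="?O"] natural_join natural_whole natural_pr1 natural_pr2 natural_id | simp)+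
  have "representable ?O (\<lambda>u. exists_loc E (src E u) ?O (\<lambda>e w. ?R (u \<cdot> e) w))"
    by (rule representable_ex[OF R]) simp_all
  then show ?thesis
    by (rule representable_cong) (simp add: omega_def exists_loc_def cong: conj_cong)
qed

lemma omega_cmp:
  assumes "omega E X u" "u \<in> hom E I (opens X)" "g \<in> Arr E" "tgt E g = I"
  shows "omega E X (u \<cdot> g)"
  by (rule representable_cmp[OF representable_omega]) (use assms in simp_all)

lemma omega_local:
  assumes "omega E X (u \<cdot> e)" "u \<in> hom E I (opens X)" "epi E e" "tgt E e = I"
  shows "omega E X u"
  by (rule representable_local[OF representable_omega, of u e]) (use assms in simp_all)

lemma omega_mono:
  assumes "omega E X u" "leq E X u v" "u \<in> hom E I (opens X)" "v \<in> hom E I (opens X)"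
  shows "omega E X v"
proof (rule omegaE[OF assms(1,3)])
  fix e w assume e: "epi E e" "e \<in> Arr E" "tgt E e = I" "w \<in> hom E (src E e) (opens X)"
    "way_below E X w (whole E X (src E e))" "covers (u \<cdot> e) w"
  have "covers (v \<cdot> e) w"
    by (rule covers_mono[OF e(6) leq_cmp[OF assms(2-)] leq_refl]) (use e assms in simp_all)
  then have "omega E X (v \<cdot> e)" by (rule omegaI[OF e(5)]) (use e assms in simp_all)
  then show ?thesis by (rule omega_local) (use e assms in simp_all)
qed

lemma omega_whole:
  assumes "I \<in> Ob E"
  shows "omega E X (whole E X I)"
  by (rule omegaI[OF way_below_empty, of _ I]) (use assms in \<open>simp_all add: covers_def\<close>)

text \<open>
  Two opens way below the whole have a join way below the whole, which covers together with each of the two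
  given opens, and hence with their meet.
\<close>

lemma omega_meet:
  assumes "omega E X u" "omega E X v" "u \<in> hom E I (opens X)" "v \<in> hom E I (opens X)"
  shows "omega E X (meet E X u v)"
proof (rule omegaE[OF assms(1,3)])
  fix e w assume e: "epi E e" "e \<in> Arr E" "tgt E e = I" "w \<in> hom E (src E e) (opens X)"
    "way_below E X w (whole E X (src E e))" "covers (u \<cdot> e) w"
  have v: "omega E X (v \<cdot> e)" by (rule omega_cmp[OF assms(2)]) (use e assms in simp_all)
  have ve: "v \<cdot> e \<in> hom E (src E e) (opens X)" using assms e by simp
  show ?thesis
  proof (rule omegaE[OF v ve])
    fix k x assume k: "epi E k" "k \<in> Arr E" "tgt E k = src E e" "x \<in> hom E (src E k) (opens X)"
      "way_below E X x (whole E X (src E k))" "covers ((v \<cdot> e) \<cdot> k) x"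
    let ?J = "src E k" and ?y = "join E X (w \<cdot> k) x"
    have y: "?y \<in> hom E ?J (opens X)" using e k by simp
    have "way_below E X (w \<cdot> k) (whole E X (src E e) \<cdot> k)"
      by (rule way_below_cmp[OF e(5)]) (use e k in simp_all)
    then have wy: "way_below E X ?y (whole E X ?J)"
      by - (rule way_below_join[of _ _ _ ?J], use e k in simp_all)
    have "covers ((u \<cdot> e) \<cdot> k) (w \<cdot> k)" by (rule covers_cmp[OF e(6)]) (use e k assms in simp_all)
    then have c1: "covers ((u \<cdot> e) \<cdot> k) ?y"
      by (rule covers_mono[of _ _ _ _ ?J]) (use e k assms in simp_all)
    have c2: "covers ((v \<cdot> e) \<cdot> k) ?y"
      by (rule covers_mono[OF k(6), of _ _ ?J]) (use e k assms in simp_all)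
    have "covers (meet E X ((u \<cdot> e) \<cdot> k) ((v \<cdot> e) \<cdot> k)) ?y"
      by (rule covers_meet[OF c1 c2, of ?J]) (use e k assms in simp_all)
    then have "omega E X (meet E X ((u \<cdot> e) \<cdot> k) ((v \<cdot> e) \<cdot> k))"
      by (rule omegaI[OF wy]) (use e k assms in simp_all)
    then have "omega E X (meet E X u v \<cdot> (e \<cdot> k))" using e k assms by simp
    then show ?thesis by (rule omega_local[of _ _ I]) (use e k assms epi_cmp in simp_all)
  qed
qed

text \<open>
  The complement of \<open>w\<close> covers together with any \<open>w'\<close> that \<open>w\<close> is rather below, and some such \<open>w'\<close> is way
  below the whole. In the compactification this makes the complement of \<open>w\<close> a neighbourhood of infinity.
\<close>

lemma omega_neg:
  assumes "locally_compact E X" "regular E X" "way_below E X w (whole E X I)" "w \<in> hom E I (opens X)"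
  shows "omega E X (neg E X w)"
proof -
  obtain e w' where e: "epi E e" "e \<in> Arr E" "tgt E e = I" "w' \<in> Arr E" "src E w' = src E e" "tgt E w' = opens X"
    "way_below E X w' (whole E X (src E e)) \<and> rather_below E X (w \<cdot> e) w'"
    by (rule exists_locE[OF way_below_whole_interpolate[OF assms]]) (rule that)
  have "covers (neg E X (w \<cdot> e)) w'" using rather_below_iff[of "w \<cdot> e" "src E e" w'] e assms(4) by simp
  then have "omega E X (neg E X (w \<cdot> e))"
    using e(7)[THEN conjunct1] by - (rule omegaI[of w' "src E e"], use e(1-6) assms(4) in simp_all)
  then have "omega E X (neg E X w \<cdot> e)" using e(1-6) assms(4) by simp
  then show ?thesis by (rule omega_local[of _ _ I]) (use e(1-6) assms(4) in simp_all)
qed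

end

section \<open>The frame of truth values\<close>

context elementary_topos
begin

lemma opens_truth [simp]: "opens (truth_frame E) = Om E"
  by (simp add: truth_frame_def)

lemma rel_truth_props:
  "le (truth_frame E) \<in> hom E (Prod E (Om E) (Om E)) (Om E) \<and>
     (\<forall>I\<in>Ob E. \<forall>u\<in>hom E I (Om E). \<forall>v\<in>hom E I (Om E).
       holds E (le (truth_frame E) \<cdot> pair E u v) \<longleftrightarrow> (\<forall>g\<in>into E (src E u). holds E (u \<cdot> g) \<longrightarrow> holds E (v \<cdot> g)))"
proof -
  let ?O = "Om E"
  let ?C = "Prod E ?O ?O"
  have "representable ?C (\<lambda>z. \<forall>g\<in>into E (src E z). holds E (pr1 E ?O ?O \<cdot> (z \<cdot> g)) \<longrightarrow> holds E (pr2 E ?O ?O \<cdot> (z \<cdot> g)))"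
    by (rule representable_imp[where P="\<lambda>z. holds E (pr1 E ?O ?O \<cdot> z)" and Q="\<lambda>z. holds E (pr2 E ?O ?O \<cdot> z)"])
      (rule representable_holds natural_pr1 natural_pr2 natural_id | simp)+
  then have "representable ?C (\<lambda>z. \<forall>g\<in>into E (src E (pr1 E ?O ?O \<cdot> z)).
      holds E ((pr1 E ?O ?O \<cdot> z) \<cdot> g) \<longrightarrow> holds E ((pr2 E ?O ?O \<cdot> z) \<cdot> g))"
    by (rule representable_cong) simp
  from rel_props[where R="\<lambda>p q. \<forall>g\<in>into E (src E p). holds E (p \<cdot> g) \<longrightarrow> holds E (q \<cdot> g)", OF this]
  show ?thesis by (simp add: truth_frame_def)
qed

lemma leq_truth_iff:
  assumes "p \<in> hom E I (Om E)" "q \<in> hom E I (Om E)"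
  shows "leq E (truth_frame E) p q \<longleftrightarrow> (\<forall>g\<in>into E I. holds E (p \<cdot> g) \<longrightarrow> holds E (q \<cdot> g))"
proof -
  have "I \<in> Ob E" "src E p = I" using assms(1) by auto
  then show ?thesis unfolding leq_def using rel_truth_props assms by blast
qed

lemma leq_truthI:
  assumes "p \<in> hom E I (Om E)" "q \<in> hom E I (Om E)"
    "\<And>g. g \<in> Arr E \<Longrightarrow> tgt E g = I \<Longrightarrow> holds E (p \<cdot> g) \<Longrightarrow> holds E (q \<cdot> g)"
  shows "leq E (truth_frame E) p q"
  using assms(3) unfolding leq_truth_iff[OF assms(1,2)] by simp

lemma leq_truthD:
  assumes "leq E (truth_frame E) p q" "holds E p" "p \<in> hom E I (Om E)" "q \<in> hom E I (Om E)"
  shows "holds E q"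
proof -
  have "I \<in> Ob E" using assms(3) by auto
  then have "holds E (p \<cdot> ident E I) \<longrightarrow> holds E (q \<cdot> ident E I)"
    using assms(1) unfolding leq_truth_iff[OF assms(3,4)] by simp
  then show ?thesis using assms by simp
qed

lemma truth_poset: "is_poset E (truth_frame E)"
  unfolding is_poset_def opens_truth
proof (intro conjI ballI)
  show "le (truth_frame E) \<in> hom E (Prod E (Om E) (Om E)) (Om E)" using rel_truth_props by blast
  fix I u v w assume u: "u \<in> hom E I (Om E)" and v: "v \<in> hom E I (Om E)" and w: "w \<in> hom E I (Om E)"
  show "leq E (truth_frame E) u u" unfolding leq_truth_iff[OF u u] by simp
  show "leq E (truth_frame E) u v \<longrightarrow> leq E (truth_frame E) v w \<longrightarrow> leq E (truth_frame E) u w"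
    unfolding leq_truth_iff[OF u v] leq_truth_iff[OF v w] leq_truth_iff[OF u w] by blast
  show "leq E (truth_frame E) u v \<longrightarrow> leq E (truth_frame E) v u \<longrightarrow> u = v"
  proof (intro impI)
    assume "leq E (truth_frame E) u v" "leq E (truth_frame E) v u"
    then have "holds E (u \<cdot> x) \<longleftrightarrow> holds E (v \<cdot> x)" if "x \<in> Arr E" "tgt E x = I" for x
      using that unfolding leq_truth_iff[OF u v] leq_truth_iff[OF v u] by (metis in_into)
    then show "u = v" by (intro Om_ext) (use u v in simp_all)
  qed
qed simp

lemma leq_truth_cmp:
  assumes "leq E (truth_frame E) p q" "holds E (p \<cdot> g)" "p \<in> hom E I (Om E)" "q \<in> hom E I (Om E)" "g \<in> Arr E" "tgt E g = I"
  shows "holds E (q \<cdot> g)"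
  using assms unfolding leq_truth_iff[OF assms(3,4)] by simp

text \<open>
  Suprema of truth values are existential quantifiers, and distributivity holds because truth values have
  implications.
\<close>

lemma truth_is_frame: "is_frame E (truth_frame E)"
proof -
  let ?T = "truth_frame E"
  interpret T: internal_poset E ?T
    by (intro internal_poset.intro internal_poset_axioms.intro truth_poset elementary_topos_axioms)
  show ?thesis
  proof (rule T.is_frameI, unfold opens_truth)
    fix I assume I: "I \<in> Ob E"
    have "is_top E ?T (tt E \<cdot> bang E I)" unfolding is_top_def
      by (intro ballI leq_truthI) (use I in auto)
    then show "\<exists>s\<in>hom E I (Om E). is_top E ?T s" by (rule bexI) (use I in simp)
  next
    fix I u v assume u: "u \<in> hom E I (Om E)" and v: "v \<in> hom E I (Om E)"
    have I: "I \<in> Ob E" using u by auto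
    have "representable I (\<lambda>x. holds E (u \<cdot> x) \<and> holds E (v \<cdot> x))"
      by (rule representable_conj representable_holds natural_comp natural_id | use u v I in simp)+
    then obtain r where r: "r \<in> Arr E" "src E r = I" "tgt E r = Om E" "I \<in> Ob E"
      "\<And>x. x \<in> Arr E \<Longrightarrow> tgt E x = I \<Longrightarrow> holds E (r \<cdot> x) \<longleftrightarrow> holds E (u \<cdot> x) \<and> holds E (v \<cdot> x)"
      by (rule representableE) (rule that)
    have "is_meet E ?T u v r" unfolding is_meet_def
    proof (intro ballI)
      fix g t assume g: "g \<in> into E (src E r)" and t: "t \<in> hom E (src E g) (opens ?T)"
      have ty: "t \<in> hom E (src E g) (Om E)" "r \<cdot> g \<in> hom E (src E g) (Om E)" "u \<cdot> g \<in> hom E (src E g) (Om E)"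
        "v \<cdot> g \<in> hom E (src E g) (Om E)" using t g r(1-3) u v by simp_all
      show "leq E ?T t (r \<cdot> g) \<longleftrightarrow> leq E ?T t (u \<cdot> g) \<and> leq E ?T t (v \<cdot> g)"
        unfolding leq_truth_iff[OF ty(1,2)] leq_truth_iff[OF ty(1,3)] leq_truth_iff[OF ty(1,4)]
        using g r u v by auto
    qed
    then show "\<exists>s\<in>hom E I (Om E). is_meet E ?T u v s" by (rule bexI) (use r(1-3) in simp)
  next
    fix I S assume S: "S \<in> hom E I (Pow E (Om E))"
    have I: "I \<in> Ob E" using S by auto
    let ?C = "Prod E I (Om E)"
    have n: "natural ?C I (\<lambda>z. pr1 E I (Om E) \<cdot> z)" "natural ?C (Om E) (\<lambda>z. pr2 E I (Om E) \<cdot> z)"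
      by (rule natural_pr1 natural_pr2 natural_id | use I in simp)+
    have nS: "natural ?C (Pow E (Om E)) (\<lambda>z. S \<cdot> (pr1 E I (Om E) \<cdot> z))"
      by (rule natural_comp[OF n(1)]) (use S in simp_all)
    have "representable I (\<lambda>x. exists_loc E (src E x) (Om E) (\<lambda>e q. mem E q (S \<cdot> (x \<cdot> e)) \<and> holds E q))"
      by (rule representable_ex[where Q="\<lambda>x q. mem E q (S \<cdot> x) \<and> holds E q",
        OF representable_conj[OF representable_mem[OF n(2) nS] representable_holds[OF n(2)]]]) (use I in simp_all)
    then obtain r where r: "r \<in> Arr E" "src E r = I" "tgt E r = Om E" "I \<in> Ob E"
      "\<And>x. x \<in> Arr E \<Longrightarrow> tgt E x = I \<Longrightarrow> holds E (r \<cdot> x) \<longleftrightarrow> exists_loc E (src E x) (Om E) (\<lambda>e q. mem E q (S \<cdot> (x \<cdot> e)) \<and> holds E q)"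
      by (rule representableE) (rule that)
    have "is_sup E ?T (\<lambda>g a. mem E a (S \<cdot> g)) r"
    proof (rule T.is_supI[of _ I], unfold opens_truth)
      show "r \<in> hom E I (Om E)" using r(1-3) by simp
    next
      fix h a assume h: "h \<in> Arr E" "tgt E h = I" and a: "a \<in> hom E (src E h) (Om E)" and m: "mem E a (S \<cdot> h)"
      show "leq E ?T a (r \<cdot> h)"
      proof (rule leq_truthI[OF a])
        fix g assume g: "g \<in> Arr E" "tgt E g = src E h" and ag: "holds E (a \<cdot> g)"
        have "mem E (a \<cdot> g) ((S \<cdot> h) \<cdot> g)" by (rule mem_cmp[OF m]) (use a S h g in simp_all)
        then have "exists_loc E (src E (h \<cdot> g)) (Om E) (\<lambda>e q. mem E q (S \<cdot> ((h \<cdot> g) \<cdot> e)) \<and> holds E q)"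
          by - (rule exists_loc_here[of _ "a \<cdot> g"], use ag a S h g in simp_all)
        then have "holds E (r \<cdot> (h \<cdot> g))" using r(5)[of "h \<cdot> g"] h g by simp
        then show "holds E ((r \<cdot> h) \<cdot> g)" using r(1-3) h g by simp
      qed (use r(1-3) h in simp)
    next
      fix g t assume g: "g \<in> Arr E" "tgt E g = I" and t: "t \<in> hom E (src E g) (Om E)"
        and all: "\<And>h a. h \<in> Arr E \<Longrightarrow> tgt E h = src E g \<Longrightarrow> a \<in> hom E (src E h) (Om E) \<Longrightarrow>
           mem E a (S \<cdot> (g \<cdot> h)) \<Longrightarrow> leq E ?T a (t \<cdot> h)"
      show "leq E ?T (r \<cdot> g) t"
      proof (rule leq_truthI[OF _ t])
        fix k assume k: "k \<in> Arr E" "tgt E k = src E g" and rk: "holds E ((r \<cdot> g) \<cdot> k)"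
        have "holds E (r \<cdot> (g \<cdot> k))" using rk r(1-3) g k by simp
        then have "exists_loc E (src E (g \<cdot> k)) (Om E) (\<lambda>e q. mem E q (S \<cdot> ((g \<cdot> k) \<cdot> e)) \<and> holds E q)"
          using r(5)[of "g \<cdot> k"] g k by simp
        then obtain e q where e: "epi E e" "e \<in> Arr E" "tgt E e = src E (g \<cdot> k)" "q \<in> Arr E" "src E q = src E e" "tgt E q = Om E"
          "mem E q (S \<cdot> ((g \<cdot> k) \<cdot> e)) \<and> holds E q"
          by (rule exists_locE) (rule that)
        have te: "tgt E e = src E k" using e(3) g k by simp
        have "leq E ?T q (t \<cdot> (k \<cdot> e))"
          by (rule all) (use e(2,4-7) te g k S in simp_all)
        then have "holds E (t \<cdot> (k \<cdot> e))"
          by (rule leq_truthD[of _ _ "src E e"]) (use e(2,4-7) te g k t in simp_all)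
        then have "holds E ((t \<cdot> k) \<cdot> e)" using t k e(2) te by simp
        then show "holds E (t \<cdot> k)" by (rule holds_local[OF _ e(1)]) (use t k te in simp_all)
      qed (use r(1-3) g in simp)
    qed
    then show "\<exists>s\<in>hom E I (Om E). is_sup E ?T (\<lambda>g a. mem E a (S \<cdot> g)) s" by (rule bexI) (use r(1-3) in simp)
  next
    fix I u S s m t
    assume u: "u \<in> hom E I (Om E)" and S: "S \<in> hom E I (Pow E (Om E))" and s: "s \<in> hom E I (Om E)"
      and m: "m \<in> hom E I (Om E)" and t: "t \<in> hom E I (Om E)"
      and sup: "is_sup E ?T (\<lambda>g a. mem E a (S \<cdot> g)) s" and ism: "is_meet E ?T u s m"
      and all: "\<And>h a b. h \<in> Arr E \<Longrightarrow> tgt E h = I \<Longrightarrow> a \<in> hom E (src E h) (Om E) \<Longrightarrow> b \<in> hom E (src E h) (Om E) \<Longrightarrow>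
        mem E a (S \<cdot> h) \<Longrightarrow> is_meet E ?T (u \<cdot> h) a b \<Longrightarrow> leq E ?T b (t \<cdot> h)"
    have I: "I \<in> Ob E" using u by auto
    have "representable I (\<lambda>x. \<forall>g\<in>into E (src E x). holds E (u \<cdot> (x \<cdot> g)) \<longrightarrow> holds E (t \<cdot> (x \<cdot> g)))"
      by (rule representable_imp[where P="\<lambda>x. holds E (u \<cdot> x)" and Q="\<lambda>x. holds E (t \<cdot> x)"])
        (rule representable_holds natural_comp natural_id | use u t I in simp)+
    then obtain w where w: "w \<in> Arr E" "src E w = I" "tgt E w = Om E" "I \<in> Ob E"
      "\<And>x. x \<in> Arr E \<Longrightarrow> tgt E x = I \<Longrightarrow> holds E (w \<cdot> x) \<longleftrightarrow> (\<forall>g\<in>into E (src E x). holds E (u \<cdot> (x \<cdot> g)) \<longrightarrow> holds E (t \<cdot> (x \<cdot> g)))"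
      by (rule representableE) (rule that)
    have sw: "leq E ?T s w"
    proof (rule T.is_sup_here[OF sup], unfold opens_truth, rule s)
      show "w \<in> hom E I (Om E)" using w(1-3) by simp
      fix h a assume h: "h \<in> Arr E" "tgt E h = I" and a: "a \<in> hom E (src E h) (Om E)" and m: "mem E a (S \<cdot> h)"
      show "leq E ?T a (w \<cdot> h)"
      proof (rule leq_truthI[OF a])
        fix k assume k: "k \<in> Arr E" "tgt E k = src E h" and ak: "holds E (a \<cdot> k)"
        have "holds E (w \<cdot> (h \<cdot> k))" unfolding w(5)[OF cmp_arr(1)[OF k(1) h(1) k(2)] trans[OF cmp_arr(3)[OF k(1) h(1) k(2)] h(2)]]
        proof (intro ballI impI)
          fix g assume g0: "g \<in> into E (src E (h \<cdot> k))" and ug: "holds E (u \<cdot> (h \<cdot> k \<cdot> g))"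
          have g: "g \<in> Arr E" "tgt E g = src E k" using g0 h k by simp_all
          let ?x = "h \<cdot> (k \<cdot> g)" and ?tt = "tt E \<cdot> bang E (src E g)"
          have "mem E (a \<cdot> (k \<cdot> g)) ((S \<cdot> h) \<cdot> (k \<cdot> g))" by (rule mem_cmp[OF m]) (use a S h k g in simp_all)
          then have mem: "mem E (a \<cdot> (k \<cdot> g)) (S \<cdot> ?x)" using S h k g by simp
          have "holds E ((a \<cdot> k) \<cdot> g)" by (rule holds_cmp[OF ak]) (use a k g in simp_all)
          then have a1: "a \<cdot> (k \<cdot> g) = ?tt" using holds_iff[of "a \<cdot> (k \<cdot> g)" "src E g"] a k g by simp
          have u1: "u \<cdot> ?x = ?tt" using ug holds_iff[of "u \<cdot> ?x" "src E g"] u h k g by simp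
          have "is_meet E ?T (u \<cdot> ?x) (a \<cdot> (k \<cdot> g)) ?tt" unfolding a1 u1 is_meet_def by simp
          then have "leq E ?T ?tt (t \<cdot> ?x)"
            by - (rule all[OF _ _ _ _ mem], use h k g a in simp_all)
          then have "holds E (t \<cdot> ?x)" by (rule leq_truthD[of _ _ "src E g"]) (use h k g t in simp_all)
          then show "holds E (t \<cdot> (h \<cdot> k \<cdot> g))" using h k g by simp
        qed
        then show "holds E ((w \<cdot> h) \<cdot> k)" using w(1-3) h k by simp
      qed (use w(1-3) h in simp)
    qed
    have mm: "leq E ?T m u" "leq E ?T m s" using T.is_meet_here[OF ism, of I m] u s m by simp_all
    show "leq E ?T m t"
    proof (rule leq_truthI[OF m t])
      fix g assume g: "g \<in> Arr E" "tgt E g = I" and mg: "holds E (m \<cdot> g)"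
      have ug: "holds E (u \<cdot> g)" by (rule leq_truth_cmp[OF mm(1) mg m u g])
      have "holds E (s \<cdot> g)" by (rule leq_truth_cmp[OF mm(2) mg m s g])
      then have "holds E (w \<cdot> g)" by (rule leq_truth_cmp[OF sw _ s _ g]) (use w(1-3) in simp)
      then have "\<forall>h\<in>into E (src E g). holds E (u \<cdot> (g \<cdot> h)) \<longrightarrow> holds E (t \<cdot> (g \<cdot> h))" using w(5)[OF g] by blast
      then have "holds E (u \<cdot> (g \<cdot> ident E (src E g))) \<longrightarrow> holds E (t \<cdot> (g \<cdot> ident E (src E g)))"
        using g by (metis ident_arr(1,3) in_into src_ob)
      then show "holds E (t \<cdot> g)" using ug g by simp
    qed
  qed
qed

lemma truth_internal_frame: "internal_frame E (truth_frame E)"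
  by (rule internal_frameI[OF elementary_topos_axioms truth_is_frame])

lemma whole_truth:
  assumes "I \<in> Ob E"
  shows "whole E (truth_frame E) I = tt E \<cdot> bang E I"
proof -
  interpret T: internal_frame E "truth_frame E" by (rule truth_internal_frame)
  have "leq E (truth_frame E) (tt E \<cdot> bang E I) (whole E (truth_frame E) I)" using assms by simp
  then have "holds E (whole E (truth_frame E) I)"
    by (rule leq_truthD[of _ _ I]) (use assms T.whole_arr[of I] in simp_all)
  then show ?thesis using holds_iff[of "whole E (truth_frame E) I" I] assms by simp
qed

lemma holds_meet_truth:
  assumes "p \<in> hom E I (Om E)" "q \<in> hom E I (Om E)"
  shows "holds E (meet E (truth_frame E) p q) \<longleftrightarrow> holds E p \<and> holds E q"
proof -
  interpret T: internal_frame E "truth_frame E" by (rule truth_internal_frame)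
  have I: "I \<in> Ob E" using assms(1) by auto
  let ?t = "tt E \<cdot> bang E I"
  have 1: "leq E (truth_frame E) ?t r \<longleftrightarrow> holds E r" if "r \<in> hom E I (Om E)" for r
  proof
    assume "leq E (truth_frame E) ?t r"
    then show "holds E r" by (rule leq_truthD[of _ _ I]) (use that I in simp_all)
  next
    assume "holds E r"
    then have "r = ?t" using holds_iff[of r I] that by simp
    then show "leq E (truth_frame E) ?t r" using I by simp
  qed
  show ?thesis using T.leq_meet_iff[of p I q ?t] 1[of p] 1[of q] 1[of "meet E (truth_frame E) p q"]
      T.meet_hom[of p I q] assms I by simp
qed

end

section \<open>Frame homomorphisms\<close>

text \<open>
  A map of frames that preserves finite meets is a frame homomorphism exactly if it has a right
  adjoint.
\<close>

locale two_frames = elementary_topos E + Y: internal_frame E Y + X: internal_frame E X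
  for E :: "('o, 'm) topos" (structure) and Y X :: "('o, 'm) frm"
begin

lemma frame_homI:
  assumes f: "f \<in> hom E (opens Y) (opens X)" and r: "r \<in> hom E (opens X) (opens Y)"
    and adj: "\<And>I u v. u \<in> hom E I (opens Y) \<Longrightarrow> v \<in> hom E I (opens X) \<Longrightarrow> leq E X (f \<cdot> u) v \<longleftrightarrow> leq E Y u (r \<cdot> v)"
    and whole: "\<And>I. I \<in> Ob E \<Longrightarrow> f \<cdot> whole E Y I = whole E X I"
    and meet: "\<And>I u v. u \<in> hom E I (opens Y) \<Longrightarrow> v \<in> hom E I (opens Y) \<Longrightarrow> f \<cdot> meet E Y u v = meet E X (f \<cdot> u) (f \<cdot> v)"
  shows "frame_hom E Y X f"
  unfolding frame_hom_def
proof (intro conjI ballI)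
  fix I S assume S: "S \<in> hom E I (Pow E (opens Y))"
  have mono: "leq E X (f \<cdot> u) (f \<cdot> v)" if "leq E Y u v" "u \<in> hom E J (opens Y)" "v \<in> hom E J (opens Y)" for u v J
  proof -
    have fv: "f \<cdot> v \<in> hom E J (opens X)" using f that by simp
    have "leq E Y v (r \<cdot> (f \<cdot> v))" using adj[OF that(3) fv] fv by simp
    then have "leq E Y u (r \<cdot> (f \<cdot> v))" by (rule Y.leq_trans[OF that(1)]) (use that f r in simp_all)
    then show ?thesis using adj[OF that(2) fv] by simp
  qed
  show "is_sup E X (\<lambda>g b. exists_loc E (src E g) (opens Y) (\<lambda>e a. mem E a (S \<cdot> g \<cdot> e) \<and> b \<cdot> e = f \<cdot> a)) (f \<cdot> Join E Y S)"
  proof (rule X.is_supI[of _ I])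
    fix h b assume h: "h \<in> Arr E" "tgt E h = I" and b: "b \<in> hom E (src E h) (opens X)"
      and ex: "exists_loc E (src E h) (opens Y) (\<lambda>e a. mem E a (S \<cdot> h \<cdot> e) \<and> b \<cdot> e = f \<cdot> a)"
    obtain e a where e: "epi E e" "e \<in> Arr E" "tgt E e = src E h" "a \<in> Arr E" "src E a = src E e" "tgt E a = opens Y"
      "mem E a (S \<cdot> h \<cdot> e) \<and> b \<cdot> e = f \<cdot> a"
      by (rule exists_locE[OF ex]) (rule that)
    have "leq E Y a (Join E Y (S \<cdot> h \<cdot> e))" by (rule Y.Join_upper[of _ _ "src E e"]) (use e S h in simp_all)
    then have "leq E X (f \<cdot> a) (f \<cdot> Join E Y (S \<cdot> h \<cdot> e))" by (rule mono[of _ _ "src E e"]) (use e(1-6) S h in simp_all)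
    then have "leq E X (b \<cdot> e) (f \<cdot> Join E Y (S \<cdot> h \<cdot> e))" unfolding e(7)[THEN conjunct2] .
    then have "leq E X (b \<cdot> e) ((f \<cdot> Join E Y S \<cdot> h) \<cdot> e)" using f S h e(1-6) by simp
    then show "leq E X b (f \<cdot> Join E Y S \<cdot> h)" by (rule X.leq_local[OF _ e(1)]) (use b f S h e(1-6) in simp_all)
  next
    fix g t assume g: "g \<in> Arr E" "tgt E g = I" and t: "t \<in> hom E (src E g) (opens X)"
      and all: "\<And>h a. h \<in> Arr E \<Longrightarrow> tgt E h = src E g \<Longrightarrow> a \<in> hom E (src E h) (opens X) \<Longrightarrow>
        exists_loc E (src E (g \<cdot> h)) (opens Y) (\<lambda>e aa. mem E aa (S \<cdot> (g \<cdot> h) \<cdot> e) \<and> a \<cdot> e = f \<cdot> aa) \<Longrightarrow> leq E X a (t \<cdot> h)"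
    have "leq E Y (Join E Y (S \<cdot> g)) (r \<cdot> t)"
    proof (rule Y.Join_least[of _ "src E g"])
      fix h a assume h: "h \<in> Arr E" "tgt E h = src E g" and a: "a \<in> hom E (src E h) (opens Y)" and m: "mem E a ((S \<cdot> g) \<cdot> h)"
      have "leq E X (f \<cdot> a) (t \<cdot> h)"
      proof (rule all)
        show "exists_loc E (src E (g \<cdot> h)) (opens Y) (\<lambda>e aa. mem E aa (S \<cdot> (g \<cdot> h) \<cdot> e) \<and> (f \<cdot> a) \<cdot> e = f \<cdot> aa)"
          by (rule exists_loc_here[of _ a]) (use h a m g S f in simp_all)
      qed (use h a f in simp_all)
      then have "leq E Y a (r \<cdot> (t \<cdot> h))" using adj[of a "src E h" "t \<cdot> h"] a t h by simp
      then show "leq E Y a ((r \<cdot> t) \<cdot> h)" using r t h by simp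
    qed (use S g r t in simp_all)
    then have "leq E X (f \<cdot> Join E Y (S \<cdot> g)) t" using adj[of "Join E Y (S \<cdot> g)" "src E g" t] S g t by simp
    then show "leq E X ((f \<cdot> Join E Y S) \<cdot> g) t" using f S g by simp
  qed (use f S in simp)
qed (use f whole meet Y.frame X.frame in simp_all)

end

locale frame_morphism = two_frames +
  fixes f
  assumes morphism: "frame_hom E Y X f"
begin

lemma f_arr [simp]: "f \<in> Arr E" "src E f = opens Y" "tgt E f = opens X"
  using morphism unfolding frame_hom_def by simp_all

lemma f_whole [simp]: "I \<in> Ob E \<Longrightarrow> f \<cdot> whole E Y I = whole E X I"
  using morphism unfolding frame_hom_def by blast

lemma f_meet:
  assumes "u \<in> hom E I (opens Y)" "v \<in> hom E I (opens Y)"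
  shows "f \<cdot> meet E Y u v = meet E X (f \<cdot> u) (f \<cdot> v)"
proof -
  have "I \<in> Ob E" using assms by auto
  then show ?thesis using morphism assms unfolding frame_hom_def by blast
qed

lemma f_mono:
  assumes "leq E Y u v" "u \<in> hom E I (opens Y)" "v \<in> hom E I (opens Y)"
  shows "leq E X (f \<cdot> u) (f \<cdot> v)"
proof -
  have "meet E Y u v = u"
  proof (rule Y.leq_antisym[of _ _ I])
    show "leq E Y u (meet E Y u v)" by (rule Y.meet_greatest) (use assms in simp_all)
  qed (use assms in simp_all)
  then have "f \<cdot> u = meet E X (f \<cdot> u) (f \<cdot> v)" using f_meet[OF assms(2,3)] by simp
  moreover have "leq E X (meet E X (f \<cdot> u) (f \<cdot> v)) (f \<cdot> v)" using assms by simp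
  ultimately show ?thesis by simp
qed

lemma f_Join_leq:
  assumes S: "S \<in> hom E I (Pow E (opens Y))" and t: "t \<in> hom E I (opens X)"
    and all: "\<And>h a. h \<in> Arr E \<Longrightarrow> tgt E h = I \<Longrightarrow> a \<in> hom E (src E h) (opens Y) \<Longrightarrow> mem E a (S \<cdot> h) \<Longrightarrow> leq E X (f \<cdot> a) (t \<cdot> h)"
  shows "leq E X (f \<cdot> Join E Y S) t"
proof -
  have I: "I \<in> Ob E" using S by auto
  have sup: "is_sup E X (\<lambda>g b. exists_loc E (src E g) (opens Y) (\<lambda>e a. mem E a (S \<cdot> g \<cdot> e) \<and> b \<cdot> e = f \<cdot> a)) (f \<cdot> Join E Y S)"
    using morphism S I unfolding frame_hom_def by blast
  show ?thesis
  proof (rule X.is_sup_here[OF sup _ t])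
    fix h b assume h: "h \<in> Arr E" "tgt E h = I" and b: "b \<in> hom E (src E h) (opens X)"
      and ex: "exists_loc E (src E h) (opens Y) (\<lambda>e a. mem E a (S \<cdot> h \<cdot> e) \<and> b \<cdot> e = f \<cdot> a)"
    obtain e a where e: "epi E e" "e \<in> Arr E" "tgt E e = src E h" "a \<in> Arr E" "src E a = src E e" "tgt E a = opens Y"
      "mem E a (S \<cdot> h \<cdot> e) \<and> b \<cdot> e = f \<cdot> a"
      by (rule exists_locE[OF ex]) (rule that)
    have "leq E X (f \<cdot> a) (t \<cdot> (h \<cdot> e))" by (rule all) (use e h S in simp_all)
    then have "leq E X (b \<cdot> e) (t \<cdot> (h \<cdot> e))" unfolding e(7)[THEN conjunct2] .
    then have "leq E X (b \<cdot> e) ((t \<cdot> h) \<cdot> e)" using t h e(1-6) by simp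
    then show "leq E X b (t \<cdot> h)" by (rule X.leq_local[OF _ e(1)]) (use b t h e(1-6) in simp_all)
  qed (use S in simp)
qed

text \<open>
  The value of the right adjoint at \<open>v\<close> is the supremum of the opens \<open>u\<close> with \<open>f u \<le> v\<close>. With it, preservation
  of any supremum is formal.
\<close>

lemma right_adjoint:
  obtains r where "r \<in> hom E (opens X) (opens Y)"
    "\<And>I u v. u \<in> hom E I (opens Y) \<Longrightarrow> v \<in> hom E I (opens X) \<Longrightarrow> leq E X (f \<cdot> u) v \<longleftrightarrow> leq E Y u (r \<cdot> v)"
proof -
  let ?A = "opens X" and ?B = "opens Y"
  have rep: "representable (Prod E ?A ?B) (\<lambda>z. leq E X (f \<cdot> (pr2 E ?A ?B \<cdot> z)) (pr1 E ?A ?B \<cdot> z))"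
    by (rule X.representable_leq natural_comp natural_pr1 natural_pr2 natural_id | simp)+
  obtain S where S: "S \<in> hom E ?A (Pow E ?B)" "is_sup E Y (\<lambda>x a. leq E X (f \<cdot> a) x) (Join E Y S)"
    "\<And>x b. x \<in> Arr E \<Longrightarrow> b \<in> Arr E \<Longrightarrow> tgt E x = ?A \<Longrightarrow> tgt E b = ?B \<Longrightarrow> src E b = src E x \<Longrightarrow>
      mem E b (S \<cdot> x) \<longleftrightarrow> leq E X (f \<cdot> b) x"
    by (rule Y.sup_exists[where Q="\<lambda>x a. leq E X (f \<cdot> a) x", OF rep X.opens_ob]) (rule that)
  show ?thesis
  proof (rule that[of "Join E Y S"])
    show "Join E Y S \<in> hom E ?A ?B" using S(1) by simp
    fix I u v assume u: "u \<in> hom E I ?B" and v: "v \<in> hom E I ?A"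
    show "leq E X (f \<cdot> u) v \<longleftrightarrow> leq E Y u (Join E Y S \<cdot> v)"
    proof
      assume "leq E X (f \<cdot> u) v"
      then have "mem E u (S \<cdot> v)" using S(3)[of v u] u v by simp
      then have "leq E Y u (Join E Y (S \<cdot> v))" by (rule Y.Join_upper[of _ _ I]) (use u v S(1) in simp_all)
      then show "leq E Y u (Join E Y S \<cdot> v)" using S(1) v by simp
    next
      assume "leq E Y u (Join E Y S \<cdot> v)"
      then have "leq E Y u (Join E Y (S \<cdot> v))" using S(1) v by simp
      then have 1: "leq E X (f \<cdot> u) (f \<cdot> Join E Y (S \<cdot> v))" by (rule f_mono[of _ _ I]) (use u v S(1) in simp_all)
      have "leq E X (f \<cdot> Join E Y (S \<cdot> v)) v"
      proof (rule f_Join_leq[OF _ v])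
        fix h a assume h: "h \<in> Arr E" "tgt E h = I" "a \<in> hom E (src E h) ?B" and m: "mem E a ((S \<cdot> v) \<cdot> h)"
        show "leq E X (f \<cdot> a) (v \<cdot> h)" using S(3)[of "v \<cdot> h" a] m S(1) v h by simp
      qed (use S(1) v in simp)
      then show "leq E X (f \<cdot> u) v" by (rule X.leq_trans[OF 1]) (use u v S(1) in simp_all)
    qed
  qed
qed

lemma f_sup_leq:
  assumes sup: "is_sup E Y P s" and s: "s \<in> hom E I (opens Y)" and t: "t \<in> hom E I (opens X)"
    and all: "\<And>h a. h \<in> Arr E \<Longrightarrow> tgt E h = I \<Longrightarrow> a \<in> hom E (src E h) (opens Y) \<Longrightarrow> P h a \<Longrightarrow> leq E X (f \<cdot> a) (t \<cdot> h)"
  shows "leq E X (f \<cdot> s) t"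
proof (rule right_adjoint)
  fix r assume r: "r \<in> hom E (opens X) (opens Y)"
    and adj: "\<And>I u v. u \<in> hom E I (opens Y) \<Longrightarrow> v \<in> hom E I (opens X) \<Longrightarrow> leq E X (f \<cdot> u) v \<longleftrightarrow> leq E Y u (r \<cdot> v)"
  have "leq E Y s (r \<cdot> t)"
  proof (rule Y.is_sup_here[OF sup s])
    fix h a assume h: "h \<in> Arr E" "tgt E h = I" "a \<in> hom E (src E h) (opens Y)" "P h a"
    have "leq E Y a (r \<cdot> (t \<cdot> h))" using adj[of a "src E h" "t \<cdot> h"] all[OF h] h t by simp
    then show "leq E Y a ((r \<cdot> t) \<cdot> h)" using r t h by simp
  qed (use r t in simp)
  then show ?thesis using adj[OF s t] by simp
qed

lemma f_join_leq:
  assumes "leq E X (f \<cdot> u) t" "leq E X (f \<cdot> v) t" "u \<in> hom E I (opens Y)" "v \<in> hom E I (opens Y)" "t \<in> hom E I (opens X)"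
  shows "leq E X (f \<cdot> join E Y u v) t"
proof (rule right_adjoint)
  fix r assume r: "r \<in> hom E (opens X) (opens Y)"
    and adj: "\<And>I u v. u \<in> hom E I (opens Y) \<Longrightarrow> v \<in> hom E I (opens X) \<Longrightarrow> leq E X (f \<cdot> u) v \<longleftrightarrow> leq E Y u (r \<cdot> v)"
  have "leq E Y (join E Y u v) (r \<cdot> t)"
    by (rule Y.join_least[of _ _ _ I]) (use adj[of u I t] adj[of v I t] assms r in simp_all)
  then show ?thesis using adj[of "join E Y u v" I t] assms by simp
qed

end

text \<open>
  Finite meets and suprema are transported along the order isomorphism. Since it has its inverse as
  adjoint on both sides, it preserves them.
\<close>

lemma frame_iso_if_order_iso:
  fixes E (structure)
  assumes "internal_poset E Z" "internal_frame E X"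
    and f: "f \<in> hom E (opens Z) (opens X)" and g: "g \<in> hom E (opens X) (opens Z)"
    and fg: "f \<cdot> g = ident E (opens X)"
    and ord: "\<And>I u v. u \<in> hom E I (opens Z) \<Longrightarrow> v \<in> hom E I (opens Z) \<Longrightarrow> leq E Z u v \<longleftrightarrow> leq E X (f \<cdot> u) (f \<cdot> v)"
  shows "frame_iso E Z X f"
proof -
  interpret elementary_topos E by (rule internal_poset.axioms(1)[OF assms(1)])
  interpret Z: internal_poset E Z by fact
  interpret X: internal_frame E X by fact
  have fgx [simp]: "f \<cdot> (g \<cdot> x) = x" if "x \<in> Arr E" "tgt E x = opens X" for x
    using cmp_reassoc[OF fg, of x] f g that by simp
  have gf: "g \<cdot> f = ident E (opens Z)"
  proof (rule Z.leq_antisym[where I="opens Z"])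
    have "f \<cdot> (g \<cdot> f) = f \<cdot> ident E (opens Z)" using fgx[of f] f by simp
    then have "leq E X (f \<cdot> (g \<cdot> f)) (f \<cdot> ident E (opens Z))" "leq E X (f \<cdot> ident E (opens Z)) (f \<cdot> (g \<cdot> f))"
      using f by simp_all
    then show "leq E Z (g \<cdot> f) (ident E (opens Z))" "leq E Z (ident E (opens Z)) (g \<cdot> f)"
      using ord[of "g \<cdot> f" "opens Z" "ident E (opens Z)"] ord[of "ident E (opens Z)" "opens Z" "g \<cdot> f"] f g by simp_all
  qed (use f g in simp_all)
  have gfx [simp]: "g \<cdot> (f \<cdot> x) = x" if "x \<in> Arr E" "tgt E x = opens Z" for x
    using cmp_reassoc[OF gf, of x] f g that by simp
  have adj: "leq E Z (g \<cdot> t) u \<longleftrightarrow> leq E X t (f \<cdot> u)" "leq E Z u (g \<cdot> t) \<longleftrightarrow> leq E X (f \<cdot> u) t"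
    if "u \<in> hom E I (opens Z)" "t \<in> hom E I (opens X)" for u t I
    using ord[of "g \<cdot> t" I u] ord[of u I "g \<cdot> t"] that f g by simp_all
  have meetI: "is_meet E Z u v (g \<cdot> meet E X (f \<cdot> u) (f \<cdot> v))"
    if u: "u \<in> hom E I (opens Z)" and v: "v \<in> hom E I (opens Z)" for I u v
    unfolding is_meet_def
  proof (intro ballI)
    fix h t assume h: "h \<in> into E (src E (g \<cdot> meet E X (f \<cdot> u) (f \<cdot> v)))" and t: "t \<in> hom E (src E h) (opens Z)"
    show "leq E Z t (g \<cdot> meet E X (f \<cdot> u) (f \<cdot> v) \<cdot> h) \<longleftrightarrow> leq E Z t (u \<cdot> h) \<and> leq E Z t (v \<cdot> h)"
      using ord[of t "src E h" "u \<cdot> h"] ord[of t "src E h" "v \<cdot> h"] adj(2)[of t "src E h" "meet E X (f \<cdot> u \<cdot> h) (f \<cdot> v \<cdot> h)"]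
        X.leq_meet_iff[of "f \<cdot> u \<cdot> h" "src E h" "f \<cdot> v \<cdot> h" "f \<cdot> t"] u v f g h t by simp
  qed
  have Zframe: "is_frame E Z"
  proof (rule Z.is_frameI)
    fix I assume I: "I \<in> Ob E"
    have "is_top E Z (g \<cdot> whole E X I)" unfolding is_top_def
    proof (intro ballI)
      fix h t assume h: "h \<in> into E (src E (g \<cdot> whole E X I))" and t: "t \<in> hom E (src E h) (opens Z)"
      show "leq E Z t (g \<cdot> whole E X I \<cdot> h)"
        using adj(2)[of t "src E h" "whole E X (src E h)"] f g h t I by simp
    qed
    then show "\<exists>s\<in>hom E I (opens Z). is_top E Z s" by (rule bexI) (use g I in simp)
  next
    fix I u v assume u: "u \<in> hom E I (opens Z)" and v: "v \<in> hom E I (opens Z)"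
    show "\<exists>s\<in>hom E I (opens Z). is_meet E Z u v s"
      using meetI[OF u v] by (rule bexI) (use u v f g in simp)
  next
    fix I S assume S: "S \<in> hom E I (Pow E (opens Z))"
    have I: "I \<in> Ob E" using S by auto
    let ?p = "pr1 E I (opens X)" and ?q = "pr2 E I (opens X)"
    have n: "natural (Prod E I (opens X)) I (\<lambda>z. ?p \<cdot> z)" "natural (Prod E I (opens X)) (opens X) (\<lambda>z. ?q \<cdot> z)"
      by (rule natural_pr1 natural_pr2 natural_id | use I in simp)+
    have rep: "representable (Prod E I (opens X)) (\<lambda>z. mem E (g \<cdot> (?q \<cdot> z)) (S \<cdot> (?p \<cdot> z)))"
      by (rule representable_mem[OF natural_comp[OF n(2)] natural_comp[OF n(1)]]) (use S g in simp_all)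
    obtain T where T: "T \<in> hom E I (Pow E (opens X))" "is_sup E X (\<lambda>x a. mem E (g \<cdot> a) (S \<cdot> x)) (Join E X T)"
      "\<And>x b. x \<in> Arr E \<Longrightarrow> b \<in> Arr E \<Longrightarrow> tgt E x = I \<Longrightarrow> tgt E b = opens X \<Longrightarrow> src E b = src E x \<Longrightarrow>
        mem E b (T \<cdot> x) \<longleftrightarrow> mem E (g \<cdot> b) (S \<cdot> x)"
      by (rule X.sup_exists[where Q="\<lambda>x a. mem E (g \<cdot> a) (S \<cdot> x)", OF rep I]) (rule that)
    have "is_sup E Z (\<lambda>h a. mem E a (S \<cdot> h)) (g \<cdot> Join E X T)"
    proof (rule Z.is_supI[of _ I])
      fix h a assume h: "h \<in> Arr E" "tgt E h = I" and a: "a \<in> hom E (src E h) (opens Z)" and m: "mem E a (S \<cdot> h)"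
      have "leq E X (f \<cdot> a) (Join E X T \<cdot> h)"
        by (rule X.is_sup_upper[OF T(2), of I]) (use T(1) m h a f in simp_all)
      then show "leq E Z a ((g \<cdot> Join E X T) \<cdot> h)" using adj(2)[of a "src E h" "Join E X T \<cdot> h"] a T(1) h g by simp
    next
      fix k t assume k: "k \<in> Arr E" "tgt E k = I" and t: "t \<in> hom E (src E k) (opens Z)"
        and all: "\<And>h a. h \<in> Arr E \<Longrightarrow> tgt E h = src E k \<Longrightarrow> a \<in> hom E (src E h) (opens Z) \<Longrightarrow> mem E a (S \<cdot> (k \<cdot> h)) \<Longrightarrow> leq E Z a (t \<cdot> h)"
      have "leq E X (Join E X (T \<cdot> k)) (f \<cdot> t)"
      proof (rule X.Join_least[of _ "src E k"])
        fix h a assume h: "h \<in> Arr E" "tgt E h = src E k" and a: "a \<in> hom E (src E h) (opens X)" and m: "mem E a ((T \<cdot> k) \<cdot> h)"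
        have "mem E (g \<cdot> a) (S \<cdot> (k \<cdot> h))" using T(3)[of "k \<cdot> h" a] m h a k T(1) by simp
        then have "leq E Z (g \<cdot> a) (t \<cdot> h)" by - (rule all, use h a g in simp_all)
        then show "leq E X a ((f \<cdot> t) \<cdot> h)" using adj(1)[of "t \<cdot> h" "src E h" a] h t a f by simp
      qed (use T(1) k f t in simp_all)
      then show "leq E Z ((g \<cdot> Join E X T) \<cdot> k) t" using adj(1)[OF t, of "Join E X (T \<cdot> k)"] T(1) k g by simp
    qed (use g T(1) in simp)
    then show "\<exists>s\<in>hom E I (opens Z). is_sup E Z (\<lambda>h a. mem E a (S \<cdot> h)) s" by (rule bexI) (use g T(1) in simp)
  next
    fix I u S s m t
    assume u: "u \<in> hom E I (opens Z)" and S: "S \<in> hom E I (Pow E (opens Z))" and s: "s \<in> hom E I (opens Z)"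
      and m: "m \<in> hom E I (opens Z)" and t: "t \<in> hom E I (opens Z)"
      and sup: "is_sup E Z (\<lambda>g a. mem E a (S \<cdot> g)) s" and ism: "is_meet E Z u s m"
      and all: "\<And>h a b. h \<in> Arr E \<Longrightarrow> tgt E h = I \<Longrightarrow> a \<in> hom E (src E h) (opens Z) \<Longrightarrow> b \<in> hom E (src E h) (opens Z) \<Longrightarrow>
        mem E a (S \<cdot> h) \<Longrightarrow> is_meet E Z (u \<cdot> h) a b \<Longrightarrow> leq E Z b (t \<cdot> h)"
    \<comment> \<open>Distributivity as an adjunction: it suffices to bound \<open>s\<close> by \<open>u \<Rightarrow> t\<close>, computed in \<open>X\<close>.\<close>
    have "leq E Z s (g \<cdot> impl E X (f \<cdot> u) (f \<cdot> t))"
    proof (rule Z.is_sup_here[OF sup s])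
      fix h a assume h: "h \<in> Arr E" "tgt E h = I" and a: "a \<in> hom E (src E h) (opens Z)" and mem: "mem E a (S \<cdot> h)"
      have uh: "u \<cdot> h \<in> hom E (src E h) (opens Z)" using u h by simp
      have "leq E Z (g \<cdot> meet E X (f \<cdot> u \<cdot> h) (f \<cdot> a)) (t \<cdot> h)"
        using all[OF h a _ mem, of "g \<cdot> meet E X (f \<cdot> (u \<cdot> h)) (f \<cdot> a)"] meetI[OF uh a] f g u h a by simp
      then have 1: "leq E X (meet E X (f \<cdot> u \<cdot> h) (f \<cdot> a)) (f \<cdot> (t \<cdot> h))"
        using adj(1)[of "t \<cdot> h" "src E h"] t h f u a by simp
      have "leq E X (meet E X (f \<cdot> a) (f \<cdot> u \<cdot> h)) (f \<cdot> (t \<cdot> h))"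
        by (rule X.leq_trans[OF X.meet_commute_leq 1, of "src E h"]) (use f u t h a in simp_all)
      then have "leq E X (f \<cdot> a) (impl E X (f \<cdot> u \<cdot> h) (f \<cdot> t \<cdot> h))"
        using X.leq_impl_iff[of "f \<cdot> u \<cdot> h" "src E h" "f \<cdot> t \<cdot> h" "f \<cdot> a"] f u t h a by simp
      then show "leq E Z a ((g \<cdot> impl E X (f \<cdot> u) (f \<cdot> t)) \<cdot> h)"
        using adj(2)[OF a, of "impl E X (f \<cdot> u \<cdot> h) (f \<cdot> t \<cdot> h)"] f g u t h by simp
    qed (use f g u t in simp)
    then have fs: "leq E X (f \<cdot> s) (impl E X (f \<cdot> u) (f \<cdot> t))" using adj(2)[OF s] f u t by simp
    have mm: "leq E Z m u" "leq E Z m s" using Z.is_meet_here[OF ism m u s m] m by simp_all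
    have "leq E X (f \<cdot> m) (impl E X (f \<cdot> u) (f \<cdot> t))"
      by (rule X.leq_trans[OF _ fs, of _ I]) (use ord[OF m s] mm f m s u t in simp_all)
    then have 1: "leq E X (meet E X (f \<cdot> m) (f \<cdot> u)) (f \<cdot> t)"
      using X.leq_impl_iff[of "f \<cdot> u" I "f \<cdot> t" "f \<cdot> m"] f u t m by simp
    have "leq E X (f \<cdot> m) (meet E X (f \<cdot> m) (f \<cdot> u))"
      by (rule X.meet_greatest[of _ _ _ I]) (use ord[OF m u] mm f m u in simp_all)
    then have "leq E X (f \<cdot> m) (f \<cdot> t)" by (rule X.leq_trans[OF _ 1, of _ I]) (use f u m t in simp_all)
    then show "leq E Z m t" using ord[OF m t] by simp
  qed
  interpret Z: internal_frame E Z by (rule internal_frameI[OF elementary_topos_axioms Zframe])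
  interpret ZX: two_frames E Z X by unfold_locales
  interpret XZ: two_frames E X Z by unfold_locales
  have fh: "frame_hom E Z X f"
  proof (rule ZX.frame_homI[OF f g])
    show "leq E X (f \<cdot> u) v \<longleftrightarrow> leq E Z u (g \<cdot> v)" if "u \<in> hom E I (opens Z)" "v \<in> hom E I (opens X)" for I u v
      using adj(2)[OF that] by simp
    show "f \<cdot> whole E Z I = whole E X I" if I: "I \<in> Ob E" for I
    proof (rule X.leq_antisym[of _ _ I])
      show "leq E X (whole E X I) (f \<cdot> whole E Z I)" using adj(1)[of "whole E Z I" I "whole E X I"] I g by simp
    qed (use f I in simp_all)
    show "f \<cdot> meet E Z u v = meet E X (f \<cdot> u) (f \<cdot> v)" if u: "u \<in> hom E I (opens Z)" and v: "v \<in> hom E I (opens Z)" for I u v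
    proof -
      have "meet E Z u v = g \<cdot> meet E X (f \<cdot> u) (f \<cdot> v)"
        by (rule Z.is_meet_unique[OF Z.meet_props[OF u v, THEN conjunct2] meetI[OF u v]]) (use u v f g in simp_all)
      then show ?thesis using u v f by simp
    qed
  qed
  have gh: "frame_hom E X Z g"
  proof (rule XZ.frame_homI[OF g f])
    show "leq E Z (g \<cdot> u) v \<longleftrightarrow> leq E X u (f \<cdot> v)" if "u \<in> hom E I (opens X)" "v \<in> hom E I (opens Z)" for I u v
      using adj(1)[OF that(2,1)] by simp
    show "g \<cdot> whole E X I = whole E Z I" if I: "I \<in> Ob E" for I
    proof (rule Z.leq_antisym[of _ _ I])
      show "leq E Z (whole E Z I) (g \<cdot> whole E X I)" using adj(2)[of "whole E Z I" I "whole E X I"] I f by simp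
    qed (use g I in simp_all)
    show "g \<cdot> meet E X u v = meet E Z (g \<cdot> u) (g \<cdot> v)" if u: "u \<in> hom E I (opens X)" and v: "v \<in> hom E I (opens X)" for I u v
    proof -
      have gu: "g \<cdot> u \<in> hom E I (opens Z)" and gv: "g \<cdot> v \<in> hom E I (opens Z)" using u v g by simp_all
      have "meet E Z (g \<cdot> u) (g \<cdot> v) = g \<cdot> meet E X (f \<cdot> (g \<cdot> u)) (f \<cdot> (g \<cdot> v))"
        by (rule Z.is_meet_unique[OF Z.meet_props[OF gu gv, THEN conjunct2] meetI[OF gu gv]]) (use u v f g in simp_all)
      then show ?thesis using u v by simp
    qed
  qed
  show ?thesis unfolding frame_iso_def using fh gh fg gf by blast
qed

section \<open>Posets and sublocales given by predicates\<close>

context elementary_topos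
begin

lemma rel_poset:
  assumes Z: "opens Z = A" "le Z = rel E A R"
    and rep: "representable (Prod E A A) (\<lambda>z. R (pr1 E A A \<cdot> z) (pr2 E A A \<cdot> z))" and A: "A \<in> Ob E"
    and refl: "\<And>I u. u \<in> hom E I A \<Longrightarrow> R u u"
    and trans: "\<And>I u v w. u \<in> hom E I A \<Longrightarrow> v \<in> hom E I A \<Longrightarrow> w \<in> hom E I A \<Longrightarrow> R u v \<Longrightarrow> R v w \<Longrightarrow> R u w"
    and antisym: "\<And>I u v. u \<in> hom E I A \<Longrightarrow> v \<in> hom E I A \<Longrightarrow> R u v \<Longrightarrow> R v u \<Longrightarrow> u = v"
  shows "internal_poset E Z"
    and "u \<in> hom E I A \<Longrightarrow> v \<in> hom E I A \<Longrightarrow> leq E Z u v \<longleftrightarrow> R u v"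
proof -
  note props = rel_props[where R=R, OF rep A]
  show leq: "leq E Z u v \<longleftrightarrow> R u v" if u: "u \<in> hom E I A" and v: "v \<in> hom E I A" for I u v
  proof -
    have "I \<in> Ob E" using u by auto
    then show ?thesis unfolding leq_def Z using props u v by blast
  qed
  have "is_poset E Z" unfolding is_poset_def Z
  proof (intro conjI ballI)
    fix I u v w assume u: "u \<in> hom E I A" and v: "v \<in> hom E I A" and w: "w \<in> hom E I A"
    show "leq E Z u u" using leq[OF u u] refl[OF u] by simp
    show "leq E Z u v \<longrightarrow> leq E Z v w \<longrightarrow> leq E Z u w"
      using leq[OF u v] leq[OF v w] leq[OF u w] trans[OF u v w] by simp
    show "leq E Z u v \<longrightarrow> leq E Z v u \<longrightarrow> u = v"
      using leq[OF u v] leq[OF v u] antisym[OF u v] by simp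
  qed (use A props in blast)+
  then show "internal_poset E Z"
    by (intro internal_poset.intro internal_poset_axioms.intro elementary_topos_axioms)
qed

end

context internal_frame
begin

lemma opens_subframe [simp]: "opens (subframe E X m) = src E m"
  by (simp add: subframe_def)

lemma subframe:
  assumes m: "mono E m" "tgt E m = opens X"
  shows "internal_poset E (subframe E X m)"
    and "u \<in> hom E I (src E m) \<Longrightarrow> v \<in> hom E I (src E m) \<Longrightarrow> leq E (subframe E X m) u v \<longleftrightarrow> leq E X (m \<cdot> u) (m \<cdot> v)"
proof -
  let ?A = "src E m"
  have A: "?A \<in> Ob E" using m by simp
  have rep: "representable (Prod E ?A ?A) (\<lambda>z. leq E X (m \<cdot> (pr1 E ?A ?A \<cdot> z)) (m \<cdot> (pr2 E ?A ?A \<cdot> z)))"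
    by (rule representable_leq natural_pr1 natural_pr2 natural_id natural_comp[where B="?A"] | use m A in simp)+
  have 1: "le (subframe E X m) = rel E ?A (\<lambda>u v. leq E X (m \<cdot> u) (m \<cdot> v))" by (simp add: subframe_def)
  note P = rel_poset[where R="\<lambda>u v. leq E X (m \<cdot> u) (m \<cdot> v)", OF opens_subframe 1 rep A]
  have rf: "leq E X (m \<cdot> u) (m \<cdot> u)" if "u \<in> hom E I ?A" for I u
    using that m by simp
  have tr: "leq E X (m \<cdot> u) (m \<cdot> w)" if "u \<in> hom E I ?A" "v \<in> hom E I ?A" "w \<in> hom E I ?A"
      "leq E X (m \<cdot> u) (m \<cdot> v)" "leq E X (m \<cdot> v) (m \<cdot> w)" for I u v w
    by (rule leq_trans[OF that(4,5), of I]) (use that(1-3) m in simp_all)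
  have an: "u = v" if "u \<in> hom E I ?A" "v \<in> hom E I ?A"
      "leq E X (m \<cdot> u) (m \<cdot> v)" "leq E X (m \<cdot> v) (m \<cdot> u)" for I u v
  proof -
    have "m \<cdot> u = m \<cdot> v" by (rule leq_antisym[OF that(3,4), of I]) (use that(1,2) m in simp_all)
    then show ?thesis by (rule monoD[OF m(1), rotated -1]) (use that(1,2) in simp_all)
  qed
  show "internal_poset E (subframe E X m)" by (rule P(1)[OF rf tr an])
  show "u \<in> hom E I ?A \<Longrightarrow> v \<in> hom E I ?A \<Longrightarrow> leq E (subframe E X m) u v \<longleftrightarrow> leq E X (m \<cdot> u) (m \<cdot> v)"
    by (rule P(2)[OF rf tr an])
qed

lemma below_incl_rep:
  assumes "c \<in> hom E (One E) (opens X)"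
  shows "representable (opens X) (\<lambda>u. leq E X u (c \<cdot> bang E (src E u)))"
  by (rule representable_leq natural_id natural_const | use assms in simp)+

lemma above_incl_rep:
  assumes "c \<in> hom E (One E) (opens X)"
  shows "representable (opens X) (\<lambda>u. leq E X (c \<cdot> bang E (src E u)) u)"
  by (rule representable_leq natural_id natural_const | use assms in simp)+

lemma open_restr_props:
  assumes c: "c \<in> hom E (One E) (opens X)"
  shows "open_restr E X c \<in> hom E (opens X) (src E (below_incl E X c)) \<and>
    below_incl E X c \<cdot> open_restr E X c = meet E X (ident E (opens X)) (c \<cdot> bang E (opens X))"
  unfolding open_restr_def open_sublocale_def opens_subframe
proof (rule theI')
  note rep = below_incl_rep[OF c]
  let ?x = "meet E X (ident E (opens X)) (c \<cdot> bang E (opens X))" and ?m = "below_incl E X c"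
  have m: "mono E ?m" "tgt E ?m = opens X" "?m \<in> Arr E" using compr_arr[OF rep] by (simp_all add: below_incl_def)
  have "leq E X ?x (c \<cdot> bang E (src E ?x))" using c by simp
  then obtain y where y: "y \<in> Arr E" "src E y = src E ?x" "tgt E y = src E ?m" "?m \<cdot> y = ?x"
    unfolding below_incl_def by - (rule compr_factor[OF rep, of ?x], use c in simp_all)
  show "\<exists>!r. r \<in> hom E (opens X) (src E ?m) \<and> ?m \<cdot> r = ?x"
  proof (rule ex1I[of _ y])
    show "y \<in> hom E (opens X) (src E ?m) \<and> ?m \<cdot> y = ?x" using y c by simp
    fix r assume r: "r \<in> hom E (opens X) (src E ?m) \<and> ?m \<cdot> r = ?x"
    then have "?m \<cdot> r = ?m \<cdot> y" using y(4) by simp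
    then show "r = y" by (rule monoD[OF m(1), rotated -1]) (use r y(1-3) c in simp_all)
  qed
qed

lemma closed_restr_props:
  assumes c: "c \<in> hom E (One E) (opens X)"
  shows "closed_restr E X c \<in> hom E (opens X) (src E (above_incl E X c)) \<and>
    above_incl E X c \<cdot> closed_restr E X c = join E X (ident E (opens X)) (c \<cdot> bang E (opens X))"
  unfolding closed_restr_def closed_sublocale_def opens_subframe
proof (rule theI')
  note rep = above_incl_rep[OF c]
  let ?x = "join E X (ident E (opens X)) (c \<cdot> bang E (opens X))" and ?m = "above_incl E X c"
  have m: "mono E ?m" "tgt E ?m = opens X" "?m \<in> Arr E" using compr_arr[OF rep] by (simp_all add: above_incl_def)
  have "leq E X (c \<cdot> bang E (src E ?x)) ?x" using c by simp
  then obtain y where y: "y \<in> Arr E" "src E y = src E ?x" "tgt E y = src E ?m" "?m \<cdot> y = ?x"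
    unfolding above_incl_def by - (rule compr_factor[OF rep, of ?x], use c in simp_all)
  show "\<exists>!r. r \<in> hom E (opens X) (src E ?m) \<and> ?m \<cdot> r = ?x"
  proof (rule ex1I[of _ y])
    show "y \<in> hom E (opens X) (src E ?m) \<and> ?m \<cdot> y = ?x" using y c by simp
    fix r assume r: "r \<in> hom E (opens X) (src E ?m) \<and> ?m \<cdot> r = ?x"
    then have "?m \<cdot> r = ?m \<cdot> y" using y(4) by simp
    then show "r = y" by (rule monoD[OF m(1), rotated -1]) (use r y(1-3) c in simp_all)
  qed
qed

end

section \<open>Points of regular locales\<close>

locale pointed_locale = elementary_topos E + Y: internal_frame E Y + P: frame_morphism E Y "truth_frame E" p
  for E :: "('o, 'm) topos" (structure) and Y p
begin

lemma p_arr [simp]: "p \<in> Arr E" "src E p = opens Y" "tgt E p = Om E"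
  using P.f_arr by simp_all

lemma holds_p_mono:
  assumes "holds E (p \<cdot> u)" "leq E Y u v" "u \<in> hom E I (opens Y)" "v \<in> hom E I (opens Y)"
  shows "holds E (p \<cdot> v)"
  by (rule leq_truthD[where I=I, OF P.f_mono[OF assms(2-)] assms(1)]) (use assms in simp_all)

lemma holds_p_meet:
  assumes "u \<in> hom E I (opens Y)" "v \<in> hom E I (opens Y)"
  shows "holds E (p \<cdot> meet E Y u v) \<longleftrightarrow> holds E (p \<cdot> u) \<and> holds E (p \<cdot> v)"
  unfolding P.f_meet[OF assms] by (rule holds_meet_truth[of _ I]) (use assms in simp_all)

lemma holds_p_whole:
  assumes "I \<in> Ob E"
  shows "holds E (p \<cdot> whole E Y I)"
  using whole_truth[OF assms] P.f_whole[OF assms] assms by simp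

text \<open>
  Since \<open>p\<close> preserves suprema, a join or a regular supremum that contains the point may be analysed
  as a disjunction or an existential statement. The conclusion \<open>C\<close> has to be representable, as it is
  used as an upper bound in the frame of truth values.
\<close>

lemma p_join_elim:
  assumes "holds E (p \<cdot> join E Y u v)" "u \<in> hom E I (opens Y)" "v \<in> hom E I (opens Y)" "representable I C"
    "\<And>g. g \<in> Arr E \<Longrightarrow> tgt E g = I \<Longrightarrow> holds E (p \<cdot> (u \<cdot> g)) \<Longrightarrow> C g"
    "\<And>g. g \<in> Arr E \<Longrightarrow> tgt E g = I \<Longrightarrow> holds E (p \<cdot> (v \<cdot> g)) \<Longrightarrow> C g"
  shows "C (ident E I)"
proof (rule representableE[OF assms(4)])
  fix t assume t: "t \<in> Arr E" "src E t = I" "tgt E t = Om E" "I \<in> Ob E"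
    "\<And>x. x \<in> Arr E \<Longrightarrow> tgt E x = I \<Longrightarrow> holds E (t \<cdot> x) \<longleftrightarrow> C x"
  have tI: "t \<in> hom E I (Om E)" using t by simp
  have "leq E (truth_frame E) (p \<cdot> join E Y u v) t"
  proof (rule P.f_join_leq[OF _ _ assms(2,3)])
    show "leq E (truth_frame E) (p \<cdot> u) t"
      by (rule leq_truthI[OF _ tI]) (use assms(2,5) t(5) in simp_all)
    show "leq E (truth_frame E) (p \<cdot> v) t"
      by (rule leq_truthI[OF _ tI]) (use assms(3,6) t(5) in simp_all)
  qed (use tI in simp)
  then have "holds E t" by (rule leq_truthD[where I=I, OF _ assms(1)]) (use assms(2,3) tI in simp_all)
  then have "holds E (t \<cdot> ident E I)" using t by simp
  then show ?thesis using t(5)[of "ident E I"] t(4) by simp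
qed

lemma p_regular_elim:
  assumes reg: "regular E Y" and "holds E (p \<cdot> v)" and v: "v \<in> hom E I (opens Y)" and "representable I C"
    and all: "\<And>h a. h \<in> Arr E \<Longrightarrow> tgt E h = I \<Longrightarrow> a \<in> hom E (src E h) (opens Y) \<Longrightarrow> rather_below E Y a (v \<cdot> h) \<Longrightarrow>
      holds E (p \<cdot> a) \<Longrightarrow> C h"
  shows "C (ident E I)"
proof (rule representableE[OF assms(4)])
  fix t assume t: "t \<in> Arr E" "src E t = I" "tgt E t = Om E" "I \<in> Ob E"
    "\<And>x. x \<in> Arr E \<Longrightarrow> tgt E x = I \<Longrightarrow> holds E (t \<cdot> x) \<longleftrightarrow> C x"
  have tI: "t \<in> hom E I (Om E)" using t by simp
  have sup: "is_sup E Y (\<lambda>g u. rather_below E Y u (v \<cdot> g)) v"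
    using reg v unfolding regular_def by simp
  have "leq E (truth_frame E) (p \<cdot> v) t"
  proof (rule P.f_sup_leq[OF sup v], unfold opens_truth, rule tI)
    fix h a assume h: "h \<in> Arr E" "tgt E h = I" and a: "a \<in> hom E (src E h) (opens Y)" and rb: "rather_below E Y a (v \<cdot> h)"
    show "leq E (truth_frame E) (p \<cdot> a) (t \<cdot> h)"
    proof (rule leq_truthI[of _ "src E h"])
      fix g assume g: "g \<in> Arr E" "tgt E g = src E h" and pa: "holds E ((p \<cdot> a) \<cdot> g)"
      have "rather_below E Y (a \<cdot> g) ((v \<cdot> h) \<cdot> g)" by (rule Y.rather_below_cmp[OF rb]) (use a v h g in simp_all)
      then have "C (h \<cdot> g)" by - (rule all[of _ "a \<cdot> g"], use a v h g pa in simp_all)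
      then show "holds E ((t \<cdot> h) \<cdot> g)" using t(1-3) t(5)[of "h \<cdot> g"] h g by simp
    qed (use a t h in simp_all)
  qed
  then have "holds E t" by (rule leq_truthD[where I=I, OF _ assms(2)]) (use v tI in simp_all)
  then have "holds E (t \<cdot> ident E I)" using t by simp
  then show ?thesis using t(5)[of "ident E I"] t(4) by simp
qed

text \<open>
  The open complement of the point is the value of the right adjoint of \<open>p\<close> at the false truth value. Hence
  \<open>u\<close> lies below it exactly if \<open>p u\<close> is false.
\<close>

lemma pt_compl_props:
  "pt_compl E Y p \<in> hom E (One E) (opens Y) \<and> (\<forall>I. \<forall>u\<in>hom E I (opens Y).
     leq E Y u (pt_compl E Y p \<cdot> bang E I) \<longleftrightarrow> leq E (truth_frame E) (p \<cdot> u) (empty E (truth_frame E) I))"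
proof -
  let ?T = "truth_frame E"
  let ?P = "\<lambda>g u. p \<cdot> u = empty E ?T (src E u)"
  obtain r where r: "r \<in> hom E (opens ?T) (opens Y)"
    and adj: "\<And>I u v. u \<in> hom E I (opens Y) \<Longrightarrow> v \<in> hom E I (opens ?T) \<Longrightarrow> leq E ?T (p \<cdot> u) v \<longleftrightarrow> leq E Y u (r \<cdot> v)"
    by (rule P.right_adjoint) (rule that)
  let ?c = "r \<cdot> empty E ?T (One E)"
  have c: "?c \<in> hom E (One E) (opens Y)" using r P.X.empty_arr[of "One E"] by simp
  have eT [simp]: "empty E ?T I \<in> Arr E" "src E (empty E ?T I) = I" "tgt E (empty E ?T I) = Om E" if "I \<in> Ob E" for I
    using P.X.empty_arr[OF that] by simp_all
  have cI: "?c \<cdot> g = r \<cdot> empty E ?T (src E g)" if "g \<in> Arr E" "tgt E g = One E" for g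
    using P.X.empty_cmp[OF that] r that by simp
  have char: "leq E Y u (?c \<cdot> g) \<longleftrightarrow> leq E ?T (p \<cdot> u) (empty E ?T (src E g))"
    if "g \<in> Arr E" "tgt E g = One E" "u \<in> hom E (src E g) (opens Y)" for u g
    unfolding cI[OF that(1,2)] by (rule adj[symmetric, OF that(3)]) (use that in simp)
  have eq: "?P h u \<longleftrightarrow> leq E ?T (p \<cdot> u) (empty E ?T I)" if u: "u \<in> hom E I (opens Y)" for h u I
  proof -
    have I: "I \<in> Ob E" using u by auto
    show ?thesis
    proof
      assume "leq E ?T (p \<cdot> u) (empty E ?T I)"
      then show "?P h u" using u I by (intro P.X.leq_antisym[of _ _ I]) simp_all
    qed (use u I in simp)
  qed
  have sup: "is_sup E Y ?P ?c"
  proof (rule Y.is_supI[OF c])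
    fix h a assume h: "h \<in> Arr E" "tgt E h = One E" and a: "a \<in> hom E (src E h) (opens Y)" and "?P h a"
    then show "leq E Y a (?c \<cdot> h)" using char[OF h a] eq[OF a] by simp
  next
    fix g t assume g: "g \<in> Arr E" "tgt E g = One E" and t: "t \<in> hom E (src E g) (opens Y)"
      and all: "\<And>h a. h \<in> Arr E \<Longrightarrow> tgt E h = src E g \<Longrightarrow> a \<in> hom E (src E h) (opens Y) \<Longrightarrow> ?P (g \<cdot> h) a \<Longrightarrow> leq E Y a (t \<cdot> h)"
    have cg: "?c \<cdot> g \<in> hom E (src E g) (opens Y)" using c g by simp
    have "?P g (?c \<cdot> g)" using char[OF g cg] eq[OF cg] cg by simp
    then have "leq E Y (?c \<cdot> g) (t \<cdot> ident E (src E g))" by - (rule all, use g cg in simp_all)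
    then show "leq E Y (?c \<cdot> g) t" using t by simp
  qed
  have "pt_compl E Y p = ?c" unfolding pt_compl_def
  proof (rule the_equality)
    show "?c \<in> hom E (One E) (opens Y) \<and> is_sup E Y ?P ?c" using c sup by blast
    fix d assume "d \<in> hom E (One E) (opens Y) \<and> is_sup E Y ?P d"
    then show "d = ?c" using Y.is_sup_unique[OF _ sup _ c] by blast
  qed
  moreover have "leq E Y u (?c \<cdot> bang E I) \<longleftrightarrow> leq E ?T (p \<cdot> u) (empty E ?T I)" if u: "u \<in> hom E I (opens Y)" for I u
  proof -
    have I: "I \<in> Ob E" using u by auto
    show ?thesis using char[of "bang E I" u] u I by simp
  qed
  ultimately show ?thesis using c by metis
qed

abbreviation c where "c \<equiv> pt_compl E Y p"

lemma c_arr [simp]: "c \<in> Arr E" "src E c = One E" "tgt E c = opens Y"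
  using pt_compl_props by simp_all

lemma leq_c_iff:
  assumes "u \<in> hom E I (opens Y)"
  shows "leq E Y u (c \<cdot> bang E I) \<longleftrightarrow> leq E (truth_frame E) (p \<cdot> u) (empty E (truth_frame E) I)"
  using pt_compl_props assms by blast

lemma p_c_leq:
  assumes "t \<in> hom E I (Om E)"
  shows "leq E (truth_frame E) (p \<cdot> (c \<cdot> bang E I)) t"
proof -
  have I: "I \<in> Ob E" using assms by auto
  have "leq E (truth_frame E) (p \<cdot> (c \<cdot> bang E I)) (empty E (truth_frame E) I)"
    using leq_c_iff[of "c \<cdot> bang E I" I] I by simp
  then show ?thesis
    by (rule P.X.leq_trans[of _ _ _ I]) (use I assms P.X.empty_arr[OF I] in simp_all)
qed

text \<open>
  The complement of the point does not contain the point, so that anything follows if it does.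
\<close>

lemma not_p_c:
  assumes "holds E (p \<cdot> (c \<cdot> bang E I))" "I \<in> Ob E" "representable I C"
  shows "C (ident E I)"
proof (rule representableE[OF assms(3)])
  fix t assume t: "t \<in> Arr E" "src E t = I" "tgt E t = Om E"
    "\<And>x. x \<in> Arr E \<Longrightarrow> tgt E x = I \<Longrightarrow> holds E (t \<cdot> x) \<longleftrightarrow> C x"
  have "holds E t" by (rule leq_truthD[where I=I, OF p_c_leq[where I=I] assms(1)]) (use t assms in simp_all)
  then have "holds E (t \<cdot> ident E I)" using t by simp
  then show ?thesis using t(4)[of "ident E I"] assms(2) by simp
qed

text \<open>
  An open and its complement cannot both contain the point, as their meet is empty.
\<close>

lemma neg_leq_c:
  assumes "holds E (p \<cdot> a)" "a \<in> hom E I (opens Y)"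
  shows "leq E Y (neg E Y a) (c \<cdot> bang E I)"
proof -
  have I: "I \<in> Ob E" using assms by auto
  have "leq E (truth_frame E) (p \<cdot> neg E Y a) (empty E (truth_frame E) I)"
  proof (rule leq_truthI[of _ I])
    fix g assume g: "g \<in> Arr E" "tgt E g = I" and n: "holds E ((p \<cdot> neg E Y a) \<cdot> g)"
    have "holds E ((p \<cdot> a) \<cdot> g)" by (rule holds_cmp[OF assms(1)]) (use assms g in simp_all)
    then have "holds E (p \<cdot> meet E Y (neg E Y (a \<cdot> g)) (a \<cdot> g))"
      using holds_p_meet[of "neg E Y (a \<cdot> g)" "src E g" "a \<cdot> g"] n assms g by simp
    then have "holds E (p \<cdot> (c \<cdot> bang E (src E g)))"
      by (rule holds_p_mono[where I="src E g", OF _ Y.meet_neg_leq(1)[where I="src E g"]]) (use assms g in simp_all)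
    then have "holds E (empty E (truth_frame E) (src E g))"
      by - (rule leq_truthD[where I="src E g", OF p_c_leq[where I="src E g"]], use g P.X.empty_arr[of "src E g"] in simp_all)
    then show "holds E (empty E (truth_frame E) I \<cdot> g)" using P.X.empty_cmp[OF g] by simp
  qed (use assms I P.X.empty_arr[OF I] in simp_all)
  then show ?thesis using leq_c_iff[of "neg E Y a" I] assms by simp
qed

lemma covers_if_rather_below:
  assumes "rather_below E Y a v" "holds E (p \<cdot> a)" "a \<in> hom E I (opens Y)" "v \<in> hom E I (opens Y)"
  shows "Y.covers v (c \<cdot> bang E I)"
proof -
  have I: "I \<in> Ob E" using assms by auto
  have "Y.covers (neg E Y a) v" using Y.rather_below_iff assms by blast
  then have "Y.covers (c \<cdot> bang E I) v"
    by (rule Y.covers_mono[OF _ neg_leq_c[OF assms(2,3)], of _ _ I]) (use assms I in simp_all)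
  then show ?thesis by (rule Y.covers_commute) (use assms I in simp_all)
qed

text \<open>
  Some \<open>a\<close> rather below \<open>v\<close> contains the point. Its complement covers together with \<open>v\<close> and lies below \<open>c\<close>.
\<close>

lemma covers_if_p:
  assumes reg: "regular E Y" and "holds E (p \<cdot> v)" and v: "v \<in> hom E I (opens Y)"
  shows "Y.covers v (c \<cdot> bang E I)"
proof -
  have I: "I \<in> Ob E" using v by auto
  let ?C = "\<lambda>h. Y.covers (v \<cdot> h) (c \<cdot> bang E (src E h))"
  have "?C (ident E I)"
  proof (rule p_regular_elim[OF assms, where C="?C"])
    show "representable I ?C"
      by (rule Y.representable_covers natural_const natural_id natural_comp | use v I in simp)+
    show "?C h" if "h \<in> Arr E" "tgt E h = I" "a \<in> hom E (src E h) (opens Y)" "rather_below E Y a (v \<cdot> h)" "holds E (p \<cdot> a)" for h a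
      by (rule covers_if_rather_below[OF that(4,5,3)]) (use that v in simp)
  qed
  then show ?thesis using v I by simp
qed

text \<open>
  An open \<open>a\<close> rather below \<open>u\<close> is treated by cases, since its complement and \<open>u\<close> cover and so one
  of them contains the point. If the complement of \<open>a\<close> does, it covers together with \<open>c\<close>, and
  \<open>a\<close> lies below \<open>c\<close>. If \<open>u\<close> contains the point, so does \<open>v\<close>, which then covers together with \<open>c\<close>.
\<close>

lemma leq_if_locally:
  assumes reg: "regular E Y" and u: "u \<in> hom E I (opens Y)" and v: "v \<in> hom E I (opens Y)"
    and 1: "leq E Y (meet E Y u (c \<cdot> bang E I)) v" and 2: "leq E (truth_frame E) (p \<cdot> u) (p \<cdot> v)"
  shows "leq E Y u v"
proof (rule Y.regular_leqI[OF reg u v])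
  fix h a assume h: "h \<in> Arr E" "tgt E h = I" and a: "a \<in> hom E (src E h) (opens Y)" and rb: "rather_below E Y a (u \<cdot> h)"
  let ?J = "src E h"
  have ty: "u \<cdot> h \<in> hom E ?J (opens Y)" "v \<cdot> h \<in> hom E ?J (opens Y)" "?J \<in> Ob E" using u v h by simp_all
  have au: "leq E Y a (u \<cdot> h)" by (rule Y.rather_below_leq[OF rb a ty(1)])
  have meet_v: "leq E Y (meet E Y (u \<cdot> g) (c \<cdot> bang E (src E g))) (v \<cdot> g)" if "g \<in> Arr E" "tgt E g = I" for g
  proof -
    have "leq E Y (meet E Y u (c \<cdot> bang E I) \<cdot> g) (v \<cdot> g)"
      by (rule Y.leq_cmp[OF 1, of I]) (use u v that in auto)
    then show ?thesis using u that by auto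
  qed
  let ?C = "\<lambda>g. leq E Y (a \<cdot> g) (v \<cdot> h \<cdot> g)"
  have cov: "Y.covers (neg E Y a) (u \<cdot> h)" using Y.rather_below_iff[OF a ty(1)] rb by blast
  then have "join E Y (neg E Y a) (u \<cdot> h) = whole E Y ?J"
    using Y.covers_iff[of "neg E Y a" ?J "u \<cdot> h"] a ty by simp
  then have pj: "holds E (p \<cdot> join E Y (neg E Y a) (u \<cdot> h))" using holds_p_whole[OF ty(3)] by simp
  have "?C (ident E ?J)"
  proof (rule p_join_elim[OF pj _ ty(1), where C="?C"])
    show "representable ?J ?C"
      by (rule Y.representable_leq natural_comp natural_id | use a ty in simp)+
    fix g assume g: "g \<in> Arr E" "tgt E g = ?J"
    let ?K = "src E g"
    have ty': "a \<cdot> g \<in> hom E ?K (opens Y)" "u \<cdot> h \<cdot> g \<in> hom E ?K (opens Y)" "v \<cdot> h \<cdot> g \<in> hom E ?K (opens Y)" "?K \<in> Ob E"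
      "c \<cdot> bang E ?K \<in> hom E ?K (opens Y)" using u v h a g by simp_all
    have aug: "leq E Y (a \<cdot> g) (u \<cdot> h \<cdot> g)" by (rule Y.leq_cmp[OF au a ty(1) g])
    have mv: "leq E Y (meet E Y (u \<cdot> h \<cdot> g) (c \<cdot> bang E ?K)) (v \<cdot> h \<cdot> g)"
      using meet_v[of "h \<cdot> g"] u v h g by simp
    have mav: "leq E Y (meet E Y (a \<cdot> g) (c \<cdot> bang E ?K)) (v \<cdot> h \<cdot> g)"
      by (rule Y.leq_trans[OF Y.meet_mono[OF aug Y.leq_refl] mv, of ?K]) (use ty' in simp_all)
    {
      assume "holds E (p \<cdot> (neg E Y a \<cdot> g))"
      then have "Y.covers (neg E Y (a \<cdot> g)) (c \<cdot> bang E ?K)"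
        by - (rule covers_if_p[OF reg], use a g in simp_all)
      then show "?C g"
        by (rule Y.leq_if_covers[OF _ Y.meet_neg_leq(2) mav]) (use ty' in simp_all)
    next
      assume "holds E (p \<cdot> ((u \<cdot> h) \<cdot> g))"
      then have "holds E ((p \<cdot> u) \<cdot> (h \<cdot> g))" using u h g by simp
      then have "holds E ((p \<cdot> v) \<cdot> (h \<cdot> g))"
        by - (rule leq_truth_cmp[where I=I, OF 2], use u v h g in simp_all)
      then have "Y.covers (v \<cdot> h \<cdot> g) (c \<cdot> bang E ?K)"
        by - (rule covers_if_p[OF reg], use v h g in simp_all)
      then show "?C g"
        by (rule Y.leq_if_covers[OF _ Y.meet_lower(2) mav]) (use ty' in simp_all)
    }
  qed (use a in simp)
  then show "leq E Y a (v \<cdot> h)" using a v h by simp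
qed

text \<open>
  An open above the complement of the point is determined by whether it contains the point, and the open
  \<open>c \<squnion> \<Squnion>{Y. q}\<close> contains the point exactly if \<open>q\<close> holds.
\<close>

lemma closed_point:
  assumes reg: "regular E Y"
  shows "closed_point E Y p"
proof -
  let ?T = "truth_frame E" and ?O = "opens Y"
  have c: "c \<in> hom E (One E) ?O" by simp
  note rep = Y.above_incl_rep[OF c]
  let ?m = "above_incl E Y c" and ?Z = "closed_sublocale E Y c"
  have m: "mono E ?m" "tgt E ?m = ?O" "?m \<in> Arr E" using compr_arr[OF rep] by (simp_all add: above_incl_def)
  have Z: "?Z = subframe E Y ?m" by (simp add: closed_sublocale_def)
  have oZ: "opens ?Z = src E ?m" by (simp add: Z)
  have c_leq_m: "leq E Y (c \<cdot> bang E I) (?m \<cdot> u)" if "u \<in> hom E I (src E ?m)" for u I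
    using compr_sat[OF rep, of u] that m by (simp add: above_incl_def)
  \<comment> \<open>The open \<open>B q\<close> is the whole to the extent that \<open>q\<close> holds.\<close>
  have repB: "representable (Prod E (Om E) ?O) (\<lambda>z. holds E (pr1 E (Om E) ?O \<cdot> z))"
    by (rule representable_holds natural_pr1 natural_id | simp)+
  obtain S where S: "S \<in> hom E (Om E) (Pow E ?O)" "is_sup E Y (\<lambda>q a. holds E q) (Join E Y S)"
    by (rule Y.sup_exists[where Q="\<lambda>q a. holds E q", OF repB Om_ob]) (rule that)
  let ?B = "Join E Y S"
  have B: "?B \<in> hom E (Om E) ?O" using S(1) by simp
  have B_upper: "leq E Y a (?B \<cdot> q)" if "holds E q" "q \<in> hom E I (Om E)" "a \<in> hom E I ?O" for q a I
    by (rule Y.is_sup_upper[OF S(2) B that(1)]) (use that in simp_all)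
  have B_sup: "is_sup E Y (\<lambda>h a. holds E (q \<cdot> h)) (?B \<cdot> q)" if "q \<in> hom E I (Om E)" for q I
    by (rule Y.is_sup_cmp[OF S(2) B]) (use that in simp_all)
  let ?V = "join E Y (c \<cdot> bang E (Om E)) ?B"
  have V: "?V \<in> hom E (Om E) ?O" using S(1) by simp
  have Vq: "?V \<cdot> q = join E Y (c \<cdot> bang E I) (?B \<cdot> q)" if "q \<in> hom E I (Om E)" for q I
    using that S(1) by simp
  have pV: "p \<cdot> (?V \<cdot> q) = q" if q: "q \<in> hom E I (Om E)" for q I
  proof (rule P.X.leq_antisym[of _ _ I])
    have I: "I \<in> Ob E" using q by auto
    have Bq: "?B \<cdot> q \<in> hom E I ?O" using B q by simp
    show "leq E ?T (p \<cdot> (?V \<cdot> q)) q" unfolding Vq[OF q]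
    proof (rule P.f_join_leq[OF p_c_leq[OF q] _ _ Bq], unfold opens_truth)
      show "leq E ?T (p \<cdot> (?B \<cdot> q)) q"
      proof (rule P.f_sup_leq[OF B_sup[OF q] Bq], unfold opens_truth, rule q)
        fix h a assume h: "h \<in> Arr E" "tgt E h = I" "a \<in> hom E (src E h) ?O" and qh: "holds E (q \<cdot> h)"
        show "leq E ?T (p \<cdot> a) (q \<cdot> h)"
        proof (rule leq_truthI[of _ "src E h"])
          show "holds E ((q \<cdot> h) \<cdot> g)" if "g \<in> Arr E" "tgt E g = src E h" for g
            by (rule holds_cmp[OF qh]) (use that h q in simp_all)
        qed (use h q in simp_all)
      qed
    qed (use q I in simp_all)
    show "leq E ?T q (p \<cdot> (?V \<cdot> q))"
    proof (rule leq_truthI[OF q])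
      fix g assume g: "g \<in> Arr E" "tgt E g = I" and qg: "holds E (q \<cdot> g)"
      have "leq E Y (whole E Y (src E g)) (?B \<cdot> (q \<cdot> g))"
        by (rule B_upper[OF qg, of "src E g"]) (use q g in simp_all)
      then have 1: "leq E Y (whole E Y (src E g)) (?B \<cdot> q \<cdot> g)" using B q g by simp
      have "leq E Y (whole E Y (src E g)) (join E Y (c \<cdot> bang E (src E g)) (?B \<cdot> q \<cdot> g))"
        by (rule Y.leq_join2[where I="src E g", OF 1]) (use B q g in simp_all)
      then have "holds E (p \<cdot> join E Y (c \<cdot> bang E (src E g)) (?B \<cdot> q \<cdot> g))"
        by - (rule holds_p_mono[where I="src E g", OF holds_p_whole[of "src E g"]], use B q g in simp_all)
      then show "holds E ((p \<cdot> (?V \<cdot> q)) \<cdot> g)" using S(1) q g I by simp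
    qed (use V q in simp)
  qed (use V q in simp_all)
  have "leq E Y (c \<cdot> bang E (src E ?V)) ?V" using S(1) by simp
  then obtain n where n: "n \<in> Arr E" "src E n = src E ?V" "tgt E n = src E ?m" "?m \<cdot> n = ?V"
    unfolding above_incl_def by - (rule compr_factor[OF rep, of ?V], use V in simp_all)
  have n': "n \<in> hom E (Om E) (src E ?m)" using n V by simp
  let ?k = "p \<cdot> ?m"
  have k: "?k \<in> hom E (src E ?m) (Om E)" using m by simp
  have iso: "frame_iso E ?Z ?T ?k"
  proof (rule frame_iso_if_order_iso[where g=n], unfold oZ opens_truth)
    show "internal_poset E ?Z" unfolding Z by (rule Y.subframe(1)[OF m(1,2)])
    show "internal_frame E ?T" by (rule truth_internal_frame)
    have "p \<cdot> (?V \<cdot> ident E (Om E)) = ident E (Om E)" by (rule pV[of _ "Om E"]) simp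
    then have "p \<cdot> (?m \<cdot> n) = ident E (Om E)" unfolding n(4) using V by simp
    then show kn: "?k \<cdot> n = ident E (Om E)" using m n'  by simp
    show leq: "leq E ?Z u v \<longleftrightarrow> leq E ?T (?k \<cdot> u) (?k \<cdot> v)" if u: "u \<in> hom E I (src E ?m)" and v: "v \<in> hom E I (src E ?m)" for I u v
    proof -
      have I: "I \<in> Ob E" using u by auto
      have mu: "?m \<cdot> u \<in> hom E I ?O" and mv: "?m \<cdot> v \<in> hom E I ?O" using m u v by simp_all
      have 1: "leq E Y (meet E Y (?m \<cdot> u) (c \<cdot> bang E I)) (?m \<cdot> v)"
        by (rule Y.meet_leq2[OF c_leq_m[OF v]]) (use mu mv I in simp_all)
      have "leq E Y (?m \<cdot> u) (?m \<cdot> v) \<longleftrightarrow> leq E ?T (p \<cdot> (?m \<cdot> u)) (p \<cdot> (?m \<cdot> v))"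
        using P.f_mono[OF _ mu mv] leq_if_locally[OF reg mu mv 1] by blast
      then show ?thesis unfolding Z Y.subframe(2)[OF m(1,2) u v] using m u v by simp
    qed
  qed (use k n' in simp_all)
  moreover have "?k \<cdot> closed_restr E Y c = p"
  proof -
    let ?r = "closed_restr E Y c"
    have r: "?r \<in> hom E ?O (src E ?m)" "?m \<cdot> ?r = join E Y (ident E ?O) (c \<cdot> bang E ?O)"
      using Y.closed_restr_props[OF c] by blast+
    have pO: "p \<in> hom E ?O (Om E)" by simp
    have "p \<cdot> (?m \<cdot> ?r) = p" unfolding r(2)
    proof (rule P.X.leq_antisym[of _ _ ?O])
      show "leq E ?T (p \<cdot> join E Y (ident E ?O) (c \<cdot> bang E ?O)) p"
        by (rule P.f_join_leq[where I="?O", OF _ p_c_leq[OF pO]]) simp_all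
      have "leq E ?T (p \<cdot> ident E ?O) (p \<cdot> join E Y (ident E ?O) (c \<cdot> bang E ?O))"
        by (rule P.f_mono[of _ _ ?O]) simp_all
      then show "leq E ?T p (p \<cdot> join E Y (ident E ?O) (c \<cdot> bang E ?O))" by simp
    qed simp_all
    then show ?thesis using m r(1) by simp
  qed
  ultimately show ?thesis unfolding closed_point_def is_point_def using P.morphism by blast
qed

end

section \<open>Opens of a one-point compactification\<close>

text \<open>
  Here \<open>f\<close> restricts opens of \<open>Y\<close> to the open complement \<open>X\<close> of the point, and \<open>j\<close> considers an open of \<open>X\<close>
  as one of \<open>Y\<close>. The assumptions say that they identify the opens of \<open>X\<close> with the opens below \<open>c\<close>; it
  follows that \<open>j\<close> is left adjoint to \<open>f\<close>.
\<close>

locale compactification = pointed_locale E Y p + X: internal_frame E X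
  for E :: "('o, 'm) topos" (structure) and Y p X +
  fixes f j
  assumes compact: "compact E Y" and regular: "regular E Y"
    and f_hom: "f \<in> hom E (opens Y) (opens X)" and j_hom: "j \<in> hom E (opens X) (opens Y)"
    and fj: "U \<in> hom E I (opens X) \<Longrightarrow> f \<cdot> (j \<cdot> U) = U"
    and jf: "V \<in> hom E I (opens Y) \<Longrightarrow> j \<cdot> (f \<cdot> V) = meet E Y V (pt_compl E Y p \<cdot> bang E I)"
    and f_mono: "leq E Y V W \<Longrightarrow> V \<in> hom E I (opens Y) \<Longrightarrow> W \<in> hom E I (opens Y) \<Longrightarrow> leq E X (f \<cdot> V) (f \<cdot> W)"
    and j_mono: "leq E X U W \<Longrightarrow> U \<in> hom E I (opens X) \<Longrightarrow> W \<in> hom E I (opens X) \<Longrightarrow> leq E Y (j \<cdot> U) (j \<cdot> W)"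
begin

lemma f_arr [simp]: "f \<in> Arr E" "src E f = opens Y" "tgt E f = opens X"
  and j_arr [simp]: "j \<in> Arr E" "src E j = opens X" "tgt E j = opens Y"
  using f_hom j_hom by simp_all

lemma fj' [simp]: "U \<in> Arr E \<Longrightarrow> tgt E U = opens X \<Longrightarrow> f \<cdot> (j \<cdot> U) = U"
  using fj[of U "src E U"] by simp

lemma j_leq_iff:
  assumes "U \<in> hom E I (opens X)" "V \<in> hom E I (opens Y)"
  shows "leq E Y (j \<cdot> U) V \<longleftrightarrow> leq E X U (f \<cdot> V)"
proof
  have I: "I \<in> Ob E" using assms by auto
  assume "leq E Y (j \<cdot> U) V"
  then have "leq E X (f \<cdot> (j \<cdot> U)) (f \<cdot> V)" by (rule f_mono[where I=I]) (use assms in simp_all)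
  then show "leq E X U (f \<cdot> V)" using assms by simp
next
  have I: "I \<in> Ob E" using assms by auto
  assume "leq E X U (f \<cdot> V)"
  then have "leq E Y (j \<cdot> U) (j \<cdot> (f \<cdot> V))" by (rule j_mono[where I=I]) (use assms in simp_all)
  then have "leq E Y (j \<cdot> U) (meet E Y V (c \<cdot> bang E I))" unfolding jf[OF assms(2)] .
  then show "leq E Y (j \<cdot> U) V" by (rule Y.leq_trans[where I=I]) (use assms I in simp_all)
qed

text \<open>
  Hence \<open>f\<close> also has a right adjoint, \<open>U \<mapsto> (c \<Rightarrow> j U)\<close>.
\<close>

lemma f_leq_iff:
  assumes "U \<in> hom E I (opens X)" "V \<in> hom E I (opens Y)"
  shows "leq E X (f \<cdot> V) U \<longleftrightarrow> leq E Y (meet E Y V (c \<cdot> bang E I)) (j \<cdot> U)"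
proof -
  have "leq E Y (j \<cdot> (f \<cdot> V)) (j \<cdot> U) \<longleftrightarrow> leq E X (f \<cdot> V) (f \<cdot> (j \<cdot> U))"
    by (rule j_leq_iff[where I=I]) (use assms in simp_all)
  then show ?thesis using jf[OF assms(2)] assms by simp
qed

lemma j_leq_c:
  assumes "U \<in> hom E I (opens X)"
  shows "leq E Y (j \<cdot> U) (c \<cdot> bang E I)"
proof -
  have I: "I \<in> Ob E" using assms by auto
  have "j \<cdot> U = meet E Y (j \<cdot> U) (c \<cdot> bang E I)" using jf[of "j \<cdot> U" I] assms by simp
  moreover have "leq E Y (meet E Y (j \<cdot> U) (c \<cdot> bang E I)) (c \<cdot> bang E I)" using assms I by simp
  ultimately show ?thesis by simp
qed

lemma j_f_leq:
  assumes "V \<in> hom E I (opens Y)"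
  shows "leq E Y (j \<cdot> (f \<cdot> V)) V"
  using j_leq_iff[of "f \<cdot> V" I V] assms by simp

lemma f_meet:
  assumes "u \<in> hom E I (opens Y)" "v \<in> hom E I (opens Y)"
  shows "f \<cdot> meet E Y u v = meet E X (f \<cdot> u) (f \<cdot> v)"
proof (rule X.eq_by_lower_bounds[where I=I])
  fix t assume t: "t \<in> hom E I (opens X)"
  show "leq E X t (f \<cdot> meet E Y u v) \<longleftrightarrow> leq E X t (meet E X (f \<cdot> u) (f \<cdot> v))"
    using j_leq_iff[OF t, of "meet E Y u v"] j_leq_iff[OF t assms(1)] j_leq_iff[OF t assms(2)]
      Y.leq_meet_iff[OF assms, of "j \<cdot> t"] X.leq_meet_iff[of "f \<cdot> u" I "f \<cdot> v" t] assms t by simp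
qed (use assms in simp_all)

lemma f_whole:
  assumes I: "I \<in> Ob E"
  shows "f \<cdot> whole E Y I = whole E X I"
proof (rule X.leq_antisym[where I=I])
  show "leq E X (whole E X I) (f \<cdot> whole E Y I)"
    using j_leq_iff[of "whole E X I" I "whole E Y I"] I by simp
qed (use I in simp_all)

lemma f_c:
  assumes I: "I \<in> Ob E"
  shows "leq E X (whole E X I) (f \<cdot> (c \<cdot> bang E I))"
  using j_leq_iff[of "whole E X I" I "c \<cdot> bang E I"] j_leq_c[of "whole E X I" I] I by simp

lemma f_covers:
  assumes "Y.covers a b" "a \<in> hom E I (opens Y)" "b \<in> hom E I (opens Y)"
  shows "X.covers (f \<cdot> a) (f \<cdot> b)"
proof -
  have I: "I \<in> Ob E" using assms by auto
  let ?w = "j \<cdot> whole E X I" and ?U = "join E X (f \<cdot> a) (f \<cdot> b)"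
  have w: "?w \<in> hom E I (opens Y)" using I by simp
  have wc: "leq E Y ?w (c \<cdot> bang E I)" by (rule j_leq_c) (use I in simp)
  have le: "leq E Y (meet E Y ?w d) (j \<cdot> ?U)" if d: "d \<in> hom E I (opens Y)" and "leq E X (f \<cdot> d) ?U" for d
  proof -
    have 1: "leq E Y (meet E Y d (c \<cdot> bang E I)) (j \<cdot> ?U)"
      using f_leq_iff[of ?U I d] that assms by simp
    have "leq E Y (meet E Y ?w d) (meet E Y d (c \<cdot> bang E I))"
      by (rule Y.meet_greatest[where I=I, OF _ Y.meet_leq1[OF wc, of I]]) (use d I in simp_all)
    then show ?thesis by (rule Y.leq_trans[OF _ 1, where I=I]) (use d assms I in simp_all)
  qed
  have "leq E Y ?w (j \<cdot> ?U)"
    by (rule Y.leq_if_covers[OF assms(1) le le]) (use assms I in simp_all)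
  then have "leq E X (whole E X I) (f \<cdot> (j \<cdot> ?U))"
    using j_leq_iff[of "whole E X I" I "j \<cdot> ?U"] assms I by simp
  then show ?thesis using assms by (simp add: X.covers_def)
qed

lemma leq_iff:
  assumes u: "u \<in> hom E I (opens Y)" and v: "v \<in> hom E I (opens Y)"
  shows "leq E Y u v \<longleftrightarrow> leq E X (f \<cdot> u) (f \<cdot> v) \<and> leq E (truth_frame E) (p \<cdot> u) (p \<cdot> v)"
proof
  assume "leq E Y u v"
  then show "leq E X (f \<cdot> u) (f \<cdot> v) \<and> leq E (truth_frame E) (p \<cdot> u) (p \<cdot> v)"
    using f_mono[OF _ u v] P.f_mono[OF _ u v] by simp
next
  have I: "I \<in> Ob E" using u by auto
  assume 1: "leq E X (f \<cdot> u) (f \<cdot> v) \<and> leq E (truth_frame E) (p \<cdot> u) (p \<cdot> v)"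
  have 2: "leq E Y (meet E Y u (c \<cdot> bang E I)) (j \<cdot> (f \<cdot> v))"
    using f_leq_iff[of "f \<cdot> v" I u] 1 u v by simp
  have "leq E Y (meet E Y u (c \<cdot> bang E I)) v"
    by (rule Y.leq_trans[OF 2 j_f_leq[OF v]]) (use u v I in simp_all)
  then show "leq E Y u v" by (rule leq_if_locally[OF regular u v]) (use 1 in simp)
qed

text \<open>
  Neighbourhoods of the point have a complement that is way below the whole of \<open>X\<close>: a net in \<open>X\<close>
  that covers \<open>X\<close> covers \<open>Y\<close> together with the neighbourhood \<open>a\<close> of the point, so by
  compactness one of its members contains the complement of \<open>a\<close>.
\<close>

lemma way_below_f_neg:
  assumes pa: "holds E (p \<cdot> a)" and a: "a \<in> hom E I (opens Y)"
  shows "way_below E X (f \<cdot> neg E Y a) (whole E X I)"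
proof (rule X.way_belowI[where I=I])
  fix g S assume g: "g \<in> Arr E" "tgt E g = I" and S: "S \<in> hom E (src E g) (Pow E (opens X))"
    and net: "is_net E X S" and cov: "leq E X (whole E X I \<cdot> g) (Join E X S)"
  let ?J = "src E g" and ?OX = "opens X" and ?OY = "opens Y"
  let ?b = "a \<cdot> g"
  have J: "?J \<in> Ob E" and b: "?b \<in> hom E ?J ?OY" using a g by simp_all
  have pb: "holds E (p \<cdot> ?b)" using holds_cmp[OF pa, of g] a g by simp
  have bc: "Y.covers ?b (c \<cdot> bang E ?J)" by (rule covers_if_p[OF regular pb b])
  have wY: "way_below E Y (whole E Y ?J) (whole E Y ?J)"
    using Y.way_below_cmp[OF compact[unfolded compact_def], of "One E" "bang E ?J"] J by simp
  let ?\<phi> = "join E Y (?b \<cdot> pr1 E ?J ?OX) (j \<cdot> pr2 E ?J ?OX)"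
  have \<phi>: "?\<phi> \<in> hom E (Prod E ?J ?OX) ?OY" using a g J by simp
  have \<phi>_pair: "?\<phi> \<cdot> pair E x U = join E Y (?b \<cdot> x) (j \<cdot> U)" if "x \<in> Arr E" "tgt E x = ?J" "U \<in> hom E (src E x) ?OX" for x U
    using that a g J by simp
  \<comment> \<open>Compactness is applied to the opens \<open>b \<squnion> j U\<close>, indexed by the members \<open>U\<close> of the net.\<close>
  have "exists_loc E ?J ?OX (\<lambda>e U. mem E U (S \<cdot> e) \<and> leq E Y (whole E Y ?J \<cdot> e) (?\<phi> \<cdot> pair E e U))"
  proof (rule Y.way_below_image[OF wY _ _ S X.opens_ob \<phi>])
    show "exists_loc E ?J ?OX (\<lambda>e U. mem E U (S \<cdot> e))" by (rule X.is_net_inhabited[OF net S])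
  next
    fix h U W assume h: "h \<in> Arr E" "tgt E h = ?J" and U: "U \<in> hom E (src E h) ?OX" and W: "W \<in> hom E (src E h) ?OX"
      and m: "mem E U (S \<cdot> h)" "mem E W (S \<cdot> h)"
    obtain e Z where e: "epi E e" "e \<in> Arr E" "tgt E e = src E h" "Z \<in> Arr E" "src E Z = src E e" "tgt E Z = ?OX"
      "mem E Z (S \<cdot> h \<cdot> e) \<and> leq E X (U \<cdot> e) Z \<and> leq E X (W \<cdot> e) Z"
      by (rule exists_locE[OF X.is_net_directed[OF net S h U W m]]) (rule that)
    have he: "h \<cdot> e \<in> Arr E" "tgt E (h \<cdot> e) = ?J" "src E (h \<cdot> e) = src E e" using h e by simp_all
    have step: "leq E Y (?\<phi> \<cdot> pair E (h \<cdot> e) (T \<cdot> e)) (?\<phi> \<cdot> pair E (h \<cdot> e) Z)"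
      if T: "T \<in> hom E (src E h) ?OX" and TZ: "leq E X (T \<cdot> e) Z" for T
    proof -
      have "leq E Y (join E Y (?b \<cdot> (h \<cdot> e)) (j \<cdot> (T \<cdot> e))) (join E Y (?b \<cdot> (h \<cdot> e)) (j \<cdot> Z))"
        by (rule Y.join_mono[where I="src E e", OF Y.leq_refl j_mono[OF TZ, of "src E e"]]) (use T b h e(1-6) in simp_all)
      then show ?thesis using \<phi>_pair[OF he(1,2), of "T \<cdot> e"] \<phi>_pair[OF he(1,2), of Z] T he e(1-6) by simp
    qed
    show "exists_loc E (src E h) ?OX (\<lambda>e Z. mem E Z (S \<cdot> (h \<cdot> e)) \<and>
        leq E Y (?\<phi> \<cdot> pair E (h \<cdot> e) (U \<cdot> e)) (?\<phi> \<cdot> pair E (h \<cdot> e) Z) \<and>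
        leq E Y (?\<phi> \<cdot> pair E (h \<cdot> e) (W \<cdot> e)) (?\<phi> \<cdot> pair E (h \<cdot> e) Z))"
    proof (rule exists_locI[OF e(1,3-6)], intro conjI)
      show "mem E Z (S \<cdot> (h \<cdot> e))" using e S h by simp
      show "leq E Y (?\<phi> \<cdot> pair E (h \<cdot> e) (U \<cdot> e)) (?\<phi> \<cdot> pair E (h \<cdot> e) Z)" by (rule step[OF U]) (use e in simp)
      show "leq E Y (?\<phi> \<cdot> pair E (h \<cdot> e) (W \<cdot> e)) (?\<phi> \<cdot> pair E (h \<cdot> e) Z)" by (rule step[OF W]) (use e in simp)
    qed
  next
    fix t assume t: "t \<in> hom E ?J ?OY" and all: "\<And>h U. h \<in> Arr E \<Longrightarrow> tgt E h = ?J \<Longrightarrow> U \<in> hom E (src E h) ?OX \<Longrightarrow>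
        mem E U (S \<cdot> h) \<Longrightarrow> leq E Y (?\<phi> \<cdot> pair E h U) (t \<cdot> h)"
    have both: "leq E Y (?b \<cdot> h) (t \<cdot> h) \<and> leq E Y (j \<cdot> U) (t \<cdot> h)"
      if "h \<in> Arr E" "tgt E h = ?J" "U \<in> hom E (src E h) ?OX" "mem E U (S \<cdot> h)" for h U
    proof -
      have "leq E Y (join E Y (?b \<cdot> h) (j \<cdot> U)) (t \<cdot> h)" using all[OF that] \<phi>_pair[OF that(1-3)] by simp
      moreover have "?b \<cdot> h \<in> hom E (src E h) ?OY" "j \<cdot> U \<in> hom E (src E h) ?OY" "t \<cdot> h \<in> hom E (src E h) ?OY"
        using that b t by simp_all
      ultimately show ?thesis using Y.join_leq_iff by blast
    qed
    have bt: "leq E Y ?b t"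
    proof -
      obtain e U where e: "epi E e" "e \<in> Arr E" "tgt E e = ?J" "U \<in> Arr E" "src E U = src E e" "tgt E U = ?OX" "mem E U (S \<cdot> e)"
        by (rule exists_locE[OF X.is_net_inhabited[OF net S]]) (rule that)
      have "leq E Y (?b \<cdot> e) (t \<cdot> e)" using both[of e U] e by simp
      then show ?thesis by (rule Y.leq_local[OF _ e(1) b t e(3)])
    qed
    have "leq E X (Join E X S) (f \<cdot> t)"
    proof (rule X.Join_least[OF S])
      fix h U assume h: "h \<in> Arr E" "tgt E h = ?J" "U \<in> hom E (src E h) ?OX" "mem E U (S \<cdot> h)"
      have "leq E X U (f \<cdot> (t \<cdot> h))" using both[OF h] j_leq_iff[of U "src E h" "t \<cdot> h"] h t by simp
      then show "leq E X U ((f \<cdot> t) \<cdot> h)" using h t by simp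
    qed (use t in simp)
    then have 1: "leq E X (whole E X ?J) (f \<cdot> t)"
      by - (rule X.leq_trans[where I="?J" and v="Join E X S"], use cov g S t in simp_all)
    have "leq E X (f \<cdot> (c \<cdot> bang E ?J)) (f \<cdot> t)"
      by (rule X.leq_trans[where I="?J" and v="whole E X ?J", OF X.leq_whole 1]) (use J t in simp_all)
    then have "leq E Y (j \<cdot> (f \<cdot> (c \<cdot> bang E ?J))) t" using j_leq_iff[of "f \<cdot> (c \<cdot> bang E ?J)" ?J t] J t by simp
    then have 2: "leq E Y (meet E Y (c \<cdot> bang E ?J) (c \<cdot> bang E ?J)) t"
      using jf[of "c \<cdot> bang E ?J" ?J] J by simp
    have 3: "leq E Y (c \<cdot> bang E ?J) (meet E Y (c \<cdot> bang E ?J) (c \<cdot> bang E ?J))"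
      by (rule Y.meet_greatest[where I="?J"]) (use J in simp_all)
    have ct: "leq E Y (c \<cdot> bang E ?J) t"
      by (rule Y.leq_trans[OF 3 2, where I="?J"]) (use J t in simp_all)
    show "leq E Y (whole E Y ?J) t"
      by (rule Y.leq_if_covers[OF bc Y.meet_leq2[OF bt] Y.meet_leq2[OF ct]]) (use J b t in simp_all)
  qed (use J in simp_all)
  then obtain e U where e: "epi E e" "e \<in> Arr E" "tgt E e = ?J" "U \<in> Arr E" "src E U = src E e" "tgt E U = ?OX"
    "mem E U (S \<cdot> e) \<and> leq E Y (whole E Y ?J \<cdot> e) (?\<phi> \<cdot> pair E e U)"
    by (rule exists_locE) (rule that)
  let ?K = "src E e"
  have be: "?b \<cdot> e \<in> hom E ?K ?OY" and jU: "j \<cdot> U \<in> hom E ?K ?OY" using a g e by simp_all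
  have "leq E Y (whole E Y ?K) (join E Y (?b \<cdot> e) (j \<cdot> U))"
    using e(7) \<phi>_pair[of e U] e(1-6) by simp
  then have "Y.covers (?b \<cdot> e) (j \<cdot> U)" using be by (simp add: Y.covers_def)
  then have "leq E Y (neg E Y (?b \<cdot> e)) (j \<cdot> U)"
    by (rule Y.leq_if_covers[OF _ Y.meet_neg_leq(1) Y.meet_lower(2)]) (use be jU in simp_all)
  then have "leq E X (f \<cdot> neg E Y (?b \<cdot> e)) (f \<cdot> (j \<cdot> U))" by (rule f_mono[where I="?K"]) (use be jU in simp_all)
  then have "leq E X ((f \<cdot> neg E Y a) \<cdot> g \<cdot> e) U" using a g e(1-6) by simp
  then show "exists_loc E ?J ?OX (\<lambda>e U. mem E U (S \<cdot> e) \<and> leq E X ((f \<cdot> neg E Y a) \<cdot> g \<cdot> e) U)"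
    by - (rule exists_locI[OF e(1,3-6)], use e(7) in simp)
qed (use a in simp)

text \<open>
  If \<open>v\<close> contains the point, then so does some \<open>a\<close> rather below \<open>v\<close>. The complement of \<open>a\<close> covers together
  with \<open>v\<close>, and its restriction to \<open>X\<close> is way below the whole.
\<close>

lemma omega_if_p:
  assumes "holds E (p \<cdot> v)" and v: "v \<in> hom E I (opens Y)"
  shows "omega E X (f \<cdot> v)"
proof -
  have I: "I \<in> Ob E" using v by auto
  let ?C = "\<lambda>h. omega E X (f \<cdot> (v \<cdot> h))"
  have "?C (ident E I)"
  proof (rule p_regular_elim[OF regular assms, where C="?C"])
    have n: "natural I (opens X) (\<lambda>h. f \<cdot> (v \<cdot> h))"
      by (rule natural_comp[OF natural_comp[OF natural_id]]) (use v I in simp_all)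
    show "representable I ?C" by (rule representable_subst[OF X.representable_omega n])
    fix h a assume h: "h \<in> Arr E" "tgt E h = I" and a: "a \<in> hom E (src E h) (opens Y)"
      and rb: "rather_below E Y a (v \<cdot> h)" and pa: "holds E (p \<cdot> a)"
    have vh: "v \<cdot> h \<in> hom E (src E h) (opens Y)" using v h by simp
    have "Y.covers (neg E Y a) (v \<cdot> h)" using Y.rather_below_iff[OF a vh] rb by blast
    then have "Y.covers (v \<cdot> h) (neg E Y a)" by (rule Y.covers_commute) (use a vh in simp_all)
    then have "X.covers (f \<cdot> (v \<cdot> h)) (f \<cdot> neg E Y a)" by (rule f_covers) (use a vh in simp_all)
    then show "?C h" by (rule X.omegaI[OF way_below_f_neg[OF pa a]]) (use a vh in simp_all)
  qed
  then show ?thesis using v I by simp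
qed

text \<open>
  Conversely the complement of an open way below the whole of \<open>X\<close> is a neighbourhood of the
  point: such an open is contained in one that is rather below \<open>c\<close>, as these form an ideal with
  supremum \<open>X\<close>.
\<close>

lemma p_neg_j:
  assumes wb: "way_below E X W (whole E X I)" and W: "W \<in> hom E I (opens X)"
  shows "holds E (p \<cdot> neg E Y (j \<cdot> W))"
proof -
  have I: "I \<in> Ob E" using W by auto
  let ?OX = "opens X" and ?OY = "opens Y"
  let ?Q = "\<lambda>x U. rather_below E Y (j \<cdot> U) (c \<cdot> bang E (src E U))"
  have "exists_loc E I ?OX (\<lambda>e U. ?Q e U \<and> leq E X (W \<cdot> e) U)"
  proof (rule X.way_below_ideal[where Q="?Q", OF wb W])
    have "representable ?OX (\<lambda>U. rather_below E Y (j \<cdot> U) (c \<cdot> bang E (src E U)))"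
      by (rule Y.representable_rather_below natural_const natural_id natural_comp | simp)+
    then show "representable (Prod E I ?OX) (\<lambda>z. ?Q (pr1 E I ?OX \<cdot> z) (pr2 E I ?OX \<cdot> z))"
      by (rule representable_subst) (rule natural_pr2 natural_id | use I in simp)+
    have "leq E Y (j \<cdot> empty E X I) (empty E Y I)"
      using j_leq_iff[of "empty E X I" I "empty E Y I"] I by simp
    then show "?Q (ident E I) (empty E X I)"
      by - (rule Y.rather_below_mono[where I=I and u="empty E Y I" and v="c \<cdot> bang E I", OF Y.rather_below_empty],
        use I in simp_all)
  next
    fix g a b assume g: "g \<in> Arr E" "tgt E g = I" and a: "a \<in> hom E (src E g) ?OX" and b: "b \<in> hom E (src E g) ?OX"
      and Qa: "?Q g a" and Qb: "?Q g b"
    let ?J = "src E g"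
    have J: "?J \<in> Ob E" using g by simp
    let ?ab = "join E Y (j \<cdot> a) (j \<cdot> b)"
    have ja: "leq E Y (j \<cdot> a) ?ab" and jb: "leq E Y (j \<cdot> b) ?ab" using a b by simp_all
    have "leq E X a (f \<cdot> ?ab)" using ja j_leq_iff[of a ?J ?ab] a b by simp
    moreover have "leq E X b (f \<cdot> ?ab)" using jb j_leq_iff[of b ?J ?ab] a b by simp
    ultimately have "leq E X (join E X a b) (f \<cdot> ?ab)" by (rule X.join_least[where I="?J"]) (use a b in simp_all)
    then have le: "leq E Y (j \<cdot> join E X a b) ?ab" using j_leq_iff[of "join E X a b" ?J ?ab] a b by simp
    have "rather_below E Y ?ab (c \<cdot> bang E ?J)"
      by (rule Y.rather_below_join[where I="?J"]) (use Qa Qb a b J in simp_all)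
    then have "rather_below E Y (j \<cdot> join E X a b) (c \<cdot> bang E ?J)"
      by (rule Y.rather_below_mono[OF _ le, where I="?J"]) (use a b J in simp_all)
    then show "?Q g (join E X a b)" using a b by simp
  next
    fix t assume t: "t \<in> hom E I ?OX" and all: "\<And>h a. h \<in> Arr E \<Longrightarrow> tgt E h = I \<Longrightarrow> a \<in> hom E (src E h) ?OX \<Longrightarrow> ?Q h a \<Longrightarrow> leq E X a (t \<cdot> h)"
    have cI: "c \<cdot> bang E I \<in> hom E I ?OY" and jt: "j \<cdot> t \<in> hom E I ?OY" using I t by simp_all
    have "leq E Y (c \<cdot> bang E I) (j \<cdot> t)"
    proof (rule Y.regular_leqI[OF regular cI jt])
      fix h a assume h: "h \<in> Arr E" "tgt E h = I" and a: "a \<in> hom E (src E h) ?OY" and rb: "rather_below E Y a ((c \<cdot> bang E I) \<cdot> h)"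
      let ?J = "src E h"
      have J: "?J \<in> Ob E" using h by simp
      have rb': "rather_below E Y a (c \<cdot> bang E ?J)" using rb h I by simp
      have ac: "leq E Y a (c \<cdot> bang E ?J)" by (rule Y.rather_below_leq[OF rb' a]) (use J in simp)
      have "rather_below E Y (j \<cdot> (f \<cdot> a)) (c \<cdot> bang E ?J)"
        by (rule Y.rather_below_mono[OF rb' j_f_leq[OF a], where I="?J"]) (use a J in simp_all)
      then have "leq E X (f \<cdot> a) (t \<cdot> h)" by - (rule all, use h a in simp_all)
      then have "leq E Y (meet E Y a (c \<cdot> bang E ?J)) (j \<cdot> (t \<cdot> h))"
        using f_leq_iff[of "t \<cdot> h" ?J a] a t h by simp
      then have "leq E Y a (j \<cdot> (t \<cdot> h))"
        by - (rule Y.leq_trans[where I="?J", OF Y.meet_greatest[where I="?J", OF Y.leq_refl ac]], use a t h J in simp_all)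
      then show "leq E Y a ((j \<cdot> t) \<cdot> h)" using t h by simp
    qed
    then have "leq E X (f \<cdot> (c \<cdot> bang E I)) (f \<cdot> (j \<cdot> t))" by (rule f_mono[OF _ cI jt])
    then have 1: "leq E X (f \<cdot> (c \<cdot> bang E I)) t" using t by simp
    show "leq E X (whole E X I) t" by (rule X.leq_trans[OF f_c 1, where I=I]) (use I t in simp_all)
  qed (use I in simp)
  then obtain e U where e: "epi E e" "e \<in> Arr E" "tgt E e = I" "U \<in> Arr E" "src E U = src E e" "tgt E U = ?OX"
    "?Q e U \<and> leq E X (W \<cdot> e) U"
    by (rule exists_locE) (rule that)
  let ?J = "src E e"
  have J: "?J \<in> Ob E" using e by simp
  let ?n = "neg E Y (j \<cdot> U)"
  have n: "?n \<in> hom E ?J ?OY" and cJ: "c \<cdot> bang E ?J \<in> hom E ?J ?OY" and jU: "j \<cdot> U \<in> hom E ?J ?OY" using e J by simp_all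
  have "rather_below E Y (j \<cdot> U) (c \<cdot> bang E ?J)" using e by simp
  then have "Y.covers ?n (c \<cdot> bang E ?J)" unfolding Y.rather_below_iff[OF jU cJ] .
  then have "join E Y ?n (c \<cdot> bang E ?J) = whole E Y ?J" unfolding Y.covers_iff[OF n cJ] .
  then have pj: "holds E (p \<cdot> join E Y ?n (c \<cdot> bang E ?J))" using holds_p_whole[OF J] by simp
  let ?C = "\<lambda>g. holds E (p \<cdot> (?n \<cdot> g))"
  have rep: "representable ?J ?C"
    by (rule representable_holds, rule natural_comp[OF natural_comp[OF natural_id]]) (use e J in simp_all)
  have "?C (ident E ?J)"
  proof (rule p_join_elim[OF pj n cJ rep])
    fix g assume g: "g \<in> Arr E" "tgt E g = ?J" and "holds E (p \<cdot> ((c \<cdot> bang E ?J) \<cdot> g))"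
    then have "holds E (p \<cdot> (c \<cdot> bang E (src E g)))" using J by simp
    moreover have "representable (src E g) (\<lambda>h. holds E (p \<cdot> ((?n \<cdot> g) \<cdot> h)))"
      by (rule representable_holds, rule natural_comp[OF natural_comp[OF natural_id]]) (use e g in simp_all)
    ultimately have "holds E (p \<cdot> ((?n \<cdot> g) \<cdot> ident E (src E g)))"
      by - (rule not_p_c[where C="\<lambda>h. holds E (p \<cdot> ((?n \<cdot> g) \<cdot> h))"], use g in simp_all)
    then show "?C g" using e g by simp
  qed simp
  then have pn: "holds E (p \<cdot> ?n)" using n J by simp
  have We: "W \<cdot> e \<in> hom E ?J ?OX" using W e by simp
  have "leq E Y (j \<cdot> (W \<cdot> e)) (j \<cdot> U)" by (rule j_mono[OF _ We]) (use e in simp_all)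
  then have "leq E Y ?n (neg E Y (j \<cdot> (W \<cdot> e)))" by (rule Y.neg_antimono[where I="?J"]) (use We jU in simp_all)
  then have "holds E (p \<cdot> neg E Y (j \<cdot> (W \<cdot> e)))" by (rule holds_p_mono[OF pn _ n]) (use We in simp)
  then have "holds E ((p \<cdot> neg E Y (j \<cdot> W)) \<cdot> e)" using W e by simp
  then show ?thesis by (rule holds_local[OF _ e(1)]) (use W e in simp_all)
qed

text \<open>
  If \<open>U\<close> and \<open>W\<close> cover \<open>X\<close> with \<open>W\<close> way below the whole, then the complement of \<open>W\<close> in \<open>Y\<close> restricts to an open
  below \<open>U\<close> and therefore lies below \<open>v\<close>. It contains the point by the previous lemma.
\<close>

lemma p_if_omega:
  assumes om: "omega E X U" and U: "U \<in> hom E I (opens X)" and v: "v \<in> hom E I (opens Y)"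
    and le: "\<And>h a. h \<in> Arr E \<Longrightarrow> tgt E h = I \<Longrightarrow> a \<in> hom E (src E h) (opens Y) \<Longrightarrow> leq E X (f \<cdot> a) (U \<cdot> h) \<Longrightarrow> leq E Y a (v \<cdot> h)"
  shows "holds E (p \<cdot> v)"
proof -
  obtain e W where e: "epi E e" "e \<in> Arr E" "tgt E e = I" "W \<in> hom E (src E e) (opens X)"
    "way_below E X W (whole E X (src E e))" "X.covers (U \<cdot> e) W"
    by (rule X.omegaE[OF om U]) (rule that)
  let ?J = "src E e" and ?n = "neg E Y (j \<cdot> W)"
  have J: "?J \<in> Ob E" and n: "?n \<in> hom E ?J (opens Y)" and jW: "j \<cdot> W \<in> hom E ?J (opens Y)" and Ue: "U \<cdot> e \<in> hom E ?J (opens X)"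
    using e U by simp_all
  have "leq E X (f \<cdot> meet E Y ?n (j \<cdot> W)) (f \<cdot> (j \<cdot> (U \<cdot> e)))"
    by (rule f_mono[where I="?J", OF Y.meet_neg_leq(1)[where I="?J"]]) (use jW n Ue in simp_all)
  then have 1: "leq E X (meet E X (f \<cdot> ?n) W) (U \<cdot> e)" using f_meet[OF n jW] e(4) Ue by simp
  have "leq E X (f \<cdot> ?n) (U \<cdot> e)"
    by (rule X.leq_if_covers[OF e(6) X.meet_lower(2) 1]) (use e(4) Ue n in simp_all)
  then have nv: "leq E Y ?n (v \<cdot> e)" by (rule le[OF e(2,3) n])
  have "holds E (p \<cdot> (v \<cdot> e))" by (rule holds_p_mono[OF p_neg_j[OF e(5,4)] nv n]) (use v e in simp)
  then have "holds E ((p \<cdot> v) \<cdot> e)" using v e by simp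
  then show ?thesis by (rule holds_local[OF _ e(1)]) (use v e in simp_all)
qed

text \<open>
  A pair \<open>(U, q)\<close> with \<open>q \<Rightarrow> omega U\<close> comes from the largest open whose components lie below \<open>U\<close> and
  \<open>q\<close>. It restricts to \<open>U\<close> as it contains \<open>j U\<close>, and it contains the point if \<open>q\<close> holds by the
  previous lemma. As the stage is arbitrary, the open depends naturally on the pair.
\<close>

lemma glue:
  assumes U: "U \<in> hom E A (opens X)" and q: "q \<in> hom E A (Om E)"
    and om: "\<And>g. g \<in> Arr E \<Longrightarrow> tgt E g = A \<Longrightarrow> holds E (q \<cdot> g) \<Longrightarrow> omega E X (U \<cdot> g)"
  obtains V where "V \<in> hom E A (opens Y)" "f \<cdot> V = U" "p \<cdot> V = q"
proof -
  have A: "A \<in> Ob E" using U by auto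
  let ?OY = "opens Y" and ?T = "truth_frame E"
  let ?C = "Prod E A ?OY"
  let ?Q = "\<lambda>x a. leq E X (f \<cdot> a) (U \<cdot> x) \<and> leq E ?T (p \<cdot> a) (q \<cdot> x)"
  have n: "natural ?C A (\<lambda>z. pr1 E A ?OY \<cdot> z)" "natural ?C ?OY (\<lambda>z. pr2 E A ?OY \<cdot> z)"
    by (rule natural_pr1 natural_pr2 natural_id | use A in simp)+
  have n2: "natural ?C (opens X) (\<lambda>z. f \<cdot> (pr2 E A ?OY \<cdot> z))" "natural ?C (opens X) (\<lambda>z. U \<cdot> (pr1 E A ?OY \<cdot> z))"
    "natural ?C (opens ?T) (\<lambda>z. p \<cdot> (pr2 E A ?OY \<cdot> z))" "natural ?C (opens ?T) (\<lambda>z. q \<cdot> (pr1 E A ?OY \<cdot> z))"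
    by (rule natural_comp[OF n(1)] natural_comp[OF n(2)]; use U q in simp)+
  have rep: "representable ?C (\<lambda>z. ?Q (pr1 E A ?OY \<cdot> z) (pr2 E A ?OY \<cdot> z))"
    by (rule representable_conj[OF X.representable_leq[OF n2(1,2)] P.X.representable_leq[OF n2(3,4)]])
  obtain S where S: "S \<in> hom E A (Pow E ?OY)" "is_sup E Y ?Q (Join E Y S)"
    by (rule Y.sup_exists[where Q="?Q", OF rep A]) (rule that)
  let ?V = "Join E Y S"
  have V: "?V \<in> hom E A ?OY" using S by simp
  \<comment> \<open>That \<open>f\<close> preserves this supremum is again the adjunction, here with \<open>c \<Rightarrow> j U\<close>.\<close>
  have "leq E Y ?V (impl E Y (c \<cdot> bang E A) (j \<cdot> U))"
  proof (rule Y.is_sup_here[OF S(2) V])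
    fix h a assume h: "h \<in> Arr E" "tgt E h = A" and a: "a \<in> hom E (src E h) ?OY" and Q: "?Q h a"
    let ?J = "src E h"
    have J: "?J \<in> Ob E" using h by simp
    have "leq E Y (meet E Y a (c \<cdot> bang E ?J)) (j \<cdot> (U \<cdot> h))"
      using f_leq_iff[of "U \<cdot> h" ?J a] Q U h a by simp
    then have "leq E Y a (impl E Y (c \<cdot> bang E ?J) (j \<cdot> (U \<cdot> h)))"
      using Y.leq_impl_iff[of "c \<cdot> bang E ?J" ?J "j \<cdot> (U \<cdot> h)" a] U h a J by simp
    then show "leq E Y a (impl E Y (c \<cdot> bang E A) (j \<cdot> U) \<cdot> h)" using U h A by simp
  qed (use U A in simp)
  then have fV_leq: "leq E X (f \<cdot> ?V) U"
    using Y.leq_impl_iff[of "c \<cdot> bang E A" A "j \<cdot> U" ?V] f_leq_iff[OF U V] U V A by simp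
  have pV_leq: "leq E ?T (p \<cdot> ?V) q"
    by (rule P.f_sup_leq[OF S(2) V]) (use q in simp_all)
  have upper: "leq E Y a (?V \<cdot> h)" if "h \<in> Arr E" "tgt E h = A" "a \<in> hom E (src E h) ?OY" "?Q h a" for h a
    by (rule Y.is_sup_upper[OF S(2) V that(4)]) (use that in simp_all)
  have fV: "f \<cdot> ?V = U"
  proof (rule X.leq_antisym[OF fV_leq])
    have pj: "leq E ?T (p \<cdot> (j \<cdot> U)) q"
    proof (rule P.X.leq_trans[where I=A])
      show "leq E ?T (p \<cdot> (j \<cdot> U)) (p \<cdot> (c \<cdot> bang E A))" by (rule P.f_mono[OF j_leq_c[OF U]]) (use U A in simp_all)
      show "leq E ?T (p \<cdot> (c \<cdot> bang E A)) q" by (rule p_c_leq[OF q])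
    qed (use U q A in simp_all)
    have "leq E Y (j \<cdot> U) (?V \<cdot> ident E A)" by (rule upper) (use U q A pj in simp_all)
    then show "leq E X U (f \<cdot> ?V)" using j_leq_iff[OF U V] V by simp
  qed (use U V in simp_all)
  have pV: "p \<cdot> ?V = q"
  proof (rule P.X.leq_antisym[OF pV_leq])
    show "leq E ?T q (p \<cdot> ?V)"
    proof (rule leq_truthI[OF q])
      fix g assume g: "g \<in> Arr E" "tgt E g = A" and qg: "holds E (q \<cdot> g)"
      have Vg: "?V \<cdot> g \<in> hom E (src E g) ?OY" using V g by simp
      have "holds E (p \<cdot> (?V \<cdot> g))"
      proof (rule p_if_omega[OF om[OF g qg] _ Vg])
        fix h a assume h: "h \<in> Arr E" "tgt E h = src E g" and a: "a \<in> hom E (src E h) ?OY" and le: "leq E X (f \<cdot> a) ((U \<cdot> g) \<cdot> h)"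
        have "leq E ?T (p \<cdot> a) (q \<cdot> (g \<cdot> h))"
        proof (rule leq_truthI[of _ "src E h"])
          fix k assume k: "k \<in> Arr E" "tgt E k = src E h"
          have "holds E ((q \<cdot> g) \<cdot> (h \<cdot> k))" by (rule holds_cmp[OF qg]) (use q g h k in simp_all)
          then show "holds E ((q \<cdot> (g \<cdot> h)) \<cdot> k)" using q g h k by simp
        qed (use a q g h in simp_all)
        then have "leq E Y a (?V \<cdot> (g \<cdot> h))" by - (rule upper, use a U g h le in simp_all)
        then show "leq E Y a ((?V \<cdot> g) \<cdot> h)" using V g h by simp
      qed (use U g in simp)
      then show "holds E ((p \<cdot> ?V) \<cdot> g)" using V g by simp
    qed (use V in simp)
  qed (use q V in simp_all)
  show ?thesis by (rule that[OF V fV pV])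
qed

end

section \<open>Uniqueness of the one-point compactification\<close>

text \<open>
  A one-point compactification in the sense of the definition gives the above data: the open sublocale is
  the frame of opens below \<open>c\<close>, and \<open>j\<close> is its inclusion composed with the inverse of \<open>k\<close>.
\<close>

lemma compactification_incl:
  fixes E (structure)
  assumes "elementary_topos E" "is_frame E X" "one_point_compactification E X Y p k"
  obtains j where "compactification E Y p X (incl E Y p k) j"
proof -
  interpret elementary_topos E by fact
  have opc: "is_frame E Y" "compact E Y" "regular E Y" "is_point E Y p"
    "frame_iso E (open_sublocale E Y (pt_compl E Y p)) X k"
    using assms(3) unfolding one_point_compactification_def by blast+
  interpret X: internal_frame E X by (rule internal_frameI[OF assms(1,2)])
  interpret Y: internal_frame E Y by (rule internal_frameI[OF assms(1) opc(1)])
  interpret T: internal_frame E "truth_frame E" by (rule truth_internal_frame)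
  interpret pointed_locale E Y p
    by unfold_locales (use opc(4) in \<open>simp add: is_point_def\<close>)
  have c: "c \<in> hom E (One E) (opens Y)" by simp
  note rep = Y.below_incl_rep[OF c]
  let ?m = "below_incl E Y c" and ?Z = "open_sublocale E Y c" and ?r = "open_restr E Y c"
  have m: "mono E ?m" "tgt E ?m = opens Y" "?m \<in> Arr E" using compr_arr[OF rep] by (simp_all add: below_incl_def)
  have Z: "?Z = subframe E Y ?m" by (simp add: open_sublocale_def)
  have oZ: "opens ?Z = src E ?m" by (simp add: Z)
  have r: "?r \<in> hom E (opens Y) (src E ?m)" "?m \<cdot> ?r = meet E Y (ident E (opens Y)) (c \<cdot> bang E (opens Y))"
    using Y.open_restr_props[OF c] by blast+
  obtain n where k: "frame_hom E ?Z X k" and n: "frame_hom E X ?Z n" and kn: "k \<cdot> n = ident E (opens X)"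
    and nk: "n \<cdot> k = ident E (opens ?Z)"
    using opc(5) unfolding frame_iso_def by blast
  have "is_frame E ?Z" using k by (simp add: frame_hom_def)
  then interpret Z: internal_frame E ?Z by (rule internal_frameI[OF assms(1)])
  interpret k: frame_morphism E ?Z X k by unfold_locales (rule k)
  interpret n: frame_morphism E X ?Z n by unfold_locales (rule n)
  have mr: "?m \<cdot> (?r \<cdot> V) = meet E Y V (c \<cdot> bang E I)" if "V \<in> hom E I (opens Y)" for V I
    using cmp_reassoc[OF r(2), of V] m r(1) that by auto
  have m_leq: "leq E Y (?m \<cdot> x) (c \<cdot> bang E I)" if "x \<in> hom E I (src E ?m)" for x I
    using compr_sat[OF rep, of x] that m by (simp add: below_incl_def)
  have rm: "?r \<cdot> (?m \<cdot> x) = x" if x: "x \<in> hom E I (src E ?m)" for x I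
  proof (rule monoD[OF m(1)])
    have I: "I \<in> Ob E" using x by auto
    have mx: "?m \<cdot> x \<in> hom E I (opens Y)" using m x by simp
    have "meet E Y (?m \<cdot> x) (c \<cdot> bang E I) = ?m \<cdot> x"
    proof (rule Y.leq_antisym[where I=I])
      show "leq E Y (?m \<cdot> x) (meet E Y (?m \<cdot> x) (c \<cdot> bang E I))"
        by (rule Y.meet_greatest[OF Y.leq_refl m_leq[OF x]]) (use mx I in simp_all)
    qed (use mx I in simp_all)
    then show "?m \<cdot> (?r \<cdot> (?m \<cdot> x)) = ?m \<cdot> x" using mr[OF mx] by simp
  qed (use m r(1) x in simp_all)
  have knx: "k \<cdot> (n \<cdot> x) = x" if "x \<in> Arr E" "tgt E x = opens X" for x
    using cmp_reassoc[OF kn, of x] that by simp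
  have nkx: "n \<cdot> (k \<cdot> x) = x" if "x \<in> Arr E" "tgt E x = src E ?m" for x
    using cmp_reassoc[OF nk, of x] that by (simp add: oZ)
  let ?f = "incl E Y p k" and ?j = "?m \<cdot> n"
  have f: "?f \<in> hom E (opens Y) (opens X)" unfolding incl_def using r(1) by (simp add: oZ)
  have fV: "?f \<cdot> V = k \<cdot> (?r \<cdot> V)" if "V \<in> Arr E" "tgt E V = opens Y" for V
    unfolding incl_def using r(1) that by (simp add: oZ)
  have j: "?j \<in> hom E (opens X) (opens Y)" using m by (simp add: oZ)
  have jU: "?j \<cdot> U = ?m \<cdot> (n \<cdot> U)" if "U \<in> Arr E" "tgt E U = opens X" for U
    using m that by (simp add: oZ)
  note sub = Y.subframe(2)[OF m(1,2), folded Z]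
  show ?thesis
  proof (rule that[of ?j], unfold_locales)
    show "?f \<cdot> (?j \<cdot> U) = U" if U: "U \<in> hom E I (opens X)" for U I
    proof -
      have nU: "n \<cdot> U \<in> hom E I (src E ?m)" using U by (simp add: oZ)
      show ?thesis using jU[of U] fV[of "?m \<cdot> (n \<cdot> U)"] rm[OF nU] knx[of U] nU U m by simp
    qed
    show "?j \<cdot> (?f \<cdot> V) = meet E Y V (c \<cdot> bang E I)" if V: "V \<in> hom E I (opens Y)" for V I
      using jU[of "?f \<cdot> V"] fV[of V] nkx[of "?r \<cdot> V"] mr[OF V] V f r(1) by (simp add: oZ)
    show "leq E X (?f \<cdot> V) (?f \<cdot> W)" if le: "leq E Y V W" and V: "V \<in> hom E I (opens Y)" and W: "W \<in> hom E I (opens Y)" for V W I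
    proof -
      have I: "I \<in> Ob E" using V by auto
      have rV: "?r \<cdot> V \<in> hom E I (src E ?m)" and rW: "?r \<cdot> W \<in> hom E I (src E ?m)" using r(1) V W by simp_all
      have "leq E Y (meet E Y V (c \<cdot> bang E I)) (meet E Y W (c \<cdot> bang E I))"
        by (rule Y.meet_mono[OF le Y.leq_refl]) (use V W I in simp_all)
      then have "leq E ?Z (?r \<cdot> V) (?r \<cdot> W)" unfolding sub[OF rV rW] mr[OF V] mr[OF W] .
      then have "leq E X (k \<cdot> (?r \<cdot> V)) (k \<cdot> (?r \<cdot> W))" by (rule k.f_mono[where I=I]) (use rV rW in \<open>simp_all add: oZ\<close>)
      then show ?thesis using fV[of V] fV[of W] V W by simp
    qed
    show "leq E Y (?j \<cdot> U) (?j \<cdot> W)" if le: "leq E X U W" and U: "U \<in> hom E I (opens X)" and W: "W \<in> hom E I (opens X)" for U W I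
    proof -
      have nU: "n \<cdot> U \<in> hom E I (src E ?m)" and nW: "n \<cdot> W \<in> hom E I (src E ?m)" using U W by (simp_all add: oZ)
      have "leq E ?Z (n \<cdot> U) (n \<cdot> W)" by (rule n.f_mono[OF le U W])
      then have "leq E Y (?m \<cdot> (n \<cdot> U)) (?m \<cdot> (n \<cdot> W))" unfolding sub[OF nU nW] .
      then show ?thesis using jU[of U] jU[of W] U W by simp
    qed
  qed (use opc f j in simp_all)
qed

context compactification
begin

lemma ext:
  assumes "u \<in> hom E I (opens Y)" "v \<in> hom E I (opens Y)" "f \<cdot> u = f \<cdot> v" "p \<cdot> u = p \<cdot> v"
  shows "u = v"
proof (rule Y.leq_antisym[OF _ _ assms(1,2)])
  have "leq E (truth_frame E) (p \<cdot> v) (p \<cdot> v)" "leq E X (f \<cdot> v) (f \<cdot> v)"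
    using P.X.leq_refl[of "p \<cdot> v"] assms(2) by simp_all
  then show "leq E Y u v" "leq E Y v u"
    using leq_iff[OF assms(1,2)] leq_iff[OF assms(2,1)] assms(3,4) by simp_all
qed

end

text \<open>
  The opens of \<open>Y'\<close> give a pair of a generic restriction to \<open>X\<close> and a generic value at the point, to which
  glueing in \<open>Y\<close> applies, and conversely. The resulting maps are inverse to each other because opens are
  determined by these two components.
\<close>

lemma unique_comparison:
  fixes E (structure)
  assumes "compactification E Y p X f j" "compactification E Y' p' X f' j'"
  shows "\<exists>!h. frame_iso E Y' Y h \<and> p \<cdot> h = p' \<and> f \<cdot> h = f'"
proof -
  interpret Y: compactification E Y p X f j by fact
  interpret Y': compactification E Y' p' X f' j' by fact
  obtain h where h: "h \<in> hom E (opens Y') (opens Y)" "f \<cdot> h = f'" "p \<cdot> h = p'"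
    by (rule Y.glue[OF Y'.f_hom, of p']) (use Y'.omega_if_p in simp_all)
  obtain g where g: "g \<in> hom E (opens Y) (opens Y')" "f' \<cdot> g = f" "p' \<cdot> g = p"
    by (rule Y'.glue[OF Y.f_hom, of p]) (use Y.omega_if_p in simp_all)
  have fh: "f \<cdot> (h \<cdot> x) = f' \<cdot> x" and ph: "p \<cdot> (h \<cdot> x) = p' \<cdot> x" if "x \<in> Arr E" "tgt E x = opens Y'" for x
    using Y.cmp_reassoc[OF h(2), of x] Y.cmp_reassoc[OF h(3), of x] h(1) that by simp_all
  have hg: "h \<cdot> g = ident E (opens Y)"
  proof (rule Y.ext[where I="opens Y"])
    show "f \<cdot> (h \<cdot> g) = f \<cdot> ident E (opens Y)" using fh[of g] g by simp
    show "p \<cdot> (h \<cdot> g) = p \<cdot> ident E (opens Y)" using ph[of g] g by simp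
  qed (use h(1) g(1) in simp_all)
  have "frame_iso E Y' Y h"
  proof (rule frame_iso_if_order_iso[OF _ _ h(1) g(1) hg])
    show "internal_poset E Y'" "internal_frame E Y" by unfold_locales
    show "leq E Y' u v \<longleftrightarrow> leq E Y (h \<cdot> u) (h \<cdot> v)" if u: "u \<in> hom E I (opens Y')" and v: "v \<in> hom E I (opens Y')" for I u v
      using Y'.leq_iff[OF u v] Y.leq_iff[of "h \<cdot> u" I "h \<cdot> v"] fh[of u] fh[of v] ph[of u] ph[of v] u v h(1) by simp
  qed
  moreover have "h' = h" if "frame_iso E Y' Y h' \<and> p \<cdot> h' = p' \<and> f \<cdot> h' = f'" for h'
  proof (rule Y.ext[where I="opens Y'"])
    show "h' \<in> hom E (opens Y') (opens Y)"
      using that unfolding frame_iso_def frame_hom_def by blast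
  qed (use that h in simp_all)
  ultimately show ?thesis using h by blast
qed

section \<open>The frame of pairs\<close>

context internal_frame
begin

abbreviation F where "F \<equiv> omega_frame E X"
abbreviation A where "A \<equiv> src E (omega_incl E X)"

lemma omega_incl_rep: "representable (Prod E (opens X) (Om E))
     (\<lambda>x. \<forall>g\<in>into E (src E x). holds E (pr2 E (opens X) (Om E) \<cdot> x \<cdot> g) \<longrightarrow>
        omega E X (pr1 E (opens X) (Om E) \<cdot> x \<cdot> g))"
proof -
  let ?C = "Prod E (opens X) (Om E)" and ?p = "pr1 E (opens X) (Om E)" and ?q = "pr2 E (opens X) (Om E)"
  have n: "natural ?C (opens X) (\<lambda>z. ?p \<cdot> z)" "natural ?C (Om E) (\<lambda>z. ?q \<cdot> z)"
    by (rule natural_pr1 natural_pr2 natural_id | simp)+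
  show ?thesis
    by (rule representable_cong[OF representable_imp[OF representable_holds[OF n(2)] representable_subst[OF representable_omega n(1)]]])
      simp
qed

lemma omega_incl_arr [simp]: "omega_incl E X \<in> Arr E" "tgt E (omega_incl E X) = Prod E (opens X) (Om E)"
  and mono_omega_incl: "mono E (omega_incl E X)"
  using compr_arr[OF omega_incl_rep] by (simp_all add: omega_incl_def)

lemma opens_F [simp]: "opens F = A"
  by (simp add: omega_frame_def)

lemma omega_fst_arr [simp]: "omega_fst E X \<in> Arr E" "src E (omega_fst E X) = A" "tgt E (omega_fst E X) = opens X"
  by (simp_all add: omega_fst_def)

lemma omega_snd_arr [simp]: "omega_snd E X \<in> Arr E" "src E (omega_snd E X) = A" "tgt E (omega_snd E X) = Om E"
  by (simp_all add: omega_snd_def)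

lemma omega_if_snd:
  assumes x: "x \<in> hom E I A" and "holds E (omega_snd E X \<cdot> x)"
  shows "omega E X (omega_fst E X \<cdot> x)"
proof -
  have I: "I \<in> Ob E" using x by auto
  let ?p = "pr1 E (opens X) (Om E)" and ?q = "pr2 E (opens X) (Om E)" and ?w = "omega_incl E X"
  have "\<forall>g\<in>into E (src E (?w \<cdot> x)). holds E (?q \<cdot> (?w \<cdot> x) \<cdot> g) \<longrightarrow> omega E X (?p \<cdot> (?w \<cdot> x) \<cdot> g)"
    using compr_sat[OF omega_incl_rep, folded omega_incl_def, of x] x by simp
  then have "holds E (?q \<cdot> (?w \<cdot> x) \<cdot> ident E I) \<longrightarrow> omega E X (?p \<cdot> (?w \<cdot> x) \<cdot> ident E I)"
    by (rule bspec) (use x I in simp)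
  then show ?thesis using assms I by (simp add: omega_fst_def omega_snd_def)
qed

text \<open>
  To give an element of the subobject at some stage is to give its two components; the implication has to
  hold at all later stages.
\<close>

lemma F_pair:
  assumes U: "U \<in> hom E I (opens X)" and q: "q \<in> hom E I (Om E)"
    and om: "\<And>g. g \<in> Arr E \<Longrightarrow> tgt E g = I \<Longrightarrow> holds E (q \<cdot> g) \<Longrightarrow> omega E X (U \<cdot> g)"
  obtains x where "x \<in> hom E I A" "omega_fst E X \<cdot> x = U" "omega_snd E X \<cdot> x = q"
proof -
  have "\<forall>g\<in>into E (src E (pair E U q)). holds E (pr2 E (opens X) (Om E) \<cdot> pair E U q \<cdot> g) \<longrightarrow>
        omega E X (pr1 E (opens X) (Om E) \<cdot> pair E U q \<cdot> g)"
    using U q om by simp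
  then obtain x where x: "x \<in> Arr E" "src E x = src E (pair E U q)" "tgt E x = A" "omega_incl E X \<cdot> x = pair E U q"
    unfolding omega_incl_def by - (rule compr_factor[OF omega_incl_rep, of "pair E U q"], use U q in simp_all)
  show ?thesis
    by (rule that[of x]) (use x U q in \<open>simp_all add: omega_fst_def omega_snd_def\<close>)
qed

lemma F_ext:
  assumes x: "x \<in> hom E I A" and y: "y \<in> hom E I A"
    and "omega_fst E X \<cdot> x = omega_fst E X \<cdot> y" "omega_snd E X \<cdot> x = omega_snd E X \<cdot> y"
  shows "x = y"
proof (rule monoD[OF mono_omega_incl])
  show "omega_incl E X \<cdot> x = omega_incl E X \<cdot> y"
    by (rule pair_ext[of _ _ "opens X" "Om E"]) (use assms in \<open>simp_all add: omega_fst_def omega_snd_def\<close>)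
qed (use x y in simp_all)

lemma F_poset: "internal_poset E F"
  and leq_F_iff: "x \<in> hom E I A \<Longrightarrow> y \<in> hom E I A \<Longrightarrow> leq E F x y \<longleftrightarrow>
      leq E X (omega_fst E X \<cdot> x) (omega_fst E X \<cdot> y) \<and> leq E (truth_frame E) (omega_snd E X \<cdot> x) (omega_snd E X \<cdot> y)"
proof -
  interpret T: internal_frame E "truth_frame E" by (rule truth_internal_frame)
  let ?R = "\<lambda>x y. leq E X (omega_fst E X \<cdot> x) (omega_fst E X \<cdot> y) \<and>
              leq E (truth_frame E) (omega_snd E X \<cdot> x) (omega_snd E X \<cdot> y)"
  have A: "A \<in> Ob E" by simp
  have n: "natural (Prod E A A) A (\<lambda>z. pr1 E A A \<cdot> z)" "natural (Prod E A A) A (\<lambda>z. pr2 E A A \<cdot> z)"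
    by (rule natural_pr1 natural_pr2 natural_id | simp)+
  have n2: "natural (Prod E A A) (opens X) (\<lambda>z. omega_fst E X \<cdot> (pr1 E A A \<cdot> z))"
    "natural (Prod E A A) (opens X) (\<lambda>z. omega_fst E X \<cdot> (pr2 E A A \<cdot> z))"
    "natural (Prod E A A) (opens (truth_frame E)) (\<lambda>z. omega_snd E X \<cdot> (pr1 E A A \<cdot> z))"
    "natural (Prod E A A) (opens (truth_frame E)) (\<lambda>z. omega_snd E X \<cdot> (pr2 E A A \<cdot> z))"
    by (rule natural_comp[OF n(1)] natural_comp[OF n(2)]; simp)+
  have rep: "representable (Prod E A A) (\<lambda>z. ?R (pr1 E A A \<cdot> z) (pr2 E A A \<cdot> z))"
    by (rule representable_conj[OF representable_leq[OF n2(1,2)] T.representable_leq[OF n2(3,4)]])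
  have le: "le F = rel E A ?R" by (simp add: omega_frame_def)
  have refl: "?R u u" if "u \<in> hom E J A" for J u
    using that T.leq_refl[of "omega_snd E X \<cdot> u"] by simp
  have trans: "?R u w" if ty: "u \<in> hom E J A" "v \<in> hom E J A" "w \<in> hom E J A" and uv: "?R u v" and vw: "?R v w" for J u v w
  proof
    show "leq E X (omega_fst E X \<cdot> u) (omega_fst E X \<cdot> w)"
      by (rule leq_trans[OF uv[THEN conjunct1] vw[THEN conjunct1], where I=J]) (use ty in simp_all)
    show "leq E (truth_frame E) (omega_snd E X \<cdot> u) (omega_snd E X \<cdot> w)"
      by (rule T.leq_trans[OF uv[THEN conjunct2] vw[THEN conjunct2], where I=J]) (use ty in simp_all)
  qed
  have antisym: "u = v" if ty: "u \<in> hom E J A" "v \<in> hom E J A" and uv: "?R u v" and vu: "?R v u" for J u v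
  proof (rule F_ext[OF ty])
    show "omega_fst E X \<cdot> u = omega_fst E X \<cdot> v"
      by (rule leq_antisym[OF uv[THEN conjunct1] vu[THEN conjunct1], where I=J]) (use ty in simp_all)
    show "omega_snd E X \<cdot> u = omega_snd E X \<cdot> v"
      by (rule T.leq_antisym[OF uv[THEN conjunct2] vu[THEN conjunct2], where I=J]) (use ty in simp_all)
  qed
  note P = rel_poset[where R="?R", OF opens_F le rep A refl trans antisym]
  show "internal_poset E F" by (rule P(1))
  show "x \<in> hom E I A \<Longrightarrow> y \<in> hom E I A \<Longrightarrow> leq E F x y \<longleftrightarrow> ?R x y" by (rule P(2))
qed

end

context compactification
begin

text \<open>
  The map \<open>v \<mapsto> (f v, p v)\<close> is well-defined, reflects the order and has a section by glueing.
\<close>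

lemma iso_to_pairs: "\<exists>i. frame_iso E Y (omega_frame E X) i \<and> omega_fst E X \<cdot> i = f \<and> omega_snd E X \<cdot> i = p"
proof -
  let ?F = "omega_frame E X" and ?fst = "omega_fst E X" and ?snd = "omega_snd E X" and ?A = "src E (omega_incl E X)"
  obtain i where i: "i \<in> hom E (opens Y) ?A" "?fst \<cdot> i = f" "?snd \<cdot> i = p"
    by (rule X.F_pair[OF f_hom, of p]) (use omega_if_p in simp_all)
  obtain V where V: "V \<in> hom E ?A (opens Y)" "f \<cdot> V = ?fst" "p \<cdot> V = ?snd"
  proof (rule glue[of ?fst ?A ?snd])
    show "omega E X (?fst \<cdot> g)" if "g \<in> Arr E" "tgt E g = ?A" "holds E (?snd \<cdot> g)" for g
      by (rule X.omega_if_snd[where I="src E g"]) (use that in simp_all)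
  qed simp_all
  have fV: "f \<cdot> (V \<cdot> x) = ?fst \<cdot> x" and pV: "p \<cdot> (V \<cdot> x) = ?snd \<cdot> x" if "x \<in> Arr E" "tgt E x = ?A" for x
    using cmp_reassoc[OF V(2), of x] cmp_reassoc[OF V(3), of x] V(1) that by simp_all
  have Vi: "V \<cdot> i = ident E (opens Y)"
  proof (rule ext[where I="opens Y"])
    show "f \<cdot> (V \<cdot> i) = f \<cdot> ident E (opens Y)" using fV[of i] i by simp
    show "p \<cdot> (V \<cdot> i) = p \<cdot> ident E (opens Y)" using pV[of i] i by simp
  qed (use V(1) i(1) in simp_all)
  have "frame_iso E ?F Y V"
  proof (rule frame_iso_if_order_iso[where g=i])
    show "internal_poset E ?F" by (rule X.F_poset)
    show "internal_frame E Y" by unfold_locales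
    show "leq E ?F u v \<longleftrightarrow> leq E Y (V \<cdot> u) (V \<cdot> v)" if "u \<in> hom E I (opens ?F)" "v \<in> hom E I (opens ?F)" for I u v
      using X.leq_F_iff[of u I v] leq_iff[of "V \<cdot> u" I "V \<cdot> v"] fV[of u] fV[of v] pV[of u] pV[of v] that V(1) by simp
  qed (use V i Vi in simp_all)
  then obtain g where g: "frame_hom E ?F Y V" "frame_hom E Y ?F g" "V \<cdot> g = ident E (opens Y)" "g \<cdot> V = ident E (opens ?F)"
    unfolding frame_iso_def by blast
  have gh: "g \<in> hom E (opens Y) ?A" using g(2) by (simp add: frame_hom_def)
  have "?fst \<cdot> g = f" using fV[of g] g(3) gh by simp
  moreover have "?snd \<cdot> g = p" using pV[of g] g(3) gh by simp
  ultimately show ?thesis unfolding frame_iso_def using g by blast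
qed

end

section \<open>Existence of the one-point compactification\<close>

context internal_frame
begin

text \<open>
  Suprema of pairs will be formed from suprema over the images of a set of pairs under both projections.
\<close>

lemma image_sup:
  assumes S: "S \<in> hom E I (Pow E B)" and B: "B \<in> Ob E" and \<phi>: "\<phi> \<in> hom E B (opens X)"
  obtains s where "s \<in> hom E I (opens X)"
    "\<And>h a. h \<in> Arr E \<Longrightarrow> tgt E h = I \<Longrightarrow> a \<in> hom E (src E h) B \<Longrightarrow> mem E a (S \<cdot> h) \<Longrightarrow> leq E X (\<phi> \<cdot> a) (s \<cdot> h)"
    "\<And>g t. g \<in> Arr E \<Longrightarrow> tgt E g = I \<Longrightarrow> t \<in> hom E (src E g) (opens X) \<Longrightarrow>
      \<forall>h\<in>into E (src E g). \<forall>a\<in>hom E (src E h) B. mem E a (S \<cdot> (g \<cdot> h)) \<longrightarrow> leq E X (\<phi> \<cdot> a) (t \<cdot> h) \<Longrightarrow>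
      leq E X (s \<cdot> g) t"
proof -
  let ?O = "opens X"
  have I: "I \<in> Ob E" using S by auto
  let ?C = "Prod E I ?O" and ?p = "pr1 E I ?O" and ?q = "pr2 E I ?O"
  let ?Q = "\<lambda>x y. exists_loc E (src E y) B (\<lambda>e a. mem E a (S \<cdot> (x \<cdot> e)) \<and> y \<cdot> e = \<phi> \<cdot> a)"
  let ?D = "Prod E ?C B"
  have n: "natural ?D I (\<lambda>z. ?p \<cdot> (pr1 E ?C B \<cdot> z))" "natural ?D ?O (\<lambda>z. ?q \<cdot> (pr1 E ?C B \<cdot> z))"
    "natural ?D B (\<lambda>z. pr2 E ?C B \<cdot> z)"
    by (rule natural_pr1 natural_pr2 natural_id | use I B in simp)+
  have nS: "natural ?D (Pow E B) (\<lambda>z. S \<cdot> (?p \<cdot> (pr1 E ?C B \<cdot> z)))"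
    by (rule natural_comp[OF n(1)]) (use S in simp_all)
  have n\<phi>: "natural ?D ?O (\<lambda>z. \<phi> \<cdot> (pr2 E ?C B \<cdot> z))"
    by (rule natural_comp[OF n(3)]) (use \<phi> in simp_all)
  have "representable ?C (\<lambda>z. exists_loc E (src E z) B (\<lambda>e a. mem E a (S \<cdot> (?p \<cdot> (z \<cdot> e))) \<and> ?q \<cdot> (z \<cdot> e) = \<phi> \<cdot> a))"
    by (rule representable_ex[where Q="\<lambda>z a. mem E a (S \<cdot> (?p \<cdot> z)) \<and> ?q \<cdot> z = \<phi> \<cdot> a",
        OF representable_conj[OF representable_mem[OF n(3) nS] representable_eq[OF n(2) n\<phi>]]]) (use I B in simp_all)
  then have rep: "representable ?C (\<lambda>z. ?Q (?p \<cdot> z) (?q \<cdot> z))"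
    by (rule representable_cong) (use I B in \<open>simp add: exists_loc_def cong: conj_cong\<close>)
  obtain R where R: "R \<in> hom E I (Pow E ?O)" "is_sup E X ?Q (Join E X R)"
    by (rule sup_exists[where Q="?Q", OF rep I]) (rule that)
  have J: "Join E X R \<in> hom E I ?O" using R by simp
  show ?thesis
  proof (rule that[OF J])
    fix h a assume h: "h \<in> Arr E" "tgt E h = I" and a: "a \<in> hom E (src E h) B" and m: "mem E a (S \<cdot> h)"
    have "?Q h (\<phi> \<cdot> a)" by (rule exists_loc_here[of _ a]) (use h a m S \<phi> in simp_all)
    then show "leq E X (\<phi> \<cdot> a) (Join E X R \<cdot> h)" by (rule is_sup_upper[OF R(2) J]) (use h a \<phi> in simp_all)
  next
    fix g t assume g: "g \<in> Arr E" "tgt E g = I" and t: "t \<in> hom E (src E g) ?O"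
      and all: "\<forall>h\<in>into E (src E g). \<forall>a\<in>hom E (src E h) B. mem E a (S \<cdot> (g \<cdot> h)) \<longrightarrow> leq E X (\<phi> \<cdot> a) (t \<cdot> h)"
    show "leq E X (Join E X R \<cdot> g) t"
    proof (rule is_sup_here[OF is_sup_cmp[OF R(2) J g] _ t])
      fix h y assume h: "h \<in> Arr E" "tgt E h = src E g" and y: "y \<in> hom E (src E h) ?O" and Q: "?Q (g \<cdot> h) y"
      obtain e a where e: "epi E e" "e \<in> Arr E" "tgt E e = src E y" "a \<in> Arr E" "src E a = src E e" "tgt E a = B"
        "mem E a (S \<cdot> (g \<cdot> h \<cdot> e)) \<and> y \<cdot> e = \<phi> \<cdot> a"
        by (rule exists_locE[OF Q]) (rule that)
      have te: "tgt E e = src E h" using e(3) y by simp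
      have "leq E X (\<phi> \<cdot> a) (t \<cdot> (h \<cdot> e))" by (rule all[rule_format]) (use e(2,4-7) te g h S in simp_all)
      then have "leq E X (y \<cdot> e) (t \<cdot> (h \<cdot> e))" unfolding e(7)[THEN conjunct2] .
      then have "leq E X (y \<cdot> e) ((t \<cdot> h) \<cdot> e)" using t h e(2) te by simp
      then show "leq E X y (t \<cdot> h)" by (rule leq_local[OF _ e(1)]) (use y t h te in simp_all)
    qed (use J g in simp)
  qed
qed

end

locale compactifiable = internal_frame +
  assumes lc: "locally_compact E X" and reg: "regular E X"
begin

sublocale T: internal_frame E "truth_frame E"
  by (rule truth_internal_frame)

abbreviation T where "T \<equiv> truth_frame E"
abbreviation fst_F where "fst_F \<equiv> omega_fst E X"
abbreviation snd_F where "snd_F \<equiv> omega_snd E X"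

lemma empty_T_arr [simp]: "I \<in> Ob E \<Longrightarrow> empty E T I \<in> Arr E" "I \<in> Ob E \<Longrightarrow> src E (empty E T I) = I"
    "I \<in> Ob E \<Longrightarrow> tgt E (empty E T I) = Om E"
  using T.empty_arr[of I] by simp_all

lemma meet_T_arr [simp]:
  assumes "u \<in> Arr E" "v \<in> Arr E" "src E u = src E v" "tgt E u = Om E" "tgt E v = Om E"
  shows "meet E T u v \<in> Arr E" "src E (meet E T u v) = src E v" "tgt E (meet E T u v) = Om E"
  using T.meet_arr[of u v] assms by simp_all

lemma omega_truth_value:
  obtains w where "w \<in> hom E (opens X) (Om E)"
    "\<And>U. U \<in> Arr E \<Longrightarrow> tgt E U = opens X \<Longrightarrow> holds E (w \<cdot> U) \<longleftrightarrow> omega E X U"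
  by (rule representableE[OF representable_omega]) (rule that, simp_all)

text \<open>
  The pairs \<open>(U, \<bottom>)\<close> correspond to the opens that do not contain the point at infinity.
\<close>

lemma F_bot_pair:
  assumes U: "U \<in> hom E I (opens X)"
  obtains x where "x \<in> hom E I A" "fst_F \<cdot> x = U" "snd_F \<cdot> x = empty E T I"
proof (rule F_pair[OF U, of "empty E T I"])
  have I: "I \<in> Ob E" using U by auto
  then show "empty E T I \<in> hom E I (Om E)" by simp
  fix g assume g: "g \<in> Arr E" "tgt E g = I" and bot: "holds E (empty E T I \<cdot> g)"
  obtain w where w: "w \<in> hom E (opens X) (Om E)"
    "\<And>U. U \<in> Arr E \<Longrightarrow> tgt E U = opens X \<Longrightarrow> holds E (w \<cdot> U) \<longleftrightarrow> omega E X U"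
    by (rule omega_truth_value) (rule that)
  have "leq E T (empty E T I \<cdot> g) (w \<cdot> (U \<cdot> g))"
    using w(1) U g I T.empty_leq[of "w \<cdot> (U \<cdot> g)" "src E g"] T.empty_cmp[OF g] by simp
  then have "holds E (w \<cdot> (U \<cdot> g))" by (rule leq_truthD[OF _ bot, where I="src E g"]) (use w(1) U g I in simp_all)
  then show "omega E X (U \<cdot> g)" using w(2) U g by simp
qed (rule that)

lemma F_top_pair:
  assumes U: "U \<in> hom E I (opens X)" and om: "omega E X U"
  obtains x where "x \<in> hom E I A" "fst_F \<cdot> x = U" "holds E (snd_F \<cdot> x)"
proof -
  have I: "I \<in> Ob E" using U by auto
  obtain x where x: "x \<in> hom E I A" "fst_F \<cdot> x = U" "snd_F \<cdot> x = tt E \<cdot> bang E I"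
    by (rule F_pair[OF U, of "tt E \<cdot> bang E I"]) (use I omega_cmp[OF om U] in simp_all)
  show ?thesis by (rule that[OF x(1,2)]) (use x(3) I in simp)
qed

lemma F_meet:
  assumes x: "x \<in> hom E I A" and y: "y \<in> hom E I A"
  obtains z where "z \<in> hom E I A" "fst_F \<cdot> z = meet E X (fst_F \<cdot> x) (fst_F \<cdot> y)"
    "snd_F \<cdot> z = meet E T (snd_F \<cdot> x) (snd_F \<cdot> y)" "is_meet E F x y z"
proof -
  have I: "I \<in> Ob E" using x by auto
  let ?U = "meet E X (fst_F \<cdot> x) (fst_F \<cdot> y)" and ?q = "meet E T (snd_F \<cdot> x) (snd_F \<cdot> y)"
  have U: "?U \<in> hom E I (opens X)" and q: "?q \<in> hom E I (Om E)" using x y by simp_all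
  obtain z where z: "z \<in> hom E I A" "fst_F \<cdot> z = ?U" "snd_F \<cdot> z = ?q"
  proof (rule F_pair[OF U q])
    fix g assume g: "g \<in> Arr E" "tgt E g = I" and h: "holds E (?q \<cdot> g)"
    have "?q \<cdot> g = meet E T (snd_F \<cdot> (x \<cdot> g)) (snd_F \<cdot> (y \<cdot> g))"
      using T.meet_cmp[of "snd_F \<cdot> x" "snd_F \<cdot> y" g] x y g by simp
    then have hh: "holds E (snd_F \<cdot> (x \<cdot> g)) \<and> holds E (snd_F \<cdot> (y \<cdot> g))"
      using holds_meet_truth[of "snd_F \<cdot> (x \<cdot> g)" "src E g" "snd_F \<cdot> (y \<cdot> g)"] h x y g by simp
    have "omega E X (meet E X (fst_F \<cdot> (x \<cdot> g)) (fst_F \<cdot> (y \<cdot> g)))"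
      by (rule omega_meet[where I="src E g"]) (use hh omega_if_snd[of "x \<cdot> g" "src E g"] omega_if_snd[of "y \<cdot> g" "src E g"] x y g in simp_all)
    then show "omega E X (?U \<cdot> g)" using x y g by simp
  qed (rule that)
  have "is_meet E F x y z" unfolding is_meet_def
  proof (intro ballI)
    fix g t assume g: "g \<in> into E (src E z)" and t: "t \<in> hom E (src E g) (opens F)"
    let ?J = "src E g"
    have ty: "t \<in> hom E ?J A" "z \<cdot> g \<in> hom E ?J A" "x \<cdot> g \<in> hom E ?J A" "y \<cdot> g \<in> hom E ?J A"
      using t g z(1) x y by simp_all
    have g': "g \<in> Arr E" "tgt E g = I" using g z(1) by simp_all
    have "fst_F \<cdot> (z \<cdot> g) = ?U \<cdot> g" using cmp_reassoc[OF z(2), of g] z(1) g' by simp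
    then have fz: "fst_F \<cdot> (z \<cdot> g) = meet E X (fst_F \<cdot> (x \<cdot> g)) (fst_F \<cdot> (y \<cdot> g))" using x y g' by simp
    have "snd_F \<cdot> (z \<cdot> g) = ?q \<cdot> g" using cmp_reassoc[OF z(3), of g] z(1) g' by simp
    then have sz: "snd_F \<cdot> (z \<cdot> g) = meet E T (snd_F \<cdot> (x \<cdot> g)) (snd_F \<cdot> (y \<cdot> g))"
      using T.meet_cmp[of "snd_F \<cdot> x" "snd_F \<cdot> y" g] x y g' by simp
    show "leq E F t (z \<cdot> g) \<longleftrightarrow> leq E F t (x \<cdot> g) \<and> leq E F t (y \<cdot> g)"
      unfolding leq_F_iff[OF ty(1,2)] leq_F_iff[OF ty(1,3)] leq_F_iff[OF ty(1,4)] fz sz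
      using leq_meet_iff[of "fst_F \<cdot> (x \<cdot> g)" ?J "fst_F \<cdot> (y \<cdot> g)" "fst_F \<cdot> t"]
        T.leq_meet_iff[of "snd_F \<cdot> (x \<cdot> g)" ?J "snd_F \<cdot> (y \<cdot> g)" "snd_F \<cdot> t"] ty by auto
  qed
  then show ?thesis by (rule that[OF z])
qed

text \<open>
  Suprema of pairs are computed componentwise: if the supremum of the truth values holds, then locally some
  \<open>(U, q)\<close> in the set has \<open>q\<close> and thus \<open>omega U\<close>, and \<open>omega\<close> is monotone. Accordingly, the truth value of \<open>omega\<close>
  at the supremum of the opens is an upper bound of the truth values.
\<close>

lemma F_sup:
  assumes S: "S \<in> hom E I (Pow E A)"
  obtains z where "z \<in> hom E I A" "is_sup E F (\<lambda>g a. mem E a (S \<cdot> g)) z"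
    "\<And>t. t \<in> hom E I (opens X) \<Longrightarrow> \<forall>h\<in>into E I. \<forall>a\<in>hom E (src E h) A. mem E a (S \<cdot> h) \<longrightarrow>
      leq E X (fst_F \<cdot> a) (t \<cdot> h) \<Longrightarrow> leq E X (fst_F \<cdot> z) t"
    "\<And>t. t \<in> hom E I (Om E) \<Longrightarrow> \<forall>h\<in>into E I. \<forall>a\<in>hom E (src E h) A. mem E a (S \<cdot> h) \<longrightarrow>
      leq E T (snd_F \<cdot> a) (t \<cdot> h) \<Longrightarrow> leq E T (snd_F \<cdot> z) t"
proof -
  interpret F: internal_poset E F by (rule F_poset)
  have I: "I \<in> Ob E" using S by auto
  have AO: "A \<in> Ob E" by simp
  have f: "fst_F \<in> hom E A (opens X)" and s: "snd_F \<in> hom E A (opens T)" by simp_all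
  obtain U where U: "U \<in> hom E I (opens X)"
    and Uup: "\<And>h a. h \<in> Arr E \<Longrightarrow> tgt E h = I \<Longrightarrow> a \<in> hom E (src E h) A \<Longrightarrow> mem E a (S \<cdot> h) \<Longrightarrow> leq E X (fst_F \<cdot> a) (U \<cdot> h)"
    and Ule: "\<And>g t. g \<in> Arr E \<Longrightarrow> tgt E g = I \<Longrightarrow> t \<in> hom E (src E g) (opens X) \<Longrightarrow>
      \<forall>h\<in>into E (src E g). \<forall>a\<in>hom E (src E h) A. mem E a (S \<cdot> (g \<cdot> h)) \<longrightarrow> leq E X (fst_F \<cdot> a) (t \<cdot> h) \<Longrightarrow>
      leq E X (U \<cdot> g) t"
    by (rule image_sup[OF S AO f]) (rule that)
  obtain q where q: "q \<in> hom E I (opens T)"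
    and qup: "\<And>h a. h \<in> Arr E \<Longrightarrow> tgt E h = I \<Longrightarrow> a \<in> hom E (src E h) A \<Longrightarrow> mem E a (S \<cdot> h) \<Longrightarrow> leq E T (snd_F \<cdot> a) (q \<cdot> h)"
    and qle: "\<And>g t. g \<in> Arr E \<Longrightarrow> tgt E g = I \<Longrightarrow> t \<in> hom E (src E g) (opens T) \<Longrightarrow>
      \<forall>h\<in>into E (src E g). \<forall>a\<in>hom E (src E h) A. mem E a (S \<cdot> (g \<cdot> h)) \<longrightarrow> leq E T (snd_F \<cdot> a) (t \<cdot> h) \<Longrightarrow>
      leq E T (q \<cdot> g) t"
    by (rule T.image_sup[OF S AO s]) (rule that)
  have q': "q \<in> hom E I (Om E)" using q by simp
  obtain w where w: "w \<in> hom E (opens X) (Om E)"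
    "\<And>U. U \<in> Arr E \<Longrightarrow> tgt E U = opens X \<Longrightarrow> holds E (w \<cdot> U) \<longleftrightarrow> omega E X U"
    by (rule omega_truth_value) (rule that)
  have "leq E T (q \<cdot> ident E I) (w \<cdot> U)"
  proof (rule qle)
    show "\<forall>h\<in>into E (src E (ident E I)). \<forall>a\<in>hom E (src E h) A. mem E a (S \<cdot> (ident E I \<cdot> h)) \<longrightarrow>
      leq E T (snd_F \<cdot> a) ((w \<cdot> U) \<cdot> h)"
    proof (intro ballI impI)
    fix h a assume h0: "h \<in> into E (src E (ident E I))" and a: "a \<in> hom E (src E h) A" and m: "mem E a (S \<cdot> (ident E I \<cdot> h))"
    have h: "h \<in> Arr E" and h': "tgt E h = I" using h0 I by simp_all
    have m': "mem E a (S \<cdot> h)" using m h h' by simp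
    have le: "leq E X (fst_F \<cdot> a) (U \<cdot> h)" by (rule Uup[OF h h' a m'])
    show "leq E T (snd_F \<cdot> a) ((w \<cdot> U) \<cdot> h)"
    proof (rule leq_truthI[where I="src E h"])
      fix k assume k: "k \<in> Arr E" "tgt E k = src E h" and "holds E ((snd_F \<cdot> a) \<cdot> k)"
      then have "omega E X (fst_F \<cdot> (a \<cdot> k))" by - (rule omega_if_snd[where I="src E k"], use a in simp_all)
      moreover have "leq E X ((fst_F \<cdot> a) \<cdot> k) ((U \<cdot> h) \<cdot> k)" by (rule leq_cmp[OF le]) (use a U h h' k in simp_all)
      ultimately have "omega E X (U \<cdot> (h \<cdot> k))" by - (rule omega_mono[where I="src E k" and u="fst_F \<cdot> (a \<cdot> k)"], use a U h h' k in simp_all)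
      then show "holds E (((w \<cdot> U) \<cdot> h) \<cdot> k)" using w(1) w(2)[of "U \<cdot> (h \<cdot> k)"] U h h' k by simp
    qed (use a w(1) U h h' in simp_all)
    qed
  qed (use I w(1) U in simp_all)
  then have qw: "leq E T q (w \<cdot> U)" using q by simp
  obtain z where z: "z \<in> hom E I A" "fst_F \<cdot> z = U" "snd_F \<cdot> z = q"
  proof (rule F_pair[OF U q'])
    fix g assume g: "g \<in> Arr E" "tgt E g = I" and qg: "holds E (q \<cdot> g)"
    have "holds E ((w \<cdot> U) \<cdot> g)" by (rule leq_truth_cmp[OF qw qg _ _ g]) (use q w(1) U in simp_all)
    then show "omega E X (U \<cdot> g)" using w(1) w(2)[of "U \<cdot> g"] U g by simp
  qed (rule that)
  have zf: "fst_F \<cdot> (z \<cdot> g) = U \<cdot> g" and zs: "snd_F \<cdot> (z \<cdot> g) = q \<cdot> g" if "g \<in> Arr E" "tgt E g = I" for g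
    using cmp_reassoc[OF z(2), of g] cmp_reassoc[OF z(3), of g] z(1) that by simp_all
  have "is_sup E F (\<lambda>g a. mem E a (S \<cdot> g)) z"
  proof (rule F.is_supI, unfold opens_F, rule z(1))
    fix h a assume h: "h \<in> Arr E" "tgt E h = I" and a: "a \<in> hom E (src E h) A" and m: "mem E a (S \<cdot> h)"
    show "leq E F a (z \<cdot> h)"
      using leq_F_iff[OF a, of "z \<cdot> h"] Uup[OF h a m] qup[OF h a m] zf[OF h] zs[OF h] z(1) h by simp
  next
    fix g t assume g: "g \<in> Arr E" "tgt E g = I" and t: "t \<in> hom E (src E g) A"
      and all: "\<And>h a. h \<in> Arr E \<Longrightarrow> tgt E h = src E g \<Longrightarrow> a \<in> hom E (src E h) A \<Longrightarrow> mem E a (S \<cdot> (g \<cdot> h)) \<Longrightarrow> leq E F a (t \<cdot> h)"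
    have both: "leq E X (fst_F \<cdot> a) ((fst_F \<cdot> t) \<cdot> h)" "leq E T (snd_F \<cdot> a) ((snd_F \<cdot> t) \<cdot> h)"
      if h: "h \<in> Arr E" "tgt E h = src E g" and a: "a \<in> hom E (src E h) A" and m: "mem E a (S \<cdot> (g \<cdot> h))" for h a
      using leq_F_iff[OF a, of "t \<cdot> h"] all[OF h a m] t h by simp_all
    have "leq E X (U \<cdot> g) (fst_F \<cdot> t)" by (rule Ule[OF g]) (use t both in simp_all)
    moreover have "leq E T (q \<cdot> g) (snd_F \<cdot> t)" by (rule qle[OF g]) (use t both in simp_all)
    ultimately show "leq E F (z \<cdot> g) t" using leq_F_iff[of "z \<cdot> g" "src E g" t] zf[OF g] zs[OF g] z(1) g t by simp
  qed
  moreover have "leq E X (fst_F \<cdot> z) t" if t: "t \<in> hom E I (opens X)" and all: "\<forall>h\<in>into E I. \<forall>a\<in>hom E (src E h) A.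
      mem E a (S \<cdot> h) \<longrightarrow> leq E X (fst_F \<cdot> a) (t \<cdot> h)" for t
  proof -
    have "leq E X (U \<cdot> ident E I) t" by (rule Ule) (use I t all in simp_all)
    then show ?thesis using z(2) U by simp
  qed
  moreover have "leq E T (snd_F \<cdot> z) t" if t: "t \<in> hom E I (Om E)" and all: "\<forall>h\<in>into E I. \<forall>a\<in>hom E (src E h) A.
      mem E a (S \<cdot> h) \<longrightarrow> leq E T (snd_F \<cdot> a) (t \<cdot> h)" for t
  proof -
    have "leq E T (q \<cdot> ident E I) t" by (rule qle) (use I t all in simp_all)
    then show ?thesis using z(3) q by simp
  qed
  ultimately show ?thesis by (rule that[OF z(1)])
qed

lemma F_is_frame: "is_frame E F"
proof -
  interpret F: internal_poset E F by (rule F_poset)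
  show ?thesis
  proof (rule F.is_frameI, unfold opens_F)
    fix I assume I: "I \<in> Ob E"
    obtain x where x: "x \<in> hom E I A" "fst_F \<cdot> x = whole E X I" "snd_F \<cdot> x = tt E \<cdot> bang E I"
      by (rule F_pair[of "whole E X I" I "tt E \<cdot> bang E I"]) (use I omega_whole in simp_all)
    have "is_top E F x" unfolding is_top_def
    proof (intro ballI)
      fix g t assume g: "g \<in> into E (src E x)" and t: "t \<in> hom E (src E g) (opens F)"
      have g': "g \<in> Arr E" "tgt E g = I" using g x(1) by simp_all
      have fx: "fst_F \<cdot> (x \<cdot> g) = whole E X (src E g)" and sx: "snd_F \<cdot> (x \<cdot> g) = tt E \<cdot> bang E (src E g)"
        using cmp_reassoc[OF x(2), of g] cmp_reassoc[OF x(3), of g] x(1) g' I by simp_all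
      have "leq E T (snd_F \<cdot> t) (tt E \<cdot> bang E (src E g))"
        by (rule leq_truthI[where I="src E g"]) (use t g' in simp_all)
      then show "leq E F t (x \<cdot> g)" using leq_F_iff[of t "src E g" "x \<cdot> g"] fx sx x(1) g' t by simp
    qed
    then show "\<exists>s\<in>hom E I A. is_top E F s" using x(1) by blast
  next
    fix I u v assume u: "u \<in> hom E I A" and v: "v \<in> hom E I A"
    show "\<exists>s\<in>hom E I A. is_meet E F u v s" by (rule F_meet[OF u v]) blast
  next
    fix I S assume S: "S \<in> hom E I (Pow E A)"
    show "\<exists>s\<in>hom E I A. is_sup E F (\<lambda>g a. mem E a (S \<cdot> g)) s" by (rule F_sup[OF S]) blast
  next
    fix I u S s m t
    assume u: "u \<in> hom E I A" and S: "S \<in> hom E I (Pow E A)" and s: "s \<in> hom E I A"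
      and m: "m \<in> hom E I A" and t: "t \<in> hom E I A"
      and sup: "is_sup E F (\<lambda>g a. mem E a (S \<cdot> g)) s" and ism: "is_meet E F u s m"
      and all: "\<And>h a b. h \<in> Arr E \<Longrightarrow> tgt E h = I \<Longrightarrow> a \<in> hom E (src E h) A \<Longrightarrow> b \<in> hom E (src E h) A \<Longrightarrow>
        mem E a (S \<cdot> h) \<Longrightarrow> is_meet E F (u \<cdot> h) a b \<Longrightarrow> leq E F b (t \<cdot> h)"
    obtain z where z: "z \<in> hom E I A" "is_sup E F (\<lambda>g a. mem E a (S \<cdot> g)) z"
      and zf: "\<And>t. t \<in> hom E I (opens X) \<Longrightarrow> \<forall>h\<in>into E I. \<forall>a\<in>hom E (src E h) A. mem E a (S \<cdot> h) \<longrightarrow>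
        leq E X (fst_F \<cdot> a) (t \<cdot> h) \<Longrightarrow> leq E X (fst_F \<cdot> z) t"
      and zs: "\<And>t. t \<in> hom E I (Om E) \<Longrightarrow> \<forall>h\<in>into E I. \<forall>a\<in>hom E (src E h) A. mem E a (S \<cdot> h) \<longrightarrow>
        leq E T (snd_F \<cdot> a) (t \<cdot> h) \<Longrightarrow> leq E T (snd_F \<cdot> z) t"
      by (rule F_sup[OF S]) (rule that)
    have sz: "s = z" by (rule F.is_sup_unique[OF sup z(2)]) (use s z(1) in simp_all)
    obtain n where n: "n \<in> hom E I A" "fst_F \<cdot> n = meet E X (fst_F \<cdot> u) (fst_F \<cdot> s)"
      "snd_F \<cdot> n = meet E T (snd_F \<cdot> u) (snd_F \<cdot> s)" "is_meet E F u s n"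
      by (rule F_meet[OF u s]) (rule that)
    have mn: "m = n" by (rule F.is_meet_unique[OF ism n(4)]) (use m n(1) u s in simp_all)
    have step: "leq E X (meet E X (fst_F \<cdot> a) (fst_F \<cdot> u \<cdot> h)) (fst_F \<cdot> t \<cdot> h) \<and>
        leq E T (meet E T (snd_F \<cdot> a) (snd_F \<cdot> u \<cdot> h)) (snd_F \<cdot> t \<cdot> h)"
      if h: "h \<in> Arr E" "tgt E h = I" and a: "a \<in> hom E (src E h) A" and mem: "mem E a (S \<cdot> h)" for h a
    proof -
      let ?J = "src E h"
      have uh: "u \<cdot> h \<in> hom E ?J A" and th: "t \<cdot> h \<in> hom E ?J A" using u t h by simp_all
      obtain b where b: "b \<in> hom E ?J A" "fst_F \<cdot> b = meet E X (fst_F \<cdot> (u \<cdot> h)) (fst_F \<cdot> a)"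
        "snd_F \<cdot> b = meet E T (snd_F \<cdot> (u \<cdot> h)) (snd_F \<cdot> a)" "is_meet E F (u \<cdot> h) a b"
        by (rule F_meet[OF uh a]) (rule that)
      have "leq E F b (t \<cdot> h)" by (rule all[OF h a b(1) mem b(4)])
      then have le: "leq E X (meet E X (fst_F \<cdot> (u \<cdot> h)) (fst_F \<cdot> a)) (fst_F \<cdot> (t \<cdot> h))"
        "leq E T (meet E T (snd_F \<cdot> (u \<cdot> h)) (snd_F \<cdot> a)) (snd_F \<cdot> (t \<cdot> h))"
        unfolding leq_F_iff[OF b(1) th] b(2,3) by blast+
      have "leq E X (meet E X (fst_F \<cdot> a) (fst_F \<cdot> (u \<cdot> h))) (fst_F \<cdot> (t \<cdot> h))"
        by (rule leq_trans[OF meet_commute_leq le(1), where I="?J"]) (use uh th a in simp_all)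
      moreover have "leq E T (meet E T (snd_F \<cdot> a) (snd_F \<cdot> (u \<cdot> h))) (snd_F \<cdot> (t \<cdot> h))"
        by (rule T.leq_trans[OF T.meet_commute_leq le(2), where I="?J"]) (use uh th a in simp_all)
      ultimately show ?thesis using u t h by simp
    qed
    \<comment> \<open>Both components are distributive because implication exists in \<open>X\<close> and in \<open>Om\<close>.\<close>
    have "leq E X (fst_F \<cdot> s) (impl E X (fst_F \<cdot> u) (fst_F \<cdot> t))" unfolding sz
    proof (rule zf)
      show "\<forall>h\<in>into E I. \<forall>a\<in>hom E (src E h) A. mem E a (S \<cdot> h) \<longrightarrow> leq E X (fst_F \<cdot> a) (impl E X (fst_F \<cdot> u) (fst_F \<cdot> t) \<cdot> h)"
      proof (intro ballI impI)
      fix h a assume h0: "h \<in> into E I" and a: "a \<in> hom E (src E h) A" and mem: "mem E a (S \<cdot> h)"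
      then have h: "h \<in> Arr E" "tgt E h = I" by simp_all
      then show "leq E X (fst_F \<cdot> a) (impl E X (fst_F \<cdot> u) (fst_F \<cdot> t) \<cdot> h)"
        using leq_impl_iff[of "fst_F \<cdot> u \<cdot> h" "src E h" "fst_F \<cdot> t \<cdot> h" "fst_F \<cdot> a"] step[OF h a mem] u t a by simp
      qed
    qed (use u t in simp)
    moreover have "leq E X (meet E X (fst_F \<cdot> u) (fst_F \<cdot> s)) (meet E X (fst_F \<cdot> s) (fst_F \<cdot> u))"
      by (rule meet_commute_leq[where I=I]) (use u s in simp_all)
    ultimately have 1: "leq E X (fst_F \<cdot> m) (fst_F \<cdot> t)" unfolding mn n(2)
      using leq_impl_iff[of "fst_F \<cdot> u" I "fst_F \<cdot> t" "fst_F \<cdot> s"] u s t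
      by - (rule leq_trans[where I=I and v="meet E X (fst_F \<cdot> s) (fst_F \<cdot> u)"], simp_all)
    have "leq E T (snd_F \<cdot> s) (impl E T (snd_F \<cdot> u) (snd_F \<cdot> t))" unfolding sz
    proof (rule zs)
      show "\<forall>h\<in>into E I. \<forall>a\<in>hom E (src E h) A. mem E a (S \<cdot> h) \<longrightarrow> leq E T (snd_F \<cdot> a) (impl E T (snd_F \<cdot> u) (snd_F \<cdot> t) \<cdot> h)"
      proof (intro ballI impI)
      fix h a assume h0: "h \<in> into E I" and a: "a \<in> hom E (src E h) A" and mem: "mem E a (S \<cdot> h)"
      then have h: "h \<in> Arr E" "tgt E h = I" by simp_all
      then show "leq E T (snd_F \<cdot> a) (impl E T (snd_F \<cdot> u) (snd_F \<cdot> t) \<cdot> h)"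
        using T.leq_impl_iff[of "snd_F \<cdot> u \<cdot> h" "src E h" "snd_F \<cdot> t \<cdot> h" "snd_F \<cdot> a"] step[OF h a mem] u t a by simp
      qed
    qed (use u t T.impl_arr[of "snd_F \<cdot> u" "snd_F \<cdot> t"] in simp)
    moreover have "leq E T (meet E T (snd_F \<cdot> u) (snd_F \<cdot> s)) (meet E T (snd_F \<cdot> s) (snd_F \<cdot> u))"
      by (rule T.meet_commute_leq[where I=I]) (use u s in simp_all)
    ultimately have 2: "leq E T (snd_F \<cdot> m) (snd_F \<cdot> t)" unfolding mn n(3)
      using T.leq_impl_iff[of "snd_F \<cdot> u" I "snd_F \<cdot> t" "snd_F \<cdot> s"] u s t
      by - (rule T.leq_trans[where I=I and v="meet E T (snd_F \<cdot> s) (snd_F \<cdot> u)"], simp_all)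
    show "leq E F m t" using leq_F_iff[OF m t] 1 2 by simp
  qed
qed

sublocale F: internal_frame E F
  by (rule internal_frameI[OF elementary_topos_axioms F_is_frame])

lemma meet_F:
  assumes "x \<in> hom E I A" "y \<in> hom E I A"
  shows "fst_F \<cdot> meet E F x y = meet E X (fst_F \<cdot> x) (fst_F \<cdot> y)"
    "snd_F \<cdot> meet E F x y = meet E T (snd_F \<cdot> x) (snd_F \<cdot> y)"
proof -
  obtain z where z: "z \<in> hom E I A" "fst_F \<cdot> z = meet E X (fst_F \<cdot> x) (fst_F \<cdot> y)"
    "snd_F \<cdot> z = meet E T (snd_F \<cdot> x) (snd_F \<cdot> y)" "is_meet E F x y z"
    by (rule F_meet[OF assms]) (rule that)
  have "meet E F x y = z"
    by (rule F.is_meet_unique[OF F.meet_props[THEN conjunct2] z(4)]) (use assms z(1) in simp_all)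
  then show "fst_F \<cdot> meet E F x y = meet E X (fst_F \<cdot> x) (fst_F \<cdot> y)"
    "snd_F \<cdot> meet E F x y = meet E T (snd_F \<cdot> x) (snd_F \<cdot> y)" using z by simp_all
qed

lemma whole_F:
  assumes I: "I \<in> Ob E"
  shows "fst_F \<cdot> whole E F I = whole E X I" "snd_F \<cdot> whole E F I = whole E T I"
proof -
  obtain x where x: "x \<in> hom E I A" "fst_F \<cdot> x = whole E X I" "snd_F \<cdot> x = tt E \<cdot> bang E I"
    by (rule F_pair[of "whole E X I" I "tt E \<cdot> bang E I"]) (use I omega_whole in simp_all)
  have "leq E F x (whole E F I)" using x(1) by simp
  then have le: "leq E X (whole E X I) (fst_F \<cdot> whole E F I)" "leq E T (whole E T I) (snd_F \<cdot> whole E F I)"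
    using leq_F_iff[of x I "whole E F I"] x I whole_truth[OF I] by simp_all
  show "fst_F \<cdot> whole E F I = whole E X I" by (rule leq_antisym[OF _ le(1), where I=I]) (use I in simp_all)
  show "snd_F \<cdot> whole E F I = whole E T I"
    by (rule T.leq_antisym[OF _ le(2), where I=I]) (use I T.whole_arr[OF I] in simp_all)
qed

text \<open>
  Both projections have right adjoints, \<open>U \<mapsto> (U, omega U)\<close> and \<open>q \<mapsto> (X, q)\<close>.
\<close>

lemma frame_hom_fst: "frame_hom E F X fst_F"
proof -
  interpret two_frames E F X by unfold_locales
  obtain w where w: "w \<in> hom E (opens X) (Om E)"
    "\<And>U. U \<in> Arr E \<Longrightarrow> tgt E U = opens X \<Longrightarrow> holds E (w \<cdot> U) \<longleftrightarrow> omega E X U"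
    by (rule omega_truth_value) (rule that)
  obtain r where r: "r \<in> hom E (opens X) A" "fst_F \<cdot> r = ident E (opens X)" "snd_F \<cdot> r = w"
    by (rule F_pair[of "ident E (opens X)" "opens X" w]) (use w in simp_all)
  show ?thesis
  proof (rule frame_homI[of _ r])
    fix I x U assume x: "x \<in> hom E I (opens F)" and U: "U \<in> hom E I (opens X)"
    have rU: "r \<cdot> U \<in> hom E I A" using r U by simp
    have fr: "fst_F \<cdot> (r \<cdot> U) = U" and sr: "snd_F \<cdot> (r \<cdot> U) = w \<cdot> U"
      using cmp_reassoc[OF r(2), of U] cmp_reassoc[OF r(3), of U] r(1) U by simp_all
    have "leq E T (snd_F \<cdot> x) (w \<cdot> U)" if le: "leq E X (fst_F \<cdot> x) U"
    proof (rule leq_truthI[where I=I])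
      fix g assume g: "g \<in> Arr E" "tgt E g = I" and "holds E ((snd_F \<cdot> x) \<cdot> g)"
      then have "omega E X (fst_F \<cdot> (x \<cdot> g))" by - (rule omega_if_snd[where I="src E g"], use x in simp_all)
      moreover have "leq E X ((fst_F \<cdot> x) \<cdot> g) (U \<cdot> g)" by (rule leq_cmp[OF le]) (use x U g in simp_all)
      ultimately have "omega E X (U \<cdot> g)" by - (rule omega_mono[where I="src E g" and u="fst_F \<cdot> (x \<cdot> g)"], use x U g in simp_all)
      then show "holds E ((w \<cdot> U) \<cdot> g)" using w(1) w(2)[of "U \<cdot> g"] U g by simp
    qed (use x w(1) U in simp_all)
    then show "leq E X (fst_F \<cdot> x) U \<longleftrightarrow> leq E F x (r \<cdot> U)"
      using leq_F_iff[of x I "r \<cdot> U"] fr sr x rU by auto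
  qed (use r(1) whole_F meet_F in simp_all)
qed

lemma frame_hom_snd: "frame_hom E F T snd_F"
proof -
  interpret two_frames E F T by unfold_locales
  obtain r where r: "r \<in> hom E (Om E) A" "fst_F \<cdot> r = whole E X (Om E)" "snd_F \<cdot> r = ident E (Om E)"
    by (rule F_pair[of "whole E X (Om E)" "Om E" "ident E (Om E)"]) (use omega_whole in simp_all)
  show ?thesis
  proof (rule frame_homI[of _ r])
    fix I x q assume x: "x \<in> hom E I (opens F)" and q: "q \<in> hom E I (opens T)"
    have rq: "r \<cdot> q \<in> hom E I A" using r q by simp
    have fr: "fst_F \<cdot> (r \<cdot> q) = whole E X I" and sr: "snd_F \<cdot> (r \<cdot> q) = q"
      using cmp_reassoc[OF r(2), of q] cmp_reassoc[OF r(3), of q] r(1) q by simp_all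
    show "leq E T (snd_F \<cdot> x) q \<longleftrightarrow> leq E F x (r \<cdot> q)"
      using leq_F_iff[of x I "r \<cdot> q"] fr sr x rq by simp
  qed (use r(1) whole_F meet_F in simp_all)
qed

sublocale fst_F: frame_morphism E F X fst_F by unfold_locales (rule frame_hom_fst)
sublocale pointed_locale E F snd_F by unfold_locales (rule frame_hom_snd)

end

context compactifiable
begin

text \<open>
  A member \<open>x\<close> of the net that contains the point at infinity leaves uncovered at most an open \<open>W\<close> way below the
  whole of \<open>X\<close>. Another member \<open>y\<close> contains \<open>W\<close>, as the net covers \<open>X\<close>, and a common upper bound of \<open>x\<close> and \<open>y\<close> is
  the whole.
\<close>

lemma F_compact_step:
  assumes S: "S \<in> hom E K (Pow E A)" and net: "is_net E F S" and cov: "leq E F (whole E F K) (Join E F S)"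
    and x: "x \<in> hom E K A" and mem: "mem E x S" and hx: "holds E (snd_F \<cdot> x)"
  shows "exists_loc E K A (\<lambda>e z. mem E z (S \<cdot> e) \<and> leq E F (whole E F (src E z)) z)"
proof -
  have K: "K \<in> Ob E" using x by auto
  have SF: "S \<in> hom E K (Pow E (opens F))" using S by simp
  have fx: "fst_F \<cdot> x \<in> hom E K (opens X)" using x by simp
  obtain e W where e: "epi E e" "e \<in> Arr E" "tgt E e = K" "W \<in> hom E (src E e) (opens X)"
    "way_below E X W (whole E X (src E e))" "covers ((fst_F \<cdot> x) \<cdot> e) W"
    by (rule omegaE[OF omega_if_snd[OF x hx] fx]) (rule that)
  let ?L = "src E e" and ?S = "S \<cdot> e"
  have L: "?L \<in> Ob E" and S': "?S \<in> hom E ?L (Pow E A)" and SF': "?S \<in> hom E ?L (Pow E (opens F))" using e S by simp_all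
  have net': "is_net E F ?S"
    by (rule representable_cmp[OF F.representable_is_net[OF natural_id], of S]) (use net S e in simp_all)
  have cov': "leq E F (whole E F ?L) (Join E F ?S)"
    using F.leq_cmp[OF cov, of K e] S e K by simp
  let ?\<phi> = "fst_F \<cdot> pr2 E ?L A"
  have \<phi>: "?\<phi> \<in> hom E (Prod E ?L A) (opens X)" using L by simp
  have \<phi>_pair: "?\<phi> \<cdot> pair E h a = fst_F \<cdot> a" if "h \<in> Arr E" "tgt E h = ?L" "a \<in> hom E (src E h) A" for h a
    using that L by simp
  have wL: "whole E X ?L \<in> hom E ?L (opens X)" using L by simp
  have AO: "A \<in> Ob E" by simp
  \<comment> \<open>That \<open>W\<close> is way below \<open>X\<close> is applied to the first components of the members of the net.\<close>
  have "exists_loc E ?L A (\<lambda>d a. mem E a (?S \<cdot> d) \<and> leq E X (W \<cdot> d) (?\<phi> \<cdot> pair E d a))"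
  proof (rule way_below_image[OF e(5,4) wL S' AO \<phi>])
    show "exists_loc E ?L A (\<lambda>e a. mem E a (?S \<cdot> e))" using F.is_net_inhabited[OF net' SF'] by simp
  next
    fix g a b assume g: "g \<in> Arr E" "tgt E g = ?L" and a: "a \<in> hom E (src E g) A" and b: "b \<in> hom E (src E g) A"
      and ma: "mem E a (?S \<cdot> g)" and mb: "mem E b (?S \<cdot> g)"
    have "exists_loc E (src E g) (opens F) (\<lambda>e c. mem E c (?S \<cdot> g \<cdot> e) \<and> leq E F (a \<cdot> e) c \<and> leq E F (b \<cdot> e) c)"
      by (rule F.is_net_directed[OF net' SF' g _ _ ma mb]) (use a b in simp_all)
    then obtain d z where d: "epi E d" "d \<in> Arr E" "tgt E d = src E g" "z \<in> Arr E" "src E z = src E d" "tgt E z = opens F"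
      "mem E z (?S \<cdot> g \<cdot> d) \<and> leq E F (a \<cdot> d) z \<and> leq E F (b \<cdot> d) z"
      by (rule exists_locE) (rule that)
    have zA: "tgt E z = A" using d(6) by simp
    have "leq E X (fst_F \<cdot> (a \<cdot> d)) (fst_F \<cdot> z)" "leq E X (fst_F \<cdot> (b \<cdot> d)) (fst_F \<cdot> z)"
      using leq_F_iff[of "a \<cdot> d" "src E d" z] leq_F_iff[of "b \<cdot> d" "src E d" z] d(2-5,7) zA a b by simp_all
    then show "exists_loc E (src E g) A (\<lambda>d z. mem E z (?S \<cdot> (g \<cdot> d)) \<and>
        leq E X (?\<phi> \<cdot> pair E (g \<cdot> d) (a \<cdot> d)) (?\<phi> \<cdot> pair E (g \<cdot> d) z) \<and>
        leq E X (?\<phi> \<cdot> pair E (g \<cdot> d) (b \<cdot> d)) (?\<phi> \<cdot> pair E (g \<cdot> d) z))"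
      by - (rule exists_locI[OF d(1,3,4,5) zA],
        use \<phi>_pair[of "g \<cdot> d" "a \<cdot> d"] \<phi>_pair[of "g \<cdot> d" "b \<cdot> d"] \<phi>_pair[of "g \<cdot> d" z] d(2-5,7) zA a b g S' in simp)
  next
    fix t assume t: "t \<in> hom E ?L (opens X)" and all: "\<And>h a. h \<in> Arr E \<Longrightarrow> tgt E h = ?L \<Longrightarrow> a \<in> hom E (src E h) A \<Longrightarrow>
      mem E a (?S \<cdot> h) \<Longrightarrow> leq E X (?\<phi> \<cdot> pair E h a) (t \<cdot> h)"
    have 1: "leq E X (fst_F \<cdot> Join E F ?S) t"
    proof (rule fst_F.f_Join_leq[OF SF' t])
      fix h a assume h: "h \<in> Arr E" "tgt E h = ?L" and a: "a \<in> hom E (src E h) (opens F)" and m: "mem E a (?S \<cdot> h)"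
      have a': "a \<in> hom E (src E h) A" using a by simp
      show "leq E X (fst_F \<cdot> a) (t \<cdot> h)" using all[OF h a' m] \<phi>_pair[OF h a'] by simp
    qed
    have "leq E X (fst_F \<cdot> whole E F ?L) (fst_F \<cdot> Join E F ?S)"
      by (rule fst_F.f_mono[OF cov', where I="?L"]) (use L SF' in simp_all)
    then have "leq E X (whole E X ?L) (fst_F \<cdot> Join E F ?S)" using whole_F(1)[OF L] by simp
    then show "leq E X (whole E X ?L) t" by (rule leq_trans[OF _ 1, where I="?L"]) (use L t SF' in simp_all)
  qed
  then obtain d y where d: "epi E d" "d \<in> Arr E" "tgt E d = ?L" "y \<in> Arr E" "src E y = src E d" "tgt E y = A"
    "mem E y (?S \<cdot> d) \<and> leq E X (W \<cdot> d) (?\<phi> \<cdot> pair E d y)"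
    by (rule exists_locE) (rule that)
  have Wy: "leq E X (W \<cdot> d) (fst_F \<cdot> y)" using d \<phi>_pair[of d y] by simp
  let ?x = "x \<cdot> (e \<cdot> d)"
  have ed: "e \<cdot> d \<in> Arr E" "tgt E (e \<cdot> d) = K" "src E (e \<cdot> d) = src E d" using e d(2,3) by simp_all
  have xm: "mem E ?x (S \<cdot> (e \<cdot> d))" by (rule mem_cmp[OF mem]) (use x S ed in simp_all)
  have ym: "mem E y (S \<cdot> (e \<cdot> d))" using d S e by simp
  have "exists_loc E (src E (e \<cdot> d)) (opens F) (\<lambda>k z. mem E z (S \<cdot> (e \<cdot> d) \<cdot> k) \<and> leq E F (?x \<cdot> k) z \<and> leq E F (y \<cdot> k) z)"
    by (rule F.is_net_directed[OF net SF ed(1,2) _ _ xm ym]) (use x ed d in simp_all)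
  then obtain k z where k: "epi E k" "k \<in> Arr E" "tgt E k = src E (e \<cdot> d)" "z \<in> Arr E" "src E z = src E k" "tgt E z = opens F"
    "mem E z (S \<cdot> (e \<cdot> d) \<cdot> k) \<and> leq E F (?x \<cdot> k) z \<and> leq E F (y \<cdot> k) z"
    by (rule exists_locE) (rule that)
  let ?M = "src E k"
  have M: "?M \<in> Ob E" and tk: "tgt E k = src E d" and z: "z \<in> hom E ?M A" using k ed by simp_all
  have xk: "x \<cdot> (e \<cdot> d \<cdot> k) \<in> hom E ?M A" and yk: "y \<cdot> k \<in> hom E ?M A" using x e(2,3) d(2-6) k(2) tk by simp_all
  have xz: "leq E F (x \<cdot> (e \<cdot> d \<cdot> k)) z" using k(7) x e(2,3) d(2,3) k(2) tk by simp
  have yz: "leq E F (y \<cdot> k) z" using k(7) by simp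
  have xz': "leq E X (fst_F \<cdot> (x \<cdot> (e \<cdot> d \<cdot> k))) (fst_F \<cdot> z)" "leq E T (snd_F \<cdot> (x \<cdot> (e \<cdot> d \<cdot> k))) (snd_F \<cdot> z)"
    using xz unfolding leq_F_iff[OF xk z] by blast+
  have yz': "leq E X (fst_F \<cdot> (y \<cdot> k)) (fst_F \<cdot> z)" using yz unfolding leq_F_iff[OF yk z] by blast
  have "leq E X ((W \<cdot> d) \<cdot> k) ((fst_F \<cdot> y) \<cdot> k)" by (rule leq_cmp[OF Wy]) (use e(4) d(2-6) k(2) tk in simp_all)
  then have Wz: "leq E X (W \<cdot> (d \<cdot> k)) (fst_F \<cdot> z)"
    by - (rule leq_trans[where I="?M", OF _ yz'], use e(4) d(2-6) k(2) tk z in simp_all)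
  have "covers (((fst_F \<cdot> x) \<cdot> e) \<cdot> (d \<cdot> k)) (W \<cdot> (d \<cdot> k))"
    by (rule covers_cmp[OF e(6)]) (use x e(2-4) d(2,3) k(2) tk in simp_all)
  then have cv: "covers (fst_F \<cdot> (x \<cdot> (e \<cdot> d \<cdot> k))) (W \<cdot> (d \<cdot> k))" using x e(2-4) d(2,3) k(2) tk by simp
  have "leq E X (whole E X ?M) (fst_F \<cdot> z)"
    by (rule leq_if_covers[OF cv meet_leq2[OF xz'(1)] meet_leq2[OF Wz]]) (use x e(2-4) d(2,3) k(2) tk z M in simp_all)
  moreover have "holds E (snd_F \<cdot> z)"
  proof (rule leq_truthD[OF xz'(2), where I="?M"])
    have "holds E ((snd_F \<cdot> x) \<cdot> (e \<cdot> d \<cdot> k))" by (rule holds_cmp[OF hx]) (use x e(2,3) d(2,3) k(2) tk in simp_all)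
    then show "holds E (snd_F \<cdot> (x \<cdot> (e \<cdot> d \<cdot> k)))" using x e(2,3) d(2,3) k(2) tk by simp
  qed (use xk z in simp_all)
  then have "snd_F \<cdot> z = whole E T ?M" using whole_truth[OF M] holds_iff[of "snd_F \<cdot> z" ?M] z by simp
  then have "leq E T (whole E T ?M) (snd_F \<cdot> z)" using T.whole_arr[OF M] by simp
  ultimately have "leq E F (whole E F ?M) z"
    using leq_F_iff[of "whole E F ?M" ?M z] whole_F[OF M] z F.whole_arr[OF M] by simp
  then show ?thesis
    by - (rule exists_locI[of "e \<cdot> (d \<cdot> k)" _ z], use k(1,2,7) z e(1-3) d(1-3) tk S in \<open>simp_all add: epi_cmp\<close>)
qed

text \<open>
  The second component of the supremum of the net is the truth value that some member contains the point at
  infinity, hence a member as in the previous lemma exists locally.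
\<close>

lemma F_compact: "compact E F"
  unfolding compact_def
proof (rule F.way_belowI[where I="One E"])
  fix g S assume g: "g \<in> Arr E" "tgt E g = One E" and SF: "S \<in> hom E (src E g) (Pow E (opens F))" and net: "is_net E F S"
    and cov: "leq E F (whole E F (One E) \<cdot> g) (Join E F S)"
  let ?J = "src E g"
  have J: "?J \<in> Ob E" and S: "S \<in> hom E ?J (Pow E A)" using g SF by simp_all
  have AO: "A \<in> Ob E" by simp
  have cov': "leq E F (whole E F ?J) (Join E F S)" using cov g by simp
  let ?C = "\<lambda>x. exists_loc E (src E x) A (\<lambda>e z. mem E z (S \<cdot> (x \<cdot> e)) \<and> leq E F (whole E F (src E z)) z)"
  have n: "natural (Prod E ?J A) (opens F) (\<lambda>z. pr2 E ?J A \<cdot> z)" "natural (Prod E ?J A) A (\<lambda>z. pr2 E ?J A \<cdot> z)"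
    "natural (Prod E ?J A) ?J (\<lambda>z. pr1 E ?J A \<cdot> z)"
    by ((subst opens_F)?, rule natural_pr1[OF natural_id] natural_pr2[OF natural_id]; use J in simp)+
  have nS: "natural (Prod E ?J A) (Pow E A) (\<lambda>z. S \<cdot> (pr1 E ?J A \<cdot> z))"
    by (rule natural_comp[OF n(3)]) (use S in simp_all)
  have le: "representable (Prod E ?J A) (\<lambda>z. leq E F (whole E F (src E (pr2 E ?J A \<cdot> z))) (pr2 E ?J A \<cdot> z))"
    by (rule representable_cong[OF F.representable_leq[OF F.natural_whole n(1)]]) (use J in simp_all)
  have "representable ?J ?C"
    by (rule representable_ex[where Q="\<lambda>x z. mem E z (S \<cdot> x) \<and> leq E F (whole E F (src E z)) z",
      OF representable_conj[OF representable_mem[OF n(2) nS] le] J AO])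
  then obtain t where t: "t \<in> Arr E" "src E t = ?J" "tgt E t = Om E" "?J \<in> Ob E"
    "\<And>x. x \<in> Arr E \<Longrightarrow> tgt E x = ?J \<Longrightarrow> holds E (t \<cdot> x) \<longleftrightarrow> ?C x"
    by (rule representableE) (rule that)
  have "leq E T (snd_F \<cdot> Join E F S) t"
  proof (rule P.f_Join_leq[OF SF])
    fix h a assume h: "h \<in> Arr E" "tgt E h = ?J" and aF: "a \<in> hom E (src E h) (opens F)" and m: "mem E a (S \<cdot> h)"
    have a: "a \<in> hom E (src E h) A" using aF by simp
    show "leq E T (snd_F \<cdot> a) (t \<cdot> h)"
    proof (rule leq_truthI[where I="src E h"])
      fix k assume k: "k \<in> Arr E" "tgt E k = src E h" and hk: "holds E ((snd_F \<cdot> a) \<cdot> k)"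
      let ?hk = "h \<cdot> k"
      have hk': "?hk \<in> Arr E" "tgt E ?hk = ?J" "src E ?hk = src E k" using h k by simp_all
      have "mem E (a \<cdot> k) ((S \<cdot> h) \<cdot> k)" by (rule mem_cmp[OF m]) (use a S h k in simp_all)
      then have mk: "mem E (a \<cdot> k) (S \<cdot> ?hk)" using S h k by simp
      have netk: "is_net E F (S \<cdot> ?hk)"
        by (rule representable_cmp[OF F.representable_is_net[OF natural_id], of S]) (use net S hk' in simp_all)
      have covk: "leq E F (whole E F (src E k)) (Join E F (S \<cdot> ?hk))"
        using F.leq_cmp[OF cov', of ?J ?hk] S hk' J by simp
      have "exists_loc E (src E k) A (\<lambda>e z. mem E z ((S \<cdot> ?hk) \<cdot> e) \<and> leq E F (whole E F (src E z)) z)"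
        by (rule F_compact_step[OF _ netk covk _ mk]) (use S hk' a k hk in simp_all)
      then have "?C ?hk" using S hk' by (simp add: exists_loc_def cong: conj_cong)
      then have "holds E (t \<cdot> ?hk)" using t(5)[OF hk'(1,2)] by simp
      then show "holds E ((t \<cdot> h) \<cdot> k)" using t(1-3) h k by simp
    qed (use a t(1-3) h in simp_all)
  qed (use t(1-3) in simp)
  moreover have "holds E (snd_F \<cdot> Join E F S)"
    by (rule holds_p_mono[OF holds_p_whole[OF J] cov']) (use J SF in simp_all)
  ultimately have "holds E t" by (rule leq_truthD[where I="?J"]) (use SF t(1-3) in simp_all)
  then have "holds E (t \<cdot> ident E ?J)" using t(1-3) J by simp
  then have "?C (ident E ?J)" using t(5)[of "ident E ?J"] J by simp
  then obtain e z where e: "epi E e" "e \<in> Arr E" "tgt E e = src E (ident E ?J)" "z \<in> Arr E" "src E z = src E e" "tgt E z = A"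
    "mem E z (S \<cdot> (ident E ?J \<cdot> e)) \<and> leq E F (whole E F (src E z)) z"
    by (rule exists_locE) (rule that)
  show "exists_loc E ?J (opens F) (\<lambda>e w. mem E w (S \<cdot> e) \<and> leq E F (whole E F (One E) \<cdot> g \<cdot> e) w)"
    by (rule exists_locI[of e _ z]) (use e g J in simp_all)
qed simp

lemma F_rather_belowI:
  assumes u: "u \<in> hom E I A" and d: "d \<in> hom E I A" and v: "v \<in> hom E I A"
    and disj: "leq E X (meet E X (fst_F \<cdot> d) (fst_F \<cdot> u)) (empty E X I)"
      "leq E T (meet E T (snd_F \<cdot> d) (snd_F \<cdot> u)) (empty E T I)"
    and cov: "covers (fst_F \<cdot> d) (fst_F \<cdot> v)" "holds E (snd_F \<cdot> d) \<or> holds E (snd_F \<cdot> v)"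
  shows "rather_below E F u v"
proof (rule F.rather_belowI[where I=I and d=d])
  have I: "I \<in> Ob E" using u by auto
  have e: "empty E F I \<in> hom E I A" "meet E F d u \<in> hom E I A" "whole E F I \<in> hom E I A" "join E F d v \<in> hom E I A"
    using I u d v by simp_all
  have "leq E X (fst_F \<cdot> meet E F d u) (fst_F \<cdot> empty E F I)" unfolding meet_F[OF d u]
    by (rule leq_trans[OF disj(1), where I=I]) (use u d I in simp_all)
  moreover have "leq E T (snd_F \<cdot> meet E F d u) (snd_F \<cdot> empty E F I)" unfolding meet_F[OF d u]
    by (rule T.leq_trans[OF disj(2), where I=I]) (use u d I in simp_all)
  ultimately show "leq E F (meet E F d u) (empty E F I)" unfolding leq_F_iff[OF e(2,1)] by blast
  have dv: "leq E F d (join E F d v)" "leq E F v (join E F d v)" using d v by simp_all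
  then have dv': "leq E X (fst_F \<cdot> d) (fst_F \<cdot> join E F d v)" "leq E X (fst_F \<cdot> v) (fst_F \<cdot> join E F d v)"
    unfolding leq_F_iff[OF d e(4)] leq_F_iff[OF v e(4)] by blast+
  have "leq E X (whole E X I) (fst_F \<cdot> join E F d v)"
    by (rule leq_if_covers[OF cov(1) meet_leq2[OF dv'(1)] meet_leq2[OF dv'(2)]]) (use d v e(4) I in simp_all)
  moreover have "holds E (snd_F \<cdot> join E F d v)"
    using cov(2) holds_p_mono[OF _ dv(1), of I] holds_p_mono[OF _ dv(2), of I] d v by auto
  then have "snd_F \<cdot> join E F d v = whole E T I" using whole_truth[OF I] holds_iff[of "snd_F \<cdot> join E F d v" I] e(4) by simp
  then have "leq E T (whole E T I) (snd_F \<cdot> join E F d v)" using T.whole_arr[OF I] by simp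
  ultimately have "leq E F (whole E F I) (join E F d v)" unfolding leq_F_iff[OF e(3,4)] whole_F[OF I] by blast
  then show "F.covers d v" using d by (simp add: F.covers_def)
qed (use u d v in simp_all)

text \<open>
  An open of \<open>X\<close> that is way below \<open>v\<close> stays rather below it in the compactification, because its
  complement is a neighbourhood of infinity.
\<close>

lemma F_rather_below_finite:
  assumes a: "a \<in> hom E I (opens X)" and v: "v \<in> hom E I A" and wb: "way_below E X a (fst_F \<cdot> v)"
    and x: "x \<in> hom E I A" "fst_F \<cdot> x = a" "snd_F \<cdot> x = empty E T I"
  shows "rather_below E F x v"
proof -
  have I: "I \<in> Ob E" using a by auto
  have fv: "fst_F \<cdot> v \<in> hom E I (opens X)" using v by simp
  have wbw: "way_below E X a (whole E X I)"
    by (rule way_below_mono[OF wb, where I=I]) (use a fv I in simp_all)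
  obtain d where d: "d \<in> hom E I A" "fst_F \<cdot> d = neg E X a" "holds E (snd_F \<cdot> d)"
    by (rule F_top_pair[OF _ omega_neg[OF lc reg wbw a]]) (use a in simp, rule that)
  have rb: "rather_below E X a (fst_F \<cdot> v)" by (rule way_below_rather_below[OF reg wb a fv])
  show ?thesis
  proof (rule F_rather_belowI[OF x(1) d(1) v])
    show "leq E X (meet E X (fst_F \<cdot> d) (fst_F \<cdot> x)) (empty E X I)" unfolding d(2) x(2)
      by (rule meet_neg_leq(1)) (use a I in simp_all)
    show "leq E T (meet E T (snd_F \<cdot> d) (snd_F \<cdot> x)) (empty E T I)" unfolding x(3)
      by (rule T.meet_lower(2)) (use d(1) I in simp_all)
    show "covers (fst_F \<cdot> d) (fst_F \<cdot> v)" unfolding d(2) using rather_below_iff[OF a fv] rb by blast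
  qed (use d(3) in simp)
qed

text \<open>
  Dually, the complement of an open \<open>W\<close> way below the whole, as a neighbourhood of infinity, is rather below any
  neighbourhood of infinity that covers together with \<open>W\<close>: the open \<open>W\<close> of \<open>X\<close> is disjoint from it.
\<close>

lemma F_rather_below_infinity:
  assumes v: "v \<in> hom E I A" and hv: "holds E (snd_F \<cdot> v)"
    and W: "W \<in> hom E I (opens X)" and wb: "way_below E X W (whole E X I)" and cov: "covers (fst_F \<cdot> v) W"
    and x: "x \<in> hom E I A" "fst_F \<cdot> x = neg E X W"
  shows "rather_below E F x v"
proof -
  have I: "I \<in> Ob E" using W by auto
  obtain d where d: "d \<in> hom E I A" "fst_F \<cdot> d = W" "snd_F \<cdot> d = empty E T I"
    by (rule F_bot_pair[OF W]) (rule that)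
  show ?thesis
  proof (rule F_rather_belowI[OF x(1) d(1) v])
    show "leq E X (meet E X (fst_F \<cdot> d) (fst_F \<cdot> x)) (empty E X I)" unfolding d(2) x(2)
      by (rule meet_neg_leq(2)) (use W I in simp_all)
    show "leq E T (meet E T (snd_F \<cdot> d) (snd_F \<cdot> x)) (empty E T I)" unfolding d(3)
      by (rule T.meet_lower(1)) (use x(1) I in simp_all)
    show "covers (fst_F \<cdot> d) (fst_F \<cdot> v)" unfolding d(2) by (rule covers_commute[OF cov]) (use v W in simp_all)
  qed (use hv in simp)
qed

text \<open>
  The two kinds of opens of the preceding lemmas suffice to generate \<open>v\<close>: the first recover its restriction to \<open>X\<close>
  by local compactness, and the second exist as soon as \<open>v\<close> contains the point at infinity.
\<close>

lemma F_regular: "regular E F"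
  unfolding regular_def
proof (intro ballI)
  fix v0 assume v0F: "v0 \<in> into E (opens F)"
  then have v0: "v0 \<in> hom E (src E v0) A" by simp
  show "is_sup E F (\<lambda>g u. rather_below E F u (v0 \<cdot> g)) v0"
  proof (rule F.is_supI)
    show "v0 \<in> hom E (src E v0) (opens F)" using v0 by simp
  next
    fix h a assume "h \<in> Arr E" "tgt E h = src E v0" "a \<in> hom E (src E h) (opens F)" "rather_below E F a (v0 \<cdot> h)"
    then show "leq E F a (v0 \<cdot> h)" by - (rule F.rather_below_leq[where I="src E h"], use v0 in simp_all)
  next
    fix g t assume g: "g \<in> Arr E" "tgt E g = src E v0" and tF: "t \<in> hom E (src E g) (opens F)"
      and all: "\<And>h a. h \<in> Arr E \<Longrightarrow> tgt E h = src E g \<Longrightarrow> a \<in> hom E (src E h) (opens F) \<Longrightarrow>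
        rather_below E F a (v0 \<cdot> (g \<cdot> h)) \<Longrightarrow> leq E F a (t \<cdot> h)"
    let ?I = "src E g" and ?v = "v0 \<cdot> g"
    have t: "t \<in> hom E ?I A" and v: "?v \<in> hom E ?I A" using tF v0 g by simp_all
    have all': "leq E F a (t \<cdot> h)" if "h \<in> Arr E" "tgt E h = ?I" "a \<in> hom E (src E h) A" "rather_below E F a (?v \<cdot> h)" for h a
      by (rule all) (use that v0 g in simp_all)
    have "leq E X (fst_F \<cdot> ?v) (fst_F \<cdot> t)"
    proof (rule locally_compact_leqI[OF lc])
      fix h a assume h: "h \<in> Arr E" "tgt E h = ?I" and a: "a \<in> hom E (src E h) (opens X)" and wb: "way_below E X a ((fst_F \<cdot> ?v) \<cdot> h)"
      obtain x where x: "x \<in> hom E (src E h) A" "fst_F \<cdot> x = a" "snd_F \<cdot> x = empty E T (src E h)"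
        by (rule F_bot_pair[OF a]) (rule that)
      have vh: "?v \<cdot> h \<in> hom E (src E h) A" and th: "t \<cdot> h \<in> hom E (src E h) A" using v t h by simp_all
      have "way_below E X a (fst_F \<cdot> (?v \<cdot> h))" using wb v0 g h by simp
      then have "leq E F x (t \<cdot> h)" by (rule all'[OF h x(1) F_rather_below_finite[OF a vh _ x]])
      then have "leq E X a (fst_F \<cdot> (t \<cdot> h))" unfolding leq_F_iff[OF x(1) th] x(2) by blast
      then show "leq E X a ((fst_F \<cdot> t) \<cdot> h)" using t h by simp
    qed (use v t in simp_all)
    moreover have "leq E T (snd_F \<cdot> ?v) (snd_F \<cdot> t)"
    proof (rule leq_truthI[where I="?I"])
      fix h assume h: "h \<in> Arr E" "tgt E h = ?I" and hv: "holds E ((snd_F \<cdot> ?v) \<cdot> h)"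
      have vh: "?v \<cdot> h \<in> hom E (src E h) A" and fvh: "fst_F \<cdot> (?v \<cdot> h) \<in> hom E (src E h) (opens X)" using v h by simp_all
      have hv': "holds E (snd_F \<cdot> (?v \<cdot> h))" using hv v0 g h by simp
      obtain e W where e: "epi E e" "e \<in> Arr E" "tgt E e = src E h" "W \<in> hom E (src E e) (opens X)"
        "way_below E X W (whole E X (src E e))" "covers ((fst_F \<cdot> (?v \<cdot> h)) \<cdot> e) W"
        by (rule omegaE[OF omega_if_snd[OF vh hv'] fvh]) (rule that)
      let ?J = "src E e"
      obtain x where x: "x \<in> hom E ?J A" "fst_F \<cdot> x = neg E X W" "holds E (snd_F \<cdot> x)"
        by (rule F_top_pair[OF _ omega_neg[OF lc reg e(5,4)]]) (use e(4) in simp, rule that)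
      have vhe: "?v \<cdot> (h \<cdot> e) \<in> hom E ?J A" and the: "t \<cdot> (h \<cdot> e) \<in> hom E ?J A" using v t h e(2,3) by simp_all
      have "holds E ((snd_F \<cdot> (?v \<cdot> h)) \<cdot> e)" by (rule holds_cmp[OF hv']) (use vh e(2,3) in simp_all)
      then have hvh: "holds E (snd_F \<cdot> (?v \<cdot> (h \<cdot> e)))" using v0 g h e(2,3) by simp
      have cv: "covers (fst_F \<cdot> (?v \<cdot> (h \<cdot> e))) W" using e(6) v0 g h e(2,3) by simp
      have "leq E F x (t \<cdot> (h \<cdot> e))"
        by (rule all'[OF _ _ _ F_rather_below_infinity[OF vhe hvh e(4,5) cv x(1,2)]]) (use h e(2,3) x(1) in simp_all)
      then have "holds E (snd_F \<cdot> (t \<cdot> (h \<cdot> e)))" by (rule holds_p_mono[OF x(3)]) (use x(1) the in simp_all)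
      then have "holds E (((snd_F \<cdot> t) \<cdot> h) \<cdot> e)" using t h e(2,3) by simp
      then show "holds E ((snd_F \<cdot> t) \<cdot> h)" by (rule holds_local[OF _ e(1)]) (use t h e(3) in simp_all)
    qed (use v t in simp_all)
    ultimately show "leq E F (v0 \<cdot> g) t" unfolding leq_F_iff[OF v t] by blast
  qed
qed

lemma leq_infinity_iff:
  assumes "x \<in> hom E I A"
  shows "leq E F x (pt_compl E F snd_F \<cdot> bang E I) \<longleftrightarrow> leq E T (snd_F \<cdot> x) (empty E T I)"
  by (rule leq_c_iff) (use assms in simp)

text \<open>
  The complement of infinity is \<open>(X, \<bottom>)\<close>, and below it only the first component varies.
\<close>

lemma F_open_complement: "\<exists>k. frame_iso E (open_sublocale E F (pt_compl E F snd_F)) X k"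
proof -
  let ?c = "pt_compl E F snd_F"
  have c: "?c \<in> hom E (One E) (opens F)" using c_arr by simp
  note rep = F.below_incl_rep[OF c]
  let ?m = "below_incl E F ?c" and ?Z = "open_sublocale E F ?c"
  have m: "mono E ?m" "tgt E ?m = opens F" "?m \<in> Arr E" using compr_arr[OF rep] by (simp_all add: below_incl_def)
  have mA: "tgt E ?m = A" using m(2) by simp
  have Z: "?Z = subframe E F ?m" by (simp add: open_sublocale_def)
  have oZ: "opens ?Z = src E ?m" unfolding Z by (rule F.opens_subframe)
  obtain z where z: "z \<in> hom E (opens X) A" "fst_F \<cdot> z = ident E (opens X)" "snd_F \<cdot> z = empty E T (opens X)"
    by (rule F_bot_pair[of "ident E (opens X)" "opens X"]) (simp, rule that)
  have "leq E F z (?c \<cdot> bang E (src E z))" using leq_infinity_iff[OF z(1)] z by simp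
  then obtain n where n: "n \<in> Arr E" "src E n = src E z" "tgt E n = src E ?m" "?m \<cdot> n = z"
    unfolding below_incl_def by - (rule compr_factor[OF rep, of z], use z(1) in simp_all)
  have n': "n \<in> hom E (opens X) (src E ?m)" using n(1-3) z(1) by simp
  let ?k = "fst_F \<cdot> ?m"
  have k: "?k \<in> hom E (src E ?m) (opens X)" using m(3) mA by simp
  have "frame_iso E ?Z X ?k"
  proof (rule frame_iso_if_order_iso[where g=n], unfold oZ)
    show "internal_poset E ?Z" unfolding Z by (rule F.subframe(1)[OF m(1,2)])
    show "internal_frame E X" by unfold_locales
    have "fst_F \<cdot> (?m \<cdot> n) = ident E (opens X)" unfolding n(4) by (rule z(2))
    then show "?k \<cdot> n = ident E (opens X)" using m(3) mA n' by simp
    fix I u v assume u: "u \<in> hom E I (src E ?m)" and v: "v \<in> hom E I (src E ?m)"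
    have I: "I \<in> Ob E" using u by auto
    have mu: "?m \<cdot> u \<in> hom E I A" and mv: "?m \<cdot> v \<in> hom E I A" using u v m(3) mA by simp_all
    have "leq E F (?m \<cdot> u) (?c \<cdot> bang E I)"
      using compr_sat[OF rep, of u] u m by (simp add: below_incl_def)
    then have "leq E T (snd_F \<cdot> (?m \<cdot> u)) (empty E T I)" unfolding leq_infinity_iff[OF mu] .
    then have "leq E T (snd_F \<cdot> (?m \<cdot> u)) (snd_F \<cdot> (?m \<cdot> v))"
      by (rule T.leq_trans[where I=I]) (use mu mv I in simp_all)
    then have "leq E F (?m \<cdot> u) (?m \<cdot> v) \<longleftrightarrow> leq E X (fst_F \<cdot> (?m \<cdot> u)) (fst_F \<cdot> (?m \<cdot> v))"
      unfolding leq_F_iff[OF mu mv] by blast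
    then show "leq E ?Z u v \<longleftrightarrow> leq E X (?k \<cdot> u) (?k \<cdot> v)"
      unfolding Z F.subframe(2)[OF m(1,2) u v] using u v m(3) mA by simp
  qed (use k n' in simp_all)
  then show ?thesis by blast
qed

lemma F_one_point_compactification:
  "\<exists>k. one_point_compactification E X F snd_F k" "closed_point E F snd_F"
  using F_open_complement F_is_frame F_compact F_regular frame_hom_snd closed_point
  unfolding one_point_compactification_def is_point_def by blast+

end

theorem theorem2p2:
  fixes E :: "('o, 'm) topos" (structure) and X :: "('o, 'm) frm"
  assumes "elementary_topos_nno E"
    and "is_frame E X" and "locally_compact E X" and "regular E X"
  shows
    "(\<exists>Y p k. one_point_compactification E X Y p k \<and> closed_point E Y p) \<and>
     (\<forall>Y p k Y' p' k'.
        one_point_compactification E X Y p k \<longrightarrow> one_point_compactification E X Y' p' k' \<longrightarrow>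
        (\<exists>!h. compatible_iso E Y p k Y' p' k' h)) \<and>
     (\<forall>Y p k. one_point_compactification E X Y p k \<longrightarrow>
        closed_point E Y p \<and>
        (\<exists>i. frame_iso E Y (omega_frame E X) i \<and>
             omega_fst E X \<cdot> i = incl E Y p k \<and>
             omega_snd E X \<cdot> i = p))"
proof (intro conjI allI impI)
  have topos: "elementary_topos E" using assms(1) by (rule elementary_topos_nno.axioms(1))
  show "\<exists>Y p k. one_point_compactification E X Y p k \<and> closed_point E Y p"
  proof -
    interpret internal_frame E X by (rule internal_frameI[OF topos assms(2)])
    interpret compactifiable E X by unfold_locales (rule assms(3,4))+
    show ?thesis using F_one_point_compactification by blast
  qed
  show "\<exists>!h. compatible_iso E Y p k Y' p' k' h"
    if Y: "one_point_compactification E X Y p k" and Y': "one_point_compactification E X Y' p' k'" for Y p k Y' p' k'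
  proof -
    obtain j where j: "compactification E Y p X (incl E Y p k) j"
      by (rule compactification_incl[OF topos assms(2) Y])
    obtain j' where j': "compactification E Y' p' X (incl E Y' p' k') j'"
      by (rule compactification_incl[OF topos assms(2) Y'])
    show ?thesis unfolding compatible_iso_def by (rule unique_comparison[OF j j'])
  qed
  fix Y p k assume Y: "one_point_compactification E X Y p k"
  obtain j where j: "compactification E Y p X (incl E Y p k) j"
    by (rule compactification_incl[OF topos assms(2) Y])
  interpret compactification E Y p X "incl E Y p k" j by (rule j)
  show "closed_point E Y p" by (rule closed_point[OF regular])
  show "\<exists>i. frame_iso E Y (omega_frame E X) i \<and> omega_fst E X \<cdot> i = incl E Y p k \<and> omega_snd E X \<cdot> i = p"
    by (rule iso_to_pairs)
qed

end
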